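(* Let $n\geq 3$ and let $\mathcal{O}$ be the ring of integers of a number field. If $H$ is a group such that $H\equiv \mathrm{SL}_n(\mathcal{O})$ in the first-order language of groups, then $H\cong \mathrm{SL}_n(R)$ for some ring $R$ with $R\equiv\mathcal{O}$ as rings.
   Context: Rings are commutative, associative and unital. The symbol $\equiv$ denotes elementary equivalence (satisfying the same first-order sentences), in the language of groups for groups and in the language of unitary rings for rings. *)

theory Defs
  imports
    "HOL-Algebra.Embedded_Algebras"
    "HOL-Algebra.Generated_Fields"
    "HOL-Algebra.Polynomials"
    "HOL-Combinatorics.Permutations"
    "Jordan_Normal_Form.Matrix"
begin

section \<open>First-order formulas and satisfaction\<close>

text \<open>Neither language has relation symbols besides equality, so a formula is determined by the
  type \<open>'t\<close> of terms of the language. The primitive connectives and quantifier form a complete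
  set. Variables are named by natural numbers.\<close>

datatype 't formula =
    Eq 't 't
  | Neg "'t formula"
  | Conj "'t formula" "'t formula"
  | Exists nat "'t formula"

primrec free_vars :: "('t \<Rightarrow> nat set) \<Rightarrow> 't formula \<Rightarrow> nat set" where
  "free_vars tv (Eq s t) = tv s \<union> tv t"
| "free_vars tv (Neg \<phi>) = free_vars tv \<phi>"
| "free_vars tv (Conj \<phi> \<psi>) = free_vars tv \<phi> \<union> free_vars tv \<psi>"
| "free_vars tv (Exists x \<phi>) = free_vars tv \<phi> - {x}"

text \<open>\<open>D\<close> is the domain of the structure, \<open>ev\<close> the evaluation of terms in it and \<open>e\<close> the
  assignment of the variables.\<close>

primrec sat :: "'a set \<Rightarrow> ((nat \<Rightarrow> 'a) \<Rightarrow> 't \<Rightarrow> 'a) \<Rightarrow> (nat \<Rightarrow> 'a) \<Rightarrow> 't formula \<Rightarrow> bool" where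
  "sat D ev e (Eq s t) \<longleftrightarrow> ev e s = ev e t"
| "sat D ev e (Neg \<phi>) \<longleftrightarrow> \<not> sat D ev e \<phi>"
| "sat D ev e (Conj \<phi> \<psi>) \<longleftrightarrow> sat D ev e \<phi> \<and> sat D ev e \<psi>"
| "sat D ev e (Exists x \<phi>) \<longleftrightarrow> (\<exists>a\<in>D. sat D ev (e(x := a)) \<phi>)"

definition models :: "'a set \<Rightarrow> ((nat \<Rightarrow> 'a) \<Rightarrow> 't \<Rightarrow> 'a) \<Rightarrow> 't formula \<Rightarrow> bool" where
  "models D ev \<phi> \<longleftrightarrow> (\<forall>e. range e \<subseteq> D \<longrightarrow> sat D ev e \<phi>)"


section \<open>The language of groups\<close>

datatype group_term =
    GVar nat
  | GOne
  | GInv group_term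
  | GMult group_term group_term

primrec group_term_vars :: "group_term \<Rightarrow> nat set" where
  "group_term_vars (GVar x) = {x}"
| "group_term_vars GOne = {}"
| "group_term_vars (GInv t) = group_term_vars t"
| "group_term_vars (GMult s t) = group_term_vars s \<union> group_term_vars t"

primrec group_eval :: "('a, 'b) monoid_scheme \<Rightarrow> (nat \<Rightarrow> 'a) \<Rightarrow> group_term \<Rightarrow> 'a" where
  "group_eval G e (GVar x) = e x"
| "group_eval G e GOne = \<one>\<^bsub>G\<^esub>"
| "group_eval G e (GInv t) = inv\<^bsub>G\<^esub> (group_eval G e t)"
| "group_eval G e (GMult s t) = group_eval G e s \<otimes>\<^bsub>G\<^esub> group_eval G e t"

definition group_elem_equiv ::
    "('a, 'm) monoid_scheme \<Rightarrow> ('b, 'n) monoid_scheme \<Rightarrow> bool" where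
  "group_elem_equiv G H \<longleftrightarrow>
    (\<forall>\<phi>. free_vars group_term_vars \<phi> = {} \<longrightarrow>
      (models (carrier G) (group_eval G) \<phi> \<longleftrightarrow> models (carrier H) (group_eval H) \<phi>))"


section \<open>The language of unitary rings\<close>

datatype ring_term =
    RVar nat
  | RZero
  | ROne
  | RNeg ring_term
  | RAdd ring_term ring_term
  | RMult ring_term ring_term

primrec ring_term_vars :: "ring_term \<Rightarrow> nat set" where
  "ring_term_vars (RVar x) = {x}"
| "ring_term_vars RZero = {}"
| "ring_term_vars ROne = {}"
| "ring_term_vars (RNeg t) = ring_term_vars t"
| "ring_term_vars (RAdd s t) = ring_term_vars s \<union> ring_term_vars t"
| "ring_term_vars (RMult s t) = ring_term_vars s \<union> ring_term_vars t"

primrec ring_eval :: "('a, 'b) ring_scheme \<Rightarrow> (nat \<Rightarrow> 'a) \<Rightarrow> ring_term \<Rightarrow> 'a" where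
  "ring_eval R e (RVar x) = e x"
| "ring_eval R e RZero = \<zero>\<^bsub>R\<^esub>"
| "ring_eval R e ROne = \<one>\<^bsub>R\<^esub>"
| "ring_eval R e (RNeg t) = \<ominus>\<^bsub>R\<^esub> (ring_eval R e t)"
| "ring_eval R e (RAdd s t) = ring_eval R e s \<oplus>\<^bsub>R\<^esub> ring_eval R e t"
| "ring_eval R e (RMult s t) = ring_eval R e s \<otimes>\<^bsub>R\<^esub> ring_eval R e t"

definition ring_elem_equiv ::
    "('a, 'm) ring_scheme \<Rightarrow> ('b, 'n) ring_scheme \<Rightarrow> bool" where
  "ring_elem_equiv R S \<longleftrightarrow>
    (\<forall>\<phi>. free_vars ring_term_vars \<phi> = {} \<longrightarrow>
      (models (carrier R) (ring_eval R) \<phi> \<longleftrightarrow> models (carrier S) (ring_eval S) \<phi>))"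


section \<open>The special linear group over a commutative ring\<close>

text \<open>The matrix operations of Jordan_Normal_Form use the type-class ring structure of the entries;
  here the entries come from a ring record, so product, unit matrix and determinant are written
  out with the operations of that record.\<close>

definition det_over :: "('a, 'm) ring_scheme \<Rightarrow> nat \<Rightarrow> 'a mat \<Rightarrow> 'a" where
  "det_over R n A =
    (\<Oplus>\<^bsub>R\<^esub>p\<in>{p. p permutes {..<n}}. [sign p] \<cdot>\<^bsub>R\<^esub> (\<Otimes>\<^bsub>R\<^esub>i\<in>{..<n}. A $$ (i, p i)))"

definition SL :: "nat \<Rightarrow> ('a, 'm) ring_scheme \<Rightarrow> 'a mat monoid" where
  "SL n R =
    \<lparr> carrier = {A \<in> carrier_mat n n. elements_mat A \<subseteq> carrier R \<and> det_over R n A = \<one>\<^bsub>R\<^esub>},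
      monoid.mult = (\<lambda>A B. mat n n (\<lambda>(i, j). \<Oplus>\<^bsub>R\<^esub>k\<in>{..<n}. A $$ (i, k) \<otimes>\<^bsub>R\<^esub> B $$ (k, j))),
      monoid.one = mat n n (\<lambda>(i, j). if i = j then \<one>\<^bsub>R\<^esub> else \<zero>\<^bsub>R\<^esub>) \<rparr>"


section \<open>Number fields and their rings of integers\<close>

text \<open>The subfield generated by the empty set is the prime field, which in characteristic zero is
  the copy of the rationals in \<open>K\<close>.\<close>

locale number_field = field K for K (structure) +
  assumes char_zero: "0 < k \<Longrightarrow> [(k::nat)] \<cdot> \<one> \<noteq> \<zero>"
    and finite_degree: "finite_dimension (generate_field K {}) (carrier K)"

text \<open>Polynomials are coefficient lists with the leading coefficient first; the elements
  \<open>[k] \<cdot> \<one>\<close> with \<open>k\<close> an integer form the copy of the integers in \<open>K\<close>.\<close>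

definition ring_of_integers :: "('a, 'm) ring_scheme \<Rightarrow> ('a, 'm) ring_scheme" where
  "ring_of_integers K = K \<lparr> carrier :=
    {x \<in> carrier K. \<exists>p. p \<noteq> [] \<and> hd p = \<one>\<^bsub>K\<^esub> \<and>
      set p \<subseteq> range (\<lambda>k::int. [k] \<cdot>\<^bsub>K\<^esub> \<one>\<^bsub>K\<^esub>) \<and> ring.eval K p x = \<zero>\<^bsub>K\<^esub>} \<rparr>"

end

theory Submission
  imports
    Defs
    "HOL-Library.Countable"
    "HOL-Algebra.Finite_Extensions"
    "Jordan_Normal_Form.Schur_Decomposition"
    "Jordan_Normal_Form.Spectral_Radius"
begin

text \<open>The field \<open>K\<close> acts on the additive maps from \<open>K\<close> to the complex numbers by commuting operators;
  a common eigenvector yields an embedding, so the ring of integers may be replaced by a subring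
  \<open>S\<close> of the complex numbers.

  Suppose that elements \<open>c\<^sub>i\<^sub>j\<close> of \<open>SL\<^sub>n S\<close> satisfy the Steinberg relations and that
  \<open>c\<^sub>i\<^sub>j\<^sup>L\<close> is not \<open>1\<close>, where \<open>L = (n!)\<^sup>n\<^sup>-\<^sup>1\<close>. The eigenvalues of commutators are roots of unity of
  bounded order, suitable powers of the \<open>c\<^sub>i\<^sub>j\<close> above the diagonal are simultaneously unitriangular, and
  counting commutators shows that each \<open>c\<^sub>i\<^sub>j\<^sup>L\<close> is a transvection. The vectors and covectors
  of these are dual bases, up to inverse transpose, so an automorphism takes the elementary matrices
  \<open>e\<^sub>i\<^sub>j(1)\<close> to the \<open>c\<^sub>i\<^sub>j\<close>. Every first-order property of the elementary matrices therefore
  transfers to all such tuples in \<open>H\<close>, and there are such tuples.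

  From the elementary matrices the ring can be defined, as well as the relation \<open>A = \<zeta> h\<close> between
  an element \<open>h\<close>, a matrix \<open>A\<close> over that ring and an unspecified scalar \<open>\<zeta>\<close> with \<open>\<zeta>\<^sup>n = 1\<close>. In
  \<open>H\<close> this relation is a subgroup \<open>P\<close> of \<open>H \<times> SL\<^sub>n R\<close>. If \<open>d\<close> is the number of scalars, the products
  of commutators and \<open>d\<close>-th powers in \<open>P\<close> form a subgroup that meets \<open>Z = {(z, 1)}\<close> trivially. A maximal
  subgroup with these properties is a complement of \<open>Z\<close>, and it is the graph of an isomorphism.\<close>

section \<open>Predicates defined by the same formula in two groups\<close>

text \<open>The obstacle is the centre. The conditions comparing h with a matrix A pass through
  conjugates \<open>inv h s h\<close>, so \<open>rho\<close> fixes A only up to a scalar, and in H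
  no formula is given that picks the right one. On commutators and d-th powers the scalar cancels,
  hence there the partner is forced; beyond them a choice is made by Zorn's lemma. The choice
  succeeds because the scalars are all the complex d-th roots of unity: a scalar z with
  \<open>z^(d/m) = 1\<close> has an m-th root among them, for every m dividing d.

  Being a product of some number of commutators and powers is not first order, hence the length k in
  \<open>Dk\<close>. Faithfulness is transferred for every k separately, but the existence statement
  on scalars needs one bound. It is n - 1, because a scalar matrix of determinant 1 is a product of
  n - 1 commutators of diagonal with monomial matrices.

  The exponent L arises as follows: the power n! makes all eigenvalues 1, and each of the n - 2
  commutators leading from position (0, 1) to the corner (0, n - 1) multiplies the exponent by
  another n!. Requiring that the L-th powers are not 1 keeps degenerate tuples away.\<close>

lemma sat_cong:
  assumes "\<And>e e' t. (\<forall>x\<in>tv t. e x = e' x) \<Longrightarrow> ev e t = ev e' t"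
  shows "(\<forall>x\<in>free_vars tv \<phi>. e x = e' x) \<Longrightarrow> sat D ev e \<phi> = sat D ev e' \<phi>"
proof (induction \<phi> arbitrary: e e')
  case (Eq s t)
  then show ?case using assms[of s e e'] assms[of t e e'] by auto
next
  case (Conj \<phi> \<psi>)
  then have "sat D ev e \<phi> = sat D ev e' \<phi>" "sat D ev e \<psi> = sat D ev e' \<psi>" by auto
  then show ?case by simp
next
  case (Exists x \<phi>)
  have "sat D ev (e(x := a)) \<phi> = sat D ev (e'(x := a)) \<phi>" for a
    by (rule Exists.IH) (use Exists.prems in auto)
  then show ?case by simp
qed auto

lemma group_eval_cong:
  "(\<forall>x\<in>group_term_vars t. e x = e' x) \<Longrightarrow> group_eval G e t = group_eval G e' t"
  by (induction t) auto

lemma sat_group_cong: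
  assumes "\<forall>x\<in>free_vars group_term_vars \<phi>. e x = e' x"
  shows "sat D (group_eval G) e \<phi> = sat D (group_eval G) e' \<phi>"
  by (rule sat_cong[where tv = group_term_vars]) (use assms group_eval_cong in blast)+

lemma finite_group_term_vars: "finite (group_term_vars t)"
  by (induction t) auto

lemma finite_free_vars:
  assumes "\<And>t. finite (tv t)"
  shows "finite (free_vars tv \<phi>)"
  by (induction \<phi>) (auto simp: assms)

lemma sat_foldr_Exists:
  "sat D ev e (foldr Exists xs \<phi>) \<longleftrightarrow>
    (\<exists>e'. (\<forall>x. x \<notin> set xs \<longrightarrow> e' x = e x) \<and> (\<forall>x\<in>set xs. e' x \<in> D) \<and> sat D ev e' \<phi>)"
proof (induction xs arbitrary: e)
  case Nil
  have "(\<exists>e'. (\<forall>x. e' x = e x) \<and> sat D ev e' \<phi>) \<longleftrightarrow> sat D ev e \<phi>"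
    by (metis ext)
  then show ?case by simp
next
  case (Cons y xs)
  show ?case (is "?l \<longleftrightarrow> ?r")
  proof
    assume ?l
    then obtain a where a: "a \<in> D" "sat D ev (e(y := a)) (foldr Exists xs \<phi>)" by auto
    then obtain e' where e': "\<forall>x. x \<notin> set xs \<longrightarrow> e' x = (e(y := a)) x" "\<forall>x\<in>set xs. e' x \<in> D"
      "sat D ev e' \<phi>" using Cons by blast
    then have "e' y \<in> D" using a(1) by (cases "y \<in> set xs") auto
    then show ?r using e' by (intro exI[of _ e']) auto
  next
    assume ?r
    then obtain e' where e': "\<forall>x. x \<notin> set (y # xs) \<longrightarrow> e' x = e x" "\<forall>x\<in>set (y # xs). e' x \<in> D"
      "sat D ev e' \<phi>" by blast
    have "sat D ev (e(y := e' y)) (foldr Exists xs \<phi>)"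
      using e' by (subst Cons, intro exI[of _ e']) auto
    then show ?l using e' by auto
  qed
qed

lemma free_vars_foldr_Exists: "free_vars tv (foldr Exists xs \<phi>) = free_vars tv \<phi> - set xs"
  by (induction xs) auto

text \<open>Only sentences are transferred by elementary equivalence. A formula has finitely many
  free variables, so binding all of them existentially turns a solution into a sentence.\<close>

lemma sat_exists_transfer:
  assumes "group G" "group H" and GH: "group_elem_equiv G H"
    and "range \<nu> \<subseteq> carrier G" "sat (carrier G) (group_eval G) \<nu> \<phi>"
  shows "\<exists>\<nu>'. range \<nu>' \<subseteq> carrier H \<and> sat (carrier H) (group_eval H) \<nu>' \<phi>"
proof -
  have fin: "finite (free_vars group_term_vars \<phi>)"
    by (rule finite_free_vars) (rule finite_group_term_vars)
  then obtain xs where xs: "set xs = free_vars group_term_vars \<phi>"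
    using finite_list by blast
  define S where "S = foldr Exists xs \<phi>"
  have S: "free_vars group_term_vars S = {}" by (simp add: S_def free_vars_foldr_Exists xs)
  have "models (carrier G) (group_eval G) S"
    unfolding models_def
  proof (intro allI impI)
    fix e :: "nat \<Rightarrow> 'a" assume "range e \<subseteq> carrier G"
    have "sat (carrier G) (group_eval G) (\<lambda>x. if x \<in> set xs then \<nu> x else e x) \<phi>"
      using assms(5) by (subst sat_group_cong[where e' = \<nu>]) (auto simp: xs)
    then show "sat (carrier G) (group_eval G) e S"
      unfolding S_def sat_foldr_Exists
      by (intro exI[of _ "\<lambda>x. if x \<in> set xs then \<nu> x else e x"]) (use assms(4) in auto)
  qed
  then have "models (carrier H) (group_eval H) S"
    using GH S unfolding group_elem_equiv_def by blast
  moreover have "range (\<lambda>_::nat. \<one>\<^bsub>H\<^esub>) \<subseteq> carrier H"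
    using assms(2) by (auto simp: group.is_monoid monoid.one_closed)
  ultimately have "sat (carrier H) (group_eval H) (\<lambda>_. \<one>\<^bsub>H\<^esub>) S"
    unfolding models_def by blast
  then obtain e' where "\<forall>x. x \<notin> set xs \<longrightarrow> e' x = \<one>\<^bsub>H\<^esub>" "\<forall>x\<in>set xs. e' x \<in> carrier H"
    "sat (carrier H) (group_eval H) e' \<phi>" unfolding S_def sat_foldr_Exists by blast
  then have "range e' \<subseteq> carrier H"
    using assms(2) by (metis group.is_monoid image_subsetI monoid.one_closed)
  then show ?thesis using \<open>sat (carrier H) (group_eval H) e' \<phi>\<close> by blast
qed

text \<open>The evaluations are arbitrary so that one induction serves group isomorphisms, ring
  isomorphisms and, with the identity as \<open>f\<close>, the passage from \<open>ring_eval\<close>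
  to \<open>reval\<close>.\<close>

lemma sat_iso:
  fixes D :: "'a set" and D' :: "'b set"
  assumes bij: "bij_betw f D D'"
    and ev: "\<And>e t. range e \<subseteq> D \<Longrightarrow> ev e t \<in> D \<and> ev' (f \<circ> e) t = f (ev e t)"
  shows "range e \<subseteq> D \<Longrightarrow> sat D ev e \<phi> = sat D' ev' (f \<circ> e) \<phi>"
proof (induction \<phi> arbitrary: e)
  case (Eq s t)
  have "inj_on f D" using bij by (simp add: bij_betw_def)
  then have "(ev e s = ev e t) = (f (ev e s) = f (ev e t))"
    using ev[OF Eq] by (metis inj_onD)
  then show ?case using ev[OF Eq, of s] ev[OF Eq, of t] by (metis sat.simps(1))
next
  case (Exists x \<phi>)
  have upd: "f \<circ> e(x := a) = (f \<circ> e)(x := f a)" for a by auto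
  have "sat D ev (e(x := a)) \<phi> = sat D' ev' ((f \<circ> e)(x := f a)) \<phi>" if "a \<in> D" for a
  proof -
    have "range (e(x := a)) \<subseteq> D" using Exists.prems that by auto
    from Exists.IH[OF this] show ?thesis by (simp only: upd)
  qed
  moreover have D': "D' = f ` D" using bij by (simp add: bij_betw_def)
  ultimately show ?case unfolding sat.simps D' by blast
qed auto

lemma models_iso:
  fixes D :: "'a set" and D' :: "'b set"
  assumes bij: "bij_betw f D D'"
    and ev: "\<And>e t. range e \<subseteq> D \<Longrightarrow> ev e t \<in> D \<and> ev' (f \<circ> e) t = f (ev e t)"
  shows "models D ev \<phi> = models D' ev' \<phi>"
proof -
  let ?g = "inv_into D f"
  have g: "f (?g y) = y" "?g y \<in> D" if "y \<in> D'" for y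
    using that bij by (auto simp: bij_betw_def f_inv_into_f inv_into_into)
  show ?thesis
    unfolding models_def
  proof (intro iffI allI impI)
    fix e :: "nat \<Rightarrow> 'b" assume *: "\<forall>e. range e \<subseteq> D \<longrightarrow> sat D ev e \<phi>" "range e \<subseteq> D'"
    have e: "e x \<in> D'" for x using *(2) by auto
    have r: "range (?g \<circ> e) \<subseteq> D" using g(2)[OF e] by auto
    have fg: "f \<circ> (?g \<circ> e) = e" using g(1)[OF e] by auto
    have "sat D ev (?g \<circ> e) \<phi>" using *(1) r by blast
    moreover have "sat D ev (?g \<circ> e) \<phi> = sat D' ev' (f \<circ> (?g \<circ> e)) \<phi>"
      using bij ev r by (rule sat_iso[where f = f and ev = ev and ev' = ev'])
    ultimately show "sat D' ev' e \<phi>" unfolding fg by blast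
  next
    fix e :: "nat \<Rightarrow> 'a" assume *: "\<forall>e. range e \<subseteq> D' \<longrightarrow> sat D' ev' e \<phi>" "range e \<subseteq> D"
    have "range (f \<circ> e) \<subseteq> D'" using *(2) bij by (auto simp: bij_betw_def)
    then have "sat D' ev' (f \<circ> e) \<phi>" using *(1) by blast
    moreover have "sat D ev e \<phi> = sat D' ev' (f \<circ> e) \<phi>"
      using bij ev *(2) by (rule sat_iso[where f = f and ev = ev and ev' = ev'])
    ultimately show "sat D ev e \<phi>" by blast
  qed
qed

lemma group_eval_iso:
  assumes "group G" "group H" "f \<in> iso G H" "range e \<subseteq> carrier G"
  shows "group_eval G e t \<in> carrier G \<and> group_eval H (f \<circ> e) t = f (group_eval G e t)"
proof -
  interpret G: group G by fact
  interpret H: group H by fact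
  interpret group_hom G H f
    using assms(3) by unfold_locales (simp add: iso_def)
  have "e x \<in> carrier G" for x using assms(4) by blast
  then show ?thesis by (induction t) auto
qed

lemma models_group_iso:
  assumes "group G" "group H" "f \<in> iso G H"
  shows "models (carrier G) (group_eval G) \<phi> = models (carrier H) (group_eval H) \<phi>"
proof (rule models_iso[where f = f])
  show "bij_betw f (carrier G) (carrier H)" using assms(3) by (simp add: iso_def)
qed (rule group_eval_iso[OF assms])

lemma ring_eval_iso:
  assumes "cring R" "cring S" "f \<in> ring_iso R S" "range e \<subseteq> carrier R"
  shows "ring_eval R e t \<in> carrier R \<and> ring_eval S (f \<circ> e) t = f (ring_eval R e t)"
proof -
  interpret R: cring R by fact
  interpret S: cring S by fact
  interpret ring_hom_cring R S f
    using assms(3) by unfold_locales (simp add: ring_iso_def)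
  have "e x \<in> carrier R" for x using assms(4) by blast
  then show ?thesis by (induction t) auto
qed

lemma models_ring_iso:
  assumes "cring R" "cring S" "f \<in> ring_iso R S"
  shows "models (carrier R) (ring_eval R) \<phi> = models (carrier S) (ring_eval S) \<phi>"
proof (rule models_iso[where f = f])
  show "bij_betw f (carrier R) (carrier S)" using assms(3) by (simp add: ring_iso_def)
qed (rule ring_eval_iso[OF assms])

section \<open>A calculus of predicates given by one formula in two groups\<close>

locale group_pair =
  fixes G :: "('a, 'm) monoid_scheme" and H :: "('b, 'n) monoid_scheme"
begin

text \<open>The index type is arbitrary, for instance pairs or sums. A finite support common to both
  sides is what permits an injective naming by natural numbers and the choice of fresh bound
  variables.\<close>

definition same_support :: "'i set \<Rightarrow> (('i \<Rightarrow> 'a) \<Rightarrow> 'c) \<Rightarrow> (('i \<Rightarrow> 'b) \<Rightarrow> 'd) \<Rightarrow> bool" where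
  "same_support I P Q \<longleftrightarrow> finite I \<and> (\<forall>e e'. (\<forall>i\<in>I. e i = e' i) \<longrightarrow> P e = P e') \<and>
    (\<forall>e e'. (\<forall>i\<in>I. e i = e' i) \<longrightarrow> Q e = Q e')"

definition dtm :: "(('i \<Rightarrow> 'a) \<Rightarrow> 'a) \<Rightarrow> (('i \<Rightarrow> 'b) \<Rightarrow> 'b) \<Rightarrow> bool" where
  "dtm f f' \<longleftrightarrow> (\<exists>I. same_support I f f') \<and>
    (\<forall>g::'i \<Rightarrow> nat. \<exists>t. (\<forall>\<nu>. f (\<nu> \<circ> g) = group_eval G \<nu> t) \<and>
      (\<forall>\<nu>. f' (\<nu> \<circ> g) = group_eval H \<nu> t))"

text \<open>The index set of the free variables is arbitrary; quantifying over all (also non-injective)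
  namings \<open>g\<close> of the variables spares any renaming of bound variables in the closure rules.\<close>

definition dfn :: "(('i \<Rightarrow> 'a) \<Rightarrow> bool) \<Rightarrow> (('i \<Rightarrow> 'b) \<Rightarrow> bool) \<Rightarrow> bool" where
  "dfn P Q \<longleftrightarrow> (\<exists>I. same_support I P Q) \<and>
    (\<forall>g::'i \<Rightarrow> nat. \<exists>\<phi>.
      (\<forall>\<nu>. range \<nu> \<subseteq> carrier G \<longrightarrow> P (\<nu> \<circ> g) = sat (carrier G) (group_eval G) \<nu> \<phi>) \<and>
      (\<forall>\<nu>. range \<nu> \<subseteq> carrier H \<longrightarrow> Q (\<nu> \<circ> g) = sat (carrier H) (group_eval H) \<nu> \<phi>))"

lemma dfnD:
  assumes "dfn P Q"
  shows "\<exists>\<phi>. (\<forall>\<nu>. range \<nu> \<subseteq> carrier G \<longrightarrow> P (\<nu> \<circ> g) = sat (carrier G) (group_eval G) \<nu> \<phi>) \<and>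
      (\<forall>\<nu>. range \<nu> \<subseteq> carrier H \<longrightarrow> Q (\<nu> \<circ> g) = sat (carrier H) (group_eval H) \<nu> \<phi>)"
  using assms unfolding dfn_def by (elim conjE) (erule spec)

lemma dfn_support: "dfn P Q \<Longrightarrow> \<exists>I. same_support I P Q"
  unfolding dfn_def by (rule conjunct1)

lemma same_supportD:
  assumes "same_support I P Q"
  shows "finite I" "\<forall>i\<in>I. e i = e' i \<Longrightarrow> P e = P e'" "\<forall>i\<in>I. d i = d' i \<Longrightarrow> Q d = Q d'"
proof -
  note * = assms[unfolded same_support_def]
  show "finite I" using * by (rule conjunct1)
  show "\<forall>i\<in>I. e i = e' i \<Longrightarrow> P e = P e'"
    by (rule *[THEN conjunct2, THEN conjunct1, THEN spec, THEN spec, THEN mp])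
  show "\<forall>i\<in>I. d i = d' i \<Longrightarrow> Q d = Q d'"
    by (rule *[THEN conjunct2, THEN conjunct2, THEN spec, THEN spec, THEN mp])
qed

lemma same_support_Un:
  assumes "same_support I P Q" "same_support J P' Q'"
  shows "same_support (I \<union> J) (\<lambda>e. F (P e) (P' e)) (\<lambda>e. F' (Q e) (Q' e))"
proof -
  have "P e = P e' \<and> P' e = P' e'" if "\<forall>i\<in>I \<union> J. e i = e' i" for e e'
    using assms that unfolding same_support_def by blast
  moreover have "Q e = Q e' \<and> Q' e = Q' e'" if "\<forall>i\<in>I \<union> J. e i = e' i" for e e'
    using assms that unfolding same_support_def by blast
  ultimately show ?thesis using assms unfolding same_support_def by (metis finite_Un)
qed

lemma same_support_map:
  assumes "same_support I P Q"
  shows "same_support I (\<lambda>e. F (P e)) (\<lambda>e. F' (Q e))"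
  using same_support_Un[OF assms assms, of "\<lambda>x y. F x" "\<lambda>x y. F' x"] by simp

lemma dtm_var: "dtm (\<lambda>e. e i) (\<lambda>e. e i)"
  unfolding dtm_def
proof (intro conjI allI)
  show "\<exists>I. same_support I (\<lambda>e. e i) (\<lambda>e. e i)"
    by (rule exI[of _ "{i}"]) (auto simp: same_support_def)
  show "\<exists>t. (\<forall>\<nu>. (\<nu> \<circ> g) i = group_eval G \<nu> t) \<and> (\<forall>\<nu>. (\<nu> \<circ> g) i = group_eval H \<nu> t)" for g :: "_ \<Rightarrow> nat"
    by (rule exI[of _ "GVar (g i)"]) auto
qed

lemma dtm_one: "dtm (\<lambda>e. \<one>\<^bsub>G\<^esub>) (\<lambda>e. \<one>\<^bsub>H\<^esub>)"
  unfolding dtm_def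
proof (intro conjI allI)
  show "\<exists>I. same_support I (\<lambda>e. \<one>\<^bsub>G\<^esub>) (\<lambda>e. \<one>\<^bsub>H\<^esub>)"
    by (rule exI[of _ "{}"]) (auto simp: same_support_def)
  show "\<exists>t. (\<forall>\<nu>::nat\<Rightarrow>'a. \<one>\<^bsub>G\<^esub> = group_eval G \<nu> t) \<and> (\<forall>\<nu>::nat\<Rightarrow>'b. \<one>\<^bsub>H\<^esub> = group_eval H \<nu> t)"
    by (rule exI[of _ "GOne"]) auto
qed

lemma dtm_mult:
  assumes "dtm f f'" "dtm h h'"
  shows "dtm (\<lambda>e. f e \<otimes>\<^bsub>G\<^esub> h e) (\<lambda>e. f' e \<otimes>\<^bsub>H\<^esub> h' e)"
  unfolding dtm_def
proof (intro conjI allI)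
  show "\<exists>I. same_support I (\<lambda>e. f e \<otimes>\<^bsub>G\<^esub> h e) (\<lambda>e. f' e \<otimes>\<^bsub>H\<^esub> h' e)"
    using assms same_support_Un[of _ f f' _ h h'] unfolding dtm_def by blast
  fix g :: "_ \<Rightarrow> nat"
  obtain s t where "(\<forall>\<nu>. f (\<nu> \<circ> g) = group_eval G \<nu> s) \<and> (\<forall>\<nu>. f' (\<nu> \<circ> g) = group_eval H \<nu> s)"
    "(\<forall>\<nu>. h (\<nu> \<circ> g) = group_eval G \<nu> t) \<and> (\<forall>\<nu>. h' (\<nu> \<circ> g) = group_eval H \<nu> t)"
    using assms unfolding dtm_def by blast
  then show "\<exists>t. (\<forall>\<nu>. f (\<nu> \<circ> g) \<otimes>\<^bsub>G\<^esub> h (\<nu> \<circ> g) = group_eval G \<nu> t) \<and>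
    (\<forall>\<nu>. f' (\<nu> \<circ> g) \<otimes>\<^bsub>H\<^esub> h' (\<nu> \<circ> g) = group_eval H \<nu> t)"
    by (intro exI[of _ "GMult s t"]) auto
qed

lemma dtm_inv:
  assumes "dtm f f'"
  shows "dtm (\<lambda>e. inv\<^bsub>G\<^esub> (f e)) (\<lambda>e. inv\<^bsub>H\<^esub> (f' e))"
  unfolding dtm_def
proof (intro conjI allI)
  show "\<exists>I. same_support I (\<lambda>e. inv\<^bsub>G\<^esub> (f e)) (\<lambda>e. inv\<^bsub>H\<^esub> (f' e))"
    using assms same_support_map[of _ f f'] unfolding dtm_def by blast
  fix g :: "_ \<Rightarrow> nat"
  obtain s where "(\<forall>\<nu>. f (\<nu> \<circ> g) = group_eval G \<nu> s) \<and> (\<forall>\<nu>. f' (\<nu> \<circ> g) = group_eval H \<nu> s)"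
    using assms unfolding dtm_def by blast
  then show "\<exists>t. (\<forall>\<nu>. inv\<^bsub>G\<^esub> (f (\<nu> \<circ> g)) = group_eval G \<nu> t) \<and>
    (\<forall>\<nu>. inv\<^bsub>H\<^esub> (f' (\<nu> \<circ> g)) = group_eval H \<nu> t)"
    by (intro exI[of _ "GInv s"]) auto
qed

lemma dtm_pow:
  assumes "dtm f f'"
  shows "dtm (\<lambda>e. f e [^]\<^bsub>G\<^esub> (k::nat)) (\<lambda>e. f' e [^]\<^bsub>H\<^esub> k)"
  by (induction k) (simp_all add: nat_pow_def dtm_one dtm_mult assms)

lemma dtm_if:
  "dtm f f' \<Longrightarrow> dtm h h' \<Longrightarrow> dtm (\<lambda>e. if b then f e else h e) (\<lambda>e. if b then f' e else h' e)"
  by (cases b) simp_all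

lemma dtm_foldr:
  assumes "\<And>k s s'. dtm s s' \<Longrightarrow> dtm (\<lambda>e. F k (s e) e) (\<lambda>e. F' k (s' e) e)" "dtm z z'"
  shows "dtm (\<lambda>e. foldr (\<lambda>k s. F k s e) xs (z e)) (\<lambda>e. foldr (\<lambda>k s. F' k s e) xs (z' e))"
  by (induction xs) (simp_all add: assms)

lemma dfn_eq:
  assumes "dtm f f'" "dtm h h'"
  shows "dfn (\<lambda>e. f e = h e) (\<lambda>e. f' e = h' e)"
  unfolding dfn_def
proof (intro conjI allI)
  show "\<exists>I. same_support I (\<lambda>e. f e = h e) (\<lambda>e. f' e = h' e)"
    using assms same_support_Un[of _ f f' _ h h'] unfolding dtm_def by blast
  fix g :: "_ \<Rightarrow> nat"
  obtain s t where "(\<forall>\<nu>. f (\<nu> \<circ> g) = group_eval G \<nu> s) \<and> (\<forall>\<nu>. f' (\<nu> \<circ> g) = group_eval H \<nu> s)"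
    "(\<forall>\<nu>. h (\<nu> \<circ> g) = group_eval G \<nu> t) \<and> (\<forall>\<nu>. h' (\<nu> \<circ> g) = group_eval H \<nu> t)"
    using assms unfolding dtm_def by blast
  then show "\<exists>\<phi>. (\<forall>\<nu>. range \<nu> \<subseteq> carrier G \<longrightarrow> (f (\<nu> \<circ> g) = h (\<nu> \<circ> g)) = sat (carrier G) (group_eval G) \<nu> \<phi>) \<and>
    (\<forall>\<nu>. range \<nu> \<subseteq> carrier H \<longrightarrow> (f' (\<nu> \<circ> g) = h' (\<nu> \<circ> g)) = sat (carrier H) (group_eval H) \<nu> \<phi>)"
    by (intro exI[of _ "Eq s t"]) auto
qed

lemma dfn_not:
  assumes "dfn P Q"
  shows "dfn (\<lambda>e. \<not> P e) (\<lambda>e. \<not> Q e)"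
  unfolding dfn_def
proof (intro conjI allI)
  show "\<exists>I. same_support I (\<lambda>e. \<not> P e) (\<lambda>e. \<not> Q e)"
    using assms same_support_map[of _ P Q] unfolding dfn_def by blast
  fix g :: "_ \<Rightarrow> nat"
  obtain s where "(\<forall>\<nu>. range \<nu> \<subseteq> carrier G \<longrightarrow> P (\<nu> \<circ> g) = sat (carrier G) (group_eval G) \<nu> s) \<and>
    (\<forall>\<nu>. range \<nu> \<subseteq> carrier H \<longrightarrow> Q (\<nu> \<circ> g) = sat (carrier H) (group_eval H) \<nu> s)"
    using assms unfolding dfn_def by blast
  then show "\<exists>\<phi>. (\<forall>\<nu>. range \<nu> \<subseteq> carrier G \<longrightarrow> (\<not> P (\<nu> \<circ> g)) = sat (carrier G) (group_eval G) \<nu> \<phi>) \<and>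
    (\<forall>\<nu>. range \<nu> \<subseteq> carrier H \<longrightarrow> (\<not> Q (\<nu> \<circ> g)) = sat (carrier H) (group_eval H) \<nu> \<phi>)"
    by (intro exI[of _ "Neg s"]) auto
qed

lemma dfn_conj:
  assumes "dfn P Q" "dfn P' Q'"
  shows "dfn (\<lambda>e. P e \<and> P' e) (\<lambda>e. Q e \<and> Q' e)"
  unfolding dfn_def
proof (intro conjI allI)
  show "\<exists>I. same_support I (\<lambda>e. P e \<and> P' e) (\<lambda>e. Q e \<and> Q' e)"
    using assms same_support_Un[of _ P Q _ P' Q'] unfolding dfn_def by blast
  fix g :: "_ \<Rightarrow> nat"
  obtain s t where "(\<forall>\<nu>. range \<nu> \<subseteq> carrier G \<longrightarrow> P (\<nu> \<circ> g) = sat (carrier G) (group_eval G) \<nu> s) \<and>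
    (\<forall>\<nu>. range \<nu> \<subseteq> carrier H \<longrightarrow> Q (\<nu> \<circ> g) = sat (carrier H) (group_eval H) \<nu> s)"
    "(\<forall>\<nu>. range \<nu> \<subseteq> carrier G \<longrightarrow> P' (\<nu> \<circ> g) = sat (carrier G) (group_eval G) \<nu> t) \<and>
    (\<forall>\<nu>. range \<nu> \<subseteq> carrier H \<longrightarrow> Q' (\<nu> \<circ> g) = sat (carrier H) (group_eval H) \<nu> t)"
    using dfnD[OF assms(1), of g] dfnD[OF assms(2), of g] by (elim exE)
  then show "\<exists>\<phi>. (\<forall>\<nu>. range \<nu> \<subseteq> carrier G \<longrightarrow> (P (\<nu> \<circ> g) \<and> P' (\<nu> \<circ> g)) = sat (carrier G) (group_eval G) \<nu> \<phi>) \<and>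
    (\<forall>\<nu>. range \<nu> \<subseteq> carrier H \<longrightarrow> (Q (\<nu> \<circ> g) \<and> Q' (\<nu> \<circ> g)) = sat (carrier H) (group_eval H) \<nu> \<phi>)"
    by (intro exI[of _ "Conj s t"]) auto
qed

lemma dfn_imp: "dfn P Q \<Longrightarrow> dfn P' Q' \<Longrightarrow> dfn (\<lambda>e. P e \<longrightarrow> P' e) (\<lambda>e. Q e \<longrightarrow> Q' e)"
  using dfn_not[OF dfn_conj[OF _ dfn_not, of P Q P' Q']] by simp

lemma dfn_disj: "dfn P Q \<Longrightarrow> dfn P' Q' \<Longrightarrow> dfn (\<lambda>e. P e \<or> P' e) (\<lambda>e. Q e \<or> Q' e)"
  using dfn_imp[OF dfn_not[of P Q], of P' Q'] by (simp add: disj_imp)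

lemma dfn_const: "dfn (\<lambda>e. b) (\<lambda>e. b)"
  using dfn_eq[OF dtm_one dtm_one] dfn_not[OF dfn_eq[OF dtm_one dtm_one]] by (cases b) simp_all

lemma dfn_iff: "dfn P Q \<Longrightarrow> dfn P' Q' \<Longrightarrow> dfn (\<lambda>e. P e \<longleftrightarrow> P' e) (\<lambda>e. Q e \<longleftrightarrow> Q' e)"
  using dfn_conj[OF dfn_imp[of P Q P' Q'] dfn_imp[of P' Q' P Q]] by (simp add: iff_conv_conj_imp)

lemma dfn_ball_finite:
  assumes "finite S" "\<And>s. s \<in> S \<Longrightarrow> dfn (P s) (Q s)"
  shows "dfn (\<lambda>e. \<forall>s\<in>S. P s e) (\<lambda>e. \<forall>s\<in>S. Q s e)"
  using assms by (induction S rule: finite_induct) (simp_all add: dfn_const dfn_conj)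

lemma dfn_all_less:
  assumes "\<And>s. dfn (P s) (Q s)"
  shows "dfn (\<lambda>e. \<forall>s<k::nat. P s e) (\<lambda>e. \<forall>s<k. Q s e)"
  using dfn_ball_finite[of "{..<k}" P Q] assms by (simp add: Ball_def)

lemma dfn_reindex:
  assumes "dfn P Q"
  shows "dfn (\<lambda>e. P (\<lambda>i. e (f i))) (\<lambda>e. Q (\<lambda>i. e (f i)))"
  unfolding dfn_def
proof (intro conjI allI)
  obtain I where "same_support I P Q" using assms unfolding dfn_def by blast
  then have "same_support (f ` I) (\<lambda>e. P (\<lambda>i. e (f i))) (\<lambda>e. Q (\<lambda>i. e (f i)))"
    unfolding same_support_def by auto
  then show "\<exists>I. same_support I (\<lambda>e. P (\<lambda>i. e (f i))) (\<lambda>e. Q (\<lambda>i. e (f i)))" by blast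
  fix g :: "_ \<Rightarrow> nat"
  have eq: "(\<lambda>i. (\<nu> \<circ> g) (f i)) = \<nu> \<circ> (g \<circ> f)" for \<nu> :: "nat \<Rightarrow> 'c" by auto
  have eq': "(\<lambda>i. (\<nu> \<circ> g) (f i)) = \<nu> \<circ> (g \<circ> f)" for \<nu> :: "nat \<Rightarrow> 'd" by auto
  show "\<exists>\<phi>. (\<forall>\<nu>. range \<nu> \<subseteq> carrier G \<longrightarrow> P (\<lambda>i. (\<nu> \<circ> g) (f i)) = sat (carrier G) (group_eval G) \<nu> \<phi>) \<and>
    (\<forall>\<nu>. range \<nu> \<subseteq> carrier H \<longrightarrow> Q (\<lambda>i. (\<nu> \<circ> g) (f i)) = sat (carrier H) (group_eval H) \<nu> \<phi>)"
    using assms unfolding dfn_def by (simp add: o_def)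
qed

lemma dtm_reindex:
  assumes "dtm P Q"
  shows "dtm (\<lambda>e. P (\<lambda>i. e (f i))) (\<lambda>e. Q (\<lambda>i. e (f i)))"
  unfolding dtm_def
proof (intro conjI allI)
  obtain I where "same_support I P Q" using assms unfolding dtm_def by blast
  then have "same_support (f ` I) (\<lambda>e. P (\<lambda>i. e (f i))) (\<lambda>e. Q (\<lambda>i. e (f i)))"
    unfolding same_support_def by auto
  then show "\<exists>I. same_support I (\<lambda>e. P (\<lambda>i. e (f i))) (\<lambda>e. Q (\<lambda>i. e (f i)))" by blast
  fix g :: "_ \<Rightarrow> nat"
  show "\<exists>t. (\<forall>\<nu>. P (\<lambda>i. (\<nu> \<circ> g) (f i)) = group_eval G \<nu> t) \<and>
    (\<forall>\<nu>. Q (\<lambda>i. (\<nu> \<circ> g) (f i)) = group_eval H \<nu> t)"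
    using assms unfolding dtm_def by (simp add: o_def)
qed

text \<open>A family such as a matrix is quantified in one stroke, although its index type may be
  infinite: only the finitely many indices \<open>Ip\<close> in the support matter, and each of them
  becomes one quantified variable.\<close>

lemma dfn_exf:
  fixes P :: "('p::countable \<Rightarrow> 'a) \<Rightarrow> ('i \<Rightarrow> 'a) \<Rightarrow> bool" and Q :: "('p \<Rightarrow> 'b) \<Rightarrow> ('i \<Rightarrow> 'b) \<Rightarrow> bool"
  assumes "dfn (\<lambda>e. P (\<lambda>p. e (Inr p)) (\<lambda>i. e (Inl i))) (\<lambda>e. Q (\<lambda>p. e (Inr p)) (\<lambda>i. e (Inl i)))"
  shows "dfn (\<lambda>e. \<exists>F. (\<forall>p. F p \<in> carrier G) \<and> P F e) (\<lambda>e. \<exists>F. (\<forall>p. F p \<in> carrier H) \<and> Q F e)"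
  unfolding dfn_def
proof (intro conjI allI)
  obtain I where I: "same_support I (\<lambda>e. P (\<lambda>p. e (Inr p)) (\<lambda>i. e (Inl i)))
      (\<lambda>e. Q (\<lambda>p. e (Inr p)) (\<lambda>i. e (Inl i)))"
    using dfn_support[OF assms] by (rule exE)
  note IP = same_supportD(2)[OF I] and IQ = same_supportD(3)[OF I]
  define Il where "Il = Inl -` I"
  define Ip where "Ip = Inr -` I"
  have fin: "finite Il" "finite Ip"
    using same_supportD(1)[OF I] unfolding Il_def Ip_def by (auto intro!: finite_vimageI)
  have agree: "\<forall>i\<in>I. case_sum e F i = case_sum e' F' i"
    if "\<forall>i\<in>Il. e i = e' i" "\<forall>p\<in>Ip. F p = F' p" for e e' :: "'i \<Rightarrow> 'c" and F F'
  proof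
    fix i assume "i \<in> I"
    then show "case_sum e F i = case_sum e' F' i"
      using that unfolding Il_def Ip_def by (cases i) auto
  qed
  have P: "P F e = P F' e'" if "\<forall>i\<in>Il. e i = e' i" "\<forall>p\<in>Ip. F p = F' p" for F F' e e'
    using IP[OF agree[OF that]] by (simp only: sum.case)
  have Q: "Q F e = Q F' e'" if "\<forall>i\<in>Il. e i = e' i" "\<forall>p\<in>Ip. F p = F' p" for F F' e e'
    using IQ[OF agree[OF that]] by (simp only: sum.case)
  have "same_support Il (\<lambda>e. \<exists>F. (\<forall>p. F p \<in> carrier G) \<and> P F e) (\<lambda>e. \<exists>F. (\<forall>p. F p \<in> carrier H) \<and> Q F e)"
    unfolding same_support_def
  proof (intro conjI allI impI)
    fix e e' :: "'i \<Rightarrow> 'a" assume "\<forall>i\<in>Il. e i = e' i"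
    then have "P F e = P F e'" for F by (rule P) simp
    then show "(\<exists>F. (\<forall>p. F p \<in> carrier G) \<and> P F e) = (\<exists>F. (\<forall>p. F p \<in> carrier G) \<and> P F e')" by (simp only:)
  next
    fix e e' :: "'i \<Rightarrow> 'b" assume "\<forall>i\<in>Il. e i = e' i"
    then have "Q F e = Q F e'" for F by (rule Q) simp
    then show "(\<exists>F. (\<forall>p. F p \<in> carrier H) \<and> Q F e) = (\<exists>F. (\<forall>p. F p \<in> carrier H) \<and> Q F e')" by (simp only:)
  qed (rule fin(1))
  then show "\<exists>I. same_support I (\<lambda>e. \<exists>F. (\<forall>p. F p \<in> carrier G) \<and> P F e) (\<lambda>e. \<exists>F. (\<forall>p. F p \<in> carrier H) \<and> Q F e)"
    by (rule exI)
  fix g :: "'i \<Rightarrow> nat"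
  \<comment> \<open>Every name of an outer variable in the support is below \<open>N\<close>, so the
    variables \<open>N + to_nat p\<close> capture none of them.\<close>
  define N where "N = Suc (Max (insert 0 (g ` Il)))"
  have N: "g i < N" if "i \<in> Il" for i
    unfolding N_def using fin that by (auto simp: less_Suc_eq_le)
  define g' where "g' = case_sum g (\<lambda>p::'p. N + to_nat p)"
  have g'r: "(\<lambda>p. (\<nu> \<circ> g') (Inr p)) = (\<lambda>p. \<nu> (N + to_nat p))"
    and g'l: "(\<lambda>i. (\<nu> \<circ> g') (Inl i)) = \<nu> \<circ> g" for \<nu> :: "nat \<Rightarrow> 'c"
    by (auto simp: g'_def)
  obtain \<phi> where \<phi>:
    "\<And>\<nu>. range \<nu> \<subseteq> carrier G \<Longrightarrow> P (\<lambda>p. \<nu> (N + to_nat p)) (\<nu> \<circ> g) = sat (carrier G) (group_eval G) \<nu> \<phi>"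
    "\<And>\<nu>. range \<nu> \<subseteq> carrier H \<Longrightarrow> Q (\<lambda>p. \<nu> (N + to_nat p)) (\<nu> \<circ> g) = sat (carrier H) (group_eval H) \<nu> \<phi>"
    using dfnD[OF assms, of g', unfolded g'r g'l] by blast
  \<comment> \<open>Only the variables of \<open>Ip\<close> are bound; the values of
    \<open>F\<close> at other indices do not influence the predicate, by \<open>P\<close> and
    \<open>Q\<close>.\<close>
  obtain xs where xs: "set xs = (\<lambda>p. N + to_nat p) ` Ip"
    using fin(2) finite_list finite_imageI by metis
  have xsN: "g i \<notin> set xs" if "i \<in> Il" for i using N[OF that] by (auto simp: xs)
  have xsp: "N + to_nat p \<in> set xs \<longleftrightarrow> p \<in> Ip" for p by (auto simp: xs)
  show "\<exists>\<phi>. (\<forall>\<nu>. range \<nu> \<subseteq> carrier G \<longrightarrow>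
      (\<exists>F. (\<forall>p. F p \<in> carrier G) \<and> P F (\<nu> \<circ> g)) = sat (carrier G) (group_eval G) \<nu> \<phi>) \<and>
    (\<forall>\<nu>. range \<nu> \<subseteq> carrier H \<longrightarrow>
      (\<exists>F. (\<forall>p. F p \<in> carrier H) \<and> Q F (\<nu> \<circ> g)) = sat (carrier H) (group_eval H) \<nu> \<phi>)"
  proof (rule exI[of _ "foldr Exists xs \<phi>"], intro conjI allI impI)
    fix \<nu> :: "nat \<Rightarrow> 'a" assume \<nu>: "range \<nu> \<subseteq> carrier G"
    show "(\<exists>F. (\<forall>p. F p \<in> carrier G) \<and> P F (\<nu> \<circ> g)) = sat (carrier G) (group_eval G) \<nu> (foldr Exists xs \<phi>)"
      unfolding sat_foldr_Exists
    proof
      assume "\<exists>F. (\<forall>p. F p \<in> carrier G) \<and> P F (\<nu> \<circ> g)"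
      then obtain F where F: "\<And>p. F p \<in> carrier G" "P F (\<nu> \<circ> g)" by blast
      define \<nu>' where "\<nu>' = (\<lambda>x. if x \<in> set xs then F (from_nat (x - N)) else \<nu> x)"
      have "\<nu>' x \<in> carrier G" for x using \<nu> F(1) unfolding \<nu>'_def by auto
      then have "range \<nu>' \<subseteq> carrier G" by blast
      moreover have "P (\<lambda>p. \<nu>' (N + to_nat p)) (\<nu>' \<circ> g) = P F (\<nu> \<circ> g)"
        by (rule P) (simp_all add: \<nu>'_def xsN xsp)
      ultimately have "sat (carrier G) (group_eval G) \<nu>' \<phi>" using \<phi>(1) F by blast
      then show "\<exists>e'. (\<forall>x. x \<notin> set xs \<longrightarrow> e' x = \<nu> x) \<and> (\<forall>x\<in>set xs. e' x \<in> carrier G) \<and> sat (carrier G) (group_eval G) e' \<phi>"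
        by (intro exI[of _ \<nu>']) (auto simp: \<nu>'_def F)
    next
      assume "\<exists>e'. (\<forall>x. x \<notin> set xs \<longrightarrow> e' x = \<nu> x) \<and> (\<forall>x\<in>set xs. e' x \<in> carrier G) \<and> sat (carrier G) (group_eval G) e' \<phi>"
      then obtain \<nu>' where e: "\<forall>x. x \<notin> set xs \<longrightarrow> \<nu>' x = \<nu> x" "\<forall>x\<in>set xs. \<nu>' x \<in> carrier G"
        "sat (carrier G) (group_eval G) \<nu>' \<phi>" by blast
      have "\<nu>' x \<in> carrier G" for x using e(1,2) \<nu> by (cases "x \<in> set xs") auto
      then have env: "range \<nu>' \<subseteq> carrier G" by blast
      have "P (\<lambda>p. \<nu>' (N + to_nat p)) (\<nu>' \<circ> g) = P (\<lambda>p. \<nu>' (N + to_nat p)) (\<nu> \<circ> g)"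
        by (rule P) (simp_all add: e(1) xsN)
      then have "P (\<lambda>p. \<nu>' (N + to_nat p)) (\<nu> \<circ> g)" using \<phi>(1)[OF env] e(3) by blast
      then show "\<exists>F. (\<forall>p. F p \<in> carrier G) \<and> P F (\<nu> \<circ> g)"
        using env by (intro exI[of _ "\<lambda>p. \<nu>' (N + to_nat p)"] conjI) auto
    qed
  next
    fix \<nu> :: "nat \<Rightarrow> 'b" assume \<nu>: "range \<nu> \<subseteq> carrier H"
    show "(\<exists>F. (\<forall>p. F p \<in> carrier H) \<and> Q F (\<nu> \<circ> g)) = sat (carrier H) (group_eval H) \<nu> (foldr Exists xs \<phi>)"
      unfolding sat_foldr_Exists
    proof
      assume "\<exists>F. (\<forall>p. F p \<in> carrier H) \<and> Q F (\<nu> \<circ> g)"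
      then obtain F where F: "\<And>p. F p \<in> carrier H" "Q F (\<nu> \<circ> g)" by blast
      define \<nu>' where "\<nu>' = (\<lambda>x. if x \<in> set xs then F (from_nat (x - N)) else \<nu> x)"
      have "\<nu>' x \<in> carrier H" for x using \<nu> F(1) unfolding \<nu>'_def by auto
      then have "range \<nu>' \<subseteq> carrier H" by blast
      moreover have "Q (\<lambda>p. \<nu>' (N + to_nat p)) (\<nu>' \<circ> g) = Q F (\<nu> \<circ> g)"
        by (rule Q) (simp_all add: \<nu>'_def xsN xsp)
      ultimately have "sat (carrier H) (group_eval H) \<nu>' \<phi>" using \<phi>(2) F by blast
      then show "\<exists>e'. (\<forall>x. x \<notin> set xs \<longrightarrow> e' x = \<nu> x) \<and> (\<forall>x\<in>set xs. e' x \<in> carrier H) \<and> sat (carrier H) (group_eval H) e' \<phi>"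
        by (intro exI[of _ \<nu>']) (auto simp: \<nu>'_def F)
    next
      assume "\<exists>e'. (\<forall>x. x \<notin> set xs \<longrightarrow> e' x = \<nu> x) \<and> (\<forall>x\<in>set xs. e' x \<in> carrier H) \<and> sat (carrier H) (group_eval H) e' \<phi>"
      then obtain \<nu>' where e: "\<forall>x. x \<notin> set xs \<longrightarrow> \<nu>' x = \<nu> x" "\<forall>x\<in>set xs. \<nu>' x \<in> carrier H"
        "sat (carrier H) (group_eval H) \<nu>' \<phi>" by blast
      have "\<nu>' x \<in> carrier H" for x using e(1,2) \<nu> by (cases "x \<in> set xs") auto
      then have env: "range \<nu>' \<subseteq> carrier H" by blast
      have "Q (\<lambda>p. \<nu>' (N + to_nat p)) (\<nu>' \<circ> g) = Q (\<lambda>p. \<nu>' (N + to_nat p)) (\<nu> \<circ> g)"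
        by (rule Q) (simp_all add: e(1) xsN)
      then have "Q (\<lambda>p. \<nu>' (N + to_nat p)) (\<nu> \<circ> g)" using \<phi>(2)[OF env] e(3) by blast
      then show "\<exists>F. (\<forall>p. F p \<in> carrier H) \<and> Q F (\<nu> \<circ> g)"
        using env by (intro exI[of _ "\<lambda>p. \<nu>' (N + to_nat p)"] conjI) auto
    qed
  qed
qed

lemma dfn_allf:
  fixes P :: "('p::countable \<Rightarrow> 'a) \<Rightarrow> ('i \<Rightarrow> 'a) \<Rightarrow> bool" and Q :: "('p \<Rightarrow> 'b) \<Rightarrow> ('i \<Rightarrow> 'b) \<Rightarrow> bool"
  assumes "dfn (\<lambda>e. P (\<lambda>p. e (Inr p)) (\<lambda>i. e (Inl i))) (\<lambda>e. Q (\<lambda>p. e (Inr p)) (\<lambda>i. e (Inl i)))"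
  shows "dfn (\<lambda>e. \<forall>F. (\<forall>p. F p \<in> carrier G) \<longrightarrow> P F e) (\<lambda>e. \<forall>F. (\<forall>p. F p \<in> carrier H) \<longrightarrow> Q F e)"
proof -
  have eqP: "(\<forall>F. (\<forall>p. F p \<in> carrier G) \<longrightarrow> P F e) = (\<not> (\<exists>F. (\<forall>p. F p \<in> carrier G) \<and> \<not> P F e))"
    and eqQ: "(\<forall>F. (\<forall>p. F p \<in> carrier H) \<longrightarrow> Q F d) = (\<not> (\<exists>F. (\<forall>p. F p \<in> carrier H) \<and> \<not> Q F d))" for e d
    by blast+
  show ?thesis unfolding eqP eqQ
    by (rule dfn_not, rule dfn_exf, rule dfn_not, rule assms)
qed

lemma dfn_ex:
  assumes "dfn (\<lambda>e. P (e (Inr ())) (\<lambda>i. e (Inl i))) (\<lambda>e. Q (e (Inr ())) (\<lambda>i. e (Inl i)))"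
  shows "dfn (\<lambda>e. \<exists>a\<in>carrier G. P a e) (\<lambda>e. \<exists>a\<in>carrier H. Q a e)"
proof -
  have "(\<exists>a\<in>carrier G. P a e) = (\<exists>F. (\<forall>p::unit. F p \<in> carrier G) \<and> P (F ()) e)" for e
    by (auto intro: exI[of _ "\<lambda>_. a" for a])
  moreover have "(\<exists>a\<in>carrier H. Q a e) = (\<exists>F. (\<forall>p::unit. F p \<in> carrier H) \<and> Q (F ()) e)" for e
    by (auto intro: exI[of _ "\<lambda>_. a" for a])
  ultimately show ?thesis
    using dfn_exf[of "\<lambda>F. P (F ())" "\<lambda>F. Q (F ())"] assms by simp
qed

lemma dfn_all:
  assumes "dfn (\<lambda>e. P (e (Inr ())) (\<lambda>i. e (Inl i))) (\<lambda>e. Q (e (Inr ())) (\<lambda>i. e (Inl i)))"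
  shows "dfn (\<lambda>e. \<forall>a\<in>carrier G. P a e) (\<lambda>e. \<forall>a\<in>carrier H. Q a e)"
  using dfn_not[OF dfn_ex[of "\<lambda>F e. \<not> P F e" "\<lambda>F e. \<not> Q F e", OF dfn_not[OF assms]]] by simp

text \<open>Relative to a naming that is injective on the support, every assignment of the indices
  comes from a valuation of the variables. The clause on \<open>f\<close> says that this valuation
  may be composed with an arbitrary map, as is done with automorphisms.\<close>

definition naming :: "(('i \<Rightarrow> 'a) \<Rightarrow> bool) \<Rightarrow> (('i \<Rightarrow> 'b) \<Rightarrow> bool) \<Rightarrow> ('i \<Rightarrow> nat) \<Rightarrow> group_term formula \<Rightarrow> bool" where
  "naming P Q g \<phi> \<longleftrightarrow> (\<forall>\<nu>. range \<nu> \<subseteq> carrier G \<longrightarrow> P (\<nu> \<circ> g) = sat (carrier G) (group_eval G) \<nu> \<phi>) \<and>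
    (\<forall>\<nu>. range \<nu> \<subseteq> carrier H \<longrightarrow> Q (\<nu> \<circ> g) = sat (carrier H) (group_eval H) \<nu> \<phi>) \<and>
    (\<forall>e. range e \<subseteq> carrier G \<longrightarrow> (\<exists>\<nu>. range \<nu> \<subseteq> carrier G \<and> P e = P (\<nu> \<circ> g) \<and>
      (\<forall>f. P (f \<circ> e) = P ((f \<circ> \<nu>) \<circ> g)))) \<and>
    (\<forall>e. range e \<subseteq> carrier H \<longrightarrow> (\<exists>\<nu>. range \<nu> \<subseteq> carrier H \<and> Q e = Q (\<nu> \<circ> g)))"

lemma dfn_naming:
  assumes "dfn P Q" "group G" "group H"
  shows "\<exists>g \<phi>. naming P Q g \<phi>"
proof -
  obtain I where I: "same_support I P Q" using dfn_support[OF assms(1)] by (rule exE)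
  obtain g :: "_ \<Rightarrow> nat" where g: "inj_on g I"
    using same_supportD(1)[OF I] finite_imp_inj_to_nat_seg by blast
  have inv: "inv_into I g (g i) = i" if "i \<in> I" for i using g that by simp
  obtain \<phi> where \<phi>:
    "(\<forall>\<nu>. range \<nu> \<subseteq> carrier G \<longrightarrow> P (\<nu> \<circ> g) = sat (carrier G) (group_eval G) \<nu> \<phi>) \<and>
    (\<forall>\<nu>. range \<nu> \<subseteq> carrier H \<longrightarrow> Q (\<nu> \<circ> g) = sat (carrier H) (group_eval H) \<nu> \<phi>)"
    using dfnD[OF assms(1), of g] by (rule exE)
  have oneG: "\<one>\<^bsub>G\<^esub> \<in> carrier G" and oneH: "\<one>\<^bsub>H\<^esub> \<in> carrier H"
    using assms(2,3) by (auto simp: group.is_monoid monoid.one_closed)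
  show ?thesis unfolding naming_def
  proof (rule exI[of _ g], rule exI[of _ \<phi>], intro conjI)
    show "\<forall>e. range e \<subseteq> carrier G \<longrightarrow> (\<exists>\<nu>. range \<nu> \<subseteq> carrier G \<and> P e = P (\<nu> \<circ> g) \<and>
      (\<forall>f. P (f \<circ> e) = P ((f \<circ> \<nu>) \<circ> g)))"
    proof (intro allI impI)
      fix e :: "'c \<Rightarrow> 'a" assume e: "range e \<subseteq> carrier G"
      let ?\<nu> = "\<lambda>x. if x \<in> g ` I then e (inv_into I g x) else \<one>\<^bsub>G\<^esub>"
      show "\<exists>\<nu>. range \<nu> \<subseteq> carrier G \<and> P e = P (\<nu> \<circ> g) \<and> (\<forall>f. P (f \<circ> e) = P ((f \<circ> \<nu>) \<circ> g))"
      proof (rule exI[of _ ?\<nu>], intro conjI allI)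
        show "range ?\<nu> \<subseteq> carrier G" using e oneG by auto
        show "P e = P (?\<nu> \<circ> g)" by (rule same_supportD(2)[OF I]) (simp add: inv)
        show "P (f \<circ> e) = P ((f \<circ> ?\<nu>) \<circ> g)" for f by (rule same_supportD(2)[OF I]) (simp add: inv)
      qed
    qed
    show "\<forall>e. range e \<subseteq> carrier H \<longrightarrow> (\<exists>\<nu>. range \<nu> \<subseteq> carrier H \<and> Q e = Q (\<nu> \<circ> g))"
    proof (intro allI impI)
      fix e :: "'c \<Rightarrow> 'b" assume e: "range e \<subseteq> carrier H"
      let ?\<nu> = "\<lambda>x. if x \<in> g ` I then e (inv_into I g x) else \<one>\<^bsub>H\<^esub>"
      show "\<exists>\<nu>. range \<nu> \<subseteq> carrier H \<and> Q e = Q (\<nu> \<circ> g)"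
      proof (rule exI[of _ ?\<nu>], intro conjI allI)
        show "range ?\<nu> \<subseteq> carrier H" using e oneH by auto
        show "Q e = Q (?\<nu> \<circ> g)" by (rule same_supportD(3)[OF I]) (simp add: inv)
      qed
    qed
  qed (rule \<phi>[THEN conjunct1], rule \<phi>[THEN conjunct2])
qed

text \<open>A counterexample in \<open>H\<close> solves \<open>Neg \<phi>\<close>. Since solvability
  is a sentence, \<open>G\<close> would contain a counterexample as well.\<close>

lemma dfn_transfer:
  assumes "dfn P Q" "group G" "group H" "group_elem_equiv H G"
    and all: "\<And>e. range e \<subseteq> carrier G \<Longrightarrow> P e" and "range e \<subseteq> carrier H"
  shows "Q e"
proof (rule ccontr)
  assume nQ: "\<not> Q e"
  obtain g \<phi> where "naming P Q g \<phi>" using dfn_naming[OF assms(1-3)] by (elim exE)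
  note * = this[unfolded naming_def]
  note 1 = *[THEN conjunct1, THEN spec, THEN mp]
    and 2 = *[THEN conjunct2, THEN conjunct1, THEN spec, THEN mp]
    and 4 = *[THEN conjunct2, THEN conjunct2, THEN conjunct2, THEN spec, THEN mp]
  obtain \<nu> where \<nu>: "range \<nu> \<subseteq> carrier H \<and> Q e = Q (\<nu> \<circ> g)" using 4[OF assms(6)] by (rule exE)
  then have "\<not> sat (carrier H) (group_eval H) \<nu> \<phi>" using 2[of \<nu>] nQ by argo
  then have "sat (carrier H) (group_eval H) \<nu> (Neg \<phi>)" by simp
  then obtain \<nu>' where \<nu>': "range \<nu>' \<subseteq> carrier G" "sat (carrier G) (group_eval G) \<nu>' (Neg \<phi>)"
    using sat_exists_transfer[OF assms(3,2,4) \<nu>[THEN conjunct1]] by blast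
  then have "\<not> P (\<nu>' \<circ> g)" unfolding 1[OF \<nu>'(1)] by simp
  moreover have "range (\<nu>' \<circ> g) \<subseteq> carrier G" using \<nu>'(1) by auto
  ultimately show False using all[of "\<nu>' \<circ> g"] by argo
qed

text \<open>Satisfaction is preserved by isomorphisms. This is what allows a property to be checked
  at the standard elementary matrices only, instead of at every tuple conjugate to them under an
  automorphism.\<close>

lemma dfn_automorphism:
  assumes "dfn P Q" "group G" "group H" "f \<in> iso G G" "range e \<subseteq> carrier G"
  shows "P (f \<circ> e) = P e"
proof -
  obtain g \<phi> where "naming P Q g \<phi>" using dfn_naming[OF assms(1-3)] by (elim exE)
  note * = this[unfolded naming_def]
  note 1 = *[THEN conjunct1, THEN spec, THEN mp]
    and 3 = *[THEN conjunct2, THEN conjunct2, THEN conjunct1, THEN spec, THEN mp]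
  obtain \<nu> where \<nu>: "range \<nu> \<subseteq> carrier G \<and> P e = P (\<nu> \<circ> g) \<and> (\<forall>f. P (f \<circ> e) = P ((f \<circ> \<nu>) \<circ> g))"
    using 3[OF assms(5)] by (rule exE)
  note r = \<nu>[THEN conjunct1]
  have r': "range (f \<circ> \<nu>) \<subseteq> carrier G" using r assms(4) by (auto simp: iso_def hom_def)
  have a: "P e = sat (carrier G) (group_eval G) \<nu> \<phi>"
    by (rule trans[OF \<nu>[THEN conjunct2, THEN conjunct1] 1[OF r]])
  have b: "P (f \<circ> e) = sat (carrier G) (group_eval G) (f \<circ> \<nu>) \<phi>"
    by (rule trans[OF \<nu>[THEN conjunct2, THEN conjunct2, THEN spec] 1[OF r']])
  have "sat (carrier G) (group_eval G) \<nu> \<phi> = sat (carrier G) (group_eval G) (f \<circ> \<nu>) \<phi>"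
  proof (rule sat_iso[where f = f])
    show "bij_betw f (carrier G) (carrier G)" using assms(4) by (simp add: iso_def)
  qed (rule group_eval_iso[OF assms(2,2,4)], assumption, rule r)
  then show ?thesis unfolding a b by (rule sym)
qed

lemmas dfn_intros = dtm_var dtm_one dtm_mult dtm_inv dtm_pow dtm_if dtm_foldr dfn_eq dfn_not
  dfn_conj dfn_imp dfn_disj dfn_iff dfn_const dfn_all_less dfn_exf dfn_allf dfn_ex dfn_all

end

section \<open>Eigenvectors in invariant subspaces\<close>

definition vsub :: "nat \<Rightarrow> complex vec set \<Rightarrow> bool" where
  "vsub n W \<longleftrightarrow> W \<subseteq> carrier_vec n \<and> (\<forall>v\<in>W. \<forall>w\<in>W. v + w \<in> W) \<and> (\<forall>v\<in>W. \<forall>a. a \<cdot>\<^sub>v v \<in> W)"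

text \<open>In coordinates in which \<open>A\<close> is upper triangular, subtracting the right multiple of \<open>w\<close> from
  \<open>A w\<close> shortens the support of \<open>w\<close>; the last non-zero vector so obtained is an eigenvector.\<close>

lemma eigenvector_in_invariant:
  assumes A: "A \<in> carrier_mat n n" and W: "vsub n W" and inv: "\<And>w. w \<in> W \<Longrightarrow> A *\<^sub>v w \<in> W"
    and w: "w \<in> W" "w \<noteq> 0\<^sub>v n"
  shows "\<exists>v\<in>W. v \<noteq> 0\<^sub>v n \<and> (\<exists>\<mu>. A *\<^sub>v v = \<mu> \<cdot>\<^sub>v v)"
proof -
  obtain es where "char_poly A = (\<Prod>a\<leftarrow>es. [:- a, 1:])"
    using char_poly_factorized[OF A] by blast
  then obtain U where U: "U \<in> carrier_mat n n" "upper_triangular U" "similar_mat A U"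
    using schur_decomposition_exists[OF A] by blast
  then obtain P Q where PQ: "similar_mat_wit A U P Q" unfolding similar_mat_def by blast
  note P = similar_mat_witD2[OF A PQ]
  have Wc: "w \<in> carrier_vec n" if "w \<in> W" for w using W that by (auto simp: vsub_def)
  \<comment> \<open>Here \<open>k\<close> bounds the support of the coordinates
    \<open>Q *v w\<close>; at \<open>k = 0\<close> the vector would be zero.\<close>
  have main: "\<exists>v\<in>W. v \<noteq> 0\<^sub>v n \<and> (\<exists>\<mu>. A *\<^sub>v v = \<mu> \<cdot>\<^sub>v v)"
    if "w \<in> W" "w \<noteq> 0\<^sub>v n" "k \<le> n" "\<And>i. k \<le> i \<Longrightarrow> i < n \<Longrightarrow> (Q *\<^sub>v w) $ i = 0" for k w
    using that
  proof (induction k arbitrary: w)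
    case 0
    have "Q *\<^sub>v w = 0\<^sub>v n" by (rule eq_vecI) (use 0 P in auto)
    then have "P *\<^sub>v (Q *\<^sub>v w) = 0\<^sub>v n" using P by auto
    moreover have "P *\<^sub>v (Q *\<^sub>v w) = w"
      using P Wc[OF 0(1)] by (simp flip: assoc_mult_mat_vec)
    ultimately show ?case using 0 by simp
  next
    case (Suc k)
    have wc: "w \<in> carrier_vec n" using Wc Suc by blast
    let ?q = "Q *\<^sub>v w"
    have q: "?q \<in> carrier_vec n" using P wc by auto
    have dims: "dim_vec w = n" "dim_row Q = n" "dim_row U = n" "dim_col U = n" using wc P U by auto
    let ?\<mu> = "U $$ (k, k)"
    let ?w' = "A *\<^sub>v w + (- ?\<mu>) \<cdot>\<^sub>v w"
    have QA: "Q *\<^sub>v (A *\<^sub>v w) = U *\<^sub>v ?q"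
    proof -
      have "Q * A = U * Q"
      proof -
        have "Q * A = Q * (P * (U * Q))" using P by simp
        also have "\<dots> = (Q * P) * (U * Q)" using P by (intro assoc_mult_mat[symmetric]) auto
        also have "\<dots> = U * Q" using P by simp
        finally show ?thesis .
      qed
      then show ?thesis using P wc A by (metis assoc_mult_mat_vec)
    qed
    have Qw': "Q *\<^sub>v ?w' = U *\<^sub>v ?q + (- ?\<mu>) \<cdot>\<^sub>v ?q"
    proof -
      have "A *\<^sub>v w \<in> carrier_vec n" using A wc by simp
      then have "Q *\<^sub>v ?w' = Q *\<^sub>v (A *\<^sub>v w) + Q *\<^sub>v ((- ?\<mu>) \<cdot>\<^sub>v w)"
        using P(7) wc by (intro mult_add_distrib_mat_vec) auto
      also have "Q *\<^sub>v ((- ?\<mu>) \<cdot>\<^sub>v w) = (- ?\<mu>) \<cdot>\<^sub>v ?q" by (rule mult_mat_vec[OF P(7) wc])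
      finally show ?thesis unfolding QA .
    qed
    have zero: "(Q *\<^sub>v ?w') $ i = 0" if i: "k \<le> i" "i < n" for i
    proof -
      have "(U *\<^sub>v ?q) $ i = (\<Sum>j\<in>{0..<n}. U $$ (i, j) * ?q $ j)"
        using i U P q by (auto simp: scalar_prod_def intro!: sum.cong)
      also have "\<dots> = (\<Sum>j\<in>{0..<n}. if j = k \<and> i = k then U $$ (k, k) * ?q $ k else 0)"
      proof (rule sum.cong)
        fix j assume j: "j \<in> {0..<n}"
        show "U $$ (i, j) * ?q $ j = (if j = k \<and> i = k then U $$ (k, k) * ?q $ k else 0)"
        proof (cases "j \<ge> Suc k")
          case True
          then show ?thesis using Suc.prems(4)[of j] j by simp
        next
          case False
          have "U $$ (i, j) = 0" if "j < i" using U(1,2) i(2) that by auto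
          moreover have "j = k \<and> i = k" if "\<not> j < i" using that False i(1) by auto
          ultimately show ?thesis using i(1) by (cases "j < i") auto
        qed
      qed simp
      also have "\<dots> = (if i = k then U $$ (k, k) * ?q $ k else 0)" using Suc.prems by (simp add: sum.delta)
      finally have Uq: "(U *\<^sub>v ?q) $ i = (if i = k then U $$ (k, k) * ?q $ k else 0)" .
      show ?thesis
      proof (cases "i = k")
        case True
        then show ?thesis unfolding Qw' using Uq i dims by (simp del: index_mult_mat_vec)
      next
        case False
        then have "?q $ i = 0" using Suc.prems(4)[of i] i by simp
        then show ?thesis unfolding Qw' using False Uq i dims by (simp del: index_mult_mat_vec)
      qed
    qed
    show ?case
    proof (cases "?w' = 0\<^sub>v n")
      case True
      have "A *\<^sub>v w = ?\<mu> \<cdot>\<^sub>v w"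
      proof (rule eq_vecI)
        fix i assume i: "i < dim_vec (?\<mu> \<cdot>\<^sub>v w)"
        then have "?w' $ i = 0" using True wc by simp
        then show "(A *\<^sub>v w) $ i = (?\<mu> \<cdot>\<^sub>v w) $ i" using i A wc by simp
      qed (use A wc in auto)
      then show ?thesis using Suc.prems by blast
    next
      case False
      have "?w' \<in> W" using W inv Suc.prems unfolding vsub_def by blast
      then show ?thesis using Suc.IH[OF _ False _ zero] Suc.prems(3) by auto
    qed
  qed
  show ?thesis by (rule main[of w n]) (use w in auto)
qed

text \<open>If \<open>b v = \<beta> v\<close> with \<open>v\<close> in the \<open>\<kappa>\<close>-eigenspace of \<open>c = a b a\<^sup>-\<^sup>1 b\<^sup>-\<^sup>1\<close>, then \<open>\<beta>\<close> is \<open>\<kappa>\<^sup>k\<close> times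
  the eigenvalue of \<open>b\<close> at \<open>a\<^sup>k v\<close>; since \<open>b\<close> has at most \<open>n\<close> eigenvalues, \<open>\<kappa>\<close> is a root of unity.\<close>

lemma commutator_eigenvalue:
  assumes abc: "a \<in> carrier_mat n n" "b \<in> carrier_mat n n" "c \<in> carrier_mat n n"
    and ab: "a * b = c * (b * a)" and ca: "c * a = a * c" and cb: "c * b = b * c"
    and det: "det a \<noteq> 0" "det b \<noteq> 0" "det c \<noteq> 0"
    and v: "v \<in> carrier_vec n" "v \<noteq> 0\<^sub>v n" "c *\<^sub>v v = \<kappa> \<cdot>\<^sub>v v"
  shows "\<kappa> ^ fact n = (1::complex)"
proof -
  have inj: "A *\<^sub>v x \<noteq> 0\<^sub>v n" if "A \<in> carrier_mat n n" "det A \<noteq> (0::complex)" "x \<in> carrier_vec n" "x \<noteq> 0\<^sub>v n" for A x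
    using that det_0_iff_vec_prod_zero[of A n] by blast
  have l0: "\<kappa> \<noteq> 0"
    using inj[OF abc(3) det(3) v(1,2)] v(3) v(1) by auto
  define W where "W = {x \<in> carrier_vec n. c *\<^sub>v x = \<kappa> \<cdot>\<^sub>v x}"
  have W: "vsub n W"
    unfolding vsub_def W_def using abc
    by (auto simp: mult_add_distrib_mat_vec[of c n n] mult_mat_vec[of c n n] smult_add_distrib_vec[of _ n]
        smult_smult_assoc mult.commute)
  have inv: "A *\<^sub>v x \<in> W" if "A \<in> carrier_mat n n" "c * A = A * c" "x \<in> W" for A x
  proof -
    have x: "x \<in> carrier_vec n" "c *\<^sub>v x = \<kappa> \<cdot>\<^sub>v x" using that by (auto simp: W_def)
    have "c *\<^sub>v (A *\<^sub>v x) = A *\<^sub>v (c *\<^sub>v x)"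
      using that(1,2) x(1) abc(3) by (metis assoc_mult_mat_vec)
    then show ?thesis using that(1) x by (simp add: W_def mult_mat_vec[of A n n])
  qed
  obtain u \<beta> where u: "u \<in> W" "u \<noteq> 0\<^sub>v n" "b *\<^sub>v u = \<beta> \<cdot>\<^sub>v u"
    using eigenvector_in_invariant[OF abc(2) W inv[OF abc(2) cb], of v] v by (auto simp: W_def)
  have "0 \<cdot>\<^sub>v u = 0\<^sub>v n" using u(1) by (intro eq_vecI) (auto simp: W_def)
  then have b0: "\<beta> \<noteq> 0"
    using inj[OF abc(2) det(2)] u by (auto simp: W_def)
  have step: "\<exists>x\<in>W. x \<noteq> 0\<^sub>v n \<and> b *\<^sub>v x = (\<beta> / \<kappa> ^ k) \<cdot>\<^sub>v x" for k
  proof (induction k)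
    case 0
    then show ?case using u by auto
  next
    case (Suc k)
    then obtain x where x: "x \<in> W" "x \<noteq> 0\<^sub>v n" "b *\<^sub>v x = (\<beta> / \<kappa> ^ k) \<cdot>\<^sub>v x" by blast
    then have xc: "x \<in> carrier_vec n" by (simp add: W_def)
    let ?y = "a *\<^sub>v x"
    have y: "?y \<in> W" "?y \<noteq> 0\<^sub>v n" using inv[OF abc(1) ca x(1)] inj[OF abc(1) det(1) xc x(2)] by auto
    have byW: "b *\<^sub>v ?y \<in> W" by (rule inv[OF abc(2) cb y(1)])
    have "\<kappa> \<cdot>\<^sub>v (b *\<^sub>v ?y) = c *\<^sub>v (b *\<^sub>v ?y)" using byW by (simp add: W_def)
    also have "\<dots> = (c * (b * a)) *\<^sub>v x"
      using abc xc by (simp add: assoc_mult_mat_vec[of _ n n _ n])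
    also have "\<dots> = a *\<^sub>v (b *\<^sub>v x)" unfolding ab[symmetric] using abc xc by (simp add: assoc_mult_mat_vec[of _ n n _ n])
    also have "\<dots> = (\<beta> / \<kappa> ^ k) \<cdot>\<^sub>v ?y" using x(3) xc abc by (simp add: mult_mat_vec[of _ n n])
    finally have "(1 / \<kappa>) \<cdot>\<^sub>v (\<kappa> \<cdot>\<^sub>v (b *\<^sub>v ?y)) = (1 / \<kappa>) \<cdot>\<^sub>v ((\<beta> / \<kappa> ^ k) \<cdot>\<^sub>v ?y)" by simp
    then have "b *\<^sub>v ?y = (\<beta> / \<kappa> ^ Suc k) \<cdot>\<^sub>v ?y" using l0 by (simp add: smult_smult_assoc)
    then show ?case using y by blast
  qed
  then have ev: "\<beta> / \<kappa> ^ k \<in> spectrum b" for k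
    unfolding spectrum_def eigenvalue_def eigenvector_def using abc(2)
    by (auto simp: W_def)
  have "\<not> inj_on (\<lambda>k. \<beta> / \<kappa> ^ k) {0..n}"
  proof
    assume "inj_on (\<lambda>k. \<beta> / \<kappa> ^ k) {0..n}"
    then have "card {0..n} \<le> card (spectrum b)"
      using ev card_finite_spectrum(1)[OF abc(2)] by (intro card_inj_on_le) auto
    then show False using card_finite_spectrum(2)[OF abc(2)] by simp
  qed
  then obtain k l where "k < l" "l \<le> n" "\<beta> / \<kappa> ^ k = \<beta> / \<kappa> ^ l"
    unfolding inj_on_def by (metis atLeastAtMost_iff nat_neq_iff)
  then have "\<kappa> ^ (l - k) = 1" using b0 l0 by (simp add: power_diff field_simps)
  \<comment> \<open>The order of \<open>\<kappa>\<close> is at most n but unknown, and n! is a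
    multiple of every candidate.\<close>
  moreover have "(l - k) dvd fact n" using \<open>k < l\<close> \<open>l \<le> n\<close> by (intro dvd_fact) auto
  ultimately show ?thesis by (metis dvdE power_mult power_one)
qed

text \<open>The \<open>\<mu>\<close>-eigenspace of \<open>c ^ m\<close> is invariant under
  \<open>c\<close> and so contains an eigenvector of \<open>c\<close>, say for
  \<open>\<kappa>\<close>; then \<open>\<mu> = \<kappa> ^ m = 1\<close>.\<close>

lemma pow_eigenvalue:
  assumes c: "c \<in> carrier_mat n n"
    and ev: "\<And>v \<kappa>. v \<in> carrier_vec n \<Longrightarrow> v \<noteq> 0\<^sub>v n \<Longrightarrow> c *\<^sub>v v = \<kappa> \<cdot>\<^sub>v v \<Longrightarrow> \<kappa> ^ m = (1::complex)"
    and v: "v \<in> carrier_vec n" "v \<noteq> 0\<^sub>v n" "(c ^\<^sub>m m) *\<^sub>v v = \<mu> \<cdot>\<^sub>v v"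
  shows "\<mu> = 1"
proof -
  have cm: "c ^\<^sub>m m \<in> carrier_mat n n" using c by simp
  define W where "W = {x \<in> carrier_vec n. (c ^\<^sub>m m) *\<^sub>v x = \<mu> \<cdot>\<^sub>v x}"
  have W: "vsub n W"
    unfolding vsub_def W_def using cm
    by (auto simp: mult_add_distrib_mat_vec[of _ n n] mult_mat_vec[of _ n n] smult_add_distrib_vec[of _ n]
        smult_smult_assoc mult.commute)
  have comm: "c * c ^\<^sub>m m = c ^\<^sub>m m * c"
  proof (induction m)
    case (Suc m)
    have "c * (c ^\<^sub>m m * c) = c * c ^\<^sub>m m * c" using c by (intro assoc_mult_mat[symmetric]) auto
    then show ?case using Suc by simp
  qed (use c in simp)
  have inv: "c *\<^sub>v x \<in> W" if "x \<in> W" for x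
  proof -
    have x: "x \<in> carrier_vec n" "(c ^\<^sub>m m) *\<^sub>v x = \<mu> \<cdot>\<^sub>v x" using that by (auto simp: W_def)
    have "(c ^\<^sub>m m) *\<^sub>v (c *\<^sub>v x) = c *\<^sub>v ((c ^\<^sub>m m) *\<^sub>v x)"
      using c x(1) cm comm by (metis assoc_mult_mat_vec)
    then show ?thesis using c x by (simp add: W_def mult_mat_vec[of c n n])
  qed
  obtain u \<kappa> where u: "u \<in> W" "u \<noteq> 0\<^sub>v n" "c *\<^sub>v u = \<kappa> \<cdot>\<^sub>v u"
    using eigenvector_in_invariant[OF c W inv, of v] v by (auto simp: W_def)
  have uc: "u \<in> carrier_vec n" "(c ^\<^sub>m m) *\<^sub>v u = \<mu> \<cdot>\<^sub>v u" using u by (auto simp: W_def)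
  have "eigenvector c u \<kappa>" using u uc c by (simp add: eigenvector_def)
  then have "(c ^\<^sub>m m) *\<^sub>v u = \<kappa> ^ m \<cdot>\<^sub>v u" by (rule eigenvector_pow[OF c])
  then have eq: "\<mu> \<cdot>\<^sub>v u = 1 \<cdot>\<^sub>v u" using ev[OF uc(1) u(2,3)] uc by simp
  obtain i where i: "i < n" "u $ i \<noteq> 0" using u(2) uc(1) by (metis carrier_vecD eq_vecI index_zero_vec)
  then have "(\<mu> \<cdot>\<^sub>v u) $ i = (1 \<cdot>\<^sub>v u) $ i" using eq by simp
  then show ?thesis using i uc by simp
qed

section \<open>Simultaneous triangularisation of the upper root elements\<close>

lemma cancel_left_mat:
  assumes "P \<in> carrier_mat n n" "Q \<in> carrier_mat n n" "P * Q = 1\<^sub>m n" "Z \<in> carrier_mat n m"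
  shows "P * (Q * Z) = (Z :: 'a::comm_ring_1 mat)"
  using assms by (simp flip: assoc_mult_mat)

lemma conj_mult:
  assumes "P \<in> carrier_mat n n" "Q \<in> carrier_mat n n" "U \<in> carrier_mat n n" "Y \<in> carrier_mat n n"
    and "P * Q = 1\<^sub>m n"
  shows "(Q * U * P) * (Q * Y * P) = Q * (U * Y) * (P :: 'a::comm_ring_1 mat)"
proof -
  have "P * (Q * (Y * P)) = Y * P" by (rule cancel_left_mat) (use assms in auto)
  then show ?thesis using assms by (simp add: assoc_mult_mat[of _ n n _ n _ n])
qed

lemma conj_pow:
  assumes "P \<in> carrier_mat n n" "Q \<in> carrier_mat n n" "U \<in> carrier_mat n n"
    and "P * Q = 1\<^sub>m n" "Q * P = 1\<^sub>m n"
  shows "(Q * U * P) ^\<^sub>m k = Q * U ^\<^sub>m k * (P :: 'a::comm_ring_1 mat)"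
proof (induction k)
  case 0
  then show ?case using assms by simp
next
  case (Suc k)
  then show ?case using conj_mult[of P n Q "U ^\<^sub>m k" U] assms by simp
qed

lemma det_nonzero_inverse:
  assumes "(A :: complex mat) \<in> carrier_mat n n" "det A \<noteq> 0"
  obtains B where "B \<in> carrier_mat n n" "A * B = 1\<^sub>m n" "B * A = 1\<^sub>m n"
  using det_non_zero_imp_unit[OF assms, where b = "()"]
  unfolding Units_def by (auto simp: ring_mat_simps)

text \<open>Some coordinate k of \<open>v\<close> is not zero. After exchanging the coordinates 0
  and k, the unit matrix with first column replaced by \<open>v\<close> is lower triangular with
  non-zero diagonal; \<open>?S\<close> exchanges the coordinates back.\<close>

lemma invertible_with_first_column:
  assumes v: "(v :: complex vec) \<in> carrier_vec n" "v \<noteq> 0\<^sub>v n"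
  obtains W where "W \<in> carrier_mat n n" "det W \<noteq> 0" "col W 0 = v" "0 < n"
proof -
  obtain k where k: "k < n" "v $ k \<noteq> 0" using v by (metis carrier_vecD eq_vecI index_zero_vec)
  define \<tau> where "\<tau> p = (if p = 0 then k else if p = k then 0 else p)" for p
  define B where "B = mat n n (\<lambda>(p, q). if q = 0 then v $ \<tau> p else if p = q then 1 else 0)"
  have B: "B \<in> carrier_mat n n" by (simp add: B_def)
  have "det B = prod_list (diag_mat B)"
    by (rule det_lower_triangular[OF _ B]) (auto simp: B_def)
  also have "\<dots> \<noteq> 0" unfolding prod_list_diag_prod using k by (auto simp: B_def \<tau>_def)
  finally have dB: "det B \<noteq> 0" .
  let ?S = "if k = 0 then 1\<^sub>m n else swaprows_mat n 0 k"
  have S: "?S \<in> carrier_mat n n" by simp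
  have dS: "det ?S \<noteq> 0" using k by (auto simp: det_swaprows_mat)
  have col: "col (?S * B) 0 = v"
  proof (rule eq_vecI)
    fix p assume "p < dim_vec v"
    then have p: "p < n" using v by simp
    show "col (?S * B) 0 $ p = v $ p"
    proof (cases "k = 0")
      case True
      then show ?thesis using p B by (simp add: B_def \<tau>_def)
    next
      case False
      have "?S * B = swaprows 0 k B" using False k by (simp add: swaprows_mat[OF B])
      then show ?thesis using p k False by (simp add: B_def \<tau>_def)
    qed
  qed (use v B in auto)
  show ?thesis
    by (rule that[of "?S * B"]) (use S B dS dB col k in \<open>auto simp: det_mult[OF S B]\<close>)
qed

text \<open>The relations satisfied by the \<open>M\<close>-th powers of the Steinberg elements above the diagonal,
  in a matrix size \<open>m\<close> that shrinks during the triangularisation while the index bound \<open>n\<close> stays.\<close>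

locale upper_family =
  fixes n M m :: nat and T :: "nat \<Rightarrow> nat \<Rightarrow> complex mat"
  assumes T: "i < j \<Longrightarrow> j < n \<Longrightarrow> T i j \<in> carrier_mat m m"
    and rel: "i < j \<Longrightarrow> j < k \<Longrightarrow> k < n \<Longrightarrow> T i j * T j k = T i k ^\<^sub>m M * (T j k * T i j)"
    and comm: "i < j \<Longrightarrow> j < n \<Longrightarrow> k < l \<Longrightarrow> l < n \<Longrightarrow> j \<noteq> k \<Longrightarrow> i \<noteq> l \<Longrightarrow> T i j * T k l = T k l * T i j"
    and ev: "i < j \<Longrightarrow> j < n \<Longrightarrow> v \<in> carrier_vec m \<Longrightarrow> v \<noteq> 0\<^sub>v m \<Longrightarrow> T i j *\<^sub>v v = \<mu> \<cdot>\<^sub>v v \<Longrightarrow> \<mu> = 1"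
begin

lemma pow_fix:
  assumes "A \<in> carrier_mat m m" "x \<in> carrier_vec m" "A *\<^sub>v x = (x :: complex vec)"
  shows "(A ^\<^sub>m k) *\<^sub>v x = x"
  using assms by (induction k) (auto simp: assoc_mult_mat_vec[of _ m m _ m])

text \<open>An argument of Lie-Kolchin type, by induction on an ideal \<open>S\<close> of positive
  roots. After removal of a root (i, j) of least height, the commutators of \<open>T i j\<close>
  with the other elements lie in root positions of the rest, so the common fixed space of the rest
  is invariant under \<open>T i j\<close>, whose only eigenvalue is 1.\<close>

lemma common_fixed_vector_aux:
  assumes "finite S" "S \<subseteq> {(i, j). i < j \<and> j < n}" "0 < m"
    and "\<And>i j l. (i, j) \<in> S \<Longrightarrow> j < l \<Longrightarrow> l < n \<Longrightarrow> (i, l) \<in> S"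
    and "\<And>i j k. (i, j) \<in> S \<Longrightarrow> k < i \<Longrightarrow> (k, j) \<in> S"
  shows "\<exists>v. v \<in> carrier_vec m \<and> v \<noteq> 0\<^sub>v m \<and> (\<forall>(i, j)\<in>S. T i j *\<^sub>v v = v)"
  using assms
proof (induction "card S" arbitrary: S)
  case 0
  then have "unit_vec m 0 \<noteq> (0\<^sub>v m :: complex vec)" by (metis index_unit_vec(1) index_zero_vec(1) zero_neq_one)
  then show ?case using 0 by (intro exI[of _ "unit_vec m 0"]) auto
next
  case (Suc c)
  \<comment> \<open>Extending a root of \<open>S\<close> to the right or upwards strictly increases
    its height \<open>j - i\<close>. With least height for (i, j), the extended roots stay in
    \<open>S'\<close>.\<close>
  define s where "s = (ARG_MIN (\<lambda>(i, j). j - i) x. x \<in> S)"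
  have "S \<noteq> {}" using Suc(2) by auto
  then have "s \<in> S \<and> (\<forall>x\<in>S. (case s of (i, j) \<Rightarrow> j - i) \<le> (case x of (i, j) \<Rightarrow> j - i))"
    unfolding s_def using arg_min_nat_lemma[of "\<lambda>x. x \<in> S"] by blast
  then obtain i j where ij: "(i, j) \<in> S" and min: "\<And>a b. (a, b) \<in> S \<Longrightarrow> j - i \<le> b - a"
    by (cases s) fastforce
  define S' where "S' = S - {(i, j)}"
  have ltS: "a < b" "b < n" if "(a, b) \<in> S" for a b using Suc(4) that by auto
  have c: "c = card S'" using Suc(2,3) ij by (simp add: S'_def)
  have cl1: "(a, l) \<in> S'" if "(a, b) \<in> S" "b < l" "l < n" for a b l
  proof -
    have "(a, l) \<noteq> (i, j)"
    proof
      assume "(a, l) = (i, j)"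
      then show False using min[OF that(1)] ltS[OF that(1)] that(2) by auto
    qed
    then show ?thesis using Suc(6) that unfolding S'_def by blast
  qed
  have cl2: "(k, b) \<in> S'" if "(a, b) \<in> S" "k < a" for a b k
  proof -
    have "(k, b) \<noteq> (i, j)"
    proof
      assume "(k, b) = (i, j)"
      then show False using min[OF that(1)] ltS[OF that(1)] that(2) by auto
    qed
    then show ?thesis using Suc(7) that unfolding S'_def by blast
  qed
  have "\<exists>v. v \<in> carrier_vec m \<and> v \<noteq> 0\<^sub>v m \<and> (\<forall>(i, j)\<in>S'. T i j *\<^sub>v v = v)"
  proof (rule Suc(1)[OF c])
    show "finite S'" "S' \<subseteq> {(i, j). i < j \<and> j < n}" "0 < m" using Suc(3-5) by (auto simp: S'_def)
    show "(a, l) \<in> S'" if "(a, b) \<in> S'" "b < l" "l < n" for a b l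
      using cl1 that by (auto simp: S'_def)
    show "(k, b) \<in> S'" if "(a, b) \<in> S'" "k < a" for a b k using cl2 that by (auto simp: S'_def)
  qed
  then obtain v where v: "v \<in> carrier_vec m" "v \<noteq> 0\<^sub>v m" "\<forall>(i, j)\<in>S'. T i j *\<^sub>v v = v" by blast
  define W where "W = {w \<in> carrier_vec m. \<forall>(i, j)\<in>S'. T i j *\<^sub>v w = w}"
  have TS: "T a b \<in> carrier_mat m m" if "(a, b) \<in> S" for a b using T ltS that by blast
  have W: "vsub m W"
    unfolding vsub_def
  proof (intro conjI ballI allI)
    show "W \<subseteq> carrier_vec m" by (auto simp: W_def)
    fix x y assume xy: "x \<in> W" "y \<in> W"
    have "T a b *\<^sub>v (x + y) = x + y" if "(a, b) \<in> S'" for a b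
    proof -
      have "T a b *\<^sub>v x = x" "T a b *\<^sub>v y = y" "x \<in> carrier_vec m" "y \<in> carrier_vec m"
        using xy that by (auto simp: W_def)
      then show ?thesis using mult_add_distrib_mat_vec[OF TS[of a b]] that by (auto simp: S'_def)
    qed
    then show "x + y \<in> W" using xy by (auto simp: W_def)
  next
    fix x a assume x: "x \<in> W"
    have "T k l *\<^sub>v (a \<cdot>\<^sub>v x) = a \<cdot>\<^sub>v x" if "(k, l) \<in> S'" for k l
    proof -
      have "T k l *\<^sub>v x = x" "x \<in> carrier_vec m" using x that by (auto simp: W_def)
      then show ?thesis using mult_mat_vec[OF TS[of k l]] that by (auto simp: S'_def)
    qed
    then show "a \<cdot>\<^sub>v x \<in> W" using x by (auto simp: W_def)
  qed
  have Tij: "T i j \<in> carrier_mat m m" by (rule TS[OF ij])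
  have ijn: "i < j" "j < n" using ltS[OF ij] by auto
  have inv: "T i j *\<^sub>v w \<in> W" if w: "w \<in> W" for w
  proof -
    have wc: "w \<in> carrier_vec m" and wf: "T a b *\<^sub>v w = w" if "(a, b) \<in> S'" for a b
      using w that by (auto simp: W_def)
    have wc: "w \<in> carrier_vec m" using w by (simp add: W_def)
    let ?x = "T i j *\<^sub>v w"
    have x: "?x \<in> carrier_vec m" using Tij wc by simp
    have commfix: "T a b *\<^sub>v ?x = ?x" if "(a, b) \<in> S'" "b \<noteq> i" "j \<noteq> a" for a b
    proof -
      have ab: "(a, b) \<in> S" using that by (simp add: S'_def)
      have "T a b *\<^sub>v ?x = (T a b * T i j) *\<^sub>v w" using TS[OF ab] Tij wc by simp
      also have "T a b * T i j = T i j * T a b" using ltS[OF ab] ijn that by (intro comm) auto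
      also have "\<dots> *\<^sub>v w = T i j *\<^sub>v (T a b *\<^sub>v w)" using TS[OF ab] Tij wc by simp
      finally show ?thesis using wf[OF that(1)] by simp
    qed
    have "T a b *\<^sub>v ?x = ?x" if ab': "(a, b) \<in> S'" for a b
    proof -
      have ab: "(a, b) \<in> S" using ab' by (simp add: S'_def)
      note abn = ltS[OF ab] and Tab = TS[OF ab]
      consider "b = i" | "a = j" | "b \<noteq> i" "j \<noteq> a" by blast
      then show ?thesis
      proof cases
        case 1
        have aj: "(a, j) \<in> S'" using cl1[OF ab, of j] 1 ijn by simp
        then have Taj: "T a j \<in> carrier_mat m m" using TS by (simp add: S'_def)
        have "T a b *\<^sub>v ?x = (T a b * T i j) *\<^sub>v w" using Tab Tij wc by simp
        also have "T a b * T i j = T a j ^\<^sub>m M * (T i j * T a b)"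
          using rel[of a i j] 1 abn ijn by simp
        also have "\<dots> *\<^sub>v w = (T a j ^\<^sub>m M) *\<^sub>v (T i j *\<^sub>v (T a b *\<^sub>v w))"
          using Tab Tij Taj wc by (simp add: assoc_mult_mat_vec[of _ m m _ m])
        also have "\<dots> = (T a j ^\<^sub>m M) *\<^sub>v ?x" using wf[OF ab'] by simp
        also have "\<dots> = ?x"
          by (rule pow_fix[OF Taj x commfix[OF aj]]) (use ijn abn 1 in auto)
        finally show ?thesis .
      next
        case 2
        have ib: "(i, b) \<in> S'" using cl2[OF ab, of i] 2 ijn by simp
        then have Tib: "T i b \<in> carrier_mat m m" using TS by (simp add: S'_def)
        \<comment> \<open>The relation now has \<open>T i j\<close> on the left, so the extra factor
          \<open>T i b ^ M\<close> acts on \<open>?y\<close> rather than on \<open>?x\<close>. It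
          fixes \<open>?y\<close> because \<open>T i b\<close> commutes with
          \<open>T a b\<close>.\<close>
        let ?y = "T a b *\<^sub>v ?x"
        have y: "?y \<in> carrier_vec m" using Tab x by simp
        have fx: "T i b *\<^sub>v ?x = ?x" by (rule commfix[OF ib]) (use ijn abn 2 in auto)
        have "T i b *\<^sub>v ?y = (T i b * T a b) *\<^sub>v ?x" using Tab Tib x by simp
        also have "T i b * T a b = T a b * T i b" using abn ijn 2 by (intro comm) auto
        also have "\<dots> *\<^sub>v ?x = T a b *\<^sub>v (T i b *\<^sub>v ?x)" using Tab Tib x by simp
        finally have fy: "(T i b ^\<^sub>m M) *\<^sub>v ?y = ?y" using pow_fix[OF Tib y] fx by simp
        have "?x = T i j *\<^sub>v (T a b *\<^sub>v w)" using wf[OF ab'] by simp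
        also have "\<dots> = (T i j * T a b) *\<^sub>v w" using Tab Tij wc by simp
        also have "T i j * T a b = T i b ^\<^sub>m M * (T a b * T i j)"
          using rel[of i j b] 2 abn ijn by simp
        also have "\<dots> *\<^sub>v w = (T i b ^\<^sub>m M) *\<^sub>v ?y"
          using Tab Tij Tib wc by (simp add: assoc_mult_mat_vec[of _ m m _ m])
        finally show ?thesis using fy by simp
      next
        case 3
        then show ?thesis using commfix[OF ab'] by blast
      qed
    qed
    then show ?thesis using x by (auto simp: W_def)
  qed
  obtain u \<mu> where u: "u \<in> W" "u \<noteq> 0\<^sub>v m" "T i j *\<^sub>v u = \<mu> \<cdot>\<^sub>v u"
    using eigenvector_in_invariant[OF Tij W inv, of v] v by (auto simp: W_def)
  then have "\<mu> = 1" using ev[OF ijn] by (auto simp: W_def)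
  then have "T i j *\<^sub>v u = u" using u by simp
  then have "\<forall>(i, j)\<in>S. T i j *\<^sub>v u = u" using u(1) by (auto simp: W_def S'_def)
  then show ?case using u by (auto simp: W_def)
qed

lemma common_fixed_vector:
  assumes "0 < m"
  obtains v where "v \<in> carrier_vec m" "v \<noteq> 0\<^sub>v m" "\<And>i j. i < j \<Longrightarrow> j < n \<Longrightarrow> T i j *\<^sub>v v = v"
proof -
  have "finite {(i, j). i < j \<and> j < n}" by (rule finite_subset[of _ "{..<n} \<times> {..<n}"]) auto
  from common_fixed_vector_aux[OF this subset_refl assms] show ?thesis using that by fastforce
qed

end

definition unitri :: "nat \<Rightarrow> complex mat \<Rightarrow> bool" where
  "unitri m U \<longleftrightarrow> U \<in> carrier_mat m m \<and> (\<forall>p<m. U $$ (p, p) = 1) \<and> (\<forall>p<m. \<forall>q<p. U $$ (p, q) = 0)"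

definition lower_block :: "complex mat \<Rightarrow> complex mat" where
  "lower_block U = mat (dim_row U - 1) (dim_col U - 1) (\<lambda>(p, q). U $$ (Suc p, Suc q))"

definition extend_block :: "complex mat \<Rightarrow> complex mat" where
  "extend_block Y = mat (Suc (dim_row Y)) (Suc (dim_col Y))
    (\<lambda>(p, q). if p = 0 \<or> q = 0 then if p = q then 1 else 0 else Y $$ (p - 1, q - 1))"

definition first_col :: "nat \<Rightarrow> complex mat \<Rightarrow> bool" where
  "first_col m U \<longleftrightarrow> U \<in> carrier_mat (Suc m) (Suc m) \<and> U $$ (0, 0) = 1 \<and> (\<forall>p<m. U $$ (Suc p, 0) = 0)"

lemma mat_mult_index:
  assumes "U \<in> carrier_mat n n" "Y \<in> carrier_mat n n" "p < n" "q < n"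
  shows "(U * Y) $$ (p, q) = (\<Sum>r<n. U $$ (p, r) * Y $$ (r, q))"
  using assms by (auto simp: scalar_prod_def atLeast0LessThan intro!: sum.cong)

lemma first_col_mult:
  assumes U: "first_col m U" and Y: "first_col m Y"
  shows "first_col m (U * Y)" "lower_block (U * Y) = lower_block U * lower_block Y"
proof -
  have c: "U \<in> carrier_mat (Suc m) (Suc m)" "Y \<in> carrier_mat (Suc m) (Suc m)"
    using assms by (auto simp: first_col_def)
  have *: "(U * Y) $$ (p, q) = U $$ (p, 0) * Y $$ (0, q) + (\<Sum>r<m. U $$ (p, Suc r) * Y $$ (Suc r, q))"
    if "p < Suc m" "q < Suc m" for p q
    unfolding mat_mult_index[OF c that] by (rule sum.lessThan_Suc_shift)
  show "first_col m (U * Y)"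
    unfolding first_col_def using U Y c by (auto simp: * first_col_def simp del: index_mult_mat(1))
  show "lower_block (U * Y) = lower_block U * lower_block Y"
  proof (rule eq_matI)
    fix p q assume "p < dim_row (lower_block U * lower_block Y)" "q < dim_col (lower_block U * lower_block Y)"
    then have pq: "p < m" "q < m" using c by (auto simp: lower_block_def)
    have l: "lower_block U \<in> carrier_mat m m" "lower_block Y \<in> carrier_mat m m" using c by (auto simp: lower_block_def)
    have "lower_block (U * Y) $$ (p, q) = (U * Y) $$ (Suc p, Suc q)"
      using pq c by (simp add: lower_block_def)
    also have "\<dots> = (\<Sum>r<m. U $$ (Suc p, Suc r) * Y $$ (Suc r, Suc q))"
      using *[of "Suc p" "Suc q"] pq U by (simp add: first_col_def)
    also have "\<dots> = (lower_block U * lower_block Y) $$ (p, q)"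
      unfolding mat_mult_index[OF l pq] using pq c by (auto simp: lower_block_def intro!: sum.cong)
    finally show "lower_block (U * Y) $$ (p, q) = (lower_block U * lower_block Y) $$ (p, q)" .
  qed (use c in \<open>auto simp: lower_block_def\<close>)
qed

lemma first_col_pow:
  assumes U: "first_col m U"
  shows "first_col m (U ^\<^sub>m k) \<and> lower_block (U ^\<^sub>m k) = lower_block U ^\<^sub>m k"
proof (induction k)
  case 0
  have "U \<in> carrier_mat (Suc m) (Suc m)" using U by (simp add: first_col_def)
  then show ?case by (auto simp: first_col_def lower_block_def intro!: eq_matI)
next
  case (Suc k)
  then show ?case using first_col_mult[OF _ U] by simp
qed

lemma first_col_extend: "Y \<in> carrier_mat m m \<Longrightarrow> first_col m (extend_block Y)"
  by (auto simp: first_col_def extend_block_def)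

lemma lower_extend: "Y \<in> carrier_mat m m \<Longrightarrow> lower_block (extend_block Y) = Y"
  by (auto simp: lower_block_def extend_block_def intro!: eq_matI)

lemma extend_block_mult:
  assumes "U \<in> carrier_mat m m" "Y \<in> carrier_mat m m"
  shows "extend_block U * extend_block Y = extend_block (U * Y)"
proof (rule eq_matI)
  fix p q assume "p < dim_row (extend_block (U * Y))" "q < dim_col (extend_block (U * Y))"
  then have pq: "p < Suc m" "q < Suc m" using assms by (auto simp: extend_block_def)
  have c: "extend_block U \<in> carrier_mat (Suc m) (Suc m)" "extend_block Y \<in> carrier_mat (Suc m) (Suc m)"
    using assms by (auto simp: extend_block_def)
  have *: "(extend_block U * extend_block Y) $$ (p, q) =
      extend_block U $$ (p, 0) * extend_block Y $$ (0, q) +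
      (\<Sum>r<m. extend_block U $$ (p, Suc r) * extend_block Y $$ (Suc r, q))"
    unfolding mat_mult_index[OF c pq] by (rule sum.lessThan_Suc_shift)
  show "(extend_block U * extend_block Y) $$ (p, q) = extend_block (U * Y) $$ (p, q)"
  proof (cases "p = 0 \<or> q = 0")
    case True
    then show ?thesis unfolding * using pq assms by (auto simp: extend_block_def)
  next
    case False
    then obtain p' q' where "p = Suc p'" "q = Suc q'" by (metis not0_implies_Suc)
    then show ?thesis unfolding * using pq assms
      by (auto simp: extend_block_def scalar_prod_def atLeast0LessThan intro!: sum.cong)
  qed
qed (use assms in \<open>auto simp: extend_block_def\<close>)

lemma extend_block_one: "extend_block (1\<^sub>m m) = 1\<^sub>m (Suc m)"
  by (auto simp: extend_block_def intro!: eq_matI)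

text \<open>Induction on the matrix size: a common fixed vector becomes the first basis vector, the
  lower right blocks form an upper family again, and the base change found for them is extended by a
  leading 1. The point that needs an argument is that the blocks have no eigenvalue besides
  1.\<close>

theorem simultaneous_unitriangular:
  assumes "upper_family n M m T"
  shows "\<exists>P Q. P \<in> carrier_mat m m \<and> Q \<in> carrier_mat m m \<and> P * Q = 1\<^sub>m m \<and> Q * P = 1\<^sub>m m \<and>
    (\<forall>i j. i < j \<longrightarrow> j < n \<longrightarrow> unitri m (Q * T i j * P))"
  using assms
proof (induction m arbitrary: T)
  case 0
  interpret upper_family n M 0 T by fact
  show ?case by (intro exI[of _ "1\<^sub>m 0"]) (use T in \<open>auto simp: unitri_def\<close>)
next
  case (Suc m)
  interpret upper_family n M "Suc m" T by fact
  obtain v where v: "v \<in> carrier_vec (Suc m)" "v \<noteq> 0\<^sub>v (Suc m)" "\<And>i j. i < j \<Longrightarrow> j < n \<Longrightarrow> T i j *\<^sub>v v = v"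
    using common_fixed_vector by auto
  obtain W where W: "W \<in> carrier_mat (Suc m) (Suc m)" "det W \<noteq> 0" "col W 0 = v"
    using invertible_with_first_column[OF v(1,2)] by metis
  obtain V where V: "V \<in> carrier_mat (Suc m) (Suc m)" "W * V = 1\<^sub>m (Suc m)" "V * W = 1\<^sub>m (Suc m)"
    using det_nonzero_inverse[OF W(1,2)] by metis
  define T' where "T' i j = V * T i j * W" for i j
  have T': "T' i j \<in> carrier_mat (Suc m) (Suc m)" if "i < j" "j < n" for i j
    using T[OF that] W V by (simp add: T'_def)
  have fc: "first_col m (T' i j)" if ij: "i < j" "j < n" for i j
  proof -
    have Tc: "T i j \<in> carrier_mat (Suc m) (Suc m)" using T ij by blast
    have "col (T' i j) 0 = (V * T i j) *\<^sub>v col W 0"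
      unfolding T'_def using V W Tc by (intro col_mult2) auto
    also have "\<dots> = V *\<^sub>v (T i j *\<^sub>v v)" unfolding W(3) using V Tc v by (intro assoc_mult_mat_vec) auto
    also have "\<dots> = V *\<^sub>v col W 0" using v(3)[OF ij] W by simp
    also have "\<dots> = col (V * W) 0" using V W by (intro col_mult2[symmetric]) auto
    finally have col: "col (T' i j) 0 = col (1\<^sub>m (Suc m)) 0" using V by simp
    have "T' i j $$ (p, 0) = (if p = 0 then 1 else 0)" if "p < Suc m" for p
    proof -
      have "T' i j $$ (p, 0) = col (T' i j) 0 $ p" using T'[OF ij] that by simp
      then show ?thesis unfolding col using that by simp
    qed
    then show ?thesis using T'[OF ij] by (simp add: first_col_def)
  qed
  let ?B = "\<lambda>i j. lower_block (T' i j)"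
  have B: "?B i j \<in> carrier_mat m m" if "i < j" "j < n" for i j
    using T'[OF that] by (simp add: lower_block_def)
  have "upper_family n M m ?B"
  proof
    fix i j k assume ijk: "i < j" "j < k" "k < n"
    then have c: "T i j \<in> carrier_mat (Suc m) (Suc m)" "T j k \<in> carrier_mat (Suc m) (Suc m)"
      "T i k \<in> carrier_mat (Suc m) (Suc m)" using T by auto
    have f: "first_col m (T' i j)" "first_col m (T' j k)" "first_col m (T' i k)" using fc ijk by auto
    have p: "T' i k ^\<^sub>m M = V * T i k ^\<^sub>m M * W"
      unfolding T'_def by (rule conj_pow) (use c W V in auto)
    have "T' i j * T' j k = T' i k ^\<^sub>m M * (T' j k * T' i j)"
      unfolding p unfolding T'_def
      using conj_mult[OF W(1) V(1) _ _ V(2)] c rel[OF ijk] by simp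
    then show "?B i j * ?B j k = ?B i k ^\<^sub>m M * (?B j k * ?B i j)"
      using first_col_mult[OF f(1,2)] first_col_mult[OF f(2,1)] first_col_pow[OF f(3), of M]
        first_col_mult(2)[of m "T' i k ^\<^sub>m M" "T' j k * T' i j"] by simp
  next
    fix i j k l assume a: "i < j" "j < n" "k < l" "l < n" "j \<noteq> k" "i \<noteq> l"
    then have c: "T i j \<in> carrier_mat (Suc m) (Suc m)" "T k l \<in> carrier_mat (Suc m) (Suc m)" using T by auto
    have f: "first_col m (T' i j)" "first_col m (T' k l)" using fc a by auto
    have "T' i j * T' k l = T' k l * T' i j"
      unfolding T'_def using conj_mult[OF W(1) V(1) _ _ V(2)] c comm[OF a] by simp
    then show "?B i j * ?B k l = ?B k l * ?B i j"
      using first_col_mult[OF f(1,2)] first_col_mult[OF f(2,1)] by simp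
  next
    fix i j y \<mu> assume ij: "i < j" "j < n" and y: "y \<in> carrier_vec m" "y \<noteq> 0\<^sub>v m" "?B i j *\<^sub>v y = \<mu> \<cdot>\<^sub>v y"
    show "\<mu> = 1"
    proof (rule ccontr)
      assume mu: "\<mu> \<noteq> 1"
      let ?U = "T' i j"
      have U: "?U \<in> carrier_mat (Suc m) (Suc m)" using T' ij by blast
      define s where "s = (\<Sum>q<m. ?U $$ (0, Suc q) * y $ q)"
      \<comment> \<open>An eigenvector \<open>y\<close> of the block for \<open>\<mu>\<close> is
        lifted to one of the full matrix. Its first coordinate t must satisfy
        \<open>t + s = \<mu> t\<close>, which is solvable because \<open>\<mu>\<close> is not
        1.\<close>
      define x where "x = vec (Suc m) (\<lambda>p. if p = 0 then s / (\<mu> - 1) else y $ (p - 1))"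
      have xc: "x \<in> carrier_vec (Suc m)" by (simp add: x_def)
      have Xx: "(?U *\<^sub>v x) $ p = ?U $$ (p, 0) * (s / (\<mu> - 1)) + (\<Sum>q<m. ?U $$ (p, Suc q) * y $ q)"
        if "p < Suc m" for p
      proof -
        have "(?U *\<^sub>v x) $ p = (\<Sum>q<Suc m. ?U $$ (p, q) * x $ q)"
          using that U xc by (auto simp: scalar_prod_def atLeast0LessThan intro!: sum.cong)
        then show ?thesis by (simp add: sum.lessThan_Suc_shift x_def del: sum.lessThan_Suc)
      qed
      have eig: "?U *\<^sub>v x = \<mu> \<cdot>\<^sub>v x"
      proof (rule eq_vecI)
        fix p assume "p < dim_vec (\<mu> \<cdot>\<^sub>v x)"
        then have p: "p < Suc m" by (simp add: x_def)
        show "(?U *\<^sub>v x) $ p = (\<mu> \<cdot>\<^sub>v x) $ p"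
        proof (cases p)
          case 0
          then show ?thesis using Xx[of 0] fc[OF ij] mu
            by (simp add: first_col_def s_def[symmetric] x_def divide_simps) (simp add: algebra_simps)
        next
          case (Suc p')
          have "(?U *\<^sub>v x) $ p = (\<Sum>q<m. ?U $$ (Suc p', Suc q) * y $ q)"
            using Xx[of p] fc[OF ij] Suc p by (simp add: first_col_def)
          also have "\<dots> = (?B i j *\<^sub>v y) $ p'"
            using Suc p U y(1) by (auto simp: lower_block_def scalar_prod_def atLeast0LessThan intro!: sum.cong)
          finally show ?thesis using y Suc p by (simp add: x_def)
        qed
      qed (use U xc in auto)
      have xs: "x $ Suc q = y $ q" if "q < m" for q using that by (simp add: x_def)
      have x0: "x \<noteq> 0\<^sub>v (Suc m)"
      proof
        assume "x = 0\<^sub>v (Suc m)"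
        then have "y $ q = 0" if "q < m" for q using xs[OF that] that by simp
        then have "y = 0\<^sub>v m" using y(1) by (intro eq_vecI) auto
        then show False using y(2) by blast
      qed
      have Tc: "T i j \<in> carrier_mat (Suc m) (Suc m)" using T ij by blast
      have WX: "W * ?U = T i j * W"
      proof -
        have "W * ?U = W * (V * (T i j * W))"
          unfolding T'_def using assoc_mult_mat[OF V(1) Tc W(1)] by (simp only:)
        also have "\<dots> = T i j * W" by (rule cancel_left_mat[OF W(1) V(1,2)]) (use Tc W(1) in auto)
        finally show ?thesis .
      qed
      have "T i j *\<^sub>v (W *\<^sub>v x) = (W * ?U) *\<^sub>v x"
        unfolding WX using assoc_mult_mat_vec[OF Tc W(1) xc] by (rule sym)
      also have "\<dots> = W *\<^sub>v (\<mu> \<cdot>\<^sub>v x)" unfolding assoc_mult_mat_vec[OF W(1) U xc] eig ..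
      finally have "T i j *\<^sub>v (W *\<^sub>v x) = \<mu> \<cdot>\<^sub>v (W *\<^sub>v x)"
        unfolding mult_mat_vec[OF W(1) xc] .
      moreover have "W *\<^sub>v x \<noteq> 0\<^sub>v (Suc m)"
        using det_0_iff_vec_prod_zero[OF W(1)] W(2) xc x0 by blast
      ultimately have "\<mu> = 1" using ev[OF ij, of "W *\<^sub>v x" \<mu>] W xc by simp
      then show False using mu by simp
    qed
  qed (use B in blast)
  from Suc.IH[OF this] obtain P Q where PQ: "P \<in> carrier_mat m m" "Q \<in> carrier_mat m m"
    "P * Q = 1\<^sub>m m" "Q * P = 1\<^sub>m m" "\<And>i j. i < j \<Longrightarrow> j < n \<Longrightarrow> unitri m (Q * ?B i j * P)" by blast
  let ?P = "extend_block P" and ?Q = "extend_block Q"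
  have e: "?P \<in> carrier_mat (Suc m) (Suc m)" "?Q \<in> carrier_mat (Suc m) (Suc m)"
    "?P * ?Q = 1\<^sub>m (Suc m)" "?Q * ?P = 1\<^sub>m (Suc m)"
    using PQ extend_block_mult[OF PQ(1,2)] extend_block_mult[OF PQ(2,1)] extend_block_one
    by (auto simp: extend_block_def)
  have un: "unitri (Suc m) (?Q * T' i j * ?P)" if ij: "i < j" "j < n" for i j
  proof -
    have f: "first_col m ?Q" "first_col m (T' i j)" "first_col m ?P"
      by (rule first_col_extend[OF PQ(2)], rule fc[OF ij], rule first_col_extend[OF PQ(1)])
    define Z where "Z = ?Q * T' i j * ?P"
    have f1: "first_col m Z"
      unfolding Z_def by (rule first_col_mult(1)[OF first_col_mult(1)[OF f(1,2)] f(3)])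
    have lZ: "lower_block Z = Q * ?B i j * P"
      unfolding Z_def first_col_mult(2)[OF first_col_mult(1)[OF f(1,2)] f(3)] first_col_mult(2)[OF f(1,2)]
        lower_extend[OF PQ(1)] lower_extend[OF PQ(2)] ..
    have u: "unitri m (lower_block Z)" unfolding lZ by (rule PQ(5)[OF ij])
    have Z: "Z \<in> carrier_mat (Suc m) (Suc m)" using f1 by (simp add: first_col_def)
    have lb: "Z $$ (Suc p, Suc q) = lower_block Z $$ (p, q)" if "p < m" "q < m" for p q
      using that Z by (simp add: lower_block_def)
    have "Z $$ (p, p) = 1" if "p < Suc m" for p
      using that f1 u lb by (cases p) (auto simp: first_col_def unitri_def)
    moreover have "Z $$ (p, q) = 0" if pq: "p < Suc m" "q < p" for p q
    proof (cases q)
      case 0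
      then show ?thesis using pq f1 by (cases p) (auto simp: first_col_def)
    next
      case (Suc q')
      then obtain p' where "p = Suc p'" using pq by (cases p) auto
      then show ?thesis using pq u lb[of p' q'] Suc by (simp add: unitri_def)
    qed
    ultimately show ?thesis unfolding Z_def[symmetric] unitri_def using Z by blast
  qed
  have WP: "W * ?P \<in> carrier_mat (Suc m) (Suc m)" and QV: "?Q * V \<in> carrier_mat (Suc m) (Suc m)"
    using W(1) V(1) e(1,2) by auto
  have 1: "W * ?P * (?Q * V) = 1\<^sub>m (Suc m)"
    unfolding assoc_mult_mat[OF W(1) e(1) QV] cancel_left_mat[OF e(1,2,3) V(1)] by (rule V(2))
  have 2: "?Q * V * (W * ?P) = 1\<^sub>m (Suc m)"
    unfolding assoc_mult_mat[OF e(2) V(1) WP] cancel_left_mat[OF V(1) W(1) V(3) e(1)] by (rule e(4))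
  have 3: "unitri (Suc m) (?Q * V * T i j * (W * ?P))" if ij: "i < j" "j < n" for i j
  proof -
    have Tc: "T i j \<in> carrier_mat (Suc m) (Suc m)" using T ij by blast
    have VT: "V * T i j \<in> carrier_mat (Suc m) (Suc m)" using V(1) Tc by simp
    have QVT: "?Q * V * T i j \<in> carrier_mat (Suc m) (Suc m)" using QV Tc by simp
    have "?Q * V * T i j * (W * ?P) = ?Q * T' i j * ?P"
      unfolding assoc_mult_mat[OF QVT W(1) e(1), symmetric]
      unfolding assoc_mult_mat[OF e(2) V(1) Tc] assoc_mult_mat[OF e(2) VT W(1)] T'_def ..
    then show ?thesis using un[OF ij] by (simp only:)
  qed
  show ?case
    by (rule exI[of _ "W * ?P"], rule exI[of _ "?Q * V"], intro conjI allI impI)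
      (rule WP, rule QV, rule 1, rule 2, rule 3)
qed

section \<open>Interpreting the ring and the matrices in a group with Steinberg elements\<close>

definition cm :: "('a, 'm) monoid_scheme \<Rightarrow> 'a \<Rightarrow> 'a \<Rightarrow> 'a" where
  "cm G x y = x \<otimes>\<^bsub>G\<^esub> y \<otimes>\<^bsub>G\<^esub> inv\<^bsub>G\<^esub> x \<otimes>\<^bsub>G\<^esub> inv\<^bsub>G\<^esub> y"

text \<open>The commutator relation is written without inverses. The last clause excludes the
  trivial tuple and, more generally, tuples whose elements vanish in the power that is going to be
  shown to be a transvection.\<close>

definition steinberg :: "nat \<Rightarrow> nat \<Rightarrow> ('a, 'm) monoid_scheme \<Rightarrow> (nat \<times> nat \<Rightarrow> 'a) \<Rightarrow> bool" where
  "steinberg n L G c \<longleftrightarrow>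
    (\<forall>i<n. \<forall>j<n. \<forall>k<n. i \<noteq> j \<longrightarrow> j \<noteq> k \<longrightarrow> i \<noteq> k \<longrightarrow>
      c (i, j) \<otimes>\<^bsub>G\<^esub> c (j, k) = c (i, k) \<otimes>\<^bsub>G\<^esub> (c (j, k) \<otimes>\<^bsub>G\<^esub> c (i, j))) \<and>
    (\<forall>i<n. \<forall>j<n. \<forall>k<n. \<forall>l<n. i \<noteq> j \<longrightarrow> k \<noteq> l \<longrightarrow> j \<noteq> k \<longrightarrow> i \<noteq> l \<longrightarrow>
      c (i, j) \<otimes>\<^bsub>G\<^esub> c (k, l) = c (k, l) \<otimes>\<^bsub>G\<^esub> c (i, j)) \<and>
    (\<forall>i<n. \<forall>j<n. i \<noteq> j \<longrightarrow> c (i, j) [^]\<^bsub>G\<^esub> L \<noteq> \<one>\<^bsub>G\<^esub>)"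

text \<open>In the standard case the centraliser of the \<open>c (k, l)\<close> with \<open>k \<noteq> 2\<close> and \<open>l \<noteq> 0\<close> is the root
  subgroup \<open>(0, 2)\<close> times the centre; the commutator with \<open>c (2, 1)\<close> removes the centre and lands in
  the root subgroup \<open>(0, 1)\<close>, which carries the ring.\<close>

definition in_rc :: "nat \<Rightarrow> ('a, 'm) monoid_scheme \<Rightarrow> (nat \<times> nat \<Rightarrow> 'a) \<Rightarrow> 'a \<Rightarrow> bool" where
  "in_rc n G c y \<longleftrightarrow> (\<exists>x\<in>carrier G. (\<forall>k<n. \<forall>l<n. k \<noteq> l \<longrightarrow> k \<noteq> 2 \<longrightarrow> l \<noteq> 0 \<longrightarrow>
      x \<otimes>\<^bsub>G\<^esub> c (k, l) = c (k, l) \<otimes>\<^bsub>G\<^esub> x) \<and> y = cm G x (c (2, 1)))"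

text \<open>In the standard case, with x and y the elements a and b of position (0, 1), the inner
  commutators carry a to position (0, 2) and b to position (2, 1); their commutator carries ab at
  (0, 1).\<close>

definition rmul :: "('a, 'm) monoid_scheme \<Rightarrow> (nat \<times> nat \<Rightarrow> 'a) \<Rightarrow> 'a \<Rightarrow> 'a \<Rightarrow> 'a" where
  "rmul G c x y = cm G (cm G x (c (1, 2))) (cm G (c (2, 0)) y)"

definition RR :: "nat \<Rightarrow> ('a, 'm) monoid_scheme \<Rightarrow> (nat \<times> nat \<Rightarrow> 'a) \<Rightarrow> 'a ring" where
  "RR n G c = \<lparr>carrier = {y \<in> carrier G. in_rc n G c y}, monoid.mult = rmul G c, one = c (0, 1),
    zero = \<one>\<^bsub>G\<^esub>, add = (\<otimes>\<^bsub>G\<^esub>)\<rparr>"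

text \<open>Commutators with the Steinberg elements move a ring element from position (0, 1) to (i,
  j). To reach (1, 0) the path goes through (0, 2) and (1, 2), since it needs a third index.\<close>

definition el :: "('a, 'm) monoid_scheme \<Rightarrow> (nat \<times> nat \<Rightarrow> 'a) \<Rightarrow> nat \<Rightarrow> nat \<Rightarrow> 'a \<Rightarrow> 'a" where
  "el G c i j x =
    (if i = 0 then if j = 1 then x else cm G x (c (1, j))
     else if j = 1 then cm G (c (i, 0)) x
     else if j \<noteq> 0 then cm G (c (i, 0)) (cm G x (c (1, j)))
     else if i = 1 then cm G (cm G (c (1, 0)) (cm G x (c (1, 2)))) (c (2, 0))
     else cm G (cm G (c (i, 0)) x) (c (1, 0)))"

text \<open>Addition in the interpreted ring is the group product. Sums run over lists so that they
  unfold to terms of the language of groups.\<close>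

definition rsum :: "('a, 'm) monoid_scheme \<Rightarrow> ('k \<Rightarrow> 'a) \<Rightarrow> 'k list \<Rightarrow> 'a" where
  "rsum G f xs = foldr (\<lambda>k s. f k \<otimes>\<^bsub>G\<^esub> s) xs \<one>\<^bsub>G\<^esub>"

definition rprod :: "('a, 'm) monoid_scheme \<Rightarrow> (nat \<times> nat \<Rightarrow> 'a) \<Rightarrow> ('k \<Rightarrow> 'a) \<Rightarrow> 'k list \<Rightarrow> 'a" where
  "rprod G c f xs = foldr (\<lambda>k s. rmul G c (f k) s) xs (c (0, 1))"

definition perms :: "nat \<Rightarrow> (nat \<Rightarrow> nat) list" where
  "perms n = (SOME xs. distinct xs \<and> set xs = {p. p permutes {..<n}})"

lemma perms: "distinct (perms n)" "set (perms n) = {p. p permutes {..<n}}"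
proof -
  have "finite {p. p permutes {..<n}}" by (rule finite_permutations) simp
  then obtain xs where "distinct xs \<and> set xs = {p. p permutes {..<n}}"
    using finite_distinct_list by blast
  then have "distinct (perms n) \<and> set (perms n) = {p. p permutes {..<n}}"
    unfolding perms_def by (rule someI)
  then show "distinct (perms n)" "set (perms n) = {p. p permutes {..<n}}" by blast+
qed

text \<open>The Leibniz formula in the interpreted ring, in which the group inverse is
  negation.\<close>

definition ldet :: "('a, 'm) monoid_scheme \<Rightarrow> (nat \<times> nat \<Rightarrow> 'a) \<Rightarrow> nat \<Rightarrow> (nat \<times> nat \<Rightarrow> 'a) \<Rightarrow> 'a" where
  "ldet G c n A = rsum G (\<lambda>p. if sign p = 1 then rprod G c (\<lambda>i. A (i, p i)) [0..<n]
    else inv\<^bsub>G\<^esub> (rprod G c (\<lambda>i. A (i, p i)) [0..<n])) (perms n)"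

definition mm :: "('a, 'm) monoid_scheme \<Rightarrow> (nat \<times> nat \<Rightarrow> 'a) \<Rightarrow> nat \<Rightarrow>
    (nat \<times> nat \<Rightarrow> 'a) \<Rightarrow> (nat \<times> nat \<Rightarrow> 'a) \<Rightarrow> nat \<times> nat \<Rightarrow> 'a" where
  "mm G c n A B p = rsum G (\<lambda>k. rmul G c (A (fst p, k)) (B (k, snd p))) [0..<n]"

definition idm :: "('a, 'm) monoid_scheme \<Rightarrow> (nat \<times> nat \<Rightarrow> 'a) \<Rightarrow> nat \<times> nat \<Rightarrow> 'a" where
  "idm G c p = (if fst p = snd p then c (0, 1) else \<one>\<^bsub>G\<^esub>)"

fun mpow :: "('a, 'm) monoid_scheme \<Rightarrow> (nat \<times> nat \<Rightarrow> 'a) \<Rightarrow> nat \<Rightarrow>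
    (nat \<times> nat \<Rightarrow> 'a) \<Rightarrow> nat \<Rightarrow> nat \<times> nat \<Rightarrow> 'a" where
  "mpow G c n A 0 p = idm G c p"
| "mpow G c n A (Suc k) p = mm G c n (mpow G c n A k) A p"

definition meq :: "nat \<Rightarrow> (nat \<times> nat \<Rightarrow> 'a) \<Rightarrow> (nat \<times> nat \<Rightarrow> 'a) \<Rightarrow> bool" where
  "meq n A B \<longleftrightarrow> (\<forall>i<n. \<forall>j<n. A (i, j) = B (i, j))"

definition slR :: "nat \<Rightarrow> ('a, 'm) monoid_scheme \<Rightarrow> (nat \<times> nat \<Rightarrow> 'a) \<Rightarrow> (nat \<times> nat \<Rightarrow> 'a) \<Rightarrow> bool" where
  "slR n G c A \<longleftrightarrow> (\<forall>i<n. \<forall>j<n. in_rc n G c (A (i, j))) \<and> ldet G c n A = c (0, 1)"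

text \<open>In the standard case the product \<open>s\<close> of the two elements \<open>el\<close> is \<open>1\<close> plus the matrix with row \<open>p\<close> equal to
  \<open>A\<^bsub>l i\<^esub> e\<^sub>k - A\<^bsub>k i\<^esub> e\<^sub>l\<close>. A non-central
  \<open>x\<close> in the centraliser of the row \<open>i\<close> root subgroup commuting with \<open>h\<^sup>-\<^sup>1 s h\<close> exists iff
  this row annihilates column \<open>i\<close> of \<open>h\<close>, so the condition says that the columns of \<open>A\<close> and \<open>h\<close>
  are parallel.\<close>

definition parallel_at :: "('a, 'm) monoid_scheme \<Rightarrow> (nat \<times> nat \<Rightarrow> 'a) \<Rightarrow> nat \<Rightarrow> 'a \<Rightarrow>
    (nat \<times> nat \<Rightarrow> 'a) \<Rightarrow> nat \<Rightarrow> nat \<Rightarrow> nat \<Rightarrow> nat \<Rightarrow> bool" where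
  "parallel_at G c n h A i k l p \<longleftrightarrow>
    (\<exists>x\<in>carrier G. (\<forall>j<n. j \<noteq> i \<longrightarrow> x \<otimes>\<^bsub>G\<^esub> c (i, j) = c (i, j) \<otimes>\<^bsub>G\<^esub> x) \<and>
      (\<exists>y\<in>carrier G. x \<otimes>\<^bsub>G\<^esub> y \<noteq> y \<otimes>\<^bsub>G\<^esub> x) \<and>
      x \<otimes>\<^bsub>G\<^esub> (inv\<^bsub>G\<^esub> h \<otimes>\<^bsub>G\<^esub> (el G c p k (A (l, i)) \<otimes>\<^bsub>G\<^esub> inv\<^bsub>G\<^esub> (el G c p l (A (k, i)))) \<otimes>\<^bsub>G\<^esub> h) =
      inv\<^bsub>G\<^esub> h \<otimes>\<^bsub>G\<^esub> (el G c p k (A (l, i)) \<otimes>\<^bsub>G\<^esub> inv\<^bsub>G\<^esub> (el G c p l (A (k, i)))) \<otimes>\<^bsub>G\<^esub> h \<otimes>\<^bsub>G\<^esub> x)"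

definition parallel :: "nat \<Rightarrow> ('a, 'm) monoid_scheme \<Rightarrow> (nat \<times> nat \<Rightarrow> 'a) \<Rightarrow> 'a \<Rightarrow>
    (nat \<times> nat \<Rightarrow> 'a) \<Rightarrow> bool" where
  "parallel n G c h A \<longleftrightarrow> (\<forall>i<n. \<forall>k<n. \<forall>l<n. \<forall>p<n. k \<noteq> l \<longrightarrow> p \<noteq> k \<longrightarrow> p \<noteq> l \<longrightarrow>
    parallel_at G c n h A i k l p)"

text \<open>Parallel columns alone would allow a different factor for each column. The test is
  therefore applied after multiplication by \<open>c (i, j)\<close>, which adds column i to column
  j: the other columns are compared as they stand, and the parallel sums force all factors to
  coincide.\<close>

definition rho :: "nat \<Rightarrow> ('a, 'm) monoid_scheme \<Rightarrow> (nat \<times> nat \<Rightarrow> 'a) \<Rightarrow> 'a \<Rightarrow>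
    (nat \<times> nat \<Rightarrow> 'a) \<Rightarrow> bool" where
  "rho n G c h A \<longleftrightarrow> slR n G c A \<and> (\<forall>i<n. \<forall>j<n. i \<noteq> j \<longrightarrow>
    parallel n G c (h \<otimes>\<^bsub>G\<^esub> c (i, j))
      (\<lambda>p. if snd p = j then A (fst p, j) \<otimes>\<^bsub>G\<^esub> A (fst p, i) else A p))"

text \<open>\<open>Dk k h A\<close>: the pair \<open>(h, A)\<close> is a product of \<open>k\<close> commutators and \<open>d\<close>-th powers of pairs
  related by \<open>rho\<close>.\<close>

fun Dk :: "nat \<Rightarrow> nat \<Rightarrow> ('a, 'm) monoid_scheme \<Rightarrow> (nat \<times> nat \<Rightarrow> 'a) \<Rightarrow> nat \<Rightarrow> 'a \<Rightarrow>
    (nat \<times> nat \<Rightarrow> 'a) \<Rightarrow> bool" where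
  "Dk n d G c 0 h A \<longleftrightarrow> h = \<one>\<^bsub>G\<^esub> \<and> meq n A (idm G c)"
| "Dk n d G c (Suc k) h A \<longleftrightarrow>
    (\<exists>h1\<in>carrier G. \<exists>h2\<in>carrier G. \<exists>h'\<in>carrier G. \<exists>h3\<in>carrier G.
     \<exists>A1. (\<forall>p. A1 p \<in> carrier G) \<and> (\<exists>A2. (\<forall>p. A2 p \<in> carrier G) \<and> (\<exists>A'. (\<forall>p. A' p \<in> carrier G) \<and>
      (\<exists>A3. (\<forall>p. A3 p \<in> carrier G) \<and>
      (rho n G c h1 A1 \<and> rho n G c h2 A2 \<and> rho n G c h' A' \<and> rho n G c h3 A3 \<and>
       Dk n d G c k h3 A3 \<and> h = h' \<otimes>\<^bsub>G\<^esub> h3 \<and> meq n A (mm G c n A' A3) \<and>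
       (h' \<otimes>\<^bsub>G\<^esub> (h2 \<otimes>\<^bsub>G\<^esub> h1) = h1 \<otimes>\<^bsub>G\<^esub> h2 \<and>
          meq n (mm G c n A' (mm G c n A2 A1)) (mm G c n A1 A2) \<or>
        h' = h1 [^]\<^bsub>G\<^esub> d \<and> meq n A' (mpow G c n A1 d)))))))"

text \<open>Interpretation of ring terms; unlike \<^const>\<open>ring_eval\<close> it does not use the definite
  description behind the additive inverse of a ring record.\<close>

primrec reval :: "('a, 'm) monoid_scheme \<Rightarrow> (nat \<times> nat \<Rightarrow> 'a) \<Rightarrow> (nat \<Rightarrow> 'a) \<Rightarrow> ring_term \<Rightarrow> 'a" where
  "reval G c e (RVar x) = e x"
| "reval G c e RZero = \<one>\<^bsub>G\<^esub>"
| "reval G c e ROne = c (0, 1)"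
| "reval G c e (RNeg t) = inv\<^bsub>G\<^esub> (reval G c e t)"
| "reval G c e (RAdd s t) = reval G c e s \<otimes>\<^bsub>G\<^esub> reval G c e t"
| "reval G c e (RMult s t) = rmul G c (reval G c e s) (reval G c e t)"

section \<open>Definability of the interpretation\<close>

context group_pair
begin

lemma dtm_cm: "dtm x x' \<Longrightarrow> dtm y y' \<Longrightarrow> dtm (\<lambda>e. cm G (x e) (y e)) (\<lambda>e. cm H (x' e) (y' e))"
  unfolding cm_def by (intro dfn_intros)

context
  fixes c :: "('i \<Rightarrow> 'a) \<Rightarrow> nat \<times> nat \<Rightarrow> 'a" and c' :: "('i \<Rightarrow> 'b) \<Rightarrow> nat \<times> nat \<Rightarrow> 'b"
  assumes c: "\<And>p. dtm (\<lambda>e. c e p) (\<lambda>e. c' e p)"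
begin

lemma dfn_steinberg: "dfn (\<lambda>e. steinberg n L G (c e)) (\<lambda>e. steinberg n L H (c' e))"
  unfolding steinberg_def by (intro dfn_intros c)

lemma dtm_rmul: "dtm x x' \<Longrightarrow> dtm y y' \<Longrightarrow> dtm (\<lambda>e. rmul G (c e) (x e) (y e)) (\<lambda>e. rmul H (c' e) (x' e) (y' e))"
  unfolding rmul_def by (intro dtm_cm c)

lemma dtm_el: "dtm x x' \<Longrightarrow> dtm (\<lambda>e. el G (c e) i j (x e)) (\<lambda>e. el H (c' e) i j (x' e))"
  unfolding el_def by (intro dtm_if dtm_cm c)

lemma dtm_rsum: "(\<And>k. dtm (\<lambda>e. f e k) (\<lambda>e. f' e k)) \<Longrightarrow> dtm (\<lambda>e. rsum G (f e) xs) (\<lambda>e. rsum H (f' e) xs)"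
  unfolding rsum_def by (rule dtm_foldr) (rule dtm_mult dtm_one | assumption)+

lemma dtm_rprod: "(\<And>k. dtm (\<lambda>e. f e k) (\<lambda>e. f' e k)) \<Longrightarrow>
    dtm (\<lambda>e. rprod G (c e) (f e) xs) (\<lambda>e. rprod H (c' e) (f' e) xs)"
  unfolding rprod_def by (rule dtm_foldr) (rule dtm_rmul c | assumption)+

lemma dtm_ldet:
  assumes A: "\<And>p. dtm (\<lambda>e. A e p) (\<lambda>e. A' e p)"
  shows "dtm (\<lambda>e. ldet G (c e) n (A e)) (\<lambda>e. ldet H (c' e) n (A' e))"
  unfolding ldet_def by (rule dtm_rsum dtm_if dtm_rprod dtm_inv A)+

lemma dtm_mm:
  assumes A: "\<And>p. dtm (\<lambda>e. A e p) (\<lambda>e. A' e p)" and B: "\<And>p. dtm (\<lambda>e. B e p) (\<lambda>e. B' e p)"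
  shows "dtm (\<lambda>e. mm G (c e) n (A e) (B e) p) (\<lambda>e. mm H (c' e) n (A' e) (B' e) p)"
  unfolding mm_def by (rule dtm_rsum dtm_rmul A B)+

lemma dtm_idm: "dtm (\<lambda>e. idm G (c e) p) (\<lambda>e. idm H (c' e) p)"
  unfolding idm_def by (rule dtm_if dtm_one c)+

lemma dtm_mpow:
  assumes A: "\<And>p. dtm (\<lambda>e. A e p) (\<lambda>e. A' e p)"
  shows "dtm (\<lambda>e. mpow G (c e) n (A e) k p) (\<lambda>e. mpow H (c' e) n (A' e) k p)"
proof (induction k arbitrary: p)
  case (Suc k)
  show ?case unfolding mpow.simps by (rule dtm_mm) (rule Suc A)+
qed (simp add: dtm_idm)

lemma dfn_in_rc:
  assumes y: "dtm y y'"
  shows "dfn (\<lambda>e. in_rc n G (c e) (y e)) (\<lambda>e. in_rc n H (c' e) (y' e))"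
  unfolding in_rc_def
  by (intro dfn_ex dfn_conj dfn_all_less dfn_imp dfn_const dfn_eq dtm_mult dtm_var dtm_cm
      dtm_reindex[OF c] dtm_reindex[OF y])

lemma dfn_slR:
  assumes A: "\<And>p. dtm (\<lambda>e. A e p) (\<lambda>e. A' e p)"
  shows "dfn (\<lambda>e. slR n G (c e) (A e)) (\<lambda>e. slR n H (c' e) (A' e))"
  unfolding slR_def by (intro dfn_conj dfn_all_less dfn_in_rc dfn_eq dtm_ldet A c)

end

lemma dfn_meq:
  assumes A: "\<And>p. dtm (\<lambda>e. A e p) (\<lambda>e. A' e p)" and B: "\<And>p. dtm (\<lambda>e. B e p) (\<lambda>e. B' e p)"
  shows "dfn (\<lambda>e. meq n (A e) (B e)) (\<lambda>e. meq n (A' e) (B' e))"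
  unfolding meq_def by (intro dfn_all_less dfn_eq A B)

lemma dfn_parallel:
  assumes c: "\<And>p. dtm (\<lambda>e. c e p) (\<lambda>e. c' e p)"
  assumes h: "dtm h h'" and A: "\<And>p. dtm (\<lambda>e. A e p) (\<lambda>e. A' e p)"
  shows "dfn (\<lambda>e. parallel n G (c e) (h e) (A e)) (\<lambda>e. parallel n H (c' e) (h' e) (A' e))"
  unfolding parallel_def parallel_at_def
  by (intro dfn_ex dfn_conj dfn_not dfn_all_less dfn_imp dfn_const dfn_eq dtm_mult dtm_inv dtm_var
      dtm_el dtm_reindex[OF c] dtm_reindex[OF h] dtm_reindex[OF A])

lemma dfn_rho:
  assumes c: "\<And>p. dtm (\<lambda>e. c e p) (\<lambda>e. c' e p)"
  assumes h: "dtm h h'" and A: "\<And>p. dtm (\<lambda>e. A e p) (\<lambda>e. A' e p)"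
  shows "dfn (\<lambda>e. rho n G (c e) (h e) (A e)) (\<lambda>e. rho n H (c' e) (h' e) (A' e))"
  unfolding rho_def
  by (intro dfn_conj dfn_slR dfn_all_less dfn_imp dfn_const dfn_parallel dtm_mult dtm_if h A c)

text \<open>The recursion of \<open>Dk\<close> rebinds h and A under new quantifiers. The induction
  is done over one fixed index type, with free variables for c, h and A, and all other occurrences
  follow by reindexing.\<close>

lemma dfn_Dk_aux:
  "dfn (\<lambda>e::(nat \<times> nat) + (unit + nat \<times> nat) \<Rightarrow> 'a.
      Dk n d G (\<lambda>p. e (Inl p)) k (e (Inr (Inl ()))) (\<lambda>p. e (Inr (Inr p))))
    (\<lambda>e. Dk n d H (\<lambda>p. e (Inl p)) k (e (Inr (Inl ()))) (\<lambda>p. e (Inr (Inr p))))"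
proof (induction k)
  case 0
  show ?case unfolding Dk.simps by (intro dfn_conj dfn_eq dfn_meq dtm_idm dtm_var dtm_one)
next
  case (Suc k)
  have IH: "dfn (\<lambda>e::'j \<Rightarrow> 'a. Dk n d G (\<lambda>p. e (f p)) k (e i) (\<lambda>p. e (g p)))
    (\<lambda>e. Dk n d H (\<lambda>p. e (f p)) k (e i) (\<lambda>p. e (g p)))" for f :: "_ \<Rightarrow> 'j" and i g
    using dfn_reindex[OF Suc, of "case_sum f (case_sum (\<lambda>_. i) g)"] by simp
  show ?case unfolding Dk.simps
    by (intro dfn_ex dfn_exf dfn_conj dfn_disj dfn_rho dfn_eq dfn_meq dtm_mm dtm_mpow dtm_mult
        dtm_pow dtm_var IH)
qed

lemma dfn_Dk: "dfn (\<lambda>e. Dk n d G (\<lambda>p. e (f p)) k (e i) (\<lambda>p. e (g p)))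
    (\<lambda>e. Dk n d H (\<lambda>p. e (f p)) k (e i) (\<lambda>p. e (g p)))"
  using dfn_reindex[OF dfn_Dk_aux, where f = "case_sum f (case_sum (\<lambda>_. i) g)"] by simp

lemma dtm_reval:
  "dtm (\<lambda>e. reval G (\<lambda>p. e (Inl p)) (\<lambda>k. e (Inr k)) t) (\<lambda>e. reval H (\<lambda>p. e (Inl p)) (\<lambda>k. e (Inr k)) t)"
  by (induction t) (auto intro!: dfn_intros dtm_rmul)

text \<open>A ring quantifier becomes a group quantifier relativised to \<open>in_rc\<close>.
  Updating the assignment at \<open>x\<close> amounts to a reindexing that sends \<open>x\<close> to
  the newly bound variable.\<close>

lemma dfn_sat_ring:
  "dfn (\<lambda>e. sat (carrier (RR n G (\<lambda>p. e (Inl p)))) (reval G (\<lambda>p. e (Inl p))) (\<lambda>k. e (Inr k)) \<phi>)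
    (\<lambda>e. sat (carrier (RR n H (\<lambda>p. e (Inl p)))) (reval H (\<lambda>p. e (Inl p))) (\<lambda>k. e (Inr k)) \<phi>)"
proof (induction \<phi>)
  case (Exists x \<phi>)
  let ?f = "\<lambda>i. case i of Inl p \<Rightarrow> Inl (Inl p) | Inr k \<Rightarrow> if k = x then Inr () else Inl (Inr k)"
  have upd: "(\<lambda>k. e (if k = x then Inr () else Inl (Inr k))) = (\<lambda>k. e (Inl (Inr k)))(x := e (Inr ()))"
    for e :: "_ \<Rightarrow> 'z" by (simp add: fun_eq_iff)
  have "dfn (\<lambda>e. sat (carrier (RR n G (\<lambda>p. e (Inl (Inl p))))) (reval G (\<lambda>p. e (Inl (Inl p))))
      ((\<lambda>k. e (Inl (Inr k)))(x := e (Inr ()))) \<phi>)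
    (\<lambda>e. sat (carrier (RR n H (\<lambda>p. e (Inl (Inl p))))) (reval H (\<lambda>p. e (Inl (Inl p))))
      ((\<lambda>k. e (Inl (Inr k)))(x := e (Inr ()))) \<phi>)"
    using dfn_reindex[OF Exists, of ?f] by (simp only: sum.case upd)
  then have "dfn (\<lambda>e. \<exists>a\<in>carrier G. in_rc n G (\<lambda>p. e (Inl p)) a \<and>
      sat (carrier (RR n G (\<lambda>p. e (Inl p)))) (reval G (\<lambda>p. e (Inl p))) ((\<lambda>k. e (Inr k))(x := a)) \<phi>)
    (\<lambda>e. \<exists>a\<in>carrier H. in_rc n H (\<lambda>p. e (Inl p)) a \<and>
      sat (carrier (RR n H (\<lambda>p. e (Inl p)))) (reval H (\<lambda>p. e (Inl p))) ((\<lambda>k. e (Inr k))(x := a)) \<phi>)"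
    by (intro dfn_ex dfn_conj dfn_in_rc dtm_var)
  then show ?case by (simp add: RR_def conj_assoc Bex_def)
qed (auto intro!: dfn_intros dtm_reval)

end

section \<open>Families of transvections satisfying the Steinberg relations\<close>

text \<open>\<open>u i j\<close> and \<open>\<phi> i j\<close> are the vector and the covector of the transvection
  \<open>1 + u \<phi>\<close> in position \<open>(i, j)\<close>.\<close>

locale rank_one_family =
  fixes n :: nat and L :: complex and u \<phi> :: "nat \<Rightarrow> nat \<Rightarrow> nat \<Rightarrow> complex"
  assumes n3: "3 \<le> n" and L0: "L \<noteq> 0"
    and u0: "i < n \<Longrightarrow> j < n \<Longrightarrow> i \<noteq> j \<Longrightarrow> \<exists>r<n. u i j r \<noteq> 0"
    and \<phi>0: "i < n \<Longrightarrow> j < n \<Longrightarrow> i \<noteq> j \<Longrightarrow> \<exists>r<n. \<phi> i j r \<noteq> 0"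
    and orth: "i < n \<Longrightarrow> j < n \<Longrightarrow> k < n \<Longrightarrow> l < n \<Longrightarrow> i \<noteq> j \<Longrightarrow> k \<noteq> l \<Longrightarrow> j \<noteq> k \<Longrightarrow> i \<noteq> l \<Longrightarrow>
      (\<Sum>r<n. \<phi> i j r * u k l r) = 0"
    and tri: "i < n \<Longrightarrow> j < n \<Longrightarrow> k < n \<Longrightarrow> i \<noteq> j \<Longrightarrow> j \<noteq> k \<Longrightarrow> i \<noteq> k \<Longrightarrow> r < n \<Longrightarrow> s < n \<Longrightarrow>
      u i j r * (\<Sum>q<n. \<phi> i j q * u j k q) * \<phi> j k s - u j k r * (\<Sum>q<n. \<phi> j k q * u i j q) * \<phi> i j s =
      L * (u i k r * \<phi> i k s)"
begin

definition dot :: "nat \<Rightarrow> nat \<Rightarrow> nat \<Rightarrow> nat \<Rightarrow> complex" where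
  "dot i j k l = (\<Sum>r<n. \<phi> i j r * u k l r)"

lemma dot_zero: "i < n \<Longrightarrow> j < n \<Longrightarrow> k < n \<Longrightarrow> l < n \<Longrightarrow> i \<noteq> j \<Longrightarrow> k \<noteq> l \<Longrightarrow> j \<noteq> k \<Longrightarrow> i \<noteq> l \<Longrightarrow> dot i j k l = 0"
  unfolding dot_def by (rule orth)

lemma dot_scale_u:
  assumes "\<And>r. r < n \<Longrightarrow> u k l r = a * u k' l' r"
  shows "dot i j k l = a * dot i j k' l'"
  unfolding dot_def using assms by (simp add: sum_distrib_left mult_ac)

lemma dot_scale_phi:
  assumes "\<And>r. r < n \<Longrightarrow> \<phi> i j r = a * \<phi> i' j' r"
  shows "dot i j k l = a * dot i' j' k l"
  unfolding dot_def using assms by (simp add: sum_distrib_left mult_ac)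

text \<open>Applying the covector \<open>\<phi> i j\<close> to the identity \<open>tri\<close>
  leaves only the product of the two numbers, so one of them is zero; if both were zero, the
  non-zero rank one matrix on the right of \<open>tri\<close> would vanish.\<close>

lemma dot_cases:
  assumes "i < n" "j < n" "k < n" "i \<noteq> j" "j \<noteq> k" "i \<noteq> k"
  shows "dot i j j k = 0 \<longleftrightarrow> dot j k i j \<noteq> 0"
proof -
  note t = tri[OF assms, folded dot_def]
  have "dot i j j k = 0 \<or> dot j k i j = 0"
  proof -
    obtain s where s: "s < n" "\<phi> i j s \<noteq> 0" using \<phi>0 assms by blast
    have "(\<Sum>r<n. \<phi> i j r * (u i j r * dot i j j k * \<phi> j k s - u j k r * dot j k i j * \<phi> i j s)) =
      (\<Sum>r<n. \<phi> i j r * (L * (u i k r * \<phi> i k s)))"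
      using t s by (intro sum.cong) auto
    moreover have "(\<Sum>r<n. \<phi> i j r * (u i j r * dot i j j k * \<phi> j k s - u j k r * dot j k i j * \<phi> i j s)) =
        dot i j i j * (dot i j j k * \<phi> j k s) - dot i j j k * (dot j k i j * \<phi> i j s)"
      unfolding dot_def[of i j i j] dot_def[of i j j k, symmetric]
      by (subst (3) dot_def) (simp add: algebra_simps sum_subtractf sum_distrib_left sum_distrib_right)
    moreover have "(\<Sum>r<n. \<phi> i j r * (L * (u i k r * \<phi> i k s))) = dot i j i k * (L * \<phi> i k s)"
      unfolding dot_def by (simp add: algebra_simps sum_distrib_left)
    moreover have "dot i j i j = 0" "dot i j i k = 0" using assms by (auto intro!: dot_zero)
    ultimately show ?thesis using s by simp
  qed
  moreover have "dot i j j k \<noteq> 0 \<or> dot j k i j \<noteq> 0"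
  proof (rule ccontr)
    assume *: "\<not> (dot i j j k \<noteq> 0 \<or> dot j k i j \<noteq> 0)"
    obtain r s where "r < n" "u i k r \<noteq> 0" "s < n" "\<phi> i k s \<noteq> 0" using u0 \<phi>0 assms by metis
    then show False using t[of r s] * L0 by simp
  qed
  ultimately show ?thesis by blast
qed

text \<open>By \<open>tri\<close> two non-zero rank one matrices are proportional, hence so are
  their vectors and their covectors.\<close>

lemma typeA_parallel:
  assumes "i < n" "j < n" "k < n" "i \<noteq> j" "j \<noteq> k" "i \<noteq> k" and A: "dot i j j k \<noteq> 0"
  shows "\<exists>a. a \<noteq> 0 \<and> (\<forall>r<n. u i k r = a * u i j r)" "\<exists>a. a \<noteq> 0 \<and> (\<forall>r<n. \<phi> i k r = a * \<phi> j k r)"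
proof -
  have b: "dot j k i j = 0" using dot_cases[OF assms(1-6)] A by blast
  have t: "u i j r * dot i j j k * \<phi> j k s = L * (u i k r * \<phi> i k s)" if "r < n" "s < n" for r s
    using tri[OF assms(1-6) that, folded dot_def] b by simp
  obtain r where r: "r < n" "u i k r \<noteq> 0" using u0 assms by metis
  obtain s where s: "s < n" "\<phi> i k s \<noteq> 0" using \<phi>0 assms by metis
  have ur: "u i j r \<noteq> 0" "\<phi> j k s \<noteq> 0" using t[OF r(1) s(1)] r s L0 by auto
  have "\<forall>x<n. u i k x = (dot i j j k * \<phi> j k s / (L * \<phi> i k s)) * u i j x"
    using t[OF _ s(1)] s L0 by (simp add: field_simps)
  moreover have "dot i j j k * \<phi> j k s / (L * \<phi> i k s) \<noteq> 0" using A ur L0 s by simp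
  ultimately show "\<exists>a. a \<noteq> 0 \<and> (\<forall>r<n. u i k r = a * u i j r)" by blast
  have "\<forall>x<n. \<phi> i k x = (dot i j j k * u i j r / (L * u i k r)) * \<phi> j k x"
    using t[OF r(1)] r L0 by (simp add: field_simps)
  moreover have "dot i j j k * u i j r / (L * u i k r) \<noteq> 0" using A ur L0 r by simp
  ultimately show "\<exists>a. a \<noteq> 0 \<and> (\<forall>r<n. \<phi> i k r = a * \<phi> j k r)" by blast
qed

text \<open>In type A the rank one matrices multiply like matrix units, position (i, j) times (j, k)
  giving (i, k). In the other type they multiply in the opposite order, as the matrix units do after
  transposition.\<close>

definition typeA :: "nat \<Rightarrow> nat \<Rightarrow> nat \<Rightarrow> bool" where
  "typeA i j k \<longleftrightarrow> i < n \<and> j < n \<and> k < n \<and> i \<noteq> j \<and> j \<noteq> k \<and> i \<noteq> k \<and> dot i j j k \<noteq> 0"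

text \<open>Proportionality of \<open>u i k\<close> and \<open>u i j\<close> reduces the pairing
  that would be non-zero in the opposite type to one that vanishes by \<open>dot_zero\<close>. The
  other two moves follow the same pattern.\<close>

lemma typeA_swap_last:
  assumes "typeA i j k"
  shows "typeA i k j"
proof -
  have d: "i < n" "j < n" "k < n" "i \<noteq> j" "j \<noteq> k" "i \<noteq> k" "dot i j j k \<noteq> 0"
    using assms by (auto simp: typeA_def)
  obtain a where a: "\<And>r. r < n \<Longrightarrow> u i k r = a * u i j r" using typeA_parallel(1)[OF d] by blast
  have "dot k j i k = a * dot k j i j" by (rule dot_scale_u[OF a])
  also have "dot k j i j = 0" using d by (intro dot_zero) auto
  finally show ?thesis using dot_cases[of i k j] d by (auto simp: typeA_def)
qed

lemma typeA_swap_first: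
  assumes "typeA i j k"
  shows "typeA j i k"
proof -
  have d: "i < n" "j < n" "k < n" "i \<noteq> j" "j \<noteq> k" "i \<noteq> k" "dot i j j k \<noteq> 0"
    using assms by (auto simp: typeA_def)
  obtain a where a: "\<And>r. r < n \<Longrightarrow> \<phi> i k r = a * \<phi> j k r" using typeA_parallel(2)[OF d] by blast
  have "dot i k j i = a * dot j k j i" by (rule dot_scale_phi[OF a])
  also have "dot j k j i = 0" using d by (intro dot_zero) auto
  finally show ?thesis using dot_cases[of j i k] d by (auto simp: typeA_def)
qed

lemma typeA_change_last:
  assumes "typeA i j k" "l < n" "l \<noteq> i" "l \<noteq> j"
  shows "typeA i j l"
proof -
  have d: "i < n" "j < n" "k < n" "i \<noteq> j" "j \<noteq> k" "i \<noteq> k" "dot i j j k \<noteq> 0"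
    using assms by (auto simp: typeA_def)
  obtain a where a: "a \<noteq> 0" "\<And>r. r < n \<Longrightarrow> u i k r = a * u i j r" using typeA_parallel(1)[OF d] by blast
  have "dot j l i k = a * dot j l i j" by (rule dot_scale_u[OF a(2)])
  moreover have "dot j l i k = 0" using d assms by (intro dot_zero) auto
  ultimately show ?thesis using dot_cases[of i j l] d assms a by (auto simp: typeA_def)
qed

text \<open>The three moves connect all triples of distinct indices, so the type of a single triple
  decides every other.\<close>

lemma typeA_all:
  assumes "typeA 0 1 2" "i < n" "j < n" "k < n" "i \<noteq> j" "j \<noteq> k" "i \<noteq> k"
  shows "typeA i j k"
proof -
  have 1: "typeA 0 1 l" if "l < n" "l \<noteq> 0" "l \<noteq> 1" for l
    by (rule typeA_change_last[OF assms(1)]) (use that in auto)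
  have 2: "typeA 0 l m" if "l < n" "m < n" "l \<noteq> 0" "m \<noteq> 0" "l \<noteq> m" for l m
  proof (cases "l = 1")
    case True
    then show ?thesis using 1[of m] that by auto
  next
    case False
    have "typeA 0 l 1" using typeA_swap_last[OF 1[of l]] that False by auto
    then show ?thesis by (rule typeA_change_last) (use that in auto)
  qed
  show ?thesis
  proof (cases "i = 0")
    case True
    then show ?thesis using 2 assms by auto
  next
    case i: False
    show ?thesis
    proof (cases "j = 0")
      case True
      then show ?thesis using typeA_swap_first[OF 2[of i k]] i assms by auto
    next
      case False
      have "typeA i j 0" using typeA_swap_last[OF typeA_swap_first[OF 2[of i j]]] i False assms by auto
      then show ?thesis by (rule typeA_change_last) (use assms in auto)
    qed
  qed
qed

lemma third_index: "\<exists>l<n. l \<noteq> i \<and> l \<noteq> (j::nat)"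
proof -
  have "card {i, j} < card {..<n}" using n3 card_insert_le_m1[of 2 "{j}" i] by simp
  then have "\<not> {..<n} \<subseteq> {i, j}" by (metis card_mono finite.emptyI finite_insert not_less)
  then show ?thesis by auto
qed

text \<open>The vectors \<open>u i j\<close> depend on i only, up to factors, and the covectors on j
  only, and both systems are dual to each other. The remaining factors \<open>y i j\<close> form a
  multiplicative cocycle, which a rescaling of the basis removes.\<close>

lemma matrix_units:
  assumes A: "typeA 0 1 2"
  shows "\<exists>P Q. (\<forall>j<n. \<forall>k<n. (\<Sum>r<n. Q j r * P r k) = (if j = k then 1 else 0)) \<and>
    (\<forall>i<n. \<forall>j<n. i \<noteq> j \<longrightarrow> (\<forall>r<n. \<forall>s<n. u i j r * \<phi> i j s = L * (P r i * Q j s)))"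
proof -
  have D: "dot i j j k \<noteq> 0" if "i < n" "j < n" "k < n" "i \<noteq> j" "j \<noteq> k" "i \<noteq> k" for i j k
    using typeA_all[OF A that] by (simp add: typeA_def)
  have pu: "\<exists>a. a \<noteq> 0 \<and> (\<forall>r<n. u i k r = a * u i j r)" if "i < n" "j < n" "k < n" "i \<noteq> j" "i \<noteq> k" for i j k
  proof (cases "j = k")
    case True
    then show ?thesis by (intro exI[of _ 1]) auto
  next
    case False
    show ?thesis by (rule typeA_parallel(1)) (use that False D[of i j k] in simp_all)
  qed
  have pphi: "\<exists>a. a \<noteq> 0 \<and> (\<forall>r<n. \<phi> i k r = a * \<phi> j k r)" if "i < n" "j < n" "k < n" "i \<noteq> k" "j \<noteq> k" for i j k
  proof (cases "i = j")
    case True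
    then show ?thesis by (intro exI[of _ 1]) auto
  next
    case False
    show ?thesis by (rule typeA_parallel(2)) (use that False D[of i j k] in simp_all)
  qed
  \<comment> \<open>\<open>dot_zero\<close> would also need \<open>i \<noteq> l\<close>; the
    proportional covector \<open>\<phi> m j\<close> with \<open>m \<noteq> l\<close> takes the place
    of \<open>\<phi> i j\<close>.\<close>
  have off: "dot i j k l = 0" if "i < n" "j < n" "k < n" "l < n" "i \<noteq> j" "k \<noteq> l" "j \<noteq> k" for i j k l
  proof -
    obtain m where m: "m < n" "m \<noteq> j" "m \<noteq> l" using third_index by blast
    have "\<exists>a. a \<noteq> 0 \<and> (\<forall>r<n. \<phi> i j r = a * \<phi> m j r)" by (rule pphi) (use m that in simp_all)
    then obtain a where a: "\<forall>r<n. \<phi> i j r = a * \<phi> m j r" by (elim exE conjE)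
    have "dot i j k l = a * dot m j k l" by (rule dot_scale_phi) (simp add: a)
    also have "dot m j k l = 0" by (rule dot_zero) (use m that in auto)
    finally show ?thesis by simp
  qed
  have on: "dot i j j l \<noteq> 0" if "i < n" "j < n" "l < n" "i \<noteq> j" "j \<noteq> l" for i j l
  proof (cases "l = i")
    case True
    obtain m where m: "m < n" "m \<noteq> j" "m \<noteq> i" using third_index by blast
    have "\<exists>a. a \<noteq> 0 \<and> (\<forall>r<n. u j i r = a * u j m r)" by (rule pu) (use m that in simp_all)
    then obtain a where a: "a \<noteq> 0" "\<forall>r<n. u j i r = a * u j m r" by (elim exE conjE)
    have "dot i j j i = a * dot i j j m" by (rule dot_scale_u) (simp add: a(2))
    moreover have "dot i j j m \<noteq> 0" by (rule D) (use m that in simp_all)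
    ultimately show ?thesis using a(1) True by simp
  next
    case False
    show ?thesis by (rule D) (use that False in simp_all)
  qed
  define k' where "k' k = (if k = 0 then 1 else 0 :: nat)" for k :: nat
  have k': "k' k < n" "k' k \<noteq> k" for k using n3 by (auto simp: k'_def)
  define g where "g j = dot (k' j) j j (k' j)" for j
  have g: "g j \<noteq> 0" if "j < n" for j
    unfolding g_def by (rule on) (use k'[of j] that in auto)
  define P0 where "P0 r k = u k (k' k) r" for r k
  define Q0 where "Q0 j s = \<phi> (k' j) j s / g j" for j s
  have QP0: "(\<Sum>r<n. Q0 j r * P0 r k) = (if j = k then 1 else 0)" if jk: "j < n" "k < n" for j k
  proof -
    have "(\<Sum>r<n. Q0 j r * P0 r k) = dot (k' j) j k (k' k) / g j"
      unfolding dot_def Q0_def P0_def by (simp add: sum_divide_distrib)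
    moreover have "dot (k' j) j k (k' k) = 0" if "j \<noteq> k"
      by (rule off) (use k'[of j] k'[of k] that jk in auto)
    ultimately show ?thesis using g[OF jk(1)] by (auto simp: g_def)
  qed
  have ex: "\<exists>y. y \<noteq> 0 \<and> (\<forall>r<n. \<forall>s<n. u i j r * \<phi> i j s = y * (P0 r i * Q0 j s))" if "i < n" "j < n" "i \<noteq> j" for i j
  proof -
    have "\<exists>a. a \<noteq> 0 \<and> (\<forall>r<n. u i j r = a * u i (k' i) r)" by (rule pu) (use k'[of i] that in simp_all)
    then obtain a where a: "a \<noteq> 0" "\<forall>r<n. u i j r = a * u i (k' i) r" by (elim exE conjE)
    have "\<exists>a. a \<noteq> 0 \<and> (\<forall>r<n. \<phi> i j r = a * \<phi> (k' j) j r)" by (rule pphi) (use k'[of j] that in simp_all)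
    then obtain b where b: "b \<noteq> 0" "\<forall>r<n. \<phi> i j r = b * \<phi> (k' j) j r" by (elim exE conjE)
    show ?thesis
      by (rule exI[of _ "a * b * g j"]) (use a b g[OF that(2)] in \<open>simp add: P0_def Q0_def\<close>)
  qed
  define y where "y i j = (SOME z. z \<noteq> 0 \<and>
    (\<forall>r<n. \<forall>s<n. u i j r * \<phi> i j s = z * (P0 r i * Q0 j s)))" for i j
  have ysel: "y i j \<noteq> 0 \<and> (\<forall>r<n. \<forall>s<n. u i j r * \<phi> i j s = y i j * (P0 r i * Q0 j s))"
    if "i < n" "j < n" "i \<noteq> j" for i j
    unfolding y_def by (rule someI_ex) (rule ex[OF that])
  have y0: "y i j \<noteq> 0" if "i < n" "j < n" "i \<noteq> j" for i j using ysel[OF that] by (rule conjunct1)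
  have y: "u i j r * \<phi> i j s = y i j * (P0 r i * Q0 j s)"
    if "i < n" "j < n" "i \<noteq> j" "r < n" "s < n" for i j r s
    using ysel[OF that(1-3)] that(4,5) by simp
  \<comment> \<open>In type A one of the two products in \<open>tri\<close> disappears, and duality
    of the bases turns the rest into the cocycle identity.\<close>
  have yy: "y i j * y j k = L * y i k" if ijk: "i < n" "j < n" "k < n" "i \<noteq> j" "j \<noteq> k" "i \<noteq> k" for i j k
  proof -
    obtain r where r: "r < n" "u i k r \<noteq> 0" using u0 ijk by metis
    obtain s where s: "s < n" "\<phi> i k s \<noteq> 0" using \<phi>0 ijk by metis
    have PQ: "P0 r i * Q0 k s \<noteq> 0" using y[of i k r s] ijk r s by auto
    have "dot j k i j = 0" using dot_cases[OF ijk] D[OF ijk] by blast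
    then have "u i j r * dot i j j k * \<phi> j k s = L * (u i k r * \<phi> i k s)"
      using tri[OF ijk r(1) s(1), folded dot_def] by simp
    moreover have "u i j r * dot i j j k * \<phi> j k s = (\<Sum>q<n. (u i j r * \<phi> i j q) * (u j k q * \<phi> j k s))"
      unfolding dot_def by (simp add: sum_distrib_left sum_distrib_right mult_ac)
    moreover have "\<dots> = (\<Sum>q<n. (y i j * (P0 r i * Q0 j q)) * (y j k * (P0 q j * Q0 k s)))"
      using ijk r s by (intro sum.cong) (auto simp: y)
    moreover have "\<dots> = y i j * y j k * (P0 r i * Q0 k s) * (\<Sum>q<n. Q0 j q * P0 q j)"
      by (simp add: sum_distrib_left mult_ac)
    moreover have "u i k r * \<phi> i k s = y i k * (P0 r i * Q0 k s)" using y ijk r s by simp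
    ultimately have "y i j * y j k * (P0 r i * Q0 k s) = L * y i k * (P0 r i * Q0 k s)"
      using QP0[of j j] ijk by simp
    then show ?thesis using PQ by simp
  qed
  \<comment> \<open>The rescaling is read off from row 0 and makes the cocycle a coboundary:
    \<open>y i j = L * sc i / sc j\<close>.\<close>
  define sc where "sc j = (if j = 0 then 1 else L / y 0 j)" for j
  have sc0: "sc j \<noteq> 0" if "j < n" for j using y0[of 0 j] that L0 n3 by (auto simp: sc_def)
  \<comment> \<open>The identity \<open>yy\<close> concerns distinct indices only, so the pair (0,
    i), (i, 0) is treated through a third index.\<close>
  have y00: "y 0 i * y i 0 = L * L" if i: "i < n" "i \<noteq> 0" for i
  proof -
    obtain j where j: "j < n" "j \<noteq> 0" "j \<noteq> i" using third_index by blast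
    have "y i 0 * y 0 j = L * y i j" "y 0 i * y i j = L * y 0 j" using yy i j n3 by auto
    then have "y 0 i * y i 0 * y 0 j = L * L * y 0 j" by (metis mult.assoc mult.left_commute)
    then show ?thesis using y0[of 0 j] j n3 by simp
  qed
  have scy: "y i j * sc j / sc i = L" if ij: "i < n" "j < n" "i \<noteq> j" for i j
  proof -
    consider "i = 0" | "j = 0" | "i \<noteq> 0" "j \<noteq> 0" by blast
    then show ?thesis
    proof cases
      case 1
      then show ?thesis using ij y0[of 0 j] by (simp add: sc_def)
    next
      case 2
      then show ?thesis using ij y00[of i] L0 by (simp add: sc_def field_simps)
    next
      case 3
      have "y 0 i * y i j = L * y 0 j" using yy[of 0 i j] ij 3 n3 by simp
      then show ?thesis using ij 3 L0 y0[of 0 j] y0[of 0 i] n3 by (simp add: sc_def field_simps)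
    qed
  qed
  show ?thesis
  proof (rule exI[of _ "\<lambda>r k. P0 r k * sc k"], rule exI[of _ "\<lambda>j s. Q0 j s / sc j"], intro conjI allI impI)
    fix j k assume jk: "j < n" "k < n"
    have "(\<Sum>r<n. Q0 j r / sc j * (P0 r k * sc k)) = (\<Sum>r<n. Q0 j r * P0 r k) * sc k / sc j"
      by (simp add: sum_distrib_right sum_divide_distrib mult.assoc)
    then show "(\<Sum>r<n. Q0 j r / sc j * (P0 r k * sc k)) = (if j = k then 1 else 0)"
      using QP0[OF jk] sc0 jk by simp
  next
    fix i j r s assume ij: "i < n" "j < n" "i \<noteq> j" "r < n" "s < n"
    have "u i j r * \<phi> i j s = (y i j * sc j / sc i) * (P0 r i * sc i * (Q0 j s / sc j))"
      using y[OF ij] sc0 ij by simp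
    then show "u i j r * \<phi> i j s = L * (P0 r i * sc i * (Q0 j s / sc j))" using scy ij by simp
  qed
qed

end

section \<open>Special linear groups over subrings of the complex numbers\<close>

definition GG :: "nat \<Rightarrow> complex set \<Rightarrow> complex mat monoid" where
  "GG n S = \<lparr>carrier = {A \<in> carrier_mat n n. (\<forall>i<n. \<forall>j<n. A $$ (i, j) \<in> S) \<and> det A = 1},
    monoid.mult = (*), one = 1\<^sub>m n\<rparr>"

definition em :: "nat \<Rightarrow> nat \<Rightarrow> nat \<Rightarrow> complex \<Rightarrow> complex mat" where
  "em n i j b = mat n n (\<lambda>(r, s). (if r = s then 1 else 0) + (if r = i \<and> s = j then b else 0))"

lemma em_carrier [simp]: "em n i j b \<in> carrier_mat n n"
  by (simp add: em_def)

lemma em_index: "r < n \<Longrightarrow> s < n \<Longrightarrow>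
    em n i j b $$ (r, s) = (if r = s then 1 else 0) + (if r = i \<and> s = j then b else 0)"
  by (simp add: em_def)

lemma det_em: "i < n \<Longrightarrow> j < n \<Longrightarrow> i \<noteq> j \<Longrightarrow> det (em n i j b) = 1"
proof -
  assume ij: "i < n" "j < n" "i \<noteq> j"
  then have "em n i j b = addrow_mat n b i j" by (intro eq_matI) (auto simp: em_def)
  then show ?thesis using det_addrow_mat ij by simp
qed

lemma mult_em:
  assumes A: "A \<in> carrier_mat n n" and ij: "i < n" "j < n" and rs: "r < n" "s < n"
  shows "(A * em n i j b) $$ (r, s) = A $$ (r, s) + (if s = j then A $$ (r, i) * b else 0)"
proof -
  have "(A * em n i j b) $$ (r, s) = (\<Sum>q<n. (if q = s then A $$ (r, s) else 0) +
      (if q = i then (if s = j then A $$ (r, i) * b else 0) else 0))"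
    unfolding mat_mult_index[OF A em_carrier rs] using rs
    by (intro sum.cong) (auto simp: em_index algebra_simps)
  then show ?thesis using rs ij by (simp add: sum.distrib)
qed

lemma em_mult:
  assumes A: "A \<in> carrier_mat n n" and ij: "i < n" "j < n" and rs: "r < n" "s < n"
  shows "(em n i j b * A) $$ (r, s) = A $$ (r, s) + (if r = i then b * A $$ (j, s) else 0)"
proof -
  have "(em n i j b * A) $$ (r, s) = (\<Sum>q<n. (if q = r then A $$ (r, s) else 0) +
      (if q = j then (if r = i then b * A $$ (j, s) else 0) else 0))"
    unfolding mat_mult_index[OF em_carrier A rs] using rs
    by (intro sum.cong) (auto simp: em_index algebra_simps)
  then show ?thesis using rs ij by (simp add: sum.distrib)
qed

lemma em_add:
  assumes "i < n" "j < n" "i \<noteq> j"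
  shows "em n i j a * em n i j b = em n i j (a + b)"
proof (rule eq_matI)
  fix r s assume "r < dim_row (em n i j (a + b))" "s < dim_col (em n i j (a + b))"
  then have rs: "r < n" "s < n" by (simp_all add: em_def)
  show "(em n i j a * em n i j b) $$ (r, s) = em n i j (a + b) $$ (r, s)"
    unfolding mult_em[OF em_carrier assms(1,2) rs] using rs assms by (auto simp: em_index)
qed (simp_all add: em_def)

lemma em_zero: "em n i j 0 = 1\<^sub>m n"
  by (rule eq_matI) (auto simp: em_def)

lemma em_commute:
  assumes "i < n" "j < n" "k < n" "l < n" "j \<noteq> k" "i \<noteq> l"
  shows "em n i j a * em n k l b = em n k l b * em n i j a"
proof (rule eq_matI)
  fix r s assume "r < dim_row (em n k l b * em n i j a)" "s < dim_col (em n k l b * em n i j a)"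
  then have rs: "r < n" "s < n" by (simp_all add: em_def)
  show "(em n i j a * em n k l b) $$ (r, s) = (em n k l b * em n i j a) $$ (r, s)"
    unfolding mult_em[OF em_carrier assms(3,4) rs] mult_em[OF em_carrier assms(1,2) rs]
    using rs assms by (auto simp: em_index)
qed (simp_all add: em_def)

lemma em_steinberg:
  assumes "i < n" "j < n" "k < n" "i \<noteq> j" "j \<noteq> k" "i \<noteq> k"
  shows "em n i j a * em n j k b = em n i k (a * b) * (em n j k b * em n i j a)"
proof (rule eq_matI)
  fix r s assume "r < dim_row (em n i k (a * b) * (em n j k b * em n i j a))"
    "s < dim_col (em n i k (a * b) * (em n j k b * em n i j a))"
  then have rs: "r < n" "s < n" by (simp_all add: em_def)
  have c: "em n j k b * em n i j a \<in> carrier_mat n n" by (rule mult_carrier_mat[OF em_carrier em_carrier])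
  show "(em n i j a * em n j k b) $$ (r, s) = (em n i k (a * b) * (em n j k b * em n i j a)) $$ (r, s)"
    unfolding mult_em[OF em_carrier assms(2,3) rs] em_mult[OF c assms(1,3) rs]
      mult_em[OF em_carrier assms(1,2) rs] mult_em[OF em_carrier assms(1,2) assms(3) rs(2)]
    using rs assms by (auto simp: em_index)
qed (simp_all add: em_def)

abbreviation ring_on :: "complex set \<Rightarrow> complex ring" where
  "ring_on S \<equiv> \<lparr>carrier = S, monoid.mult = (*), one = 1, zero = 0, add = (+)\<rparr>"

locale complex_subring =
  fixes S :: "complex set" and n :: nat
  assumes one_S: "1 \<in> S" and add_S: "a \<in> S \<Longrightarrow> b \<in> S \<Longrightarrow> a + b \<in> S"
    and mult_S: "a \<in> S \<Longrightarrow> b \<in> S \<Longrightarrow> a * b \<in> S" and uminus_S: "a \<in> S \<Longrightarrow> - a \<in> S"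
    and n3: "3 \<le> n"
begin

abbreviation "G \<equiv> GG n S"

lemma zero_S: "0 \<in> S"
  using add_S[OF one_S uminus_S[OF one_S]] by simp

lemma sum_S: "(\<And>i. i \<in> I \<Longrightarrow> f i \<in> S) \<Longrightarrow> sum f I \<in> S"
  by (induction I rule: infinite_finite_induct) (simp_all add: zero_S add_S)

lemma prod_S: "(\<And>i. i \<in> I \<Longrightarrow> f i \<in> S) \<Longrightarrow> prod f I \<in> S"
  by (induction I rule: infinite_finite_induct) (simp_all add: one_S mult_S)

lemma power_S: "a \<in> S \<Longrightarrow> a ^ k \<in> S"
  by (induction k) (simp_all add: one_S mult_S)

lemma det_S:
  assumes "A \<in> carrier_mat m m" "\<And>i j. i < m \<Longrightarrow> j < m \<Longrightarrow> A $$ (i, j) \<in> S"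
  shows "det A \<in> S"
  unfolding det_def'[OF assms(1)]
proof (rule sum_S)
  fix p assume "p \<in> {p. p permutes {0..<m}}"
  then have p: "p permutes {0..<m}" by simp
  have "(\<Prod>i = 0..<m. A $$ (i, p i)) \<in> S"
  proof (rule prod_S)
    fix i assume i: "i \<in> {0..<m}"
    then have "p i \<in> {0..<m}" using permutes_in_image[OF p] by blast
    then show "A $$ (i, p i) \<in> S" using i assms(2) by simp
  qed
  moreover have "signof p = (1::complex) \<or> signof p = (-1::complex)" by (cases rule: sign_cases[of p]) simp_all
  ultimately show "signof p * (\<Prod>i = 0..<m. A $$ (i, p i)) \<in> S" using uminus_S by auto
qed

lemma GG_D:
  assumes "A \<in> carrier G"
  shows "A \<in> carrier_mat n n" "i < n \<Longrightarrow> j < n \<Longrightarrow> A $$ (i, j) \<in> S" "det A = 1"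
  using assms by (auto simp: GG_def)

lemma GG_I:
  assumes "A \<in> carrier_mat n n" "\<And>i j. i < n \<Longrightarrow> j < n \<Longrightarrow> A $$ (i, j) \<in> S" "det A = 1"
  shows "A \<in> carrier G"
  using assms by (auto simp: GG_def)

lemma GG_mult [simp]: "A \<otimes>\<^bsub>G\<^esub> B = A * B" and GG_one [simp]: "\<one>\<^bsub>G\<^esub> = 1\<^sub>m n"
  by (simp_all add: GG_def)

lemma GG_mult_closed:
  assumes A: "A \<in> carrier G" and B: "B \<in> carrier G"
  shows "A * B \<in> carrier G"
proof (rule GG_I)
  note a = GG_D[OF A] and b = GG_D[OF B]
  show "A * B \<in> carrier_mat n n" using a(1) b(1) by simp
  show "det (A * B) = 1" using det_mult[OF a(1) b(1)] a(3) b(3) by simp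
  show "(A * B) $$ (i, j) \<in> S" if "i < n" "j < n" for i j
    unfolding mat_mult_index[OF a(1) b(1) that] using a(2) b(2) that
    by (intro sum_S mult_S) simp_all
qed

text \<open>The inverse of a matrix of determinant 1 is its adjugate, whose entries are signed
  minors and thus lie in \<open>S\<close>.\<close>

lemma GG_inverse_exists:
  assumes A: "A \<in> carrier G"
  shows "\<exists>B\<in>carrier G. B * A = 1\<^sub>m n"
proof -
  note a = GG_D[OF A]
  note adj = adj_mat[OF a(1)]
  have m: "adj_mat A * A = 1\<^sub>m n" unfolding adj(3) a(3) by (intro eq_matI) simp_all
  have "det (adj_mat A) * det A = 1" using det_mult[OF adj(1) a(1)] m by simp
  then have d: "det (adj_mat A) = 1" using a(3) by simp
  have "adj_mat A $$ (i, j) \<in> S" if ij: "i < n" "j < n" for i j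
  proof -
    have "det (mat_delete A j i) \<in> S"
    proof (rule det_S)
      show "mat_delete A j i \<in> carrier_mat (n - 1) (n - 1)" using a(1) by (rule mat_delete_carrier)
      show "mat_delete A j i $$ (p, q) \<in> S" if "p < n - 1" "q < n - 1" for p q
        using that a(1) by (auto simp: mat_delete_def intro!: a(2))
    qed
    moreover have "(-1::complex) ^ (j + i) \<in> S" by (intro power_S uminus_S one_S)
    ultimately show ?thesis using ij a(1) by (auto simp: adj_mat_def cofactor_def intro!: mult_S)
  qed
  then have "adj_mat A \<in> carrier G" using adj(1) d by (intro GG_I) auto
  then show ?thesis using m by blast
qed

lemma GG_group: "group G"
proof (rule groupI)
  show "\<one>\<^bsub>G\<^esub> \<in> carrier G" by (auto simp: GG_def one_S zero_S)
  show "\<exists>y\<in>carrier G. y \<otimes>\<^bsub>G\<^esub> x = \<one>\<^bsub>G\<^esub>" if "x \<in> carrier G" for x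
    using GG_inverse_exists[OF that] by simp
  show "x \<otimes>\<^bsub>G\<^esub> y \<otimes>\<^bsub>G\<^esub> z = x \<otimes>\<^bsub>G\<^esub> (y \<otimes>\<^bsub>G\<^esub> z)" if "x \<in> carrier G" "y \<in> carrier G" "z \<in> carrier G" for x y z
    using assoc_mult_mat[OF GG_D(1)[OF that(1)] GG_D(1)[OF that(2)] GG_D(1)[OF that(3)]] by simp
  show "\<one>\<^bsub>G\<^esub> \<otimes>\<^bsub>G\<^esub> x = x" if "x \<in> carrier G" for x using GG_D(1)[OF that] by simp
qed (simp add: GG_mult_closed)

sublocale GG: group G by (rule GG_group)

lemma GG_inv:
  assumes A: "A \<in> carrier G"
  shows "inv\<^bsub>G\<^esub> A \<in> carrier G" "inv\<^bsub>G\<^esub> A * A = 1\<^sub>m n" "A * inv\<^bsub>G\<^esub> A = 1\<^sub>m n"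
  using GG.inv_closed[OF A] GG.l_inv[OF A] GG.r_inv[OF A] by simp_all

lemma GG_pow: "A \<in> carrier G \<Longrightarrow> A [^]\<^bsub>G\<^esub> k = A ^\<^sub>m k"
  by (induction k) (auto simp: GG_D(1) dest: GG_D(1))

lemma em_G: "i < n \<Longrightarrow> j < n \<Longrightarrow> i \<noteq> j \<Longrightarrow> b \<in> S \<Longrightarrow> em n i j b \<in> carrier G"
  by (rule GG_I) (auto simp: em_index det_em zero_S one_S add_S)

lemma em_inv:
  assumes "i < n" "j < n" "i \<noteq> j" "b \<in> S"
  shows "inv\<^bsub>G\<^esub> (em n i j b) = em n i j (- b)"
  by (rule GG.inv_equality) (use assms in \<open>simp_all add: em_G uminus_S em_add em_zero\<close>)

lemma em_commutator:
  assumes "i < n" "j < n" "k < n" "i \<noteq> j" "j \<noteq> k" "i \<noteq> k" "a \<in> S" "b \<in> S"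
  shows "cm G (em n i j a) (em n j k b) = em n i k (a * b)"
proof -
  let ?A = "em n i j a" and ?B = "em n j k b" and ?C = "em n i k (a * b)"
  have c: "?A \<in> carrier G" "?B \<in> carrier G" "?C \<in> carrier G" using assms by (auto intro: em_G mult_S)
  have "?A \<otimes>\<^bsub>G\<^esub> ?B = ?C \<otimes>\<^bsub>G\<^esub> (?B \<otimes>\<^bsub>G\<^esub> ?A)" using em_steinberg[OF assms(1-6)] by simp
  then have "cm G ?A ?B = ?C \<otimes>\<^bsub>G\<^esub> (?B \<otimes>\<^bsub>G\<^esub> ?A) \<otimes>\<^bsub>G\<^esub> inv\<^bsub>G\<^esub> ?A \<otimes>\<^bsub>G\<^esub> inv\<^bsub>G\<^esub> ?B"
    unfolding cm_def by (simp only:)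
  also have "\<dots> = ?C" using c by (simp add: GG.m_assoc GG.inv_solve_right' del: GG_mult GG_one)
  finally show ?thesis .
qed

end

text \<open>The relation of the Heisenberg group: since z commutes with x and y, moving each of p
  factors x past each of q factors y leaves one z behind.\<close>

lemma (in group) steinberg_pow:
  assumes c: "x \<in> carrier G" "y \<in> carrier G" "z \<in> carrier G"
    and xy: "x \<otimes> y = z \<otimes> (y \<otimes> x)" and zx: "z \<otimes> x = x \<otimes> z" and zy: "z \<otimes> y = y \<otimes> z"
  shows "x [^] (p::nat) \<otimes> y [^] (q::nat) = z [^] (p * q) \<otimes> (y [^] q \<otimes> x [^] p)"
proof -
  have zyp: "z [^] (k::nat) \<otimes> y = y \<otimes> z [^] k" for k by (rule group_commutes_pow[OF zy c(3,2)])
  have zxp: "z [^] (k::nat) \<otimes> x = x \<otimes> z [^] k" for k by (rule group_commutes_pow[OF zx c(3,1)])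
  have 1: "x \<otimes> y [^] q = z [^] q \<otimes> (y [^] q \<otimes> x)" for q :: nat
  proof (induction q)
    case 0
    then show ?case using c by simp
  next
    case (Suc q)
    have "x \<otimes> y [^] Suc q = x \<otimes> y [^] q \<otimes> y" using c by (simp add: m_assoc)
    also have "\<dots> = z [^] q \<otimes> (y [^] q \<otimes> (x \<otimes> y))" unfolding Suc using c by (simp add: m_assoc)
    also have "\<dots> = z [^] q \<otimes> ((y [^] q \<otimes> z) \<otimes> (y \<otimes> x))" unfolding xy using c by (simp add: m_assoc)
    also have "y [^] q \<otimes> z = z \<otimes> y [^] q" by (rule group_commutes_pow[OF zy[symmetric] c(2,3)])
    also have "z [^] q \<otimes> (z \<otimes> y [^] q \<otimes> (y \<otimes> x)) = z [^] Suc q \<otimes> (y [^] Suc q \<otimes> x)" using c by (simp add: m_assoc)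
    finally show ?case .
  qed
  show ?thesis
  proof (induction p)
    case 0
    then show ?case using c by simp
  next
    case (Suc p)
    have zq: "z [^] q \<otimes> x [^] p = x [^] p \<otimes> z [^] q"
      by (rule group_commutes_pow[OF zxp[symmetric], symmetric]) (use c in simp_all)
    have "x [^] Suc p \<otimes> y [^] q = x [^] p \<otimes> (x \<otimes> y [^] q)" using c by (simp add: m_assoc)
    also have "\<dots> = (x [^] p \<otimes> z [^] q) \<otimes> (y [^] q \<otimes> x)" unfolding 1 using c by (simp add: m_assoc)
    also have "\<dots> = z [^] q \<otimes> (x [^] p \<otimes> y [^] q) \<otimes> x" unfolding zq[symmetric] using c by (simp add: m_assoc)
    also have "\<dots> = (z [^] q \<otimes> z [^] (p * q)) \<otimes> (y [^] q \<otimes> x [^] Suc p)" unfolding Suc using c by (simp add: m_assoc)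
    also have "z [^] q \<otimes> z [^] (p * q) = z [^] (Suc p * q)" using c by (simp add: nat_pow_mult)
    finally show ?case .
  qed
qed

section \<open>Steinberg elements are standard up to an automorphism\<close>

text \<open>For \<open>d \<ge> 1\<close> these matrices form the d-th term of the lower central
  series of the unitriangular group.\<close>

definition fil :: "nat \<Rightarrow> nat \<Rightarrow> complex mat \<Rightarrow> bool" where
  "fil n d A \<longleftrightarrow> A \<in> carrier_mat n n \<and> (\<forall>p<n. \<forall>q<n. q < p + d \<longrightarrow> A $$ (p, q) = (if p = q then 1 else 0))"

text \<open>At distance less than a + b from the diagonal, both xy and yx have the entries of x + y
  - 1, so they agree there. As \<open>w = yx\<close> is unitriangular, \<open>z w\<close> and
  \<open>w\<close> can agree there only if z looks like the unit matrix.\<close>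

lemma fil_commutator:
  assumes x: "fil n a x" and y: "fil n b y" and ab: "1 \<le> a" "1 \<le> b"
    and z: "z \<in> carrier_mat n n" and eq: "x * y = z * (y * x)"
  shows "fil n (a + b) z"
proof -
  have xc: "x \<in> carrier_mat n n" and yc: "y \<in> carrier_mat n n" using x y by (simp_all add: fil_def)
  have x0: "x $$ (p, q) = (if p = q then 1 else 0)" if "p < n" "q < n" "q < p + a" for p q
    using x that by (simp add: fil_def)
  have y0: "y $$ (p, q) = (if p = q then 1 else 0)" if "p < n" "q < n" "q < p + b" for p q
    using y that by (simp add: fil_def)
  let ?w = "y * x"
  have wc: "?w \<in> carrier_mat n n" using xc yc by simp
  have prod: "(\<Sum>r<n. f p r * g r q) = f p q + g p q - (if p = q then 1 else 0)"
    if pq: "p < n" "q < n" "q < p + (d + e)" and "1 \<le> d" "1 \<le> e"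
      and f: "\<And>p q. p < n \<Longrightarrow> q < n \<Longrightarrow> q < p + d \<Longrightarrow> f p q = (if p = q then 1 else 0)"
      and g: "\<And>p q. p < n \<Longrightarrow> q < n \<Longrightarrow> q < p + e \<Longrightarrow> g p q = (if p = q then 1 else 0)"
    for f g :: "nat \<Rightarrow> nat \<Rightarrow> complex" and d e p q
  proof -
    have "f p r * g r q = (if r = p then g p q else 0) + (if r = q then f p q else 0) -
        (if r = p then if p = q then 1 else 0 else 0)" if r: "r < n" for r
    proof (cases "r < p + d")
      case True
      then have fr: "f p r = (if p = r then 1 else 0)" using f[of p r] pq r by simp
      show ?thesis
      proof (cases "r = p")
        case True
        then show ?thesis using fr f[of p p] pq \<open>1 \<le> d\<close> by auto
      next
        case False
        then show ?thesis using fr by auto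
      qed
    next
      case False
      then have gr: "g r q = (if r = q then 1 else 0)" using g[of r q] pq r by simp
      show ?thesis using gr False \<open>1 \<le> d\<close> by auto
    qed
    then have "(\<Sum>r<n. f p r * g r q) = (\<Sum>r<n. (if r = p then g p q else 0) + (if r = q then f p q else 0) -
        (if r = p then if p = q then 1 else 0 else 0))" by (intro sum.cong) simp_all
    then show ?thesis using pq by (simp add: sum.distrib sum_subtractf)
  qed
  have xy: "(x * y) $$ (p, q) = (y * x) $$ (p, q)" if pq: "p < n" "q < n" "q < p + (a + b)" for p q
  proof -
    have "(x * y) $$ (p, q) = x $$ (p, q) + y $$ (p, q) - (if p = q then 1 else 0)"
      unfolding mat_mult_index[OF xc yc pq(1,2)]
      by (rule prod[where f = "\<lambda>p q. x $$ (p, q)" and g = "\<lambda>p q. y $$ (p, q)" and d = a and e = b])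
        (use pq ab x0 y0 in simp_all)
    moreover have "(y * x) $$ (p, q) = y $$ (p, q) + x $$ (p, q) - (if p = q then 1 else 0)"
      unfolding mat_mult_index[OF yc xc pq(1,2)]
      by (rule prod[where f = "\<lambda>p q. y $$ (p, q)" and g = "\<lambda>p q. x $$ (p, q)" and d = b and e = a])
        (use pq ab x0 y0 in simp_all)
    ultimately show ?thesis by simp
  qed
  have w: "?w $$ (p, q) = (if p = q then 1 else 0)" if pq: "p < n" "q \<le> p" for p q
  proof -
    have "(y * x) $$ (p, q) = y $$ (p, q) + x $$ (p, q) - (if p = q then 1 else 0)"
      unfolding mat_mult_index[OF yc xc pq(1) le_less_trans[OF pq(2,1)]]
      by (rule prod[where f = "\<lambda>p q. y $$ (p, q)" and g = "\<lambda>p q. x $$ (p, q)" and d = b and e = a])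
        (use pq ab x0 y0 in simp_all)
    then show ?thesis using x0[of p q] y0[of p q] pq ab by simp
  qed
  \<comment> \<open>Since w is unitriangular, the column q of \<open>z w\<close> involves only the
    columns of z up to q, which allows induction on q.\<close>
  have main: "z $$ (p, q) = (if p = q then 1 else 0)" if "p < n" "q < n" "q < p + (a + b)" for p q
    using that
  proof (induction q rule: less_induct)
    case (less q)
    have "(\<Sum>r<n. z $$ (p, r) * ?w $$ (r, q)) = ?w $$ (p, q)"
      using mat_mult_index[OF z wc less.prems(1,2)] xy[OF less.prems] eq by simp
    moreover have "(\<Sum>r<n. z $$ (p, r) * ?w $$ (r, q)) =
      (\<Sum>r<n. (if r = q then z $$ (p, q) else 0) + (if r = p then if p < q then ?w $$ (p, q) else 0 else 0))"
    proof (rule sum.cong)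
      fix r assume "r \<in> {..<n}"
      then have r: "r < n" by simp
      consider "r < q" | "r = q" | "q < r" by linarith
      then show "z $$ (p, r) * ?w $$ (r, q) =
        (if r = q then z $$ (p, q) else 0) + (if r = p then if p < q then ?w $$ (p, q) else 0 else 0)"
      proof cases
        case 1
        then have "z $$ (p, r) = (if p = r then 1 else 0)" using less.IH[of r] less.prems r by simp
        then show ?thesis using 1 by auto
      next
        case 2
        then have "?w $$ (r, q) = 1" using w[of r q] r by simp
        then show ?thesis using 2 by auto
      next
        case 3
        then have "?w $$ (r, q) = 0" using w[of r q] r by simp
        then show ?thesis using 3 by auto
      qed
    qed simp
    ultimately have "z $$ (p, q) + (if p < q then ?w $$ (p, q) else 0) = ?w $$ (p, q)"
      using less.prems by (simp add: sum.distrib)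
    then show ?case using w[of p q] less.prems by (cases "p < q") auto
  qed
  then show ?thesis using z by (simp add: fil_def)
qed

lemma third_index: "3 \<le> n \<Longrightarrow> \<exists>l<n. l \<noteq> i \<and> l \<noteq> (j::nat)"
proof -
  assume n: "3 \<le> n"
  have "card {i, j} < card {..<n}" using n card_insert_le_m1[of 2 "{j}" i] by simp
  then have "\<not> {..<n} \<subseteq> {i, j}" by (metis card_mono finite.emptyI finite_insert not_less)
  then show ?thesis by auto
qed

locale steinberg_elements = complex_subring +
  fixes c :: "nat \<times> nat \<Rightarrow> complex mat"
  assumes c_G: "i < n \<Longrightarrow> j < n \<Longrightarrow> i \<noteq> j \<Longrightarrow> c (i, j) \<in> carrier G"
    and st: "steinberg n (fact n ^ (n - 1)) G c"
begin

lemma rel: "i < n \<Longrightarrow> j < n \<Longrightarrow> k < n \<Longrightarrow> i \<noteq> j \<Longrightarrow> j \<noteq> k \<Longrightarrow> i \<noteq> k \<Longrightarrow>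
    c (i, j) * c (j, k) = c (i, k) * (c (j, k) * c (i, j))"
  using st by (simp add: steinberg_def)

lemma comm: "i < n \<Longrightarrow> j < n \<Longrightarrow> k < n \<Longrightarrow> l < n \<Longrightarrow> i \<noteq> j \<Longrightarrow> k \<noteq> l \<Longrightarrow> j \<noteq> k \<Longrightarrow> i \<noteq> l \<Longrightarrow>
    c (i, j) * c (k, l) = c (k, l) * c (i, j)"
  using st by (simp add: steinberg_def)

lemma nontriv: "i < n \<Longrightarrow> j < n \<Longrightarrow> i \<noteq> j \<Longrightarrow> c (i, j) ^\<^sub>m (fact n ^ (n - 1)) \<noteq> 1\<^sub>m n"
proof -
  assume ij: "i < n" "j < n" "i \<noteq> j"
  have "c (i, j) [^]\<^bsub>G\<^esub> ((fact n :: nat) ^ (n - 1)) \<noteq> \<one>\<^bsub>G\<^esub>" using st ij unfolding steinberg_def by blast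
  then show ?thesis unfolding GG_pow[OF c_G[OF ij]] GG_one .
qed

lemma c_carrier: "i < n \<Longrightarrow> j < n \<Longrightarrow> i \<noteq> j \<Longrightarrow> c (i, j) \<in> carrier_mat n n"
  using GG_D(1)[OF c_G] .

lemma pow_rel:
  assumes "i < n" "j < n" "k < n" "i \<noteq> j" "j \<noteq> k" "i \<noteq> k"
  shows "c (i, j) ^\<^sub>m p * c (j, k) ^\<^sub>m q = c (i, k) ^\<^sub>m (p * q) * (c (j, k) ^\<^sub>m q * c (i, j) ^\<^sub>m p)"
proof -
  have g: "c (i, j) \<in> carrier G" "c (j, k) \<in> carrier G" "c (i, k) \<in> carrier G"
    using assms by (auto intro: c_G)
  have "c (i, j) [^]\<^bsub>G\<^esub> p \<otimes>\<^bsub>G\<^esub> c (j, k) [^]\<^bsub>G\<^esub> q =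
      c (i, k) [^]\<^bsub>G\<^esub> (p * q) \<otimes>\<^bsub>G\<^esub> (c (j, k) [^]\<^bsub>G\<^esub> q \<otimes>\<^bsub>G\<^esub> c (i, j) [^]\<^bsub>G\<^esub> p)"
  proof (rule GG.steinberg_pow[OF g])
    show "c (i, j) \<otimes>\<^bsub>G\<^esub> c (j, k) = c (i, k) \<otimes>\<^bsub>G\<^esub> (c (j, k) \<otimes>\<^bsub>G\<^esub> c (i, j))"
      unfolding GG_mult by (rule rel[OF assms])
    show "c (i, k) \<otimes>\<^bsub>G\<^esub> c (i, j) = c (i, j) \<otimes>\<^bsub>G\<^esub> c (i, k)"
      unfolding GG_mult by (rule comm) (use assms in simp_all)
    show "c (i, k) \<otimes>\<^bsub>G\<^esub> c (j, k) = c (j, k) \<otimes>\<^bsub>G\<^esub> c (i, k)"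
      unfolding GG_mult by (rule comm) (use assms in simp_all)
  qed
  then show ?thesis unfolding GG_pow[OF g(1)] GG_pow[OF g(2)] GG_pow[OF g(3)] GG_mult .
qed

lemma pow_comm:
  assumes "i < n" "j < n" "k < n" "l < n" "i \<noteq> j" "k \<noteq> l" "j \<noteq> k" "i \<noteq> l"
  shows "c (i, j) ^\<^sub>m p * c (k, l) ^\<^sub>m q = c (k, l) ^\<^sub>m q * c (i, j) ^\<^sub>m p"
proof -
  have g: "c (i, j) \<in> carrier G" "c (k, l) \<in> carrier G" using assms by (auto intro: c_G)
  have 1: "c (i, j) \<otimes>\<^bsub>G\<^esub> c (k, l) = c (k, l) \<otimes>\<^bsub>G\<^esub> c (i, j)"
    unfolding GG_mult by (rule comm[OF assms])
  have 2: "c (i, j) [^]\<^bsub>G\<^esub> p \<otimes>\<^bsub>G\<^esub> c (k, l) = c (k, l) \<otimes>\<^bsub>G\<^esub> c (i, j) [^]\<^bsub>G\<^esub> p"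
    by (rule GG.group_commutes_pow[OF 1 g])
  have "c (k, l) [^]\<^bsub>G\<^esub> q \<otimes>\<^bsub>G\<^esub> c (i, j) [^]\<^bsub>G\<^esub> p = c (i, j) [^]\<^bsub>G\<^esub> p \<otimes>\<^bsub>G\<^esub> c (k, l) [^]\<^bsub>G\<^esub> q"
    by (rule GG.group_commutes_pow[OF 2[symmetric]]) (use g in \<open>simp_all del: GG_mult GG_one\<close>)
  then show ?thesis unfolding GG_pow[OF g(1)] GG_pow[OF g(2)] GG_mult by (rule sym)
qed

text \<open>With a third index k, the element \<open>c (i, j)\<close> is a commutator of
  \<open>c (i, k)\<close> and \<open>c (k, j)\<close> and commutes with both.\<close>

lemma root_of_unity:
  assumes ij: "i < n" "j < n" "i \<noteq> j"
    and v: "v \<in> carrier_vec n" "v \<noteq> 0\<^sub>v n" "c (i, j) *\<^sub>v v = \<mu> \<cdot>\<^sub>v v"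
  shows "\<mu> ^ fact n = 1"
proof -
  obtain k where k: "k < n" "k \<noteq> i" "k \<noteq> j" using third_index[OF n3] by blast
  have d: "det (c (a, b)) \<noteq> 0" if "a < n" "b < n" "a \<noteq> b" for a b using GG_D(3)[OF c_G[OF that]] by simp
  show ?thesis
  proof (rule commutator_eigenvalue[where a = "c (i, k)" and b = "c (k, j)" and c = "c (i, j)"])
    show "c (i, k) * c (k, j) = c (i, j) * (c (k, j) * c (i, k))" by (rule rel) (use ij k in simp_all)
    show "c (i, j) * c (i, k) = c (i, k) * c (i, j)" by (rule comm) (use ij k in simp_all)
    show "c (i, j) * c (k, j) = c (k, j) * c (i, j)" by (rule comm) (use ij k in simp_all)
    show "c (i, k) \<in> carrier_mat n n" "c (k, j) \<in> carrier_mat n n" "c (i, j) \<in> carrier_mat n n"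
      using ij k by (auto intro: c_carrier)
    show "det (c (i, k)) \<noteq> 0" by (rule d) (use ij k in simp_all)
    show "det (c (k, j)) \<noteq> 0" by (rule d) (use ij k in simp_all)
    show "det (c (i, j)) \<noteq> 0" by (rule d[OF ij])
  qed (rule v)+
qed

text \<open>The permutation \<open>\<sigma>\<close> makes any order of the indices the standard one.
  With M = n!, the commutator of two M-th powers has exponent M times M, whence the power of
  \<open>T i k\<close> in the relation of an upper family.\<close>

lemma upper_family_perm:
  assumes \<sigma>: "\<And>i. i < n \<Longrightarrow> \<sigma> i < n" "inj_on \<sigma> {..<n}"
  shows "upper_family n (fact n) n (\<lambda>i j. c (\<sigma> i, \<sigma> j) ^\<^sub>m fact n)"
proof
  have ne: "\<sigma> i \<noteq> \<sigma> j" if "i < n" "j < n" "i \<noteq> j" for i j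
    using \<sigma>(2) that by (auto simp: inj_on_def)
  show "c (\<sigma> i, \<sigma> j) ^\<^sub>m fact n \<in> carrier_mat n n" if "i < j" "j < n" for i j
    using c_carrier[of "\<sigma> i" "\<sigma> j"] \<sigma>(1)[of i] \<sigma>(1)[of j] ne[of i j] that by simp
  show "c (\<sigma> i, \<sigma> j) ^\<^sub>m fact n * c (\<sigma> j, \<sigma> k) ^\<^sub>m fact n = (c (\<sigma> i, \<sigma> k) ^\<^sub>m fact n) ^\<^sub>m fact n *
      (c (\<sigma> j, \<sigma> k) ^\<^sub>m fact n * c (\<sigma> i, \<sigma> j) ^\<^sub>m fact n)" if ijk: "i < j" "j < k" "k < n" for i j k
  proof -
    have g: "c (\<sigma> i, \<sigma> k) \<in> carrier G" using c_G[of "\<sigma> i" "\<sigma> k"] \<sigma>(1)[of i] \<sigma>(1)[of k] ne[of i k] ijk by simp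
    have g': "c (\<sigma> i, \<sigma> k) ^\<^sub>m fact n \<in> carrier G"
      using GG.nat_pow_closed[OF g, of "fact n"] unfolding GG_pow[OF g] .
    have "(c (\<sigma> i, \<sigma> k) ^\<^sub>m fact n) ^\<^sub>m fact n = c (\<sigma> i, \<sigma> k) ^\<^sub>m (fact n * fact n)"
      using GG.nat_pow_pow[OF g, of "fact n" "fact n"] unfolding GG_pow[OF g] GG_pow[OF g'] .
    moreover have "c (\<sigma> i, \<sigma> j) ^\<^sub>m fact n * c (\<sigma> j, \<sigma> k) ^\<^sub>m fact n = c (\<sigma> i, \<sigma> k) ^\<^sub>m (fact n * fact n) *
      (c (\<sigma> j, \<sigma> k) ^\<^sub>m fact n * c (\<sigma> i, \<sigma> j) ^\<^sub>m fact n)"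
      by (rule pow_rel) (use ijk ne \<sigma>(1) in simp_all)
    ultimately show ?thesis by (simp only:)
  qed
  show "c (\<sigma> i, \<sigma> j) ^\<^sub>m fact n * c (\<sigma> k, \<sigma> l) ^\<^sub>m fact n = c (\<sigma> k, \<sigma> l) ^\<^sub>m fact n * c (\<sigma> i, \<sigma> j) ^\<^sub>m fact n"
    if "i < j" "j < n" "k < l" "l < n" "j \<noteq> k" "i \<noteq> l" for i j k l
    by (rule pow_comm) (use that ne \<sigma>(1) in simp_all)
  fix i j v \<mu>
  assume ij: "i < j" "j < n" and v: "v \<in> carrier_vec n" "v \<noteq> 0\<^sub>v n"
    "(c (\<sigma> i, \<sigma> j) ^\<^sub>m fact n) *\<^sub>v v = \<mu> \<cdot>\<^sub>v v"
  have s: "\<sigma> i < n" "\<sigma> j < n" "\<sigma> i \<noteq> \<sigma> j" using ij \<sigma>(1) ne by simp_all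
  show "\<mu> = 1"
    by (rule pow_eigenvalue[OF c_carrier[OF s] root_of_unity[OF s] v])
qed

text \<open>The power \<open>(n!)^k\<close> of the element in position
  \<open>(\<sigma> 0, \<sigma> k)\<close> is, in a triangularising basis, at filtration level k:
  each step to the next k takes a commutator with an n!-th power, which raises the level by one and
  multiplies the exponent by n!. At level n - 1 only the corner entry is left.\<close>

lemma rank_one_corner:
  assumes \<sigma>: "\<And>i. i < n \<Longrightarrow> \<sigma> i < n" "inj_on \<sigma> {..<n}"
  shows "\<exists>u \<phi>. (\<forall>r<n. \<forall>s<n. (c (\<sigma> 0, \<sigma> (n - 1)) ^\<^sub>m (fact n ^ (n - 1))) $$ (r, s) =
      (if r = s then 1 else 0) + u r * \<phi> s) \<and> (\<Sum>r<n. \<phi> r * u r) = 0"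
proof -
  have ne: "\<sigma> i \<noteq> \<sigma> j" if "i < n" "j < n" "i \<noteq> j" for i j
    using \<sigma>(2) that by (auto simp: inj_on_def)
  obtain P Q where P: "P \<in> carrier_mat n n" and Q: "Q \<in> carrier_mat n n"
    and PQ: "P * Q = 1\<^sub>m n" and QP: "Q * P = 1\<^sub>m n"
    and uni: "\<And>i j. i < j \<Longrightarrow> j < n \<Longrightarrow> unitri n (Q * c (\<sigma> i, \<sigma> j) ^\<^sub>m fact n * P)"
    using simultaneous_unitriangular[OF upper_family_perm[OF \<sigma>]] by blast
  define z where "z k = Q * c (\<sigma> 0, \<sigma> k) ^\<^sub>m (fact n ^ k) * P" for k
  have fil1: "fil n 1 A" if "unitri n A" for A
    using that by (auto simp: fil_def unitri_def less_Suc_eq_le)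
  have cc: "c (\<sigma> i, \<sigma> j) ^\<^sub>m k \<in> carrier_mat n n" if "i < n" "j < n" "i \<noteq> j" for i j k
    using c_carrier[of "\<sigma> i" "\<sigma> j"] \<sigma>(1)[of i] \<sigma>(1)[of j] ne[of i j] that by simp
  have zf: "fil n k (z k)" if "1 \<le> k" "k < n" for k
    using that
  proof (induction k rule: dec_induct)
    case base
    then show ?case unfolding z_def using fil1[OF uni[of 0 1]] by simp
  next
    case (step k)
    let ?y = "Q * c (\<sigma> k, \<sigma> (Suc k)) ^\<^sub>m fact n * P"
    have k: "1 \<le> k" "Suc k < n" "k < n" "0 < n" "k \<noteq> 0" using step by auto
    have "fil n (k + 1) (z (Suc k))"
    proof (rule fil_commutator[of n k "z k" 1 ?y])
      show "fil n k (z k)" by (rule step.IH) (use k in simp)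
      show "fil n 1 ?y" by (rule fil1[OF uni]) (use k in simp_all)
      have c1: "c (\<sigma> 0, \<sigma> k) ^\<^sub>m (fact n ^ k) \<in> carrier_mat n n" by (rule cc) (use k in simp_all)
      have c2: "c (\<sigma> k, \<sigma> (Suc k)) ^\<^sub>m fact n \<in> carrier_mat n n" by (rule cc) (use k in simp_all)
      have c3: "c (\<sigma> 0, \<sigma> (Suc k)) ^\<^sub>m (fact n ^ Suc k) \<in> carrier_mat n n" by (rule cc) (use k in simp_all)
      have c21: "c (\<sigma> k, \<sigma> (Suc k)) ^\<^sub>m fact n * c (\<sigma> 0, \<sigma> k) ^\<^sub>m (fact n ^ k) \<in> carrier_mat n n"
        by (rule mult_carrier_mat[OF c2 c1])
      show "z (Suc k) \<in> carrier_mat n n" unfolding z_def using Q P c3 by simp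
      have "c (\<sigma> 0, \<sigma> k) ^\<^sub>m (fact n ^ k) * c (\<sigma> k, \<sigma> (Suc k)) ^\<^sub>m fact n =
        c (\<sigma> 0, \<sigma> (Suc k)) ^\<^sub>m (fact n ^ k * fact n) *
        (c (\<sigma> k, \<sigma> (Suc k)) ^\<^sub>m fact n * c (\<sigma> 0, \<sigma> k) ^\<^sub>m (fact n ^ k))"
        by (rule pow_rel) (use k ne \<sigma>(1) in simp_all)
      then have e: "c (\<sigma> 0, \<sigma> k) ^\<^sub>m (fact n ^ k) * c (\<sigma> k, \<sigma> (Suc k)) ^\<^sub>m fact n =
        c (\<sigma> 0, \<sigma> (Suc k)) ^\<^sub>m (fact n ^ Suc k) *
        (c (\<sigma> k, \<sigma> (Suc k)) ^\<^sub>m fact n * c (\<sigma> 0, \<sigma> k) ^\<^sub>m (fact n ^ k))" by (simp only: power_Suc2)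
      show "z k * ?y = z (Suc k) * (?y * z k)"
        unfolding z_def conj_mult[OF P Q c1 c2 PQ] conj_mult[OF P Q c2 c1 PQ] conj_mult[OF P Q c3 c21 PQ] e ..
    qed (use k in simp_all)
    then show ?case by simp
  qed
  have n0: "0 < n" using n3 by simp
  define N where "N = n - 1"
  have N: "N < n" "N \<noteq> 0" "q < N \<or> q = N \<longleftrightarrow> q < n" for q using n3 unfolding N_def by auto
  let ?C = "c (\<sigma> 0, \<sigma> N) ^\<^sub>m (fact n ^ N)"
  have Cc: "?C \<in> carrier_mat n n" by (rule cc) (use N n3 in simp_all)
  have zN: "fil n N (z N)" by (rule zf) (use N in simp_all)
  have zc: "z N \<in> carrier_mat n n" using zN by (simp add: fil_def)
  \<comment> \<open>At level \<open>N = n - 1\<close> the position (0, N) is the only one whose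
    entry is not prescribed; conjugating back makes it a rank one matrix.\<close>
  define x where "x = z N $$ (0, N)"
  have zE: "z N $$ (p, q) = (if p = q then 1 else 0) + (if p = 0 \<and> q = N then x else 0)" if "p < n" "q < n" for p q
  proof (cases "q < p + N")
    case True
    then have "z N $$ (p, q) = (if p = q then 1 else 0)" using zN that by (simp add: fil_def)
    then show ?thesis using True that by auto
  next
    case False
    then have "p = 0" "q = N" using that N(3)[of q] by auto
    then show ?thesis using N by (simp add: x_def)
  qed
  have "P * z N * Q = P * (Q * (?C * P)) * Q"
    unfolding z_def using assoc_mult_mat[OF Q Cc P] by (simp only:)
  also have "\<dots> = ?C * P * Q"
    using cancel_left_mat[OF P Q PQ, of "?C * P" n] Cc P by simp
  also have "\<dots> = ?C * (P * Q)" by (rule assoc_mult_mat[OF Cc P Q])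
  also have "\<dots> = ?C" unfolding PQ by (rule right_mult_one_mat[OF Cc])
  finally have C: "?C = P * z N * Q" by (rule sym)
  have "?C $$ (r, s) = (if r = s then 1 else 0) + (P $$ (r, 0) * x) * Q $$ (N, s)" if rs: "r < n" "s < n" for r s
  proof -
    have Pz: "(P * z N) $$ (r, q) = P $$ (r, q) + (if q = N then P $$ (r, 0) * x else 0)" if q: "q < n" for q
    proof -
      have "(P * z N) $$ (r, q) = (\<Sum>p<n. (if p = q then P $$ (r, q) else 0) +
        (if p = 0 then if q = N then P $$ (r, 0) * x else 0 else 0))"
        unfolding mat_mult_index[OF P zc rs(1) q]
        by (intro sum.cong) (use q N(1,2) in \<open>auto simp: zE algebra_simps\<close>)
      then show ?thesis using q N(1) by (simp add: sum.distrib)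
    qed
    have Pzc: "P * z N \<in> carrier_mat n n" using P zc by simp
    have "?C $$ (r, s) = (\<Sum>q<n. P $$ (r, q) * Q $$ (q, s) + (if q = N then P $$ (r, 0) * x * Q $$ (N, s) else 0))"
      unfolding C mat_mult_index[OF Pzc Q rs] by (intro sum.cong) (auto simp: Pz algebra_simps)
    also have "\<dots> = (P * Q) $$ (r, s) + (P $$ (r, 0) * x) * Q $$ (N, s)"
      unfolding mat_mult_index[OF P Q rs] using N(1) by (simp add: sum.distrib)
    finally show ?thesis unfolding PQ using rs by simp
  qed
  moreover have "(\<Sum>r<n. Q $$ (N, r) * (P $$ (r, 0) * x)) = 0"
  proof -
    have "(\<Sum>r<n. Q $$ (N, r) * (P $$ (r, 0) * x)) = (Q * P) $$ (N, 0) * x"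
      unfolding mat_mult_index[OF Q P N(1) n0] by (simp add: sum_distrib_right mult.assoc)
    then show ?thesis unfolding QP using N n3 by simp
  qed
  ultimately show ?thesis unfolding N_def[symmetric]
    by (intro exI[of _ "\<lambda>r. P $$ (r, 0) * x"] exI[of _ "\<lambda>s. Q $$ (N, s)"] conjI allI impI)
qed

text \<open>Two transpositions give a permutation with 0 going to i and n - 1 going to j, so that
  (i, j) becomes the corner of some index order.\<close>

lemma rank_one:
  assumes ij: "i < n" "j < n" "i \<noteq> j"
  shows "\<exists>u \<phi>. (\<forall>r<n. \<forall>s<n. (c (i, j) ^\<^sub>m (fact n ^ (n - 1))) $$ (r, s) =
      (if r = s then 1 else 0) + u r * \<phi> s) \<and> (\<Sum>r<n. \<phi> r * u r) = 0"
proof -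
  define \<tau> where "\<tau> = transpose 0 i"
  define \<sigma> where "\<sigma> k = \<tau> (transpose (n - 1) (\<tau> j) k)" for k
  have \<tau>n: "\<tau> k < n" if "k < n" for k using ij that unfolding \<tau>_def transpose_def by presburger
  have \<tau>j: "\<tau> j \<noteq> 0" using ij unfolding \<tau>_def transpose_def by presburger
  have \<tau>\<tau>: "\<tau> (\<tau> j) = j" unfolding \<tau>_def by (rule transpose_involutory)
  have n0: "n - 1 \<noteq> 0" "n - 1 < n" using n3 by simp_all
  have s1: "\<sigma> k < n" if k: "k < n" for k
  proof -
    have "transpose (n - 1) (\<tau> j) k < n" using k \<tau>n[OF ij(2)] n0 unfolding transpose_def by presburger
    then show ?thesis unfolding \<sigma>_def by (rule \<tau>n)
  qed
  have s2: "inj_on \<sigma> {..<n}"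
  proof (rule inj_onI)
    fix a b assume "\<sigma> a = \<sigma> b"
    then have "transpose (n - 1) (\<tau> j) a = transpose (n - 1) (\<tau> j) b"
      unfolding \<sigma>_def \<tau>_def by (rule injD[OF inj_transpose])
    then show "a = b" by (rule injD[OF inj_transpose])
  qed
  have s3: "\<sigma> 0 = i" using n0 \<tau>j unfolding \<sigma>_def by (simp add: transpose_def) (simp add: \<tau>_def)
  have s4: "\<sigma> (n - 1) = j" unfolding \<sigma>_def transpose_apply_first by (rule \<tau>\<tau>)
  show ?thesis by (rule rank_one_corner[OF s1 s2, unfolded s3 s4])
qed

end

section \<open>Rank one perturbations of the unit matrix and centralisers of elementary
  matrices\<close>

lemma outer_mult:
  assumes A: "A \<in> carrier_mat n n" and B: "B \<in> carrier_mat n n"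
    and a: "\<And>r s. r < n \<Longrightarrow> s < n \<Longrightarrow> A $$ (r, s) = (if r = s then 1 else 0) + a r * (b s :: complex)"
    and b: "\<And>r s. r < n \<Longrightarrow> s < n \<Longrightarrow> B $$ (r, s) = (if r = s then 1 else 0) + a' r * b' s"
    and rs: "r < n" "s < n"
  shows "(A * B) $$ (r, s) = (if r = s then 1 else 0) + a r * b s + a' r * b' s + a r * (\<Sum>q<n. b q * a' q) * b' s"
proof -
  have "(A * B) $$ (r, s) = (\<Sum>q<n. (if q = r then (if r = s then 1 else 0) + a' r * b' s else 0) +
      (if q = s then a r * b s else 0) + a r * (b q * a' q) * b' s)"
    unfolding mat_mult_index[OF A B rs] using rs
    by (intro sum.cong) (auto simp: a b algebra_simps)
  also have "\<dots> = (if r = s then 1 else 0) + a' r * b' s + a r * b s + (\<Sum>q<n. a r * (b q * a' q) * b' s)"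
    using rs by (simp add: sum.distrib)
  also have "(\<Sum>q<n. a r * (b q * a' q) * b' s) = a r * (\<Sum>q<n. b q * a' q) * b' s"
    by (simp add: sum_distrib_left sum_distrib_right)
  finally show ?thesis by (simp add: algebra_simps)
qed

lemma outer_pow:
  assumes A: "A \<in> carrier_mat n n"
    and a: "\<And>r s. r < n \<Longrightarrow> s < n \<Longrightarrow> A $$ (r, s) = (if r = s then 1 else 0) + a r * (b s :: complex)"
    and ba: "(\<Sum>q<n. b q * a q) = 0"
  shows "r < n \<Longrightarrow> s < n \<Longrightarrow> (A ^\<^sub>m k) $$ (r, s) = (if r = s then 1 else 0) + of_nat k * a r * b s"
proof (induction k arbitrary: r s)
  case 0
  then show ?case using A by simp
next
  case (Suc k)
  have Ak: "A ^\<^sub>m k \<in> carrier_mat n n" using A by simp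
  have "(A ^\<^sub>m Suc k) $$ (r, s) = (if r = s then 1 else 0) + of_nat k * a r * b s + a r * b s +
      of_nat k * a r * (\<Sum>q<n. b q * a q) * b s"
    unfolding pow_mat.simps
    by (rule outer_mult[OF Ak A]) (use Suc a in simp_all)
  then show ?case unfolding ba by (simp add: algebra_simps)
qed

text \<open>Applying the covector b to the equation of rank one matrices kills the left side because
  ba = 0. If x were not zero, this would give y = 0, and then the left side itself, a non-zero
  matrix, would be zero.\<close>

lemma outer_commute:
  assumes comm: "\<And>r s. r < n \<Longrightarrow> s < n \<Longrightarrow> a r * x * b' s = a' r * y * (b s :: complex)"
    and x: "(\<Sum>q<n. b q * a' q) = x" and y: "(\<Sum>q<n. b' q * a q) = y" and ba: "(\<Sum>q<n. b q * a q) = 0"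
    and nz: "\<exists>r<n. a r \<noteq> 0" "\<exists>r<n. b r \<noteq> 0" "\<exists>r<n. a' r \<noteq> 0" "\<exists>r<n. b' r \<noteq> 0"
  shows "x = 0"
proof (rule ccontr)
  assume x0: "x \<noteq> 0"
  obtain s where s: "s < n" "b s \<noteq> 0" using nz(2) by blast
  have "(\<Sum>r<n. b r * (a r * x * b' s)) = (\<Sum>r<n. b r * (a' r * y * b s))"
    using comm s by (intro sum.cong) simp_all
  moreover have "(\<Sum>r<n. b r * (a r * x * b' s)) = (\<Sum>q<n. b q * a q) * (x * b' s)"
    by (simp add: sum_distrib_left sum_distrib_right mult_ac)
  moreover have "(\<Sum>r<n. b r * (a' r * y * b s)) = (\<Sum>q<n. b q * a' q) * (y * b s)"
    by (simp add: sum_distrib_left sum_distrib_right mult_ac)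
  ultimately have "y = 0" using ba x x0 s by simp
  obtain p q where "p < n" "a p \<noteq> 0" "q < n" "b' q \<noteq> 0" using nz(1,4) by blast
  then show False using comm[of p q] x0 \<open>y = 0\<close> by simp
qed

lemma em_commutant_entries:
  assumes D: "D \<in> carrier_mat n n" and kl: "k < n" "l < n" and b: "b \<noteq> 0"
    and eq: "D * em n k l b = em n k l b * D"
  shows "r < n \<Longrightarrow> r \<noteq> k \<Longrightarrow> D $$ (r, k) = 0" "s < n \<Longrightarrow> s \<noteq> l \<Longrightarrow> D $$ (l, s) = 0" "D $$ (k, k) = D $$ (l, l)"
proof -
  have e: "(if s = l then D $$ (r, k) * b else 0) = (if r = k then b * D $$ (l, s) else 0)" if "r < n" "s < n" for r s
    using mult_em[OF D kl that, of b] em_mult[OF D kl that, of b] eq by simp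
  show "D $$ (r, k) = 0" if "r < n" "r \<noteq> k" using e[OF that(1) kl(2)] that b by simp
  show "D $$ (l, s) = 0" if "s < n" "s \<noteq> l" using e[OF kl(1) that(1)] that b by simp
  show "D $$ (k, k) = D $$ (l, l)" using e[OF kl] b by simp
qed

text \<open>Commuting with position (k, l) clears column k and row l away from the diagonal and
  equates two diagonal entries. Over all permitted (k, l) only the entry (i, j) escapes, and the
  diagonal becomes constant.\<close>

lemma em_commutant:
  assumes n: "3 \<le> n" and D: "D \<in> carrier_mat n n" and ij: "i < n" "j < n" "i \<noteq> j" and b: "b \<noteq> 0"
    and comm: "\<And>k l. k < n \<Longrightarrow> l < n \<Longrightarrow> k \<noteq> l \<Longrightarrow> k \<noteq> j \<Longrightarrow> l \<noteq> i \<Longrightarrow> D * em n k l b = em n k l b * D"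
    and rs: "r < n" "s < n"
  shows "D $$ (r, s) = (if r = s then D $$ (0, 0) else 0) + (if r = i \<and> s = j then D $$ (i, j) else 0)"
proof (cases "r = s")
  case True
  have "D $$ (p, p) = D $$ (q, q)" if "p < n" "q < n" "p \<noteq> q" "p \<noteq> j" "q \<noteq> i" for p q
    by (rule em_commutant_entries(3)[OF D that(1,2) b comm]) (use that in simp_all)
  then have "D $$ (r, r) = D $$ (0, 0)" using ij rs n by (cases "r = 0") (metis gr_implies_not0 not_gr_zero)+
  then show ?thesis using True ij by auto
next
  case False
  have "D $$ (r, s) = 0" if "s \<noteq> j \<or> r \<noteq> i"
  proof (cases "s \<noteq> j")
    case True
    obtain l where l: "l < n" "l \<noteq> s" "l \<noteq> i" using third_index[OF n] by blast
    show ?thesis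
      by (rule em_commutant_entries(1)[OF D rs(2) l(1) b comm]) (use l True rs False in simp_all)
  next
    case False
    then have ri: "r \<noteq> i" using that by blast
    obtain k where k: "k < n" "k \<noteq> r" "k \<noteq> j" using third_index[OF n] by blast
    show ?thesis
      by (rule em_commutant_entries(2)[OF D k(1) rs(1) b comm]) (use k ri rs \<open>r \<noteq> s\<close> in simp_all)
  qed
  then show ?thesis using False by auto
qed

text \<open>The off-diagonal entry of the k-th power is \<open>k \<alpha>^(k-1) \<beta>\<close>;
  multiplying by \<open>\<alpha>\<close> avoids the truncated exponent at k = 0.\<close>

lemma scalar_em_pow:
  assumes D: "D \<in> carrier_mat n n" and ij: "i < n" "j < n" "i \<noteq> j"
    and d: "\<And>r s. r < n \<Longrightarrow> s < n \<Longrightarrow> D $$ (r, s) = (if r = s then \<alpha> else 0) + (if r = i \<and> s = j then \<beta> else (0::complex))"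
  shows "\<exists>\<gamma>. \<alpha> * \<gamma> = of_nat k * \<alpha> ^ k * \<beta> \<and> (\<forall>r<n. \<forall>s<n. (D ^\<^sub>m k) $$ (r, s) =
    (if r = s then \<alpha> ^ k else 0) + (if r = i \<and> s = j then \<gamma> else 0))"
proof (induction k)
  case 0
  then show ?case using D by (intro exI[of _ 0]) auto
next
  case (Suc k)
  then obtain \<gamma> where g: "\<alpha> * \<gamma> = of_nat k * \<alpha> ^ k * \<beta>"
    and e: "\<forall>r<n. \<forall>s<n. (D ^\<^sub>m k) $$ (r, s) = (if r = s then \<alpha> ^ k else 0) + (if r = i \<and> s = j then \<gamma> else 0)"
    by blast
  have Dk: "D ^\<^sub>m k \<in> carrier_mat n n" using D by simp
  have "(D ^\<^sub>m Suc k) $$ (r, s) = (if r = s then \<alpha> ^ Suc k else 0) + (if r = i \<and> s = j then \<alpha> ^ k * \<beta> + \<gamma> * \<alpha> else 0)"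
    if rs: "r < n" "s < n" for r s
  proof -
    have "(D ^\<^sub>m Suc k) $$ (r, s) = (\<Sum>q<n. (if q = s then if r = s then \<alpha> ^ Suc k else 0 else 0) +
        (if q = i then if r = i \<and> s = j then \<alpha> ^ k * \<beta> else 0 else 0) +
        (if q = j then if r = i \<and> s = j then \<gamma> * \<alpha> else 0 else 0))"
      unfolding pow_mat.simps mat_mult_index[OF Dk D rs] using rs ij e
      by (intro sum.cong) (auto simp: d)
    then show ?thesis using rs ij by (simp add: sum.distrib)
  qed
  moreover have "\<alpha> * (\<alpha> ^ k * \<beta> + \<gamma> * \<alpha>) = of_nat (Suc k) * \<alpha> ^ Suc k * \<beta>"
    using arg_cong[OF g, of "\<lambda>x. \<alpha> * x"] by (simp add: algebra_simps)
  ultimately show ?case by blast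
qed

context complex_subring
begin

definition conj_iso :: "complex mat \<Rightarrow> complex mat \<Rightarrow> complex mat \<Rightarrow> complex mat" where
  "conj_iso P Q g = P * g * Q"

text \<open>\<open>F\<^sub>i\<^sub>j = P E\<^sub>i\<^sub>j Q\<close> has entries in \<open>S\<close>, and so have \<open>P g Q\<close>, a combination of the
  \<open>F\<^sub>i\<^sub>j\<close>, and \<open>Q g P\<close>, whose entries are the traces of the \<open>F\<^sub>j\<^sub>i g\<close>.\<close>

lemma conj_iso:
  assumes P: "P \<in> carrier_mat n n" and Q: "Q \<in> carrier_mat n n" and PQ: "P * Q = 1\<^sub>m n" and QP: "Q * P = 1\<^sub>m n"
    and F: "\<And>i j r s. i < n \<Longrightarrow> j < n \<Longrightarrow> r < n \<Longrightarrow> s < n \<Longrightarrow> P $$ (r, i) * Q $$ (j, s) \<in> S"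
  shows "conj_iso P Q \<in> iso G G"
proof -
  have dPQ: "det P * det Q = 1" using det_mult[OF P Q] PQ by simp
  have closed: "A * g * B \<in> carrier G"
    if A: "A \<in> carrier_mat n n" and B: "B \<in> carrier_mat n n" and d: "det A * det B = 1" and g: "g \<in> carrier G"
      and f: "\<And>i j r s. i < n \<Longrightarrow> j < n \<Longrightarrow> r < n \<Longrightarrow> s < n \<Longrightarrow> A $$ (r, i) * B $$ (j, s) \<in> S" for A B g
  proof (rule GG_I)
    note g' = GG_D[OF g]
    have Ag: "A * g \<in> carrier_mat n n" using A g' by simp
    show "A * g * B \<in> carrier_mat n n" using Ag B by simp
    show "det (A * g * B) = 1" using det_mult[OF Ag B] det_mult[OF A g'(1)] g'(3) d by simp
    fix r s assume rs: "r < n" "s < n"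
    have "(A * g * B) $$ (r, s) = (\<Sum>q<n. \<Sum>p<n. g $$ (p, q) * (A $$ (r, p) * B $$ (q, s)))"
      unfolding mat_mult_index[OF Ag B rs]
      by (intro sum.cong) (use rs in \<open>simp_all add: mat_mult_index[OF A g'(1)] sum_distrib_left mult_ac del: index_mult_mat\<close>)
    also have "\<dots> \<in> S" by (intro sum_S mult_S[OF g'(2)] f) (use rs in simp_all)
    finally show "(A * g * B) $$ (r, s) \<in> S" .
  qed
  have m1: "P * g * Q \<in> carrier G" if "g \<in> carrier G" for g
    by (rule closed[OF P Q dPQ that F])
  have m2: "Q * g * P \<in> carrier G" if "g \<in> carrier G" for g
    by (rule closed[OF Q P _ that]) (use dPQ F in \<open>simp_all add: mult.commute\<close>)
  have inv1: "Q * (P * g * Q) * P = g" if g: "g \<in> carrier_mat n n" for g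
  proof -
    have "Q * (P * g * Q) * P = Q * (P * (g * Q)) * P" using assoc_mult_mat[OF P g Q] by simp
    also have "\<dots> = g * Q * P" using cancel_left_mat[OF Q P QP, of "g * Q" n] g Q by simp
    also have "\<dots> = g" using assoc_mult_mat[OF g Q P] QP g by simp
    finally show ?thesis .
  qed
  have inv2: "P * (Q * g * P) * Q = g" if g: "g \<in> carrier_mat n n" for g
  proof -
    have "P * (Q * g * P) * Q = P * (Q * (g * P)) * Q" using assoc_mult_mat[OF Q g P] by simp
    also have "\<dots> = g * P * Q" using cancel_left_mat[OF P Q PQ, of "g * P" n] g P by simp
    also have "\<dots> = g" using assoc_mult_mat[OF g P Q] PQ g by simp
    finally show ?thesis .
  qed
  show ?thesis
  proof (rule isoI)
    show "conj_iso P Q \<in> hom G G"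
    proof (rule homI)
      show "conj_iso P Q g \<in> carrier G" if "g \<in> carrier G" for g unfolding conj_iso_def by (rule m1[OF that])
      show "conj_iso P Q (g \<otimes>\<^bsub>G\<^esub> h) = conj_iso P Q g \<otimes>\<^bsub>G\<^esub> conj_iso P Q h"
        if "g \<in> carrier G" "h \<in> carrier G" for g h
        unfolding conj_iso_def GG_mult
        by (rule conj_mult[OF Q P GG_D(1)[OF that(1)] GG_D(1)[OF that(2)] QP, symmetric])
    qed
    show "bij_betw (conj_iso P Q) (carrier G) (carrier G)"
      by (rule bij_betw_byWitness[where f' = "\<lambda>g. Q * g * P"])
        (use m1 m2 inv1[OF GG_D(1)] inv2[OF GG_D(1)] in \<open>auto simp: conj_iso_def\<close>)
  qed
qed

end

section \<open>The transvections obtained from Steinberg elements and their simultaneous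
  conjugation\<close>

context steinberg_elements
begin

definition L :: nat where "L = fact n ^ (n - 1)"

lemma L_pos: "0 < L"
  by (simp add: L_def)

text \<open>\<open>u i j\<close> and \<open>\<phi> i j\<close> describe the transvection \<open>c (i, j) ^ L\<close>.\<close>

definition trans_data :: "(nat \<Rightarrow> nat \<Rightarrow> nat \<Rightarrow> complex) \<Rightarrow> (nat \<Rightarrow> nat \<Rightarrow> nat \<Rightarrow> complex) \<Rightarrow> bool" where
  "trans_data u \<phi> \<longleftrightarrow> (\<forall>i j. i < n \<longrightarrow> j < n \<longrightarrow> i \<noteq> j \<longrightarrow>
    (\<forall>r<n. \<forall>s<n. (c (i, j) ^\<^sub>m L) $$ (r, s) = (if r = s then 1 else 0) + u i j r * \<phi> i j s) \<and>
    (\<Sum>r<n. \<phi> i j r * u i j r) = 0)"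

lemma trans_data_exists: "\<exists>u \<phi>. trans_data u \<phi>"
proof -
  define Pr :: "nat \<Rightarrow> nat \<Rightarrow> (nat \<Rightarrow> complex) \<times> (nat \<Rightarrow> complex) \<Rightarrow> bool" where
    "Pr i j p \<longleftrightarrow> (\<forall>r<n. \<forall>s<n. (c (i, j) ^\<^sub>m L) $$ (r, s) = (if r = s then 1 else 0) + fst p r * snd p s) \<and>
      (\<Sum>r<n. snd p r * fst p r) = 0" for i j p
  define sel where "sel i j = (SOME p. Pr i j p)" for i j
  have sel: "Pr i j (sel i j)" if ij: "i < n" "j < n" "i \<noteq> j" for i j
  proof -
    obtain u \<phi> where *: "(\<forall>r<n. \<forall>s<n. (c (i, j) ^\<^sub>m L) $$ (r, s) =
      (if r = s then 1 else 0) + u r * \<phi> s) \<and> (\<Sum>r<n. \<phi> r * u r) = 0"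
      using rank_one[OF ij, folded L_def] by (elim exE)
    have "Pr i j (u, \<phi>)" unfolding Pr_def fst_conv snd_conv by (rule *)
    then show ?thesis unfolding sel_def by (rule someI)
  qed
  have "trans_data (\<lambda>i j. fst (sel i j)) (\<lambda>i j. snd (sel i j))"
    unfolding trans_data_def by (intro allI impI, rule sel[unfolded Pr_def])
  then show ?thesis by (intro exI)
qed

context
  fixes u \<phi> assumes td: "trans_data u \<phi>"
begin

lemma td_entry: "i < n \<Longrightarrow> j < n \<Longrightarrow> i \<noteq> j \<Longrightarrow> r < n \<Longrightarrow> s < n \<Longrightarrow>
    (c (i, j) ^\<^sub>m L) $$ (r, s) = (if r = s then 1 else 0) + u i j r * \<phi> i j s"
  by (rule td[unfolded trans_data_def, THEN spec, THEN spec, THEN mp, THEN mp, THEN mp, THEN conjunct1,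
      THEN spec, THEN mp, THEN spec, THEN mp])

lemma td_orth: "i < n \<Longrightarrow> j < n \<Longrightarrow> i \<noteq> j \<Longrightarrow> (\<Sum>r<n. \<phi> i j r * u i j r) = 0"
  by (rule td[unfolded trans_data_def, THEN spec, THEN spec, THEN mp, THEN mp, THEN mp, THEN conjunct2])

lemma tc: "i < n \<Longrightarrow> j < n \<Longrightarrow> i \<noteq> j \<Longrightarrow> c (i, j) ^\<^sub>m k \<in> carrier_mat n n"
  using c_carrier by simp

lemma td_nonzero:
  assumes ij: "i < n" "j < n" "i \<noteq> j"
  shows "\<exists>r<n. u i j r \<noteq> 0" "\<exists>r<n. \<phi> i j r \<noteq> 0"
proof -
  have "\<exists>r<n. \<exists>s<n. u i j r * \<phi> i j s \<noteq> 0"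
  proof (rule ccontr)
    assume *: "\<not> (\<exists>r<n. \<exists>s<n. u i j r * \<phi> i j s \<noteq> 0)"
    have "c (i, j) ^\<^sub>m L = 1\<^sub>m n"
    proof (rule eq_matI)
      fix r s assume "r < dim_row (1\<^sub>m n :: complex mat)" "s < dim_col (1\<^sub>m n :: complex mat)"
      then have rs: "r < n" "s < n" by simp_all
      then have "u i j r * \<phi> i j s = 0" using * by blast
      then show "(c (i, j) ^\<^sub>m L) $$ (r, s) = 1\<^sub>m n $$ (r, s)" unfolding td_entry[OF ij rs] using rs by simp
    qed (use tc[OF ij, of L] in auto)
    then show False using nontriv[OF ij, folded L_def] by blast
  qed
  then show "\<exists>r<n. u i j r \<noteq> 0" "\<exists>r<n. \<phi> i j r \<noteq> 0" by auto
qed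

lemma td_mult:
  assumes ij: "i < n" "j < n" "i \<noteq> j" and kl: "k < n" "l < n" "k \<noteq> l" and rs: "r < n" "s < n"
  shows "(c (i, j) ^\<^sub>m L * c (k, l) ^\<^sub>m L) $$ (r, s) = (if r = s then 1 else 0) + u i j r * \<phi> i j s +
    u k l r * \<phi> k l s + u i j r * (\<Sum>q<n. \<phi> i j q * u k l q) * \<phi> k l s"
  by (rule outer_mult[OF tc[OF ij] tc[OF kl] td_entry[OF ij] td_entry[OF kl] rs])

lemma td_dot_zero:
  assumes "i < n" "j < n" "k < n" "l < n" "i \<noteq> j" "k \<noteq> l" "j \<noteq> k" "i \<noteq> l"
  shows "(\<Sum>r<n. \<phi> i j r * u k l r) = 0"
proof (rule outer_commute[where a = "u i j" and b = "\<phi> i j" and a' = "u k l" and b' = "\<phi> k l"])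
  fix r s assume rs: "r < n" "s < n"
  have "(c (i, j) ^\<^sub>m L * c (k, l) ^\<^sub>m L) $$ (r, s) = (c (k, l) ^\<^sub>m L * c (i, j) ^\<^sub>m L) $$ (r, s)"
    unfolding pow_comm[OF assms] ..
  then show "u i j r * (\<Sum>r<n. \<phi> i j r * u k l r) * \<phi> k l s = u k l r * (\<Sum>r<n. \<phi> k l r * u i j r) * \<phi> i j s"
    unfolding td_mult[OF assms(1,2,5,3,4,6) rs] td_mult[OF assms(3,4,6,1,2,5) rs]
    by (simp add: algebra_simps)
qed (use td_orth[OF assms(1,2,5)] td_nonzero[OF assms(1,2,5)] td_nonzero[OF assms(3,4,6)] in simp_all)

text \<open>The exponent rule gives \<open>c (i, k)\<close> to the power L times L, which is 1 + L u
  \<phi> for the vector and covector of (i, k). That covector is orthogonal to both other vectors,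
  so on the product of the two transvections it acts as on the unit matrix.\<close>

lemma td_tri:
  assumes ijk: "i < n" "j < n" "k < n" "i \<noteq> j" "j \<noteq> k" "i \<noteq> k" and rs: "r < n" "s < n"
  shows "u i j r * (\<Sum>q<n. \<phi> i j q * u j k q) * \<phi> j k s - u j k r * (\<Sum>q<n. \<phi> j k q * u i j q) * \<phi> i j s =
      of_nat L * (u i k r * \<phi> i k s)"
proof -
  let ?A = "c (i, j) ^\<^sub>m L" and ?B = "c (j, k) ^\<^sub>m L" and ?C = "c (i, k) ^\<^sub>m (L * L)"
  have cs: "?A \<in> carrier_mat n n" "?B \<in> carrier_mat n n" "?C \<in> carrier_mat n n" using tc ijk by simp_all
  have BA: "?B * ?A \<in> carrier_mat n n" using cs by simp
  have g: "c (i, k) \<in> carrier G" by (rule c_G) (use ijk in simp_all)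
  have g': "c (i, k) ^\<^sub>m L \<in> carrier G" using GG.nat_pow_closed[OF g, of L] unfolding GG_pow[OF g] .
  have "?C = (c (i, k) ^\<^sub>m L) ^\<^sub>m L"
    using GG.nat_pow_pow[OF g, of L L] unfolding GG_pow[OF g] GG_pow[OF g'] by (rule sym)
  then have C: "?C $$ (p, q) = (if p = q then 1 else 0) + of_nat L * u i k p * \<phi> i k q" if "p < n" "q < n" for p q
    using outer_pow[OF tc[OF ijk(1,3,6), of L] td_entry[OF ijk(1,3,6)] td_orth[OF ijk(1,3,6)] that, of L] by simp
  note AB = td_mult[OF ijk(1,2,4) ijk(2,3,5)]
  note BAe = td_mult[OF ijk(2,3,5) ijk(1,2,4)]
  have z: "(\<Sum>q<n. \<phi> i k q * u j k q) = 0" "(\<Sum>q<n. \<phi> i k q * u i j q) = 0"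
    using ijk by (auto intro!: td_dot_zero)
  have "(?C * (?B * ?A)) $$ (r, s) = (\<Sum>q<n. (if q = r then (?B * ?A) $$ (r, s) else 0) +
      of_nat L * u i k r * (\<phi> i k q * (?B * ?A) $$ (q, s)))"
    unfolding mat_mult_index[OF cs(3) BA rs]
    by (intro sum.cong) (use rs in \<open>simp_all add: C algebra_simps del: index_mult_mat\<close>)
  also have "\<dots> = (?B * ?A) $$ (r, s) + of_nat L * u i k r * (\<Sum>q<n. \<phi> i k q * (?B * ?A) $$ (q, s))"
    using rs by (simp add: sum.distrib sum_distrib_left del: index_mult_mat)
  also have "(\<Sum>q<n. \<phi> i k q * (?B * ?A) $$ (q, s)) = (\<Sum>q<n. (if q = s then \<phi> i k s else 0) +
      \<phi> i k q * u j k q * \<phi> j k s + \<phi> i k q * u i j q * \<phi> i j s +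
      \<phi> i k q * u j k q * ((\<Sum>q<n. \<phi> j k q * u i j q) * \<phi> i j s))"
    by (intro sum.cong) (use rs in \<open>simp_all add: BAe algebra_simps del: index_mult_mat\<close>)
  also have "\<dots> = \<phi> i k s"
    using rs z by (simp add: sum.distrib sum_distrib_right[symmetric])
  finally have "(?A * ?B) $$ (r, s) = (?B * ?A) $$ (r, s) + of_nat L * u i k r * \<phi> i k s"
    unfolding pow_rel[OF ijk] .
  then show ?thesis unfolding AB[OF rs] BAe[OF rs] by (simp add: algebra_simps)
qed

lemma rank_one_family: "rank_one_family n (of_nat L) u \<phi>"
proof
  show "3 \<le> n" by (rule n3)
  show "of_nat L \<noteq> (0::complex)" using L_pos by simp
qed (erule td_nonzero td_dot_zero td_tri; assumption)+

text \<open>The matrix units of the transvections conjugate \<open>c\<close> into the standard elements.\<close>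

lemma conjugate_standard:
  assumes A: "(\<Sum>r<n. \<phi> 0 1 r * u 1 2 r) \<noteq> 0"
  shows "\<exists>f\<in>iso G G. \<forall>i<n. \<forall>j<n. i \<noteq> j \<longrightarrow> f (em n i j 1) = c (i, j)"
proof -
  interpret R: rank_one_family n "of_nat L" u \<phi> by (rule rank_one_family)
  have "R.typeA 0 1 2" using A n3 by (simp add: R.typeA_def R.dot_def)
  then obtain P0 Q0 where QP0: "\<forall>j<n. \<forall>k<n. (\<Sum>r<n. Q0 j r * P0 r k) = (if j = k then 1 else 0)"
    and u0: "\<forall>i<n. \<forall>j<n. i \<noteq> j \<longrightarrow> (\<forall>r<n. \<forall>s<n. u i j r * \<phi> i j s = of_nat L * (P0 r i * Q0 j s))"
    using R.matrix_units by blast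
  define P where "P = mat n n (\<lambda>(r, k). P0 r k)"
  define Q where "Q = mat n n (\<lambda>(j, s). Q0 j s)"
  have P: "P \<in> carrier_mat n n" and Q: "Q \<in> carrier_mat n n" by (simp_all add: P_def Q_def)
  have QP: "Q * P = 1\<^sub>m n"
  proof (rule eq_matI)
    fix j k assume "j < dim_row (1\<^sub>m n :: complex mat)" "k < dim_col (1\<^sub>m n :: complex mat)"
    then have jk: "j < n" "k < n" by simp_all
    have "(Q * P) $$ (j, k) = (\<Sum>r<n. Q0 j r * P0 r k)"
      unfolding mat_mult_index[OF Q P jk] by (intro sum.cong) (use jk in \<open>simp_all add: P_def Q_def\<close>)
    then show "(Q * P) $$ (j, k) = 1\<^sub>m n $$ (j, k)" using QP0 jk by simp
  qed (use P Q in auto)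
  have PQ: "P * Q = 1\<^sub>m n" by (rule mat_mult_left_right_inverse[OF Q P QP])
  have Lnz: "of_nat L \<noteq> (0::complex)" using L_pos by simp
  \<comment> \<open>Being equal to 1 plus L times a matrix unit in the basis \<open>P\<close>, the
    transvection becomes an elementary matrix there.\<close>
  have tP: "c (k, l) ^\<^sub>m L * P = P * em n k l (of_nat L)" if kl: "k < n" "l < n" "k \<noteq> l" for k l
  proof (rule eq_matI)
    fix r s assume "r < dim_row (P * em n k l (of_nat L))" "s < dim_col (P * em n k l (of_nat L))"
    then have rs: "r < n" "s < n" using P by (simp_all add: em_def)
    have t: "(c (k, l) ^\<^sub>m L) $$ (r, q) = (if r = q then 1 else 0) + of_nat L * (P $$ (r, k) * Q $$ (l, q))" if "q < n" for q
      using td_entry[OF kl rs(1) that] u0 kl rs that by (simp add: P_def Q_def)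
    have "(c (k, l) ^\<^sub>m L * P) $$ (r, s) = (\<Sum>q<n. (if q = r then P $$ (r, s) else 0) +
        of_nat L * P $$ (r, k) * (Q $$ (l, q) * P $$ (q, s)))"
      unfolding mat_mult_index[OF tc[OF kl] P rs] by (intro sum.cong) (simp_all add: t algebra_simps)
    also have "\<dots> = P $$ (r, s) + of_nat L * P $$ (r, k) * (Q * P) $$ (l, s)"
      unfolding mat_mult_index[OF Q P kl(2) rs(2)] using rs by (simp add: sum.distrib sum_distrib_left)
    also have "\<dots> = (P * em n k l (of_nat L)) $$ (r, s)"
      unfolding mult_em[OF P kl(1,2) rs] QP using kl rs by simp
    finally show "(c (k, l) ^\<^sub>m L * P) $$ (r, s) = (P * em n k l (of_nat L)) $$ (r, s)" .
  qed (use P tc[OF kl, of L] in \<open>auto simp: em_def\<close>)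
  have QtP: "Q * c (k, l) ^\<^sub>m L * P = em n k l (of_nat L)" if kl: "k < n" "l < n" "k \<noteq> l" for k l
    unfolding assoc_mult_mat[OF Q tc[OF kl] P] tP[OF kl] by (rule cancel_left_mat[OF Q P QP em_carrier])
  define y where "y i j = Q * c (i, j) * P" for i j
  have yc: "y i j \<in> carrier_mat n n" if "i < n" "j < n" "i \<noteq> j" for i j
    using c_carrier[OF that] P Q by (simp add: y_def)
  \<comment> \<open>The element itself commutes with suitable L-th powers, so it is a scalar plus a
    multiple of one matrix unit. Its own L-th power is known, which makes the two coefficients
    equal: an elementary matrix up to a scalar \<open>\<alpha>\<close> with
    \<open>\<alpha>^L = 1\<close>.\<close>
  have yem: "\<exists>\<alpha>. \<alpha> \<noteq> 0 \<and> y i j = \<alpha> \<cdot>\<^sub>m em n i j 1" if ij: "i < n" "j < n" "i \<noteq> j" for i j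
  proof -
    have ye: "y i j $$ (r, s) = (if r = s then y i j $$ (0, 0) else 0) + (if r = i \<and> s = j then y i j $$ (i, j) else 0)"
      if rs: "r < n" "s < n" for r s
    proof (rule em_commutant[OF n3 yc[OF ij] ij Lnz _ rs])
      fix k l assume kl: "k < n" "l < n" "k \<noteq> l" "k \<noteq> j" "l \<noteq> i"
      have "c (i, j) ^\<^sub>m 1 * c (k, l) ^\<^sub>m L = c (k, l) ^\<^sub>m L * c (i, j) ^\<^sub>m 1"
        by (rule pow_comm) (use ij kl in simp_all)
      then have "c (i, j) * c (k, l) ^\<^sub>m L = c (k, l) ^\<^sub>m L * c (i, j)" using c_carrier[OF ij] by simp
      then show "y i j * em n k l (of_nat L) = em n k l (of_nat L) * y i j"
        unfolding y_def QtP[OF kl(1-3), symmetric] conj_mult[OF P Q c_carrier[OF ij] tc[OF kl(1-3)] PQ]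
          conj_mult[OF P Q tc[OF kl(1-3)] c_carrier[OF ij] PQ] by (simp only:)
    qed
    let ?\<alpha> = "y i j $$ (0, 0)" and ?\<beta> = "y i j $$ (i, j)"
    obtain \<gamma> where g: "?\<alpha> * \<gamma> = of_nat L * ?\<alpha> ^ L * ?\<beta>" and pw: "\<forall>r<n. \<forall>s<n. (y i j ^\<^sub>m L) $$ (r, s) =
      (if r = s then ?\<alpha> ^ L else 0) + (if r = i \<and> s = j then \<gamma> else 0)"
      using scalar_em_pow[OF yc[OF ij] ij ye] by blast
    have "y i j ^\<^sub>m L = em n i j (of_nat L)"
      unfolding y_def conj_pow[OF P Q c_carrier[OF ij] PQ QP] by (rule QtP[OF ij])
    then have "?\<alpha> ^ L = 1" "\<gamma> = of_nat L"
      using pw[rule_format, of i i] pw[rule_format, of i j] ij by (simp_all add: em_index)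
    then have ab: "?\<beta> = ?\<alpha>" using g Lnz by simp
    have a0: "?\<alpha> \<noteq> 0"
    proof
      assume "?\<alpha> = 0"
      moreover note L_pos
      ultimately show False using \<open>?\<alpha> ^ L = 1\<close> by (simp add: power_0_left)
    qed
    have "y i j = ?\<alpha> \<cdot>\<^sub>m em n i j 1"
    proof (rule eq_matI)
      fix r s assume "r < dim_row (?\<alpha> \<cdot>\<^sub>m em n i j 1)" "s < dim_col (?\<alpha> \<cdot>\<^sub>m em n i j 1)"
      then have rs: "r < n" "s < n" by (simp_all add: em_def)
      show "y i j $$ (r, s) = (?\<alpha> \<cdot>\<^sub>m em n i j 1) $$ (r, s)"
        using ye[OF rs] ab ij rs by (auto simp: em_def)
    qed (use yc[OF ij] in \<open>auto simp: em_def\<close>)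
    then show ?thesis using a0 by blast
  qed
  \<comment> \<open>In the commutator relation the scalars of (i, j) and (j, k) occur on both sides
    and cancel; the scalar of (i, k) remains on one side only and must be 1.\<close>
  have y1: "y i k = em n i k 1" if ik: "i < n" "k < n" "i \<noteq> k" for i k
  proof -
    obtain j where j: "j < n" "j \<noteq> i" "j \<noteq> k" using third_index[OF n3] by blast
    obtain a where a: "a \<noteq> 0" "y i j = a \<cdot>\<^sub>m em n i j 1" using yem[of i j] ik j by blast
    obtain b where b: "b \<noteq> 0" "y j k = b \<cdot>\<^sub>m em n j k 1" using yem[of j k] ik j by blast
    obtain d where d: "d \<noteq> 0" "y i k = d \<cdot>\<^sub>m em n i k 1" using yem[of i k] ik j by blast
    have c3: "c (i, j) \<in> carrier_mat n n" "c (j, k) \<in> carrier_mat n n" "c (i, k) \<in> carrier_mat n n"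
      using c_carrier ik j by simp_all
    have cji: "c (j, k) * c (i, j) \<in> carrier_mat n n" using c3 by simp
    have "y i j * y j k = y i k * (y j k * y i j)"
      unfolding y_def conj_mult[OF P Q c3(1,2) PQ] conj_mult[OF P Q c3(2,1) PQ] conj_mult[OF P Q c3(3) cji PQ]
      using rel[of i j k] ik j by simp
    moreover have sm: "(e \<cdot>\<^sub>m em n p q 1) * (f \<cdot>\<^sub>m B) = (e * f) \<cdot>\<^sub>m (em n p q 1 * B)"
      if B: "B \<in> carrier_mat n n" for e f :: complex and p q B
    proof -
      have "(e \<cdot>\<^sub>m em n p q 1) * (f \<cdot>\<^sub>m B) = e \<cdot>\<^sub>m (em n p q 1 * (f \<cdot>\<^sub>m B))"
        by (rule mult_smult_assoc_mat[OF em_carrier smult_carrier_mat[OF B]])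
      also have "\<dots> = e \<cdot>\<^sub>m (f \<cdot>\<^sub>m (em n p q 1 * B))" unfolding mult_smult_distrib[OF em_carrier B] ..
      also have "\<dots> = (e * f) \<cdot>\<^sub>m (em n p q 1 * B)" by (intro eq_matI) (simp_all add: mult.assoc)
      finally show ?thesis .
    qed
    ultimately have "(a * b) \<cdot>\<^sub>m (em n i j 1 * em n j k 1) =
        (d * (b * a)) \<cdot>\<^sub>m (em n i k 1 * (em n j k 1 * em n i j 1))"
      unfolding a(2) b(2) d(2) sm[OF em_carrier] sm[OF mult_carrier_mat[OF em_carrier em_carrier]] by (simp only:)
    moreover have "em n i j 1 * em n j k 1 = em n i k 1 * (em n j k 1 * em n i j 1)"
      using em_steinberg[of i n j k 1 1] ik j by simp
    moreover define E where "E = em n i j 1 * em n j k 1"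
    ultimately have "((a * b) \<cdot>\<^sub>m E) $$ (i, i) = ((d * (b * a)) \<cdot>\<^sub>m E) $$ (i, i)" by (simp only:)
    moreover have "E $$ (i, i) = 1"
      unfolding E_def using mult_em[OF em_carrier[of n i j 1] j(1) ik(2) ik(1) ik(1), of 1] ik j by (simp add: em_index)
    moreover have "E \<in> carrier_mat n n" unfolding E_def by (rule mult_carrier_mat[OF em_carrier em_carrier])
    ultimately have "a * b = d * (b * a)" using ik(1) by auto
    then have "d = 1" using a(1) b(1) by (simp add: mult.commute)
    then show ?thesis using d(2) by (auto intro!: eq_matI simp: em_def)
  qed
  have cP: "c (i, j) = P * em n i j 1 * Q" if ij: "i < n" "j < n" "i \<noteq> j" for i j
  proof -
    have cc: "c (i, j) \<in> carrier_mat n n" by (rule c_carrier[OF ij])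
    have cP': "c (i, j) * P \<in> carrier_mat n n" using cc P by simp
    have "P * em n i j 1 * Q = P * (Q * (c (i, j) * P)) * Q"
      unfolding y1[OF ij, symmetric] y_def assoc_mult_mat[OF Q cc P] ..
    also have "\<dots> = c (i, j) * P * Q" unfolding cancel_left_mat[OF P Q PQ cP'] ..
    also have "\<dots> = c (i, j)" unfolding assoc_mult_mat[OF cc P Q] PQ by (rule right_mult_one_mat[OF cc])
    finally show ?thesis by (rule sym)
  qed
  \<comment> \<open>Off the diagonal, P times a matrix unit times Q equals \<open>c (i, j)\<close>
    minus the unit matrix, which has entries in \<open>S\<close>.\<close>
  have Fne: "P $$ (r, i) * Q $$ (j, s) \<in> S" if ij: "i < n" "j < n" "i \<noteq> j" and rs: "r < n" "s < n" for i j r s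
  proof -
    have Pe: "P * em n i j 1 \<in> carrier_mat n n" using P by simp
    have "c (i, j) $$ (r, s) = (\<Sum>q<n. P $$ (r, q) * Q $$ (q, s) + (if q = j then P $$ (r, i) * Q $$ (j, s) else 0))"
      unfolding cP[OF ij] mat_mult_index[OF Pe Q rs]
      by (intro sum.cong) (use rs in \<open>simp_all add: mult_em[OF P ij(1,2) rs(1)] algebra_simps del: index_mult_mat\<close>)
    also have "\<dots> = (P * Q) $$ (r, s) + P $$ (r, i) * Q $$ (j, s)"
      unfolding mat_mult_index[OF P Q rs] using ij by (simp add: sum.distrib)
    finally have eq: "P $$ (r, i) * Q $$ (j, s) = c (i, j) $$ (r, s) + - (1\<^sub>m n $$ (r, s))" unfolding PQ by simp
    have "1\<^sub>m n $$ (r, s) \<in> S" using rs one_S zero_S by simp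
    then show ?thesis unfolding eq by (rule add_S[OF GG_D(2)[OF c_G[OF ij] rs] uminus_S])
  qed
  have F: "P $$ (r, i) * Q $$ (j, s) \<in> S" if ij: "i < n" "j < n" and rs: "r < n" "s < n" for i j r s
  proof (cases "i = j")
    case True
    obtain k where k: "k < n" "k \<noteq> i" using third_index[OF n3] by blast
    \<comment> \<open>A diagonal matrix unit is the product of those of (i, k) and (k, i), and these
      are covered by \<open>Fne\<close>.\<close>
    have "P $$ (r, i) * Q $$ (i, s) = P $$ (r, i) * (Q * P) $$ (k, k) * Q $$ (i, s)" unfolding QP using k by simp
    also have "\<dots> = (\<Sum>q<n. (P $$ (r, i) * Q $$ (k, q)) * (P $$ (q, k) * Q $$ (i, s)))"
      unfolding mat_mult_index[OF Q P k(1) k(1)] by (simp add: sum_distrib_left sum_distrib_right mult_ac)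
    also have "\<dots> \<in> S" by (intro sum_S mult_S Fne) (use ij rs k in simp_all)
    finally show ?thesis using True by simp
  next
    case False
    then show ?thesis using Fne ij rs by blast
  qed
  have "conj_iso P Q \<in> iso G G" by (rule conj_iso[OF P Q PQ QP F])
  then show ?thesis by (rule bexI[rotated]) (simp add: conj_iso_def cP)
qed

end

end

section \<open>The inverse transpose as an automorphism\<close>

context complex_subring
begin

definition contragredient :: "complex mat \<Rightarrow> complex mat" where
  "contragredient g = transpose_mat (inv\<^bsub>G\<^esub> g)"

lemma contragredient_closed:
  assumes g: "g \<in> carrier G"
  shows "contragredient g \<in> carrier G"
proof (rule GG_I)
  note i = GG_D[OF GG_inv(1)[OF g]]
  show "contragredient g \<in> carrier_mat n n" using i(1) by (simp add: contragredient_def)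
  show "det (contragredient g) = 1" unfolding contragredient_def det_transpose[OF i(1)] by (rule i(3))
  show "contragredient g $$ (r, s) \<in> S" if "r < n" "s < n" for r s
    using i(1) i(2)[OF that(2,1)] that by (simp add: contragredient_def)
qed

lemma contragredient_mult:
  assumes g: "g \<in> carrier G" and h: "h \<in> carrier G"
  shows "contragredient (g * h) = contragredient g * contragredient h"
proof -
  have "inv\<^bsub>G\<^esub> (g * h) = inv\<^bsub>G\<^esub> h * inv\<^bsub>G\<^esub> g" using GG.inv_mult_group[OF g h] by simp
  then show ?thesis unfolding contragredient_def
    using transpose_mult[OF GG_D(1)[OF GG_inv(1)[OF h]] GG_D(1)[OF GG_inv(1)[OF g]]] by (simp only:)
qed

lemma contragredient_involutive:
  assumes g: "g \<in> carrier G"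
  shows "contragredient (contragredient g) = g"
proof -
  note i = GG_D(1)[OF GG_inv(1)[OF g]] and gc = GG_D(1)[OF g]
  have tG: "transpose_mat g \<in> carrier G"
    using GG_D[OF g] det_transpose[OF gc] by (intro GG_I) auto
  have "transpose_mat g * contragredient g = transpose_mat (inv\<^bsub>G\<^esub> g * g)"
    unfolding contragredient_def by (rule transpose_mult[OF i gc, symmetric])
  also have "\<dots> = 1\<^sub>m n" unfolding GG_inv(2)[OF g] by simp
  finally have "inv\<^bsub>G\<^esub> (contragredient g) = transpose_mat g"
    using GG.inv_equality[of "transpose_mat g" "contragredient g"] contragredient_closed[OF g] tG by simp
  then show ?thesis unfolding contragredient_def[of "contragredient g"] by simp
qed

lemma contragredient_iso: "contragredient \<in> iso G G"
proof (rule isoI)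
  show "contragredient \<in> hom G G"
    by (rule homI) (simp_all add: contragredient_closed contragredient_mult)
  show "bij_betw contragredient (carrier G) (carrier G)"
    by (rule bij_betw_byWitness[where f' = contragredient])
      (auto simp: contragredient_closed contragredient_involutive)
qed

end

context steinberg_elements
begin

lemma steinberg_elements_contragredient: "steinberg_elements S n (\<lambda>p. contragredient (c p))"
proof unfold_locales
  show "contragredient (c (i, j)) \<in> carrier G" if "i < n" "j < n" "i \<noteq> j" for i j
    by (rule contragredient_closed[OF c_G[OF that]])
  interpret H: group_hom G G contragredient
    by unfold_locales (use contragredient_iso in \<open>simp add: iso_def\<close>)
  show "steinberg n (fact n ^ (n - 1)) G (\<lambda>p. contragredient (c p))"
    unfolding steinberg_def
  proof (intro conjI allI impI)
    fix i j k assume ijk: "i < n" "j < n" "k < n" "i \<noteq> j" "j \<noteq> k" "i \<noteq> k"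
    have g: "c (i, j) \<in> carrier G" "c (j, k) \<in> carrier G" "c (i, k) \<in> carrier G"
      using ijk by (auto intro: c_G)
    show "contragredient (c (i, j)) \<otimes>\<^bsub>G\<^esub> contragredient (c (j, k)) = contragredient (c (i, k)) \<otimes>\<^bsub>G\<^esub>
        (contragredient (c (j, k)) \<otimes>\<^bsub>G\<^esub> contragredient (c (i, j)))"
      using arg_cong[OF rel[OF ijk], of contragredient]
      unfolding GG_mult contragredient_mult[OF g(1,2)] contragredient_mult[OF g(3) GG_mult_closed[OF g(2,1)]]
        contragredient_mult[OF g(2,1)] .
  next
    fix i j k l assume ij: "i < n" "j < n" "k < n" "l < n" "i \<noteq> j" "k \<noteq> l" "j \<noteq> k" "i \<noteq> l"
    have g: "c (i, j) \<in> carrier G" "c (k, l) \<in> carrier G" using ij by (auto intro: c_G)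
    show "contragredient (c (i, j)) \<otimes>\<^bsub>G\<^esub> contragredient (c (k, l)) =
        contragredient (c (k, l)) \<otimes>\<^bsub>G\<^esub> contragredient (c (i, j))"
      using arg_cong[OF comm[OF ij], of contragredient]
      unfolding GG_mult contragredient_mult[OF g] contragredient_mult[OF g(2,1)] .
  next
    fix i j assume ij: "i < n" "j < n" "i \<noteq> j"
    let ?L = "(fact n :: nat) ^ (n - 1)"
    have g: "c (i, j) \<in> carrier G" by (rule c_G[OF ij])
    have gL: "c (i, j) [^]\<^bsub>G\<^esub> ?L \<in> carrier G" by (rule GG.nat_pow_closed[OF g])
    have ne: "c (i, j) [^]\<^bsub>G\<^esub> ?L \<noteq> \<one>\<^bsub>G\<^esub>"
      unfolding GG_pow[OF g] GG_one by (rule nontriv[OF ij])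
    show "contragredient (c (i, j)) [^]\<^bsub>G\<^esub> ?L \<noteq> \<one>\<^bsub>G\<^esub>"
    proof
      assume "contragredient (c (i, j)) [^]\<^bsub>G\<^esub> ?L = \<one>\<^bsub>G\<^esub>"
      then have "contragredient (c (i, j) [^]\<^bsub>G\<^esub> ?L) = contragredient \<one>\<^bsub>G\<^esub>"
        unfolding H.hom_nat_pow[OF g] H.hom_one .
      from arg_cong[OF this, of contragredient] have "c (i, j) [^]\<^bsub>G\<^esub> ?L = \<one>\<^bsub>G\<^esub>"
        unfolding contragredient_involutive[OF gL] contragredient_involutive[OF GG.one_closed] .
      then show False using ne by blast
    qed
  qed
qed

text \<open>If the products of the transvections multiply in the opposite order, the elements are
  standard up to the inverse transpose.\<close>

theorem standard_up_to_automorphism: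
  "\<exists>f\<in>iso G G. \<forall>i<n. \<forall>j<n. i \<noteq> j \<longrightarrow> f (em n i j 1) = c (i, j)"
proof -
  obtain u \<phi> where td: "trans_data u \<phi>" using trans_data_exists by (elim exE)
  interpret R: rank_one_family n "of_nat L" u \<phi> by (rule rank_one_family[OF td])
  show ?thesis
  proof (cases "(\<Sum>r<n. \<phi> 0 1 r * u 1 2 r) = 0")
    case False
    then show ?thesis by (rule conjugate_standard[OF td])
  next
    case True
    then have b: "(\<Sum>r<n. \<phi> 1 2 r * u 0 1 r) \<noteq> 0"
      using R.dot_cases[of 0 1 2] n3 by (simp add: R.dot_def)
    interpret B: steinberg_elements S n "\<lambda>p. contragredient (c p)"
      by (rule steinberg_elements_contragredient)
    interpret H: group_hom G G contragredient
      by unfold_locales (use contragredient_iso in \<open>simp add: iso_def\<close>)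
    \<comment> \<open>Since the covector annihilates the vector, the inverse of 1 + u \<phi> is 1 -
      u \<phi>. Transposition exchanges the roles of vector and covector, and the pairing that
      decides the type becomes, up to sign, the one known to be non-zero.\<close>
    have "B.trans_data (\<lambda>i j r. - \<phi> i j r) u"
      unfolding B.trans_data_def
    proof (intro allI impI conjI)
      fix i j r s assume ij: "i < n" "j < n" "i \<noteq> j" and rs: "r < n" "s < n"
      have g: "c (i, j) \<in> carrier G" by (rule c_G[OF ij])
      have cg: "contragredient (c (i, j)) \<in> carrier G" by (rule contragredient_closed[OF g])
      let ?T = "c (i, j) ^\<^sub>m L"
      have T: "?T \<in> carrier G" using GG.nat_pow_closed[OF g, of L] unfolding GG_pow[OF g] .
      let ?W = "inv\<^bsub>G\<^esub> ?T"
      have W: "?W \<in> carrier_mat n n" by (rule GG_D(1)[OF GG_inv(1)[OF T]])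
      define Z where "Z = mat n n (\<lambda>(r, s). (if r = s then 1 else 0) + (- u i j r) * \<phi> i j s)"
      have Z: "Z \<in> carrier_mat n n" by (simp add: Z_def)
      have Ze: "Z $$ (r, s) = (if r = s then 1 else 0) + (- u i j r) * \<phi> i j s" if "r < n" "s < n" for r s
        using that by (simp add: Z_def)
      have "Z * ?T = 1\<^sub>m n"
      proof (rule eq_matI)
        fix r s assume "r < dim_row (1\<^sub>m n :: complex mat)" "s < dim_col (1\<^sub>m n :: complex mat)"
        then have rs: "r < n" "s < n" by simp_all
        have e: "(Z * ?T) $$ (r, s) = (if r = s then 1 else 0) + (- u i j r) * \<phi> i j s + u i j r * \<phi> i j s +
            (- u i j r) * (\<Sum>q<n. \<phi> i j q * u i j q) * \<phi> i j s"
          by (rule outer_mult[OF Z GG_D(1)[OF T] Ze td_entry[OF td ij] rs])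
        show "(Z * ?T) $$ (r, s) = 1\<^sub>m n $$ (r, s)"
          unfolding e td_orth[OF td ij] using rs by simp
      qed (use Z GG_D(1)[OF T] in auto)
      then have "Z = ?W"
        using assoc_mult_mat[OF Z GG_D(1)[OF T] W] Z W GG_inv(3)[OF T] by simp
      have "contragredient (c (i, j)) ^\<^sub>m L = contragredient ?T"
        using H.hom_nat_pow[OF g, of L] unfolding GG_pow[OF g] GG_pow[OF cg] by (rule sym)
      also have "\<dots> = transpose_mat Z" unfolding contragredient_def \<open>Z = ?W\<close> ..
      finally have "(contragredient (c (i, j)) ^\<^sub>m L) $$ (r, s) = Z $$ (s, r)" using Z rs by simp
      then show "(contragredient (c (i, j)) ^\<^sub>m L) $$ (r, s) = (if r = s then 1 else 0) + - \<phi> i j r * u i j s"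
        unfolding Ze[OF rs(2,1)] by (simp add: mult.commute eq_commute[of s r])
    next
      fix i j assume ij: "i < n" "j < n" "i \<noteq> j"
      show "(\<Sum>r<n. u i j r * - \<phi> i j r) = 0"
        using td_orth[OF td ij] by (simp add: sum_negf mult.commute)
    qed
    moreover have "(\<Sum>r<n. u 0 1 r * - \<phi> 1 2 r) \<noteq> 0" using b by (simp add: sum_negf mult.commute)
    ultimately obtain f where f: "f \<in> iso G G" and fe: "\<forall>i<n. \<forall>j<n. i \<noteq> j \<longrightarrow> f (em n i j 1) = contragredient (c (i, j))"
      using B.conjugate_standard by blast
    show ?thesis
    proof (rule bexI[of _ "contragredient \<circ> f"], intro allI impI)
      show "contragredient \<circ> f \<in> iso G G" by (rule iso_set_trans[OF f contragredient_iso])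
      show "(contragredient \<circ> f) (em n i j 1) = c (i, j)" if "i < n" "j < n" "i \<noteq> j" for i j
        using fe that contragredient_involutive[OF c_G[OF that]] by simp
    qed
  qed
qed

end

section \<open>The interpretation at the standard elements\<close>

lemma (in group) cm_eqI:
  assumes "x \<in> carrier G" "y \<in> carrier G" "z \<in> carrier G" "x \<otimes> y = z \<otimes> (y \<otimes> x)"
  shows "cm G x y = z"
proof -
  have "cm G x y = z \<otimes> (y \<otimes> x) \<otimes> inv x \<otimes> inv y" unfolding cm_def assms(4) ..
  also have "\<dots> = z" using assms(1-3) by (simp add: m_assoc)
  finally show ?thesis .
qed

locale standard_elements = complex_subring +
  fixes c :: "nat \<times> nat \<Rightarrow> complex mat"
  assumes c: "i < n \<Longrightarrow> j < n \<Longrightarrow> i \<noteq> j \<Longrightarrow> c (i, j) = em n i j 1"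
begin

abbreviation e :: "complex \<Rightarrow> complex mat" where "e b \<equiv> em n 0 (Suc 0) b"

lemma n_pos: "0 < n" "1 < n" "2 < n" "Suc 0 < n" using n3 by simp_all

lemma e_G: "b \<in> S \<Longrightarrow> e b \<in> carrier G"
  using em_G n_pos by simp

lemma e_add: "e a * e b = e (a + b)"
  using em_add n_pos by simp

lemma e_inj: "e a = e b \<longleftrightarrow> a = b"
proof
  assume "e a = e b"
  then have "e a $$ (0, Suc 0) = e b $$ (0, Suc 0)" by simp
  then show "a = b" using n_pos by (simp add: em_index)
qed simp

lemma in_rc_iff: "in_rc n G c y \<longleftrightarrow> (\<exists>b\<in>S. y = e b)"
proof
  assume "\<exists>b\<in>S. y = e b"
  then obtain b where b: "b \<in> S" "y = e b" by blast
  show "in_rc n G c y"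
    unfolding in_rc_def
  proof (rule bexI[of _ "em n 0 2 b"], intro conjI allI impI)
    show "em n 0 2 b \<otimes>\<^bsub>G\<^esub> c (k, l) = c (k, l) \<otimes>\<^bsub>G\<^esub> em n 0 2 b"
      if "k < n" "l < n" "k \<noteq> l" "k \<noteq> 2" "l \<noteq> 0" for k l
      unfolding c[OF that(1-3)] GG_mult by (rule em_commute) (use that n_pos in simp_all)
    show "y = cm G (em n 0 2 b) (c (2, 1))"
      using em_commutator[of 0 2 1 b 1] c[of 2 1] n_pos b one_S by simp
  qed (use em_G b n_pos in simp)
next
  assume "in_rc n G c y"
  then obtain x where x: "x \<in> carrier G"
    and comm: "\<forall>k<n. \<forall>l<n. k \<noteq> l \<longrightarrow> k \<noteq> 2 \<longrightarrow> l \<noteq> 0 \<longrightarrow> x \<otimes>\<^bsub>G\<^esub> c (k, l) = c (k, l) \<otimes>\<^bsub>G\<^esub> x"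
    and y: "y = cm G x (c (2, 1))" unfolding in_rc_def by blast
  note xG = GG_D[OF x]
  have xe: "x $$ (r, s) = (if r = s then x $$ (0, 0) else 0) + (if r = 0 \<and> s = 2 then x $$ (0, 2) else 0)"
    if "r < n" "s < n" for r s
  proof (rule em_commutant[OF n3 xG(1) _ _ _ _ _ that, where b = 1])
    fix k l assume "k < n" "l < n" "k \<noteq> l" "k \<noteq> 2" "l \<noteq> 0"
    then show "x * em n k l 1 = em n k l 1 * x" using comm[rule_format, of k l] c[of k l] by simp
  qed (use n_pos in simp_all)
  let ?w = "inv\<^bsub>G\<^esub> x" and ?\<alpha> = "x $$ (0, 0)" and ?\<beta> = "x $$ (0, 2)"
  note wG = GG_D[OF GG_inv(1)[OF x]]
  have "(?w * x) $$ (1, 1) = (\<Sum>q<n. if q = 1 then ?w $$ (1, 1) * ?\<alpha> else 0)"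
    unfolding mat_mult_index[OF wG(1) xG(1) n_pos(2) n_pos(2)]
  proof (rule sum.cong)
    fix q assume "q \<in> {..<n}"
    then show "?w $$ (1, q) * x $$ (q, 1) = (if q = 1 then ?w $$ (1, 1) * ?\<alpha> else 0)"
      using xe[of q 1] n_pos by (cases "q = 1") simp_all
  qed simp
  then have wa: "?w $$ (1, 1) * ?\<alpha> = 1" unfolding GG_inv(2)[OF x] using n_pos by simp
  \<comment> \<open>The matrix x is \<open>\<alpha>\<close> plus \<open>\<beta>\<close> at position
    (0, 2). Its commutator should carry \<open>\<beta> / \<alpha>\<close>; that this lies in
    \<open>S\<close> is seen from the entry of the inverse matrix, which is
    \<open>1 / \<alpha>\<close>.\<close>
  let ?b = "?\<beta> * ?w $$ (1, 1)"
  have bS: "?b \<in> S" using xG(2) wG(2) n_pos by (intro mult_S) simp_all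
  have "cm G x (em n 2 1 1) = e ?b"
  proof (rule GG.cm_eqI[OF x _ e_G[OF bS]])
    show "em n 2 1 1 \<in> carrier G" using em_G n_pos one_S by simp
    have yx: "em n 2 1 1 * x \<in> carrier_mat n n" by (rule mult_carrier_mat[OF em_carrier xG(1)])
    have "x * em n 2 1 1 = e ?b * (em n 2 1 1 * x)"
    proof (rule eq_matI)
      fix r s assume "r < dim_row (e ?b * (em n 2 1 1 * x))" "s < dim_col (e ?b * (em n 2 1 1 * x))"
      then have rs: "r < n" "s < n" using xG(1) by (simp_all add: em_def)
      show "(x * em n 2 1 1) $$ (r, s) = (e ?b * (em n 2 1 1 * x)) $$ (r, s)"
        unfolding mult_em[OF xG(1) n_pos(3,2) rs] em_mult[OF yx n_pos(1,4) rs]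
          em_mult[OF xG(1) n_pos(3,2) rs] em_mult[OF xG(1) n_pos(3,2) n_pos(4) rs(2)]
        using xe[OF rs] xe[OF rs(1) n_pos(3)] xe[OF n_pos(2) rs(2)] xe[OF n_pos(4) rs(2)] wa n_pos
        by (auto simp: mult.assoc)
    qed (use xG(1) in \<open>auto simp: em_def\<close>)
    then show "x \<otimes>\<^bsub>G\<^esub> em n 2 1 1 = e ?b \<otimes>\<^bsub>G\<^esub> (em n 2 1 1 \<otimes>\<^bsub>G\<^esub> x)" by simp
  qed
  then show "\<exists>b\<in>S. y = e b" using y c[of 2 1] n_pos bS by auto
qed

lemma rmul_e: "a \<in> S \<Longrightarrow> b \<in> S \<Longrightarrow> rmul G c (e a) (e b) = e (a * b)"
  unfolding rmul_def using c[of 1 2] c[of 2 0] em_commutator[of 0 1 2 a 1] em_commutator[of 2 0 1 1 b] em_commutator[of 0 2 1 a b]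
    n_pos one_S by simp

lemma el_e:
  assumes "a \<in> S" "i < n" "j < n" "i \<noteq> j"
  shows "el G c i j (e a) = em n i j a"
proof -
  note cc = c[of 1 2] c[of 1 0] c[of 2 0] c[of 1 j] c[of i 0]
  show ?thesis
    unfolding el_def using assms cc n_pos one_S
      em_commutator[of 0 1 j a 1] em_commutator[of i 0 1 1 a] em_commutator[of i 0 j 1 a] em_commutator[of 0 1 2 a 1]
      em_commutator[of 1 0 2 1 a] em_commutator[of 1 2 0 a 1] em_commutator[of i 1 0 a 1]
    by auto
qed

definition code :: "(nat \<times> nat \<Rightarrow> complex mat) \<Rightarrow> complex mat \<Rightarrow> bool" where
  "code A a \<longleftrightarrow> a \<in> carrier_mat n n \<and> (\<forall>i<n. \<forall>j<n. a $$ (i, j) \<in> S \<and> A (i, j) = e (a $$ (i, j)))"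

text \<open>Quantified families must take values in the group at every index, so positions outside
  the matrix receive a default.\<close>

definition cf :: "complex mat \<Rightarrow> nat \<times> nat \<Rightarrow> complex mat" where
  "cf a p = (if fst p < n \<and> snd p < n then e (a $$ p) else \<one>\<^bsub>G\<^esub>)"

lemma codeD:
  assumes "code A a"
  shows "a \<in> carrier_mat n n" "i < n \<Longrightarrow> j < n \<Longrightarrow> a $$ (i, j) \<in> S" "i < n \<Longrightarrow> j < n \<Longrightarrow> A (i, j) = e (a $$ (i, j))"
  using assms by (auto simp: code_def)

lemma code_cf: "a \<in> carrier_mat n n \<Longrightarrow> (\<And>i j. i < n \<Longrightarrow> j < n \<Longrightarrow> a $$ (i, j) \<in> S) \<Longrightarrow> code (cf a) a"
  by (simp add: code_def cf_def)

lemma cf_G: "(\<And>i j. i < n \<Longrightarrow> j < n \<Longrightarrow> a $$ (i, j) \<in> S) \<Longrightarrow> cf a p \<in> carrier G"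
  using e_G GG.one_closed by (cases p) (auto simp: cf_def simp del: GG_one)

lemma code_G: "g \<in> carrier G \<Longrightarrow> code (cf g) g"
  by (rule code_cf) (simp_all add: GG_D)

lemma code_meq: "code A a \<Longrightarrow> code B b \<Longrightarrow> meq n A B \<longleftrightarrow> a = b"
proof
  assume A: "code A a" and B: "code B b"
  show "meq n A B \<Longrightarrow> a = b"
  proof (rule eq_matI)
    assume AB: "meq n A B"
    fix i j assume "i < dim_row b" "j < dim_col b"
    then have ij: "i < n" "j < n" using codeD(1)[OF B] by simp_all
    have "e (a $$ (i, j)) = e (b $$ (i, j))"
      using AB[unfolded meq_def, THEN spec, THEN mp, THEN spec, THEN mp, OF ij] codeD(3)[OF A ij] codeD(3)[OF B ij] by argo
    then show "a $$ (i, j) = b $$ (i, j)" unfolding e_inj .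
  qed (use codeD(1)[OF A] codeD(1)[OF B] in simp_all)
  show "a = b \<Longrightarrow> meq n A B" unfolding meq_def using codeD(3)[OF A] codeD(3)[OF B] by simp
qed

lemma code_cong: "code A a \<Longrightarrow> meq n A B \<Longrightarrow> code B a"
  unfolding code_def meq_def by auto

lemma rsum_e: "rsum G (\<lambda>k. e (f k)) xs = e (\<Sum>k\<leftarrow>xs. f k)"
proof (induction xs)
  case Nil
  then show ?case by (simp add: rsum_def em_zero)
next
  case (Cons x xs)
  have "rsum G (\<lambda>k. e (f k)) (x # xs) = e (f x) * rsum G (\<lambda>k. e (f k)) xs" by (simp add: rsum_def)
  then show ?case unfolding Cons e_add by simp
qed

lemma rsum_cong: "(\<And>k. k \<in> set xs \<Longrightarrow> f k = g k) \<Longrightarrow> rsum G' f xs = rsum G' g xs"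
  unfolding rsum_def by (induction xs) auto

lemma rprod_cong: "(\<And>k. k \<in> set xs \<Longrightarrow> f k = g k) \<Longrightarrow> rprod G' c' f xs = rprod G' c' g xs"
  unfolding rprod_def by (induction xs) auto

lemma rprod_e:
  assumes "\<And>k. k \<in> set xs \<Longrightarrow> f k \<in> S"
  shows "rprod G c (\<lambda>k. e (f k)) xs = e (\<Prod>k\<leftarrow>xs. f k) \<and> (\<Prod>k\<leftarrow>xs. f k) \<in> S"
  using assms
proof (induction xs)
  case Nil
  then show ?case using c[of 0 1] n_pos one_S by (simp add: rprod_def)
next
  case (Cons x xs)
  then have ih: "rprod G c (\<lambda>k. e (f k)) xs = e (\<Prod>k\<leftarrow>xs. f k)" "(\<Prod>k\<leftarrow>xs. f k) \<in> S" "f x \<in> S" by simp_all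
  have "rprod G c (\<lambda>k. e (f k)) (x # xs) = rmul G c (e (f x)) (rprod G c (\<lambda>k. e (f k)) xs)" by (simp add: rprod_def)
  then show ?case unfolding ih(1) rmul_e[OF ih(3,2)] using mult_S[OF ih(3,2)] by simp
qed

lemma code_mm:
  assumes A: "code A a" and B: "code B b"
  shows "code (mm G c n A B) (a * b)"
  unfolding code_def
proof (intro conjI allI impI)
  note a = codeD[OF A] and b = codeD[OF B]
  show "a * b \<in> carrier_mat n n" using a b by simp
  fix i j assume ij: "i < n" "j < n"
  show "(a * b) $$ (i, j) \<in> S"
    unfolding mat_mult_index[OF a(1) b(1) ij] by (intro sum_S mult_S a(2) b(2)) (use ij in simp_all)
  have "mm G c n A B (i, j) = rsum G (\<lambda>k. e (a $$ (i, k) * b $$ (k, j))) [0..<n]"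
    unfolding mm_def fst_conv snd_conv
    proof (rule rsum_cong)
    fix k assume "k \<in> set [0..<n]"
    then have k: "k < n" by simp
    show "rmul G c (A (i, k)) (B (k, j)) = e (a $$ (i, k) * b $$ (k, j))"
      unfolding a(3)[OF ij(1) k] b(3)[OF k ij(2)] by (rule rmul_e[OF a(2)[OF ij(1) k] b(2)[OF k ij(2)]])
  qed
  also have "\<dots> = e (\<Sum>k\<leftarrow>[0..<n]. a $$ (i, k) * b $$ (k, j))" by (rule rsum_e)
  also have "(\<Sum>k\<leftarrow>[0..<n]. a $$ (i, k) * b $$ (k, j)) = (a * b) $$ (i, j)"
    unfolding mat_mult_index[OF a(1) b(1) ij] by (simp add: sum_list_distinct_conv_sum_set atLeast0LessThan)
  finally show "mm G c n A B (i, j) = e ((a * b) $$ (i, j))" .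
qed

lemma code_idm: "code (idm G c) (1\<^sub>m n)"
  using c[of 0 1] n_pos by (auto simp: code_def idm_def zero_S one_S em_zero)

lemma code_mpow:
  assumes "code A a"
  shows "code (mpow G c n A k) (a ^\<^sub>m k)"
proof (induction k)
  case 0
  have "mpow G c n A 0 = idm G c" by (rule ext) simp
  then show ?case using code_idm codeD(1)[OF assms] by simp
next
  case (Suc k)
  have "mpow G c n A (Suc k) = mm G c n (mpow G c n A k) A" by (rule ext) simp
  then show ?case using code_mm[OF Suc assms] by simp
qed

lemma code_ldet:
  assumes A: "code A a"
  shows "ldet G c n A = e (det a)"
proof -
  note a = codeD[OF A]
  let ?t = "\<lambda>p. of_int (sign p) * (\<Prod>i = 0..<n. a $$ (i, p i))"
  have "ldet G c n A = rsum G (\<lambda>p. e (?t p)) (perms n)"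
    unfolding ldet_def
  proof (rule rsum_cong)
    fix p assume "p \<in> set (perms n)"
    then have "p permutes {..<n}" using perms by blast
    then have p: "p i < n" if "i < n" for i using permutes_in_image[of p "{..<n}" i] that by simp
    have "rprod G c (\<lambda>i. A (i, p i)) [0..<n] = rprod G c (\<lambda>i. e (a $$ (i, p i))) [0..<n]"
      by (rule rprod_cong) (use a(3) p in simp)
    moreover have "rprod G c (\<lambda>i. e (a $$ (i, p i))) [0..<n] = e (\<Prod>i\<leftarrow>[0..<n]. a $$ (i, p i)) \<and>
        (\<Prod>i\<leftarrow>[0..<n]. a $$ (i, p i)) \<in> S"
      by (rule rprod_e) (use a(2) p in simp)
    moreover have "(\<Prod>i\<leftarrow>[0..<n]. a $$ (i, p i)) = (\<Prod>i = 0..<n. a $$ (i, p i))"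
      by (simp add: prod.distinct_set_conv_list[symmetric])
    ultimately have r: "rprod G c (\<lambda>i. A (i, p i)) [0..<n] = e (\<Prod>i = 0..<n. a $$ (i, p i))"
      and rS: "(\<Prod>i = 0..<n. a $$ (i, p i)) \<in> S" by simp_all
    have inv: "inv\<^bsub>G\<^esub> (e (\<Prod>i = 0..<n. a $$ (i, p i))) = e (- (\<Prod>i = 0..<n. a $$ (i, p i)))"
      using em_inv[OF n_pos(1,4) _ rS] by simp
    show "(if sign p = 1 then rprod G c (\<lambda>i. A (i, p i)) [0..<n] else inv\<^bsub>G\<^esub> rprod G c (\<lambda>i. A (i, p i)) [0..<n]) = e (?t p)"
      unfolding r inv by (cases rule: sign_cases[of p]) simp_all
  qed
  also have "\<dots> = e (\<Sum>p\<leftarrow>perms n. ?t p)" by (rule rsum_e)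
  also have "(\<Sum>p\<leftarrow>perms n. ?t p) = det a"
    unfolding det_def'[OF a(1)] using perms[of n] by (simp add: sum_list_distinct_conv_sum_set atLeast0LessThan)
  finally show ?thesis .
qed

lemma slR_iff: "slR n G c A \<longleftrightarrow> (\<exists>a\<in>carrier G. code A a)"
proof
  assume sl: "slR n G c A"
  define a where "a = mat n n (\<lambda>p. SOME b. b \<in> S \<and> A p = e b)"
  have "a $$ (i, j) \<in> S \<and> A (i, j) = e (a $$ (i, j))" if "i < n" "j < n" for i j
  proof -
    have "\<exists>b. b \<in> S \<and> A (i, j) = e b" using sl that by (auto simp: slR_def in_rc_iff)
    from someI_ex[OF this] show ?thesis using that by (simp add: a_def)
  qed
  then have code: "code A a" by (simp add: code_def a_def)
  then have "e (det a) = e 1" using sl code_ldet c[of 0 1] n_pos by (simp add: slR_def)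
  then have "det a = 1" unfolding e_inj .
  then have "a \<in> carrier G" using codeD[OF code] by (intro GG_I) simp_all
  then show "\<exists>a\<in>carrier G. code A a" using code by blast
next
  assume "\<exists>a\<in>carrier G. code A a"
  then obtain a where a: "a \<in> carrier G" "code A a" by blast
  then show "slR n G c A"
    unfolding slR_def code_ldet[OF a(2)] GG_D(3)[OF a(1)] in_rc_iff
    using codeD[OF a(2)] c[of 0 1] n_pos by auto
qed

text \<open>The matrix \<open>h\<^sup>-\<^sup>1 s h - 1\<close> is the product of the column \<open>q\<close> and the row \<open>\<gamma>\<close>.\<close>

lemma parallel_iff:
  assumes h: "h \<in> carrier G" and A: "code A a"
  shows "parallel n G c h A \<longleftrightarrow> (\<forall>i<n. \<forall>k<n. \<forall>l<n. a $$ (l, i) * h $$ (k, i) = a $$ (k, i) * h $$ (l, i))"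
proof -
  note hG = GG_D[OF h] and a = codeD[OF A] and w = GG_D[OF GG_inv(1)[OF h]]
  let ?w = "inv\<^bsub>G\<^esub> h"
  \<comment> \<open>The auxiliary row p disappears from the criterion; any index different from k
    and l serves.\<close>
  have key: "parallel_at G c n h A i k l p \<longleftrightarrow>
    a $$ (l, i) * h $$ (k, i) = a $$ (k, i) * h $$ (l, i)"
    if i: "i < n" and kl: "k < n" "l < n" "k \<noteq> l" and p: "p < n" "p \<noteq> k" "p \<noteq> l" for i k l p
  proof -
    let ?s = "em n p k (a $$ (l, i)) * em n p l (- (a $$ (k, i)))"
    have s: "el G c p k (A (l, i)) \<otimes>\<^bsub>G\<^esub> inv\<^bsub>G\<^esub> (el G c p l (A (k, i))) = ?s"
      using el_e a(2,3) em_inv i kl p by simp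
    define \<gamma> where "\<gamma> t = a $$ (l, i) * h $$ (k, t) - a $$ (k, i) * h $$ (l, t)" for t
    define q where "q r = ?w $$ (r, p)" for r
    have sc: "?s \<in> carrier_mat n n" by (rule mult_carrier_mat[OF em_carrier em_carrier])
    have eh: "em n p l (- (a $$ (k, i))) * h \<in> carrier_mat n n" by (rule mult_carrier_mat[OF em_carrier hG(1)])
    have sh: "?s * h \<in> carrier_mat n n" using hG sc by simp
    have she: "(?s * h) $$ (r, t) = h $$ (r, t) + (if r = p then \<gamma> t else 0)" if rt: "r < n" "t < n" for r t
      unfolding assoc_mult_mat[OF em_carrier em_carrier hG(1)] em_mult[OF eh p(1) kl(1) rt]
        em_mult[OF hG(1) p(1) kl(2) rt] em_mult[OF hG(1) p(1) kl(2) kl(1) rt(2)]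
      using p by (simp add: \<gamma>_def)
    define W where "W = ?w * (?s * h)"
    have Wc: "W \<in> carrier_mat n n" unfolding W_def using w(1) sh by simp
    have We: "W $$ (r, t) = (if r = t then 1 else 0) + q r * \<gamma> t" if rt: "r < n" "t < n" for r t
    proof -
      have "W $$ (r, t) = (\<Sum>m<n. ?w $$ (r, m) * h $$ (m, t) + (if m = p then q r * \<gamma> t else 0))"
        unfolding W_def mat_mult_index[OF w(1) sh rt]
        by (intro sum.cong) (use rt in \<open>simp_all add: she q_def algebra_simps del: index_mult_mat\<close>)
      also have "\<dots> = (?w * h) $$ (r, t) + q r * \<gamma> t"
        unfolding mat_mult_index[OF w(1) hG(1) rt] using p by (simp add: sum.distrib)
      finally show ?thesis unfolding GG_inv(2)[OF h] using rt by simp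
    qed
    have W: "?w \<otimes>\<^bsub>G\<^esub> ?s \<otimes>\<^bsub>G\<^esub> h = W"
      unfolding W_def GG_mult by (rule assoc_mult_mat[OF w(1) sc hG(1)])
    have q0: "\<exists>r<n. q r \<noteq> 0"
    proof (rule ccontr)
      assume *: "\<not> (\<exists>r<n. q r \<noteq> 0)"
      have "(h * ?w) $$ (p, p) = (\<Sum>r<n. 0)"
        unfolding mat_mult_index[OF hG(1) w(1) p(1) p(1)]
        by (intro sum.cong) (use * in \<open>auto simp: q_def\<close>)
      then show False unfolding GG_inv(3)[OF h] using p by simp
    qed
    \<comment> \<open>An element centralising the row i root subgroup is a scalar plus off-diagonal
      entries in row i. For such x the scalar part drops out of the equation with
      \<open>W = 1 + q \<gamma>\<close>, and the row acts on q on one side while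
      \<open>\<gamma> i\<close> multiplies it on the other.\<close>
    have xW: "x * W = W * x \<longleftrightarrow> (\<forall>r<n. \<forall>t<n. (if r = i then (\<Sum>m<n. (if m = i then 0 else x $$ (i, m) * q m)) * \<gamma> t else 0) =
        (if t = i then 0 else q r * \<gamma> i * x $$ (i, t)))"
      if x: "x \<in> carrier_mat n n" and xe: "\<And>r s. r < n \<Longrightarrow> s < n \<Longrightarrow> x $$ (r, s) =
        (if r = s then x $$ (i, i) else 0) + (if r = i \<and> s \<noteq> i then x $$ (i, s) else 0)" for x
    proof -
      let ?bq = "\<Sum>m<n. (if m = i then 0 else x $$ (i, m) * q m)"
      have 1: "(x * W) $$ (r, t) = x $$ (r, t) + x $$ (i, i) * q r * \<gamma> t + (if r = i then ?bq * \<gamma> t else 0)"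
        if rt: "r < n" "t < n" for r t
      proof -
        have "(x * W) $$ (r, t) = (\<Sum>m<n. (if m = t then x $$ (r, t) else 0) +
            (if m = r then x $$ (i, i) * q r * \<gamma> t else 0) +
            (if r = i then if m = i then 0 else x $$ (i, m) * q m else 0) * \<gamma> t)"
          unfolding mat_mult_index[OF x Wc rt]
        proof (rule sum.cong)
          fix m assume "m \<in> {..<n}"
          then have m: "m < n" by simp
          show "x $$ (r, m) * W $$ (m, t) = (if m = t then x $$ (r, t) else 0) +
            (if m = r then x $$ (i, i) * q r * \<gamma> t else 0) +
            (if r = i then if m = i then 0 else x $$ (i, m) * q m else 0) * \<gamma> t"
            unfolding We[OF m rt(2)] using xe[OF rt(1) m] by (auto simp: algebra_simps)
        qed simp
        then show ?thesis using rt by (simp add: sum.distrib sum_distrib_right)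
      qed
      have 2: "(W * x) $$ (r, t) = x $$ (r, t) + x $$ (i, i) * q r * \<gamma> t + (if t = i then 0 else q r * \<gamma> i * x $$ (i, t))"
        if rt: "r < n" "t < n" for r t
      proof -
        have "(W * x) $$ (r, t) = (\<Sum>m<n. (if m = r then x $$ (r, t) else 0) +
            (if m = t then x $$ (i, i) * q r * \<gamma> t else 0) +
            (if m = i then if t = i then 0 else q r * \<gamma> i * x $$ (i, t) else 0))"
          unfolding mat_mult_index[OF Wc x rt]
        proof (rule sum.cong)
          fix m assume "m \<in> {..<n}"
          then have m: "m < n" by simp
          show "W $$ (r, m) * x $$ (m, t) = (if m = r then x $$ (r, t) else 0) +
            (if m = t then x $$ (i, i) * q r * \<gamma> t else 0) +
            (if m = i then if t = i then 0 else q r * \<gamma> i * x $$ (i, t) else 0)"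
            unfolding We[OF rt(1) m] using xe[OF m rt(2)] by (auto simp: algebra_simps)
        qed simp
        then show ?thesis using rt i by (simp add: sum.distrib)
      qed
      have "x * W = W * x \<longleftrightarrow> (\<forall>r<n. \<forall>t<n. (x * W) $$ (r, t) = (W * x) $$ (r, t))"
      proof
        assume *: "\<forall>r<n. \<forall>t<n. (x * W) $$ (r, t) = (W * x) $$ (r, t)"
        show "x * W = W * x" by (rule eq_matI) (use * x Wc in \<open>simp_all del: index_mult_mat(1)\<close>)
      qed simp
      also have "\<dots> \<longleftrightarrow> (\<forall>r<n. \<forall>t<n. (if r = i then ?bq * \<gamma> t else 0) = (if t = i then 0 else q r * \<gamma> i * x $$ (i, t)))"
        using 1 2 by (simp del: index_mult_mat(1) cong: all_cong)
      finally show ?thesis .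
    qed
    have "(\<exists>x\<in>carrier G. (\<forall>j<n. j \<noteq> i \<longrightarrow> x \<otimes>\<^bsub>G\<^esub> c (i, j) = c (i, j) \<otimes>\<^bsub>G\<^esub> x) \<and>
      (\<exists>y\<in>carrier G. x \<otimes>\<^bsub>G\<^esub> y \<noteq> y \<otimes>\<^bsub>G\<^esub> x) \<and> x * W = W * x) \<longleftrightarrow> \<gamma> i = 0"
    proof
      assume "\<exists>x\<in>carrier G. (\<forall>j<n. j \<noteq> i \<longrightarrow> x \<otimes>\<^bsub>G\<^esub> c (i, j) = c (i, j) \<otimes>\<^bsub>G\<^esub> x) \<and>
        (\<exists>y\<in>carrier G. x \<otimes>\<^bsub>G\<^esub> y \<noteq> y \<otimes>\<^bsub>G\<^esub> x) \<and> x * W = W * x"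
      then obtain x y where x: "x \<in> carrier G" and xc: "\<And>j. j < n \<Longrightarrow> j \<noteq> i \<Longrightarrow> x * c (i, j) = c (i, j) * x"
        and y: "y \<in> carrier G" "x * y \<noteq> y * x" and xWx: "x * W = W * x" by auto
      note xG = GG_D[OF x]
      have xem: "x * em n i j 1 = em n i j 1 * x" if "j < n" "j \<noteq> i" for j
        using xc[OF that] c[OF i that(1)] that(2) by simp
      have xe: "x $$ (r, s) = (if r = s then x $$ (i, i) else 0) + (if r = i \<and> s \<noteq> i then x $$ (i, s) else 0)"
        if rs: "r < n" "s < n" for r s
      proof (cases "r = i")
        case True
        then show ?thesis by auto
      next
        case False
        note ent = em_commutant_entries[OF xG(1) i rs(1) one_neq_zero xem[OF rs(1) False]]
        show ?thesis using ent(2)[OF rs(2)] ent(3) False by (cases "r = s") auto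
      qed
      \<comment> \<open>A non-central x of this shape cannot be scalar, so its row has a non-zero
        entry off the diagonal.\<close>
      obtain t where t: "t < n" "t \<noteq> i" "x $$ (i, t) \<noteq> 0"
      proof (rule ccontr)
        assume "\<not> thesis"
        then have z: "x $$ (i, t) = 0" if "t < n" "t \<noteq> i" for t using that \<open>\<And>t. t < n \<Longrightarrow> t \<noteq> i \<Longrightarrow> x $$ (i, t) \<noteq> 0 \<Longrightarrow> thesis\<close> by blast
        define \<xi> where "\<xi> = x $$ (i, i)"
        have "x = \<xi> \<cdot>\<^sub>m 1\<^sub>m n" unfolding \<xi>_def
        proof (rule eq_matI)
          fix r s assume "r < dim_row (x $$ (i, i) \<cdot>\<^sub>m 1\<^sub>m n)" "s < dim_col (x $$ (i, i) \<cdot>\<^sub>m 1\<^sub>m n)"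
          then have rs: "r < n" "s < n" by simp_all
          show "x $$ (r, s) = (x $$ (i, i) \<cdot>\<^sub>m 1\<^sub>m n) $$ (r, s)"
          proof -
            have "(if r = i \<and> s \<noteq> i then x $$ (i, s) else 0) = 0" using z[OF rs(2)] by simp
            then have "x $$ (r, s) = (if r = s then x $$ (i, i) else 0)"
              by (intro trans[OF xe[OF rs]]) simp
            then show ?thesis using rs by simp
          qed
        qed (use xG(1) in simp_all)
        then have "x * y = \<xi> \<cdot>\<^sub>m y" "y * x = \<xi> \<cdot>\<^sub>m y"
          using mult_smult_assoc_mat[OF one_carrier_mat GG_D(1)[OF y(1)], of \<xi>]
            mult_smult_distrib[OF GG_D(1)[OF y(1)] one_carrier_mat, of \<xi>] GG_D(1)[OF y(1)] by simp_all
        then show False using y(2) by simp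
      qed
      have eq: "(if r = i then (\<Sum>m<n. (if m = i then 0 else x $$ (i, m) * q m)) * \<gamma> t else 0) = q r * \<gamma> i * x $$ (i, t)"
        if "r < n" for r
        using iffD1[OF xW[OF xG(1) xe] xWx, THEN spec, THEN mp, OF _ _ that, THEN spec, THEN mp, OF _ _ t(1)] t(2)
        by (simp only: if_False)
      show "\<gamma> i = 0"
      proof (rule ccontr)
        assume g: "\<gamma> i \<noteq> 0"
        \<comment> \<open>If \<open>\<gamma> i\<close> were not zero, column t of the equation would
          kill q outside i, then the pairing of the row with q, and finally \<open>q i\<close>; but
          q is a column of an invertible matrix.\<close>
        have qr: "q r = 0" if "r < n" "r \<noteq> i" for r using eq[OF that(1)] that g t by simp
        then have "(\<Sum>m<n. (if m = i then 0 else x $$ (i, m) * q m)) = 0" by (intro sum.neutral) simp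
        then have "q i = 0" using eq[OF i] g t by simp
        then show False using q0 qr by blast
      qed
    next
      assume g: "\<gamma> i = 0"
      obtain j1 where j1: "j1 < n" "j1 \<noteq> i" using third_index[OF n3] by blast
      obtain j2 where j2: "j2 < n" "j2 \<noteq> i" "j2 \<noteq> j1" using third_index[OF n3] by blast
      \<comment> \<open>Conversely, a row supported at two positions and orthogonal to q is wanted:
        \<open>(q j2, - q j1)\<close> is one, unless both vanish, when (1, 0) is taken. No division
        occurs, so the entries stay in \<open>S\<close>.\<close>
      define b1 where "b1 = (if q j1 = 0 \<and> q j2 = 0 then 1 else q j2)"
      define b2 where "b2 = (if q j1 = 0 \<and> q j2 = 0 then 0 else - q j1)"
      have qS: "q r \<in> S" if "r < n" for r unfolding q_def using w(2) that p by simp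
      have bS: "b1 \<in> S" "b2 \<in> S" using qS j1 j2 one_S zero_S uminus_S by (auto simp: b1_def b2_def)
      have bq: "b1 * q j1 + b2 * q j2 = 0" by (simp add: b1_def b2_def)
      have bn: "b1 \<noteq> 0 \<or> b2 \<noteq> 0" by (auto simp: b1_def b2_def)
      let ?x = "em n i j1 b1 * em n i j2 b2"
      have xG: "?x \<in> carrier G" by (rule GG_mult_closed) (use em_G i j1 j2 bS in auto)
      have x: "?x \<in> carrier_mat n n" by (rule GG_D(1)[OF xG])
      have xv: "?x $$ (r, s) = (if r = s then 1 else 0) + (if r = i \<and> s = j1 then b1 else 0) + (if r = i \<and> s = j2 then b2 else 0)"
        if rs: "r < n" "s < n" for r s
        unfolding mult_em[OF em_carrier i j2(1) rs] using rs i j1 j2 by (auto simp: em_index)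
      show "\<exists>x\<in>carrier G. (\<forall>j<n. j \<noteq> i \<longrightarrow> x \<otimes>\<^bsub>G\<^esub> c (i, j) = c (i, j) \<otimes>\<^bsub>G\<^esub> x) \<and>
        (\<exists>y\<in>carrier G. x \<otimes>\<^bsub>G\<^esub> y \<noteq> y \<otimes>\<^bsub>G\<^esub> x) \<and> x * W = W * x"
      proof (rule bexI[OF _ xG], intro conjI allI impI)
        fix j assume j: "j < n" "j \<noteq> i"
        have "?x * em n i j 1 = em n i j 1 * ?x"
        proof (rule eq_matI)
          fix r s assume "r < dim_row (em n i j 1 * ?x)" "s < dim_col (em n i j 1 * ?x)"
          then have rs: "r < n" "s < n" by (simp_all add: em_def)
          show "(?x * em n i j 1) $$ (r, s) = (em n i j 1 * ?x) $$ (r, s)"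
            unfolding mult_em[OF x i j(1) rs] em_mult[OF x i j(1) rs] xv[OF rs] xv[OF rs(1) i] xv[OF j(1) rs(2)]
            using j j1 j2 by auto
        qed (simp_all add: em_def)
        then show "?x \<otimes>\<^bsub>G\<^esub> c (i, j) = c (i, j) \<otimes>\<^bsub>G\<^esub> ?x" using c[OF i j(1)] j by simp
      next
        obtain j where j: "j < n" "j \<noteq> i" "?x $$ (i, j) \<noteq> 0"
        proof (cases "b1 = 0")
          case True
          then show ?thesis using that[of j2] bn xv[OF i j2(1)] j1 j2 by simp
        next
          case False
          then show ?thesis using that[of j1] xv[OF i j1(1)] j1 j2 by simp
        qed
        \<comment> \<open>Multiplying by the opposite elementary matrix on either side changes the
          diagonal entry (i, i) on one side only, so the element is not central.\<close>
        have "(?x * em n j i 1) $$ (i, i) \<noteq> (em n j i 1 * ?x) $$ (i, i)"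
          unfolding mult_em[OF x j(1) i i i] em_mult[OF x j(1) i i i] using j by simp
        then show "\<exists>y\<in>carrier G. ?x \<otimes>\<^bsub>G\<^esub> y \<noteq> y \<otimes>\<^bsub>G\<^esub> ?x"
          using em_G[OF j(1) i j(2) one_S] by (intro bexI[of _ "em n j i 1"]) auto
      next
        have xe: "?x $$ (r, s) = (if r = s then ?x $$ (i, i) else 0) + (if r = i \<and> s \<noteq> i then ?x $$ (i, s) else 0)"
          if "r < n" "s < n" for r s
          unfolding xv[OF that] xv[OF i i] xv[OF i that(2)] using j1 j2 by auto
        have "(\<Sum>m<n. (if m = i then 0 else ?x $$ (i, m) * q m)) =
          (\<Sum>m<n. (if m = j1 then b1 * q j1 else 0) + (if m = j2 then b2 * q j2 else 0))"
          by (intro sum.cong) (use i j1 j2 in \<open>auto simp: xv simp del: index_mult_mat\<close>)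
        also have "\<dots> = 0" using j1 j2 bq by (simp add: sum.distrib)
        finally have z: "(\<Sum>m<n. (if m = i then 0 else ?x $$ (i, m) * q m)) = 0" .
        show "?x * W = W * ?x"
        proof (rule iffD2[OF xW[OF x]])
          show "?x $$ (r, s) = (if r = s then ?x $$ (i, i) else 0) + (if r = i \<and> s \<noteq> i then ?x $$ (i, s) else 0)"
            if "r < n" "s < n" for r s by (rule xe[OF that])
        qed (unfold z g, simp)
      qed
    qed
    then show ?thesis unfolding parallel_at_def s W GG_mult[of _ W] GG_mult[of W] \<gamma>_def by simp
  qed
  show ?thesis
  proof
    assume P: "parallel n G c h A"
    show "\<forall>i<n. \<forall>k<n. \<forall>l<n. a $$ (l, i) * h $$ (k, i) = a $$ (k, i) * h $$ (l, i)"
    proof (intro allI impI)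
      fix i k l assume ikl: "i < n" "k < n" "l < n"
      show "a $$ (l, i) * h $$ (k, i) = a $$ (k, i) * h $$ (l, i)"
      proof (cases "k = l")
        case False
        obtain p where p: "p < n" "p \<noteq> k" "p \<noteq> l" using third_index[OF n3] by blast
        show ?thesis
          by (rule iffD1[OF key[OF ikl False p]], rule P[unfolded parallel_def, THEN spec, THEN mp, THEN spec, THEN mp,
              THEN spec, THEN mp, THEN spec, THEN mp, THEN mp, THEN mp, THEN mp]) (use ikl False p in simp_all)
      qed simp
    qed
  next
    assume Q: "\<forall>i<n. \<forall>k<n. \<forall>l<n. a $$ (l, i) * h $$ (k, i) = a $$ (k, i) * h $$ (l, i)"
    show "parallel n G c h A"
      unfolding parallel_def
    proof (intro allI impI)
      fix i k l p assume *: "i < n" "k < n" "l < n" "p < n" "k \<noteq> l" "p \<noteq> k" "p \<noteq> l"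
      show "parallel_at G c n h A i k l p"
        by (rule iffD2[OF key[OF *(1,2,3,5,4,6,7)]]) (use Q * in blast)
    qed
  qed
qed

end

section \<open>The first-order properties that are transferred\<close>

definition rc_ring :: "nat \<Rightarrow> ('a, 'm) monoid_scheme \<Rightarrow> (nat \<times> nat \<Rightarrow> 'a) \<Rightarrow> bool" where
  "rc_ring n G c \<longleftrightarrow> in_rc n G c (c (0, 1)) \<and> in_rc n G c \<one>\<^bsub>G\<^esub> \<and>
    (\<forall>x\<in>carrier G. in_rc n G c x \<longrightarrow> in_rc n G c (inv\<^bsub>G\<^esub> x) \<and> rmul G c (c (0, 1)) x = x \<and>
      (\<forall>y\<in>carrier G. in_rc n G c y \<longrightarrow> in_rc n G c (x \<otimes>\<^bsub>G\<^esub> y) \<and> in_rc n G c (rmul G c x y) \<and>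
        x \<otimes>\<^bsub>G\<^esub> y = y \<otimes>\<^bsub>G\<^esub> x \<and> rmul G c x y = rmul G c y x \<and>
        (\<forall>z\<in>carrier G. in_rc n G c z \<longrightarrow> rmul G c (rmul G c x y) z = rmul G c x (rmul G c y z) \<and>
          rmul G c (x \<otimes>\<^bsub>G\<^esub> y) z = rmul G c x z \<otimes>\<^bsub>G\<^esub> rmul G c y z)))"

text \<open>These clauses make the pairs related by \<open>rho\<close> a group projecting onto both
  factors. Elements related to the identity matrix are the scalars; the last clause provides the
  roots needed for splitting, and its quantifier over m is a finite conjunction.\<close>

definition rho_group :: "nat \<Rightarrow> nat \<Rightarrow> ('a, 'm) monoid_scheme \<Rightarrow> (nat \<times> nat \<Rightarrow> 'a) \<Rightarrow> bool" where
  "rho_group n d G c \<longleftrightarrow> rho n G c \<one>\<^bsub>G\<^esub> (idm G c) \<and>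
    (\<forall>h\<in>carrier G. \<exists>A. (\<forall>p. A p \<in> carrier G) \<and> rho n G c h A) \<and>
    (\<forall>A. (\<forall>p. A p \<in> carrier G) \<longrightarrow> slR n G c A \<longrightarrow> (\<exists>h\<in>carrier G. rho n G c h A) \<and>
      meq n (mm G c n (idm G c) A) A \<and>
      (\<forall>B. (\<forall>p. B p \<in> carrier G) \<longrightarrow> slR n G c B \<longrightarrow> (\<forall>C. (\<forall>p. C p \<in> carrier G) \<longrightarrow> slR n G c C \<longrightarrow>
        meq n (mm G c n (mm G c n A B) C) (mm G c n A (mm G c n B C))))) \<and>
    (\<forall>h\<in>carrier G. \<forall>A. (\<forall>p. A p \<in> carrier G) \<longrightarrow> rho n G c h A \<longrightarrow>
      (\<exists>B. (\<forall>p. B p \<in> carrier G) \<and> rho n G c (inv\<^bsub>G\<^esub> h) B \<and> meq n (mm G c n B A) (idm G c)) \<and>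
      (\<forall>B. (\<forall>p. B p \<in> carrier G) \<longrightarrow> meq n A B \<longrightarrow> rho n G c h B) \<and>
      (\<forall>h'\<in>carrier G. \<forall>B. (\<forall>p. B p \<in> carrier G) \<longrightarrow> rho n G c h' B \<longrightarrow>
        rho n G c (h \<otimes>\<^bsub>G\<^esub> h') (mm G c n A B))) \<and>
    (\<forall>m<Suc d. m dvd d \<longrightarrow> (\<forall>z\<in>carrier G. rho n G c z (idm G c) \<longrightarrow> z [^]\<^bsub>G\<^esub> (d div m) = \<one>\<^bsub>G\<^esub> \<longrightarrow>
      (\<exists>u\<in>carrier G. rho n G c u (idm G c) \<and> u [^]\<^bsub>G\<^esub> m = z)))"

text \<open>One property for each length k: that the union over all k meets the scalars trivially is
  not a single sentence, but follows from the whole scheme.\<close>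

definition Dk_faithful :: "nat \<Rightarrow> nat \<Rightarrow> nat \<Rightarrow> ('a, 'm) monoid_scheme \<Rightarrow> (nat \<times> nat \<Rightarrow> 'a) \<Rightarrow> bool" where
  "Dk_faithful n d k G c \<longleftrightarrow> (\<forall>h\<in>carrier G. \<forall>A. (\<forall>p. A p \<in> carrier G) \<longrightarrow> rho n G c h A \<longrightarrow>
    Dk n d G c k h A \<longrightarrow> (h = \<one>\<^bsub>G\<^esub> \<longleftrightarrow> meq n A (idm G c)))"

text \<open>Every scalar, as a group element or as a matrix, has a partner in the subgroup of
  commutators and powers. A fixed k is essential for this to be first order.\<close>

definition Dk_scalars :: "nat \<Rightarrow> nat \<Rightarrow> nat \<Rightarrow> ('a, 'm) monoid_scheme \<Rightarrow> (nat \<times> nat \<Rightarrow> 'a) \<Rightarrow> bool" where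
  "Dk_scalars n d k G c \<longleftrightarrow>
    (\<forall>h\<in>carrier G. rho n G c h (idm G c) \<longrightarrow>
      (\<exists>A. (\<forall>p. A p \<in> carrier G) \<and> rho n G c h A \<and> Dk n d G c k h A)) \<and>
    (\<forall>A. (\<forall>p. A p \<in> carrier G) \<longrightarrow> rho n G c \<one>\<^bsub>G\<^esub> A \<longrightarrow>
      (\<exists>h\<in>carrier G. rho n G c h A \<and> Dk n d G c k h A))"

context group_pair
begin

lemma dfn_rc_ring: "dfn (rc_ring n G) (rc_ring n H)"
  unfolding rc_ring_def[abs_def]
  by (intro dfn_conj dfn_all dfn_imp dfn_in_rc dfn_eq dtm_rmul dtm_mult dtm_inv dtm_one dtm_var)

lemma dfn_rho_group: "dfn (rho_group n d G) (rho_group n d H)"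
  unfolding rho_group_def[abs_def]
  by (intro dfn_conj dfn_all dfn_allf dfn_ex dfn_exf dfn_all_less dfn_imp dfn_const dfn_rho dfn_slR dfn_meq dfn_eq
      dtm_mm dtm_idm dtm_pow dtm_mult dtm_inv dtm_one dtm_var)

lemma dfn_Dk_faithful: "dfn (Dk_faithful n d k G) (Dk_faithful n d k H)"
  unfolding Dk_faithful_def[abs_def]
  by (intro dfn_conj dfn_all dfn_allf dfn_imp dfn_iff dfn_rho dfn_Dk dfn_meq dfn_eq dtm_idm dtm_one dtm_var)

lemma dfn_Dk_scalars: "dfn (Dk_scalars n d k G) (Dk_scalars n d k H)"
  unfolding Dk_scalars_def[abs_def]
  by (intro dfn_conj dfn_all dfn_allf dfn_ex dfn_exf dfn_imp dfn_iff dfn_rho dfn_Dk dfn_meq dfn_eq dtm_idm dtm_one dtm_var)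

end

text \<open>Multiplying by \<open>\<Sum>l<n. w l * v l\<close>, which is 1, exhibits the ratio of
  parallel vectors without division. With w a row of an inverse matrix the ratio therefore stays in
  the ring.\<close>

lemma parallel_scale:
  fixes u v w :: "nat \<Rightarrow> 'a::comm_ring_1"
  assumes "\<And>k l. k < n \<Longrightarrow> l < n \<Longrightarrow> u l * v k = u k * v l" "(\<Sum>l<n. w l * v l) = 1" "k < n"
  shows "u k = (\<Sum>l<n. w l * u l) * v k"
proof -
  have "u k = u k * (\<Sum>l<n. w l * v l)" using assms(2) by simp
  also have "\<dots> = (\<Sum>l<n. w l * (u k * v l))" by (simp add: sum_distrib_left mult.left_commute)
  also have "\<dots> = (\<Sum>l<n. w l * (u l * v k))" by (intro sum.cong refl) (simp add: assms(1)[OF assms(3)])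
  also have "\<dots> = (\<Sum>l<n. w l * u l) * v k" by (simp add: sum_distrib_right mult.assoc)
  finally show ?thesis .
qed

text \<open>Multiplication by z permutes M; comparing the products over M gives
  \<open>z ^ card M = 1\<close>. There are just as many such roots of unity as elements of
  M.\<close>

lemma finite_roots_subgroup:
  fixes M :: "complex set"
  assumes fin: "finite M" and one: "1 \<in> M" and mult: "\<And>x y. x \<in> M \<Longrightarrow> y \<in> M \<Longrightarrow> x * y \<in> M" and nz: "0 \<notin> M"
  shows "M = {z. z ^ card M = 1}"
proof (rule card_subset_eq[OF _ _ sym])
  have pos: "0 < card M" using fin one card_gt_0_iff by blast
  show "finite {z::complex. z ^ card M = 1}" using finite_roots_unity[of "card M"] pos by simp
  have "z ^ card M = 1" if z: "z \<in> M" for z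
  proof -
    have inj: "inj_on ((*) z) M" using z nz by (auto simp: inj_on_def)
    have im: "(*) z ` M = M"
      by (rule card_subset_eq[OF fin]) (use mult z card_image[OF inj] in auto)
    have "prod id M = prod id ((*) z ` M)" unfolding im ..
    also have "\<dots> = (\<Prod>x\<in>M. z * x)" using prod.reindex[OF inj, of id] by (simp add: o_def)
    also have "\<dots> = z ^ card M * prod id M" by (simp add: prod.distrib)
    finally have "(z ^ card M - 1) * prod id M = 0" by (simp add: algebra_simps)
    moreover have "prod id M \<noteq> 0" using nz fin by (simp add: prod_zero_iff)
    ultimately show ?thesis by simp
  qed
  then show "M \<subseteq> {z. z ^ card M = 1}" by blast
  show "card {z::complex. z ^ card M = 1} = card M" by (rule card_roots_unity_eq[OF pos])
qed

lemma complex_root_exists: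
  assumes "0 < m"
  shows "\<exists>u. u ^ m = (z::complex)"
proof -
  obtain r a where z: "z = rcis r a" "0 \<le> r" using rcis_Ex[of z] rcis_cmod_Arg[of z] by (metis norm_ge_zero)
  have "rcis (root m r) (a / real m) ^ m = z" unfolding DeMoivre2 z(1) using assms z(2) by simp
  then show ?thesis by blast
qed

definition dg :: "nat \<Rightarrow> (nat \<Rightarrow> complex) \<Rightarrow> complex mat" where
  "dg n f = mat n n (\<lambda>(i, j). if i = j then f i else 0)"

lemma dg_carrier [simp]: "dg n f \<in> carrier_mat n n"
  by (simp add: dg_def)

lemma dg_mult:
  assumes "A \<in> carrier_mat n n" "r < n" "s < n"
  shows "(dg n f * A) $$ (r, s) = f r * A $$ (r, s)"
proof -
  have "(dg n f * A) $$ (r, s) = (\<Sum>q<n. if q = r then f r * A $$ (r, s) else 0)"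
    unfolding mat_mult_index[OF dg_carrier assms] by (intro sum.cong) (use assms in \<open>auto simp: dg_def\<close>)
  then show ?thesis using assms by simp
qed

lemma mult_dg:
  assumes "A \<in> carrier_mat n n" "r < n" "s < n"
  shows "(A * dg n f) $$ (r, s) = A $$ (r, s) * f s"
proof -
  have "(A * dg n f) $$ (r, s) = (\<Sum>q<n. if q = s then A $$ (r, s) * f s else 0)"
    unfolding mat_mult_index[OF assms(1) dg_carrier assms(2,3)] by (intro sum.cong) (use assms in \<open>auto simp: dg_def\<close>)
  then show ?thesis using assms by simp
qed

lemma dg_dg: "dg n f * dg n g = dg n (\<lambda>i. f i * g i)"
proof (rule eq_matI)
  fix r s assume "r < dim_row (dg n (\<lambda>i. f i * g i))" "s < dim_col (dg n (\<lambda>i. f i * g i))"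
  then have rs: "r < n" "s < n" by (simp_all add: dg_def)
  show "(dg n f * dg n g) $$ (r, s) = dg n (\<lambda>i. f i * g i) $$ (r, s)"
    unfolding dg_mult[OF dg_carrier rs] using rs by (simp add: dg_def)
qed (simp_all add: dg_def)

lemma det_dg: "det (dg n f) = (\<Prod>i<n. f i)"
proof -
  have "det (dg n f) = prod_list (diag_mat (dg n f))"
    by (rule det_upper_triangular[of _ n]) (auto simp: upper_triangular_def dg_def)
  also have "diag_mat (dg n f) = map f [0..<n]" by (auto simp: diag_mat_def dg_def)
  finally show ?thesis by (simp add: prod.distinct_set_conv_list[symmetric] atLeast0LessThan)
qed

section \<open>Scalars and the relations \<open>rho\<close> and \<open>Dk\<close> in the standard
  case\<close>

context standard_elements
begin

definition mu :: "complex set" where "mu = {z \<in> S. z ^ n = 1}"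

definition d :: nat where "d = card mu"

lemma mu: "mu = {z. z ^ d = 1}" "0 < d"
proof -
  have fin: "finite mu"
    by (rule finite_subset[OF _ finite_roots_unity[of n]]) (use n_pos in \<open>auto simp: mu_def\<close>)
  have one: "1 \<in> mu" using one_S by (simp add: mu_def)
  show "mu = {z. z ^ d = 1}" unfolding d_def
  proof (rule finite_roots_subgroup[OF fin one])
    show "x * y \<in> mu" if "x \<in> mu" "y \<in> mu" for x y
      using that mult_S by (simp add: mu_def power_mult_distrib)
    show "0 \<notin> mu" using n_pos by (simp add: mu_def power_0_left)
  qed
  show "0 < d" using fin one card_gt_0_iff unfolding d_def by blast
qed

lemma muD: "z \<in> mu \<Longrightarrow> z \<in> S" "z \<in> mu \<Longrightarrow> z ^ n = 1" "z \<in> mu \<Longrightarrow> z ^ d = 1" "z \<in> mu \<Longrightarrow> z \<noteq> 0"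
  using mu n_pos by (auto simp: mu_def power_0_left)

lemma det_smult: "g \<in> carrier_mat n n \<Longrightarrow> det (z \<cdot>\<^sub>m g) = z ^ n * det g"
  using det_smult[of z g] by simp

lemma scale_G: "g \<in> carrier G \<Longrightarrow> z \<in> mu \<Longrightarrow> z \<cdot>\<^sub>m g \<in> carrier G"
  using GG_D[of g] muD[of z] det_smult[of g z] by (intro GG_I) (auto intro: mult_S)

lemma code_column:
  assumes aG: "a \<in> carrier G" and code: "code A a" and ij: "i < n" "j < n" "i \<noteq> j"
  shows "code (\<lambda>p. if snd p = j then A (fst p, j) \<otimes>\<^bsub>G\<^esub> A (fst p, i) else A p) (a * em n i j 1)"
  unfolding code_def
proof (intro conjI allI impI)
  note G = GG_mult_closed[OF aG em_G[OF ij one_S]]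
  show "a * em n i j 1 \<in> carrier_mat n n" by (rule GG_D(1)[OF G])
  fix r s assume rs: "r < n" "s < n"
  show "(a * em n i j 1) $$ (r, s) \<in> S" by (rule GG_D(2)[OF G rs])
  show "(if snd (r, s) = j then A (fst (r, s), j) \<otimes>\<^bsub>G\<^esub> A (fst (r, s), i) else A (r, s)) = e ((a * em n i j 1) $$ (r, s))"
    unfolding mult_em[OF GG_D(1)[OF aG] ij(1,2) rs]
    using codeD(3)[OF code rs] codeD(3)[OF code rs(1) ij(1)] by (cases "s = j") (simp_all add: e_add)
qed

text \<open>Each column of A is a multiple of that of h. Parallel sums of columns, together with the
  linear independence of the columns of h, make the ratio common; comparing determinants makes it an
  n-th root of unity.\<close>

lemma rho_iff:
  assumes h: "h \<in> carrier G"
  shows "rho n G c h A \<longleftrightarrow> (\<exists>z\<in>mu. code A (z \<cdot>\<^sub>m h))"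
proof
  assume "\<exists>z\<in>mu. code A (z \<cdot>\<^sub>m h)"
  then obtain z where z: "z \<in> mu" and code: "code A (z \<cdot>\<^sub>m h)" by blast
  let ?a = "z \<cdot>\<^sub>m h"
  have aG: "?a \<in> carrier G" by (rule scale_G[OF h z])
  have "parallel n G c (h \<otimes>\<^bsub>G\<^esub> c (i, j)) (\<lambda>p. if snd p = j then A (fst p, j) \<otimes>\<^bsub>G\<^esub> A (fst p, i) else A p)"
    if ij: "i < n" "j < n" "i \<noteq> j" for i j
  proof -
    have emG: "em n i j 1 \<in> carrier G" by (rule em_G[OF ij one_S])
    note c' = code_column[OF aG code ij]
    have sc: "?a * em n i j 1 = z \<cdot>\<^sub>m (h * em n i j 1)"
      by (rule mult_smult_assoc_mat[OF GG_D(1)[OF h] em_carrier])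
    show ?thesis
      unfolding c[OF ij] GG_mult[of h]
      unfolding parallel_iff[OF GG_mult_closed[OF h emG] c'] sc
      using GG_D(1)[OF GG_mult_closed[OF h emG]] by (simp del: index_mult_mat)
  qed
  then show "rho n G c h A" unfolding rho_def slR_iff using aG code by blast
next
  assume r: "rho n G c h A"
  then obtain a where aG: "a \<in> carrier G" and code: "code A a" unfolding rho_def slR_iff by blast
  note a = GG_D[OF aG] and hG = GG_D[OF h]
  have par: "(a * em n i j 1) $$ (l, q) * (h * em n i j 1) $$ (k, q) = (a * em n i j 1) $$ (k, q) * (h * em n i j 1) $$ (l, q)"
    if ij: "i < n" "j < n" "i \<noteq> j" and q: "q < n" "k < n" "l < n" for i j q k l
  proof -
    have emG: "em n i j 1 \<in> carrier G" by (rule em_G[OF ij one_S])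
    note c' = code_column[OF aG code ij]
    have "parallel n G c (h \<otimes>\<^bsub>G\<^esub> c (i, j)) (\<lambda>p. if snd p = j then A (fst p, j) \<otimes>\<^bsub>G\<^esub> A (fst p, i) else A p)"
      by (rule r[unfolded rho_def, THEN conjunct2, THEN spec, THEN mp, THEN spec, THEN mp, THEN mp]) fact+
    then show ?thesis
      unfolding c[OF ij] GG_mult[of h] parallel_iff[OF GG_mult_closed[OF h emG] c']
      using q by blast
  qed
  let ?w = "inv\<^bsub>G\<^esub> h"
  note wG = GG_D[OF GG_inv(1)[OF h]]
  have wh: "(\<Sum>l<n. ?w $$ (q, l) * h $$ (l, s)) = (if q = s then 1 else 0)" if "q < n" "s < n" for q s
    unfolding mat_mult_index[OF wG(1) hG(1) that, symmetric] GG_inv(2)[OF h] using that by simp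
  define z where "z q = (\<Sum>l<n. ?w $$ (q, l) * a $$ (l, q))" for q
  \<comment> \<open>Column q is not affected by an elementary matrix that adds it to another column
    j, so this instance of \<open>par\<close> compares the original columns.\<close>
  have az: "a $$ (k, q) = z q * h $$ (k, q)" if kq: "k < n" "q < n" for k q
    unfolding z_def
  proof (rule parallel_scale[OF _ _ kq(1)])
    show "(\<Sum>l<n. ?w $$ (q, l) * h $$ (l, q)) = 1" using wh[OF kq(2,2)] by simp
    fix k l assume kl: "k < n" "l < n"
    obtain j where j: "j < n" "j \<noteq> q" using third_index[OF n3] by blast
    show "a $$ (l, q) * h $$ (k, q) = a $$ (k, q) * h $$ (l, q)"
      using par[OF kq(2) j(1) j(2)[symmetric] kq(2) kl]
      unfolding mult_em[OF a(1) kq(2) j(1) kl(1) kq(2)] mult_em[OF a(1) kq(2) j(1) kl(2) kq(2)]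
        mult_em[OF hG(1) kq(2) j(1) kl(1) kq(2)] mult_em[OF hG(1) kq(2) j(1) kl(2) kq(2)]
      using j by simp
  qed
  \<comment> \<open>Row j of the inverse of h pairs to 1 with the sum of columns i and j of h, since
    it kills column i. The ratio of the sums is thus \<open>z j\<close>, and comparison in a row
    where column i is not zero gives \<open>z i = z j\<close>.\<close>
  have zz: "z i = z j" if ij: "i < n" "j < n" "i \<noteq> j" for i j
  proof -
    have *: "a $$ (k, j) + a $$ (k, i) = (\<Sum>l<n. ?w $$ (j, l) * (a $$ (l, j) + a $$ (l, i))) * (h $$ (k, j) + h $$ (k, i))"
      if k: "k < n" for k
    proof (rule parallel_scale[OF _ _ k])
      show "(\<Sum>l<n. ?w $$ (j, l) * (h $$ (l, j) + h $$ (l, i))) = 1"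
        using wh[OF ij(2,2)] wh[OF ij(2,1)] ij(3) by (simp add: algebra_simps sum.distrib)
      fix k l assume kl: "k < n" "l < n"
      show "(a $$ (l, j) + a $$ (l, i)) * (h $$ (k, j) + h $$ (k, i)) = (a $$ (k, j) + a $$ (k, i)) * (h $$ (l, j) + h $$ (l, i))"
        using par[OF ij ij(2) kl]
        unfolding mult_em[OF a(1) ij(1,2) kl(1) ij(2)] mult_em[OF a(1) ij(1,2) kl(2) ij(2)]
          mult_em[OF hG(1) ij(1,2) kl(1) ij(2)] mult_em[OF hG(1) ij(1,2) kl(2) ij(2)] by simp
    qed
    have "(\<Sum>l<n. ?w $$ (j, l) * a $$ (l, i)) = z i * (\<Sum>l<n. ?w $$ (j, l) * h $$ (l, i))"
      unfolding sum_distrib_left by (intro sum.cong) (use az ij in \<open>simp_all add: algebra_simps\<close>)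
    then have s: "(\<Sum>l<n. ?w $$ (j, l) * (a $$ (l, j) + a $$ (l, i))) = z j"
      using wh[OF ij(2,1)] ij(3) by (simp add: algebra_simps sum.distrib z_def)
    obtain k where k: "k < n" "h $$ (k, i) \<noteq> 0"
    proof (rule ccontr)
      assume "\<not> thesis"
      then have "h $$ (k, i) = 0" if "k < n" for k using that \<open>\<And>k. k < n \<Longrightarrow> h $$ (k, i) \<noteq> 0 \<Longrightarrow> thesis\<close> by blast
      then show False using wh[OF ij(1,1)] by simp
    qed
    have "z i * h $$ (k, i) = z j * h $$ (k, i)"
      using *[OF k(1)] unfolding s az[OF k(1) ij(1)] az[OF k(1) ij(2)] by (simp add: algebra_simps)
    then show ?thesis using k by simp
  qed
  have ah: "a = z 0 \<cdot>\<^sub>m h"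
  proof (rule eq_matI)
    fix r s assume "r < dim_row (z 0 \<cdot>\<^sub>m h)" "s < dim_col (z 0 \<cdot>\<^sub>m h)"
    then have rs: "r < n" "s < n" using hG by simp_all
    have "z s = z 0" using zz[OF rs(2) n_pos(1)] by (cases "s = 0") simp_all
    then show "a $$ (r, s) = (z 0 \<cdot>\<^sub>m h) $$ (r, s)" using az[OF rs] rs hG by simp
  qed (use a hG in simp_all)
  have "z 0 \<in> S" unfolding z_def by (intro sum_S mult_S wG(2) a(2)) (use n_pos in simp_all)
  moreover have "z 0 ^ n = 1" using a(3) unfolding ah det_smult[OF hG(1)] hG(3) by simp
  ultimately show "\<exists>z\<in>mu. code A (z \<cdot>\<^sub>m h)" using code unfolding ah mu_def by blast
qed

lemma smult_eq_cancel: "h \<in> carrier G \<Longrightarrow> x \<cdot>\<^sub>m h = y \<cdot>\<^sub>m h \<Longrightarrow> x = y"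
proof (rule ccontr)
  assume h: "h \<in> carrier G" and e: "x \<cdot>\<^sub>m h = y \<cdot>\<^sub>m h" and xy: "x \<noteq> y"
  note hG = GG_D[OF h]
  have "h $$ (r, s) = 0" if rs: "r < n" "s < n" for r s
  proof -
    have "(x \<cdot>\<^sub>m h) $$ (r, s) = (y \<cdot>\<^sub>m h) $$ (r, s)" unfolding e ..
    then show ?thesis using rs hG xy by simp
  qed
  then have "(h * inv\<^bsub>G\<^esub> h) $$ (0, 0) = 0"
    unfolding mat_mult_index[OF hG(1) GG_D(1)[OF GG_inv(1)[OF h]] n_pos(1) n_pos(1)] using n_pos by simp
  then show False unfolding GG_inv(3)[OF h] using n_pos by simp
qed

lemma code_unique: "code A a \<Longrightarrow> code A b \<Longrightarrow> a = b"
  using code_meq[of A a A b] by (simp add: meq_def)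

lemma smult_one_mat: "a \<in> carrier_mat n n \<Longrightarrow> (1 :: complex) \<cdot>\<^sub>m a = a"
  by (rule eq_matI) simp_all

lemma smult_mult: "a \<in> carrier_mat n n \<Longrightarrow> b \<in> carrier_mat n n \<Longrightarrow> (x \<cdot>\<^sub>m a) * (y \<cdot>\<^sub>m b) = (x * y :: complex) \<cdot>\<^sub>m (a * b)"
  by (intro eq_matI) (simp_all add: mult_smult_assoc_mat[of _ n n] mult_smult_distrib[of _ n n])

lemma smult_pow: "a \<in> carrier_mat n n \<Longrightarrow> (x \<cdot>\<^sub>m a) ^\<^sub>m k = (x ^ k :: complex) \<cdot>\<^sub>m (a ^\<^sub>m k)"
proof (induction k)
  case 0
  then show ?case by (intro eq_matI) simp_all
next
  case (Suc k)
  show ?case unfolding pow_mat.simps Suc(1)[OF Suc(2)] smult_mult[OF pow_carrier_mat[OF Suc(2)] Suc(2)] by (simp add: mult.commute)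
qed

text \<open>The unknown scalars of the factors cancel in a commutator and become 1 in a d-th power.
  So along such products the matrix is the one of h itself, not only up to a scalar.\<close>

lemma Dk_code: "h \<in> carrier G \<Longrightarrow> Dk n d G c k h A \<Longrightarrow> code A h"
proof (induction k arbitrary: h A)
  case 0
  then have "h = 1\<^sub>m n" "meq n (idm G c) A" by (auto simp: meq_def)
  then show ?case using code_cong[OF code_idm] by simp
next
  case (Suc k)
  from Suc.prems(2) obtain h1 h2 h' h3 A1 A2 A' A3 where
    G: "h1 \<in> carrier G" "h2 \<in> carrier G" "h' \<in> carrier G" "h3 \<in> carrier G" and
    rho: "rho n G c h1 A1" "rho n G c h2 A2" "rho n G c h' A'" and
    D: "Dk n d G c k h3 A3" and h: "h = h' \<otimes>\<^bsub>G\<^esub> h3" and A: "meq n A (mm G c n A' A3)" and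
    basic: "h' \<otimes>\<^bsub>G\<^esub> (h2 \<otimes>\<^bsub>G\<^esub> h1) = h1 \<otimes>\<^bsub>G\<^esub> h2 \<and> meq n (mm G c n A' (mm G c n A2 A1)) (mm G c n A1 A2) \<or>
      h' = h1 [^]\<^bsub>G\<^esub> d \<and> meq n A' (mpow G c n A1 d)"
    unfolding Dk.simps by (elim bexE exE conjE) (rule that)
  obtain z1 z2 z' where z: "z1 \<in> mu" "z2 \<in> mu" "z' \<in> mu" and
    code: "code A1 (z1 \<cdot>\<^sub>m h1)" "code A2 (z2 \<cdot>\<^sub>m h2)" "code A' (z' \<cdot>\<^sub>m h')"
    using rho unfolding rho_iff[OF G(1)] rho_iff[OF G(2)] rho_iff[OF G(3)] by blast
  note m = GG_D(1)[OF G(1)] GG_D(1)[OF G(2)] GG_D(1)[OF G(3)]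
  have "z' = 1"
    using basic
  proof
    assume b: "h' \<otimes>\<^bsub>G\<^esub> (h2 \<otimes>\<^bsub>G\<^esub> h1) = h1 \<otimes>\<^bsub>G\<^esub> h2 \<and> meq n (mm G c n A' (mm G c n A2 A1)) (mm G c n A1 A2)"
    have "(z' \<cdot>\<^sub>m h') * ((z2 \<cdot>\<^sub>m h2) * (z1 \<cdot>\<^sub>m h1)) = (z1 \<cdot>\<^sub>m h1) * (z2 \<cdot>\<^sub>m h2)"
      using b code_meq[OF code_mm[OF code(3) code_mm[OF code(2,1)]] code_mm[OF code(1,2)]] by blast
    then have "(z' * (z2 * z1)) \<cdot>\<^sub>m (h' * (h2 * h1)) = (z1 * z2) \<cdot>\<^sub>m (h1 * h2)"
      unfolding smult_mult[OF m(2,1)] smult_mult[OF m(1,2)] smult_mult[OF m(3) mult_carrier_mat[OF m(2,1)]] .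
    then have "(z' * (z2 * z1)) \<cdot>\<^sub>m (h1 * h2) = (z1 * z2) \<cdot>\<^sub>m (h1 * h2)" using b by simp
    then have "z' * (z2 * z1) = z1 * z2" by (rule smult_eq_cancel[OF GG_mult_closed[OF G(1,2)]])
    then show ?thesis using muD(4)[OF z(1)] muD(4)[OF z(2)] by simp
  next
    assume b: "h' = h1 [^]\<^bsub>G\<^esub> d \<and> meq n A' (mpow G c n A1 d)"
    have "z' \<cdot>\<^sub>m h' = (z1 \<cdot>\<^sub>m h1) ^\<^sub>m d" using b code_meq[OF code(3) code_mpow[OF code(1)]] by blast
    then have "z' \<cdot>\<^sub>m h' = 1 \<cdot>\<^sub>m h'" unfolding smult_pow[OF m(1)] muD(3)[OF z(1)] using b GG_pow[OF G(1), of d] by simp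
    then show ?thesis by (rule smult_eq_cancel[OF G(3)])
  qed
  then have "code A' h'" using code(3) smult_one_mat[OF m(3)] by simp
  then have "code (mm G c n A' A3) h" using code_mm Suc.IH[OF G(4) D] unfolding h by simp
  then show ?case by (rule code_cong) (use A in \<open>simp add: meq_def\<close>)
qed

end

lemma meq_sym: "meq n A B \<Longrightarrow> meq n B A" and meq_trans: "meq n A B \<Longrightarrow> meq n B C \<Longrightarrow> meq n A C"
  by (simp_all add: meq_def)

lemma Dk_meq:
  assumes "Dk n d G c k h A" "meq n A B"
  shows "Dk n d G c k h B"
proof (cases k)
  case 0
  then show ?thesis using assms meq_trans[OF meq_sym[OF assms(2)]] by simp
next
  case (Suc k')
  show ?thesis using assms(1) unfolding Suc Dk.simps
    by (elim bexE exE conjE, intro bexI exI conjI) (assumption | rule meq_trans[OF meq_sym[OF assms(2)]])+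
qed

context standard_elements
begin

lemma rc_ring: "rc_ring n G c"
proof -
  have c01: "c (0, 1) = e 1" using c[of 0 1] n_pos by simp
  have oneG: "\<one>\<^bsub>G\<^esub> = e 0" by (simp add: em_zero)
  have mulG: "a \<otimes>\<^bsub>G\<^esub> b = a * b" for a b by simp
  have inv: "inv\<^bsub>G\<^esub> (e b) = e (- b)" if "b \<in> S" for b using em_inv[of 0 "Suc 0" b] that n_pos by simp
  have rc: "in_rc n G c (e b)" if "b \<in> S" for b using that in_rc_iff by blast
  show ?thesis unfolding rc_ring_def c01 oneG mulG
  proof (intro conjI ballI impI)
    fix x assume "in_rc n G c x"
    then obtain a where a: "a \<in> S" "x = e a" using in_rc_iff by blast
    show "in_rc n G c (inv\<^bsub>G\<^esub> x)" unfolding a(2) inv[OF a(1)] by (rule rc[OF uminus_S[OF a(1)]])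
    show "rmul G c (e 1) x = x" unfolding a(2) rmul_e[OF one_S a(1)] by simp
    fix y assume "in_rc n G c y"
    then obtain b where b: "b \<in> S" "y = e b" using in_rc_iff by blast
    show "in_rc n G c (x * y)" unfolding a(2) b(2) e_add by (rule rc[OF add_S[OF a(1) b(1)]])
    show "in_rc n G c (rmul G c x y)" unfolding a(2) b(2) rmul_e[OF a(1) b(1)] by (rule rc[OF mult_S[OF a(1) b(1)]])
    show "x * y = y * x" unfolding a(2) b(2) e_add by (simp add: add.commute)
    show "rmul G c x y = rmul G c y x" unfolding a(2) b(2) rmul_e[OF a(1) b(1)] rmul_e[OF b(1) a(1)] by (simp add: mult.commute)
    fix z assume "in_rc n G c z"
    then obtain z' where z: "z' \<in> S" "z = e z'" using in_rc_iff by blast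
    show "rmul G c (rmul G c x y) z = rmul G c x (rmul G c y z)"
      unfolding a(2) b(2) z(2) rmul_e[OF a(1) b(1)] rmul_e[OF b(1) z(1)] rmul_e[OF mult_S[OF a(1) b(1)] z(1)]
        rmul_e[OF a(1) mult_S[OF b(1) z(1)]] by (simp add: mult.assoc)
    show "rmul G c (x * y) z = rmul G c x z * rmul G c y z"
      unfolding a(2) b(2) z(2) e_add rmul_e[OF a(1) z(1)] rmul_e[OF b(1) z(1)] rmul_e[OF add_S[OF a(1) b(1)] z(1)]
      by (simp add: algebra_simps)
  qed (rule rc, rule one_S zero_S)+
qed

lemma scalar_G: "z \<in> mu \<Longrightarrow> z \<cdot>\<^sub>m 1\<^sub>m n \<in> carrier G"
  using scale_G[OF GG.one_closed] by simp

lemma one_mu: "1 \<in> mu"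
  unfolding mu by simp

lemma inverse_mu: "z \<in> mu \<Longrightarrow> inverse z \<in> mu"
  unfolding mu by (simp add: power_inverse)

lemma mult_mu: "x \<in> mu \<Longrightarrow> y \<in> mu \<Longrightarrow> x * y \<in> mu"
  unfolding mu by (simp add: power_mult_distrib)

lemma smult_smult: "x \<cdot>\<^sub>m (y \<cdot>\<^sub>m a) = (x * y :: complex) \<cdot>\<^sub>m a"
  by (rule eq_matI) simp_all

lemma rho_idm:
  assumes h: "h \<in> carrier G"
  shows "rho n G c h (idm G c) \<longleftrightarrow> (\<exists>z\<in>mu. h = z \<cdot>\<^sub>m 1\<^sub>m n)"
proof
  assume "rho n G c h (idm G c)"
  then obtain z where z: "z \<in> mu" "code (idm G c) (z \<cdot>\<^sub>m h)" unfolding rho_iff[OF h] by blast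
  have "z \<cdot>\<^sub>m h = 1\<^sub>m n" by (rule code_unique[OF z(2) code_idm])
  then have "inverse z \<cdot>\<^sub>m (z \<cdot>\<^sub>m h) = inverse z \<cdot>\<^sub>m 1\<^sub>m n" by simp
  then have "h = inverse z \<cdot>\<^sub>m 1\<^sub>m n"
    unfolding smult_smult using smult_one_mat[OF GG_D(1)[OF h]] muD(4)[OF z(1)] by simp
  then show "\<exists>z\<in>mu. h = z \<cdot>\<^sub>m 1\<^sub>m n" using inverse_mu[OF z(1)] by blast
next
  assume "\<exists>z\<in>mu. h = z \<cdot>\<^sub>m 1\<^sub>m n"
  then obtain z where z: "z \<in> mu" "h = z \<cdot>\<^sub>m 1\<^sub>m n" by blast
  have "inverse z \<cdot>\<^sub>m h = 1\<^sub>m n"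
    unfolding z(2) smult_smult using smult_one_mat[OF one_carrier_mat] muD(4)[OF z(1)] by simp
  then show "rho n G c h (idm G c)" unfolding rho_iff[OF h] using code_idm inverse_mu[OF z(1)] by (intro bexI[of _ "inverse z"]) simp_all
qed

lemma rho_self: "h \<in> carrier G \<Longrightarrow> code A h \<Longrightarrow> rho n G c h A"
  unfolding rho_iff using one_mu smult_one_mat[OF GG_D(1)] by (intro bexI[of _ 1]) simp_all

lemma rho_group: "rho_group n d G c"
  unfolding rho_group_def
proof (intro conjI ballI allI impI)
  show "rho n G c \<one>\<^bsub>G\<^esub> (idm G c)"
    by (rule rho_self[OF GG.one_closed]) (simp add: code_idm)
  show "\<exists>A. (\<forall>p. A p \<in> carrier G) \<and> rho n G c h A" if h: "h \<in> carrier G" for h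
    by (intro exI[of _ "cf h"] conjI allI cf_G rho_self[OF h] code_G[OF h] GG_D(2)[OF h])
next
  fix A assume "slR n G c A"
  then obtain a where a: "a \<in> carrier G" "code A a" unfolding slR_iff by blast
  show "\<exists>h\<in>carrier G. rho n G c h A" using rho_self[OF a] a by blast
  show "meq n (mm G c n (idm G c) A) A"
    unfolding code_meq[OF code_mm[OF code_idm a(2)] a(2)] using GG_D(1)[OF a(1)] by simp
  fix B assume "slR n G c B"
  then obtain b where b: "b \<in> carrier G" "code B b" unfolding slR_iff by blast
  fix C assume "slR n G c C"
  then obtain g where g: "g \<in> carrier G" "code C g" unfolding slR_iff by blast
  show "meq n (mm G c n (mm G c n A B) C) (mm G c n A (mm G c n B C))"
    unfolding code_meq[OF code_mm[OF code_mm[OF a(2) b(2)] g(2)] code_mm[OF a(2) code_mm[OF b(2) g(2)]]]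
    by (rule assoc_mult_mat[OF GG_D(1)[OF a(1)] GG_D(1)[OF b(1)] GG_D(1)[OF g(1)]])
next
  fix h A assume h: "h \<in> carrier G" and "rho n G c h A"
  then obtain z where z: "z \<in> mu" "code A (z \<cdot>\<^sub>m h)" unfolding rho_iff[OF h] by blast
  note zh = scale_G[OF h z(1)]
  have w: "inv\<^bsub>G\<^esub> h \<in> carrier G" by (rule GG.inv_closed[OF h])
  let ?b = "inverse z \<cdot>\<^sub>m inv\<^bsub>G\<^esub> h"
  have bG: "?b \<in> carrier G" by (rule scale_G[OF w inverse_mu[OF z(1)]])
  show "\<exists>B. (\<forall>p. B p \<in> carrier G) \<and> rho n G c (inv\<^bsub>G\<^esub> h) B \<and> meq n (mm G c n B A) (idm G c)"
  proof (intro exI[of _ "cf ?b"] conjI allI)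
    show "cf ?b p \<in> carrier G" for p by (rule cf_G[OF GG_D(2)[OF bG]])
    show "rho n G c (inv\<^bsub>G\<^esub> h) (cf ?b)" unfolding rho_iff[OF w] using inverse_mu[OF z(1)] code_G[OF bG] by blast
    show "meq n (mm G c n (cf ?b) A) (idm G c)"
      unfolding code_meq[OF code_mm[OF code_G[OF bG] z(2)] code_idm] smult_mult[OF GG_D(1)[OF w] GG_D(1)[OF h]] GG_inv(2)[OF h]
      using muD(4)[OF z(1)] smult_one_mat[OF one_carrier_mat] by simp
  qed
  show "rho n G c h B" if "meq n A B" for B
    unfolding rho_iff[OF h] using z(1) code_cong[OF z(2) that] by blast
  fix h' B assume h': "h' \<in> carrier G" and "rho n G c h' B"
  then obtain z' where z': "z' \<in> mu" "code B (z' \<cdot>\<^sub>m h')" unfolding rho_iff[OF h'] by blast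
  have hh: "h \<otimes>\<^bsub>G\<^esub> h' \<in> carrier G" by (rule GG.m_closed[OF h h'])
  show "rho n G c (h \<otimes>\<^bsub>G\<^esub> h') (mm G c n A B)"
    unfolding rho_iff[OF hh]
    using code_mm[OF z(2) z'(2)] mult_mu[OF z(1) z'(1)] unfolding smult_mult[OF GG_D(1)[OF h] GG_D(1)[OF h']]
    by (intro bexI[of _ "z * z'"]) simp_all
next
  fix m x assume m: "m < Suc d" "m dvd d" and xG: "x \<in> carrier G" and x: "rho n G c x (idm G c)"
    and xm: "x [^]\<^bsub>G\<^esub> (d div m) = \<one>\<^bsub>G\<^esub>"
  have m0: "0 < m" using m mu(2) by (intro Nat.gr0I) simp
  obtain z where z: "z \<in> mu" "x = z \<cdot>\<^sub>m 1\<^sub>m n" using x unfolding rho_idm[OF xG] by blast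
  have pw: "(w \<cdot>\<^sub>m 1\<^sub>m n) ^\<^sub>m k = w ^ k \<cdot>\<^sub>m 1\<^sub>m n" for w :: complex and k

  proof -
    have "1\<^sub>m n ^\<^sub>m k = (1\<^sub>m n :: complex mat)" by (induction k) simp_all
    then show ?thesis unfolding smult_pow[OF one_carrier_mat] by simp
  qed
  have "z ^ (d div m) \<cdot>\<^sub>m 1\<^sub>m n = 1 \<cdot>\<^sub>m 1\<^sub>m n"
    using xm[unfolded GG_pow[OF xG]] unfolding z(2) pw using smult_one_mat[OF one_carrier_mat] by simp
  then have zd: "z ^ (d div m) = 1" by (rule smult_eq_cancel[OF GG.one_closed[unfolded GG_one]])
  \<comment> \<open>A complex root suffices: its d-th power is \<open>z^(d/m) = 1\<close>, and all
    complex d-th roots of unity lie in \<open>mu\<close>.\<close>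
  obtain u where u: "u ^ m = z" using complex_root_exists[OF m0] by blast
  have "u ^ d = (u ^ m) ^ (d div m)" using m by (simp add: power_mult[symmetric])
  then have umu: "u \<in> mu" unfolding mu u zd by simp
  show "\<exists>u\<in>carrier G. rho n G c u (idm G c) \<and> u [^]\<^bsub>G\<^esub> m = x"
  proof (rule bexI[OF _ scalar_G[OF umu]], rule conjI)
    show "rho n G c (u \<cdot>\<^sub>m 1\<^sub>m n) (idm G c)" unfolding rho_idm[OF scalar_G[OF umu]] using umu by blast
    show "(u \<cdot>\<^sub>m 1\<^sub>m n) [^]\<^bsub>G\<^esub> m = x" unfolding GG_pow[OF scalar_G[OF umu]] pw u z(2) ..
  qed
qed

lemma Dk_faithful: "Dk_faithful n d k G c"
  unfolding Dk_faithful_def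
proof (intro ballI allI impI)
  fix h A assume h: "h \<in> carrier G" and D: "Dk n d G c k h A"
  show "h = \<one>\<^bsub>G\<^esub> \<longleftrightarrow> meq n A (idm G c)"
    unfolding code_meq[OF Dk_code[OF h D] code_idm] by simp
qed

section \<open>Scalar matrices as products of n - 1 commutators\<close>

lemma dg_G: "(\<And>i. i < n \<Longrightarrow> f i \<in> S) \<Longrightarrow> (\<Prod>i<n. f i) = 1 \<Longrightarrow> dg n f \<in> carrier G"
  by (rule GG_I) (auto simp: det_dg, auto simp: dg_def zero_S)

text \<open>The usual Weyl element for the indices i and j, a signed transposition.\<close>

definition wm :: "nat \<Rightarrow> nat \<Rightarrow> complex mat" where
  "wm i j = em n i j 1 * (em n j i (-1) * em n i j 1)"

lemma wm_G: "i < n \<Longrightarrow> j < n \<Longrightarrow> i \<noteq> j \<Longrightarrow> wm i j \<in> carrier G"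
  unfolding wm_def by (intro GG_mult_closed em_G one_S uminus_S) auto

lemma wm_entries:
  assumes ij: "i < n" "j < n" "i \<noteq> j" and rs: "r < n" "s < n"
  shows "wm i j $$ (r, s) = (if r = i \<and> s = j then 1 else if r = j \<and> s = i then -1
    else if r = s \<and> r \<noteq> i \<and> r \<noteq> j then 1 else 0)"
proof -
  have 1: "em n j i (-1) * em n i j 1 \<in> carrier_mat n n" by (rule mult_carrier_mat[OF em_carrier em_carrier])
  show ?thesis
    unfolding wm_def em_mult[OF 1 ij(1,2) rs] em_mult[OF em_carrier ij(2,1) rs] em_mult[OF em_carrier ij(2,1) ij(2) rs(2)]
    using assms by (auto simp: em_index)
qed

definition sw :: "nat \<Rightarrow> nat \<Rightarrow> complex \<Rightarrow> nat \<Rightarrow> complex" where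
  "sw i p z = (\<lambda>k. if k = i then z else if k = p then inverse z else 1)"

lemma prod_sw: "i < n \<Longrightarrow> p < n \<Longrightarrow> i \<noteq> p \<Longrightarrow> z \<noteq> 0 \<Longrightarrow> (\<Prod>k<n. sw i p z k) = 1"
proof -
  assume a: "i < n" "p < n" "i \<noteq> p" "z \<noteq> 0"
  have "(\<Prod>k<n. sw i p z k) = (\<Prod>k<n. (if k = i then z else 1) * (if k = p then inverse z else 1))"
    by (rule prod.cong) (use a in \<open>auto simp: sw_def\<close>)
  then show ?thesis using a by (simp add: prod.distrib)
qed

text \<open>Conjugation by the Weyl element moves the entry z from i to j. The quotient of the
  matrices with z at i and with z at j has z at i and its inverse at j, and the index p
  cancels.\<close>

lemma sw_commutator:
  assumes "i < n" "j < n" "p < n" "i \<noteq> j" "i \<noteq> p" "j \<noteq> p" "z \<noteq> 0"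
  shows "dg n (sw i j z) * (wm i j * dg n (sw i p z)) = dg n (sw i p z) * wm i j"
proof (rule eq_matI)
  note W = GG_D(1)[OF wm_G[OF assms(1,2,4)]]
  fix r s assume "r < dim_row (dg n (sw i p z) * wm i j)" "s < dim_col (dg n (sw i p z) * wm i j)"
  then have rs: "r < n" "s < n" using W by (simp_all add: dg_def)
  show "(dg n (sw i j z) * (wm i j * dg n (sw i p z))) $$ (r, s) = (dg n (sw i p z) * wm i j) $$ (r, s)"
    unfolding dg_mult[OF mult_carrier_mat[OF W dg_carrier] rs] mult_dg[OF W rs] dg_mult[OF W rs]
      wm_entries[OF assms(1,2,4) rs]
    using assms by (auto simp: sw_def)
qed (use GG_D(1)[OF wm_G[OF assms(1,2,4)]] in \<open>simp_all add: dg_def\<close>)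

lemma Dk_Suc_commutator:
  assumes G: "h1 \<in> carrier G" "h2 \<in> carrier G" "h' \<in> carrier G" "h3 \<in> carrier G"
    and eq: "h' * (h2 * h1) = h1 * h2" and D: "Dk n d G c k h3 (cf h3)"
  shows "Dk n d G c (Suc k) (h' * h3) (cf (h' * h3))"
proof -
  note cd = code_G[OF G(1)] code_G[OF G(2)] code_G[OF G(3)] code_G[OF G(4)]
  have cG: "\<forall>p. cf h p \<in> carrier G" if "h \<in> carrier G" for h
    by (intro allI cf_G GG_D(2)[OF that])
  have b: "h' \<otimes>\<^bsub>G\<^esub> (h2 \<otimes>\<^bsub>G\<^esub> h1) = h1 \<otimes>\<^bsub>G\<^esub> h2 \<and> meq n (mm G c n (cf h') (mm G c n (cf h2) (cf h1))) (mm G c n (cf h1) (cf h2))"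
    unfolding code_meq[OF code_mm[OF cd(3) code_mm[OF cd(2,1)]] code_mm[OF cd(1,2)]] GG_mult using eq by blast
  have e: "meq n (cf (h' * h3)) (mm G c n (cf h') (cf h3))"
    unfolding code_meq[OF code_G[OF GG_mult_closed[OF G(3,4)]] code_mm[OF cd(3,4)]] ..
  show ?thesis unfolding Dk.simps
    by (rule bexI[OF _ G(1)], rule bexI[OF _ G(2)], rule bexI[OF _ G(3)], rule bexI[OF _ G(4)],
      rule exI, rule conjI[OF cG[OF G(1)]], rule exI, rule conjI[OF cG[OF G(2)]], rule exI, rule conjI[OF cG[OF G(3)]],
      rule exI, rule conjI[OF cG[OF G(4)]], rule conjI[OF rho_self[OF G(1) cd(1)]], rule conjI[OF rho_self[OF G(2) cd(2)]],
      rule conjI[OF rho_self[OF G(3) cd(3)]], rule conjI[OF rho_self[OF G(4) cd(4)]], rule conjI[OF D], rule conjI[OF GG_mult[symmetric]],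
      rule conjI[OF e], rule disjI1, rule b)
qed

text \<open>For each m < n - 1 one commutator puts z at m and its inverse at the last position.
  After all of them the last entry is the inverse of \<open>z^(n-1)\<close>, which equals z because
  \<open>z^n = 1\<close>.\<close>

lemma Dk_scalar:
  assumes z: "z \<in> mu"
  shows "Dk n d G c (n - 1) (z \<cdot>\<^sub>m 1\<^sub>m n) (cf (z \<cdot>\<^sub>m 1\<^sub>m n))"
proof -
  define p where "p = n - 1"
  have p: "p < n" "Suc p = n" using n_pos by (simp_all add: p_def)
  \<comment> \<open>The diagonal of the partial product of the first m factors; the last position p
    accumulates the inverses.\<close>
  define f where "f m k = (if k < m then z else if k = p then inverse z ^ m else 1)" for m k :: nat
  note z0 = muD(4)[OF z]
  have iS: "inverse z \<in> S" using muD(1)[OF inverse_mu[OF z]] .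
  have swG: "dg n (sw i j z) \<in> carrier G" if "i < n" "j < n" "i \<noteq> j" for i j
    by (rule dg_G[OF _ prod_sw[OF that z0]]) (use muD(1)[OF z] iS one_S in \<open>simp add: sw_def\<close>)
  have "m \<le> p \<Longrightarrow> dg n (f m) \<in> carrier G \<and> Dk n d G c m (dg n (f m)) (cf (dg n (f m)))" for m
  proof (induction m)
    case 0
    have "dg n (f 0) = 1\<^sub>m n" by (rule eq_matI) (simp_all add: dg_def f_def)
    then show ?case
      using GG.one_closed code_meq[OF code_G[OF GG.one_closed] code_idm] by simp
  next
    case (Suc m)
    then have m: "m < p" "m < n" "m \<noteq> p" using p by simp_all
    then have IH: "dg n (f m) \<in> carrier G" "Dk n d G c m (dg n (f m)) (cf (dg n (f m)))" using Suc by simp_all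
    obtain j where j: "j < n" "j \<noteq> m" "j \<noteq> p" using third_index[OF n3] by blast
    have eq: "dg n (sw m p z) * (wm m p * dg n (sw m j z)) = dg n (sw m j z) * wm m p"
      by (rule sw_commutator) (use m p j z0 in simp_all)
    have f: "dg n (sw m p z) * dg n (f m) = dg n (f (Suc m))"
      unfolding dg_dg by (rule arg_cong[of _ _ "dg n"]) (use m in \<open>auto simp: sw_def f_def fun_eq_iff\<close>)
    have G: "dg n (sw m p z) \<in> carrier G" "wm m p \<in> carrier G" "dg n (sw m j z) \<in> carrier G"
      using swG wm_G m p j by auto
    show ?case
      using Dk_Suc_commutator[OF G(3,2,1) IH(1) eq IH(2)] GG_mult_closed[OF G(1) IH(1)] unfolding f by blast
  qed
  from this[of p] have "Dk n d G c p (dg n (f p)) (cf (dg n (f p)))" by simp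
  moreover have "dg n (f p) = z \<cdot>\<^sub>m 1\<^sub>m n"
  proof (rule eq_matI)
    have "z * z ^ p = 1" using muD(2)[OF z] p(2) by (metis power_Suc)
    then have "inverse z ^ p = z" using z0 by (simp add: field_simps)
    then show "dg n (f p) $$ (r, s) = (z \<cdot>\<^sub>m 1\<^sub>m n) $$ (r, s)"
      if "r < dim_row (z \<cdot>\<^sub>m 1\<^sub>m n)" "s < dim_col (z \<cdot>\<^sub>m 1\<^sub>m n)" for r s
      using that p by (auto simp: dg_def f_def)
  qed (simp_all add: dg_def)
  ultimately show ?thesis by (simp add: p_def)
qed

lemma Dk_scalars: "Dk_scalars n d (n - 1) G c"
  unfolding Dk_scalars_def
proof (intro conjI ballI allI impI)
  fix h assume h: "h \<in> carrier G" and "rho n G c h (idm G c)"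
  then obtain z where z: "z \<in> mu" "h = z \<cdot>\<^sub>m 1\<^sub>m n" using rho_idm[OF h] by blast
  show "\<exists>A. (\<forall>p. A p \<in> carrier G) \<and> rho n G c h A \<and> Dk n d G c (n - 1) h A"
    by (intro exI[of _ "cf h"] conjI allI cf_G[OF GG_D(2)[OF h]] rho_self[OF h code_G[OF h]])
      (use Dk_scalar[OF z(1)] z(2) in simp_all)
next
  fix A assume "rho n G c \<one>\<^bsub>G\<^esub> A"
  then obtain z where z: "z \<in> mu" "code A (z \<cdot>\<^sub>m 1\<^sub>m n)" unfolding rho_iff[OF GG.one_closed] by auto
  note h = scalar_G[OF z(1)]
  have m: "meq n (cf (z \<cdot>\<^sub>m 1\<^sub>m n)) A" unfolding code_meq[OF code_G[OF h] z(2)] ..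
  show "\<exists>h\<in>carrier G. rho n G c h A \<and> Dk n d G c (n - 1) h A"
    using rho_self[OF h z(2)] Dk_meq[OF Dk_scalar[OF z(1)] m] h by blast
qed

lemma e_ring_iso: "e \<in> ring_iso (ring_on S) (RR n G c)"
proof (rule ring_iso_memI)
  show "e x \<in> carrier (RR n G c)" if "x \<in> carrier (ring_on S)" for x
    using that in_rc_iff e_G by (auto simp: RR_def)
  show "bij_betw e (carrier (ring_on S)) (carrier (RR n G c))"
    unfolding bij_betw_def using in_rc_iff e_G by (auto simp: RR_def inj_on_def e_inj)
qed (use c[of 0 1] n_pos in \<open>simp_all add: RR_def rmul_e e_add\<close>)

end

section \<open>Splitting off the central part\<close>

context group
begin

text \<open>Graded by the number of factors in order to match \<open>Dk\<close>, where the number of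
  factors has to be fixed.\<close>

primrec commutator_powers :: "nat \<Rightarrow> nat \<Rightarrow> 'a set" where
  "commutator_powers d 0 = {\<one>}"
| "commutator_powers d (Suc k) = {b \<otimes> x | b x. x \<in> commutator_powers d k \<and> b \<in> carrier G \<and>
    (\<exists>x1\<in>carrier G. \<exists>x2\<in>carrier G. b \<otimes> (x2 \<otimes> x1) = x1 \<otimes> x2 \<or> b = x1 [^] d)}"

lemma commutator_powers_closed: "x \<in> commutator_powers d k \<Longrightarrow> x \<in> carrier G"
  by (induction k arbitrary: x) auto

lemma commutator_powers_mult:
  "x \<in> commutator_powers d k \<Longrightarrow> y \<in> commutator_powers d l \<Longrightarrow> x \<otimes> y \<in> commutator_powers d (k + l)"
proof (induction k arbitrary: x)
  case 0
  then show ?case using commutator_powers_closed by simp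
next
  case (Suc k)
  from Suc.prems(1) obtain b x' where b: "x = b \<otimes> x'" "x' \<in> commutator_powers d k" "b \<in> carrier G"
    "\<exists>x1\<in>carrier G. \<exists>x2\<in>carrier G. b \<otimes> (x2 \<otimes> x1) = x1 \<otimes> x2 \<or> b = x1 [^] d"
    unfolding commutator_powers.simps by blast
  have "x \<otimes> y = b \<otimes> (x' \<otimes> y)"
    unfolding b(1) using b(2,3) commutator_powers_closed Suc.prems(2) by (intro m_assoc) auto
  then show ?case using b(3,4) Suc.IH[OF b(2) Suc.prems(2)] unfolding add_Suc commutator_powers.simps by blast
qed

lemma commutator_powers_1:
  assumes "b \<in> carrier G" "x1 \<in> carrier G" "x2 \<in> carrier G" "b \<otimes> (x2 \<otimes> x1) = x1 \<otimes> x2 \<or> b = x1 [^] d"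
  shows "b \<in> commutator_powers d (Suc 0)"
proof -
  have "b = b \<otimes> \<one>" using assms(1) by simp
  then show ?thesis unfolding commutator_powers.simps using assms by blast
qed

text \<open>The inverse of a commutator is the commutator in the opposite order, and that of a d-th
  power is a d-th power; reversing the product keeps the number of factors.\<close>

lemma commutator_powers_inv: "x \<in> commutator_powers d k \<Longrightarrow> inv x \<in> commutator_powers d k"
proof (induction k arbitrary: x)
  case (Suc k)
  from Suc.prems(1) obtain b y x1 x2 where b: "x = b \<otimes> y" "y \<in> commutator_powers d k" "b \<in> carrier G"
    and x: "x1 \<in> carrier G" "x2 \<in> carrier G" "b \<otimes> (x2 \<otimes> x1) = x1 \<otimes> x2 \<or> b = x1 [^] d"
    unfolding commutator_powers.simps by blast
  have "inv b \<in> commutator_powers d (Suc 0)"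
    using x(3)
  proof
    assume e: "b \<otimes> (x2 \<otimes> x1) = x1 \<otimes> x2"
    have "inv b \<otimes> (x1 \<otimes> x2) = x2 \<otimes> x1" unfolding e[symmetric] using b(3) x by (simp add: m_assoc[symmetric])
    then show ?thesis using b(3) x by (intro commutator_powers_1[of _ x2 x1]) simp_all
  next
    assume "b = x1 [^] d"
    then have "inv b = inv x1 [^] d" using x by (simp add: nat_pow_inv)
    then show ?thesis using b(3) x by (intro commutator_powers_1[of _ "inv x1" x2]) simp_all
  qed
  from commutator_powers_mult[OF Suc.IH[OF b(2)] this]
  have "inv y \<otimes> inv b \<in> commutator_powers d (Suc k)" unfolding add_Suc_right add_0_right .
  moreover have "inv x = inv y \<otimes> inv b"
    unfolding b(1) using b(2,3) commutator_powers_closed by (intro inv_mult_group) auto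
  ultimately show ?case by argo
qed simp

lemma commutator_powers_subgroup: "subgroup (\<Union>k. commutator_powers d k) G"
proof (rule subgroupI)
  show "(\<Union>k. commutator_powers d k) \<subseteq> carrier G" using commutator_powers_closed by blast
  have "\<one> \<in> commutator_powers d 0" by simp
  then show "(\<Union>k. commutator_powers d k) \<noteq> {}" by blast
  show "inv a \<in> (\<Union>k. commutator_powers d k)" if "a \<in> (\<Union>k. commutator_powers d k)" for a
  proof -
    obtain k where "a \<in> commutator_powers d k" using \<open>a \<in> _\<close> by blast
    from commutator_powers_inv[OF this] show ?thesis by blast
  qed
  show "a \<otimes> b \<in> (\<Union>k. commutator_powers d k)" if "a \<in> (\<Union>k. commutator_powers d k)" "b \<in> (\<Union>k. commutator_powers d k)" for a b
  proof -
    obtain k l where "a \<in> commutator_powers d k" "b \<in> commutator_powers d l" using \<open>a \<in> _\<close> \<open>b \<in> _\<close> by blast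
    from commutator_powers_mult[OF this] show ?thesis by blast
  qed
qed

lemma subgroup_chain_Union:
  assumes ne: "\<C> \<noteq> {}" and sub: "\<And>C. C \<in> \<C> \<Longrightarrow> subgroup C G"
    and chain: "\<And>A B. A \<in> \<C> \<Longrightarrow> B \<in> \<C> \<Longrightarrow> A \<subseteq> B \<or> B \<subseteq> A"
  shows "subgroup (\<Union>\<C>) G"
proof (rule subgroupI)
  show "\<Union>\<C> \<subseteq> carrier G" using sub subgroup.subset by blast
  obtain C where C: "C \<in> \<C>" using ne by blast
  show "\<Union>\<C> \<noteq> {}" using subgroup.one_closed[OF sub[OF C]] C by blast
  show "inv a \<in> \<Union>\<C>" if "a \<in> \<Union>\<C>" for a
  proof -
    obtain C where C: "C \<in> \<C>" "a \<in> C" using \<open>a \<in> \<Union>\<C>\<close> by blast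
    then show ?thesis using subgroup.m_inv_closed[OF sub[OF C(1)] C(2)] by blast
  qed
  show "a \<otimes> b \<in> \<Union>\<C>" if a: "a \<in> \<Union>\<C>" and b: "b \<in> \<Union>\<C>" for a b
  proof -
    obtain A B where AB: "A \<in> \<C>" "a \<in> A" "B \<in> \<C>" "b \<in> B" using a b by blast
    have "\<exists>C\<in>\<C>. a \<in> C \<and> b \<in> C" using chain[OF AB(1,3)] AB(1-4) by auto
    then obtain C where C: "C \<in> \<C>" "a \<in> C" "b \<in> C" by blast
    then show ?thesis using subgroup.m_closed[OF sub[OF C(1)] C(2,3)] by blast
  qed
qed

text \<open>The hypothesis on roots in \<open>Z\<close> makes \<open>Z\<close> injective among the groups of exponent \<open>d\<close>, so it
  splits off modulo \<open>D\<close>.\<close>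

lemma central_complement:
  fixes d :: nat
  assumes Z: "subgroup Z G" and D: "subgroup D G" and DZ: "D \<inter> Z \<subseteq> {\<one>}" and d: "0 < d"
    and comm: "\<And>x y. x \<in> carrier G \<Longrightarrow> y \<in> carrier G \<Longrightarrow> \<exists>b\<in>D. x \<otimes> y = b \<otimes> (y \<otimes> x)"
    and pow: "\<And>x. x \<in> carrier G \<Longrightarrow> x [^] d \<in> D"
    and root: "\<And>m z. m dvd d \<Longrightarrow> z \<in> Z \<Longrightarrow> z [^] (d div m) = \<one> \<Longrightarrow> \<exists>u\<in>Z. u [^] m = z"
  shows "\<exists>C. subgroup C G \<and> D \<subseteq> C \<and> C \<inter> Z \<subseteq> {\<one>} \<and> (\<forall>x\<in>carrier G. \<exists>b\<in>C. \<exists>z\<in>Z. x = b \<otimes> z)"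
proof -
  let ?A = "{C. subgroup C G \<and> D \<subseteq> C \<and> C \<inter> Z \<subseteq> {\<one>}}"
  have "\<exists>C\<in>?A. \<forall>B\<in>?A. C \<subseteq> B \<longrightarrow> B = C"
  proof (rule subset_Zorn_nonempty)
    show "?A \<noteq> {}" using D DZ by blast
    fix \<C> assume ne: "\<C> \<noteq> {}" and ch: "subset.chain ?A \<C>"
    have sub: "C \<in> ?A" if "C \<in> \<C>" for C
      using ch[unfolded subset_chain_def, THEN conjunct1] that by (rule subsetD)
    have chain: "A \<subseteq> B \<or> B \<subseteq> A" if "A \<in> \<C>" "B \<in> \<C>" for A B
      using ch[unfolded subset_chain_def, THEN conjunct2, THEN bspec, OF that(1), THEN bspec, OF that(2)] .
    have "subgroup (\<Union>\<C>) G"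
    proof (rule subgroup_chain_Union[OF ne])
      show "subgroup C G" if "C \<in> \<C>" for C using sub[OF that] by simp
    qed (rule chain)
    moreover have "D \<subseteq> \<Union>\<C>"
    proof -
      obtain C where C: "C \<in> \<C>" using ne by blast
      then show ?thesis using sub[OF C] by blast
    qed
    moreover have "\<Union>\<C> \<inter> Z \<subseteq> {\<one>}"
    proof
      fix x assume "x \<in> \<Union>\<C> \<inter> Z"
      then obtain C where "C \<in> \<C>" "x \<in> C \<inter> Z" by blast
      then show "x \<in> {\<one>}" using sub[of C] by blast
    qed
    ultimately show "\<Union>\<C> \<in> ?A" by simp
  qed
  then obtain C where m: "C \<in> ?A" "\<forall>B\<in>?A. C \<subseteq> B \<longrightarrow> B = C" by (rule bexE)
  have C: "subgroup C G" "D \<subseteq> C" "C \<inter> Z \<subseteq> {\<one>}" using m(1) by simp_all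
  have max: "B = C" if "subgroup B G" "D \<subseteq> B" "B \<inter> Z \<subseteq> {\<one>}" "C \<subseteq> B" for B
    by (rule m(2)[THEN bspec, THEN mp]) (use that in simp_all)
  \<comment> \<open>C contains D and hence all commutators.\<close>
  have norm: "C \<lhd> G"
    unfolding normal_inv_iff
  proof (intro conjI ballI C(1))
    fix x h assume x: "x \<in> carrier G" and h: "h \<in> C"
    then have hG: "h \<in> carrier G" using subgroup.mem_carrier[OF C(1)] by blast
    obtain b where b: "b \<in> D" "x \<otimes> h = b \<otimes> (h \<otimes> x)" using comm[OF x hG] by blast
    have bC: "b \<in> C" using b(1) C(2) by blast
    then have bG: "b \<in> carrier G" using subgroup.mem_carrier[OF C(1)] by blast
    have "x \<otimes> h \<otimes> inv x = b \<otimes> h" unfolding b(2) using x hG bG by (simp add: m_assoc)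
    then show "x \<otimes> h \<otimes> inv x \<in> C" using subgroup.m_closed[OF C(1) bC h] by simp
  qed
  interpret C: normal C G by (rule norm)
  define Q where "Q = G Mod C"
  define p where "p a = C #> a" for a
  have ph: "p \<in> hom G Q" unfolding p_def[abs_def] Q_def by (rule C.r_coset_hom_Mod)
  have Qg: "group Q" unfolding Q_def by (rule C.factorgroup_is_group)
  interpret Q: group Q by (rule Qg)
  interpret p: group_hom G Q p by (intro group_hom.intro group_hom_axioms.intro Qg ph is_group)
  have p1: "p a = \<one>\<^bsub>Q\<^esub> \<longleftrightarrow> a \<in> C" if "a \<in> carrier G" for a
    unfolding p_def Q_def FactGroup_def using coset_join1[OF _ that C(1)] coset_join2[OF that C(1)] by auto
  have "comm_group Q"
  proof (rule group.group_comm_groupI[OF Qg])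
    fix x y assume "x \<in> carrier Q" "y \<in> carrier Q"
    then obtain a b where ab: "a \<in> carrier G" "b \<in> carrier G" "x = p a" "y = p b"
      unfolding Q_def FactGroup_def RCOSETS_def p_def by auto
    obtain k where k: "k \<in> D" "a \<otimes> b = k \<otimes> (b \<otimes> a)" using comm[OF ab(1,2)] by blast
    have kG: "k \<in> carrier G" "p k = \<one>\<^bsub>Q\<^esub>" using k(1) C(2) p1 C.subset by auto
    have "p (a \<otimes> b) = p (b \<otimes> a)" unfolding k(2) using kG ab by simp
    then show "x \<otimes>\<^bsub>Q\<^esub> y = y \<otimes>\<^bsub>Q\<^esub> x" using ab by simp
  qed
  then interpret Q: comm_group Q .
  have ZG: "z \<in> carrier G" if "z \<in> Z" for z using that subgroup.mem_carrier[OF Z] by blast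
  have Zm: "a \<otimes> b \<in> Z" if "a \<in> Z" "b \<in> Z" for a b by (rule subgroup.m_closed[OF Z that])
  have Zi: "inv a \<in> Z" if "a \<in> Z" for a by (rule subgroup.m_inv_closed[OF Z that])
  have Zp: "z [^] k \<in> Z" if "z \<in> Z" for z and k :: nat
    by (induction k) (simp_all add: subgroup.one_closed[OF Z] Zm that)
  have inj: "z = z'" if "z \<in> Z" "z' \<in> Z" "p z = p z'" for z z'
  proof -
    have "p (z \<otimes> inv z') = \<one>\<^bsub>Q\<^esub>" using that ZG by simp
    then have "z \<otimes> inv z' \<in> C" using p1[of "z \<otimes> inv z'"] that ZG by simp
    moreover have "z \<otimes> inv z' \<in> Z" by (rule Zm[OF that(1) Zi[OF that(2)]])
    ultimately have "z \<otimes> inv z' = \<one>" using C(3) by blast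
    then show ?thesis using inv_equality[of z "inv z'"] that ZG by simp
  qed
  have "\<exists>b\<in>C. \<exists>z\<in>Z. x = b \<otimes> z" if x: "x \<in> carrier G" for x
  proof (rule ccontr)
    assume no: "\<not> (\<exists>b\<in>C. \<exists>z\<in>Z. x = b \<otimes> z)"
    have pxd: "p x [^]\<^bsub>Q\<^esub> d = \<one>\<^bsub>Q\<^esub>"
      using p1[of "x [^] d"] pow[OF x] C(2) x unfolding p.hom_nat_pow[OF x] by blast
    \<comment> \<open>The exponents k for which the k-th power of x lies in Z modulo C. They are the
      multiples of the least positive one, which divides d because d-th powers lie in C.\<close>
    define T where "T k \<longleftrightarrow> (\<exists>z\<in>Z. p x [^]\<^bsub>Q\<^esub> k = p z)" for k :: nat
    have Td: "T d" unfolding T_def pxd using subgroup.one_closed[OF Z] p.hom_one by force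
    define m where "m = (LEAST k. 0 < k \<and> T k)"
    have m: "0 < m" "T m" using LeastI[of "\<lambda>k. 0 < k \<and> T k" d] Td d unfolding m_def by simp_all
    have least: "m \<le> k" if "0 < k" "T k" for k using that unfolding m_def by (intro Least_le) simp
    obtain z0 where z0: "z0 \<in> Z" "p x [^]\<^bsub>Q\<^esub> m = p z0" using m(2) T_def by blast
    have dvd: "m dvd k" if k: "T k" for k
    proof -
      obtain z where z: "z \<in> Z" "p x [^]\<^bsub>Q\<^esub> k = p z" using k T_def by blast
      have "p x [^]\<^bsub>Q\<^esub> (k mod m) \<otimes>\<^bsub>Q\<^esub> (p x [^]\<^bsub>Q\<^esub> m) [^]\<^bsub>Q\<^esub> (k div m) = p x [^]\<^bsub>Q\<^esub> k"
        using x by (simp add: Q.nat_pow_pow Q.nat_pow_mult)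
      then have "p x [^]\<^bsub>Q\<^esub> (k mod m) \<otimes>\<^bsub>Q\<^esub> p (z0 [^] (k div m)) = p z"
        unfolding z0 z using p.hom_nat_pow[OF ZG[OF z0(1)]] by simp
      then have "p x [^]\<^bsub>Q\<^esub> (k mod m) = p z \<otimes>\<^bsub>Q\<^esub> inv\<^bsub>Q\<^esub> p (z0 [^] (k div m))"
        using x ZG[OF z0(1)] ZG[OF z(1)] by (intro Q.inv_solve_right[THEN iffD2]) simp_all
      also have "\<dots> = p (z \<otimes> inv (z0 [^] (k div m)))" using ZG[OF z0(1)] ZG[OF z(1)] by simp
      finally have "T (k mod m)"
        unfolding T_def by (rule bexI) (rule Zm[OF z(1) Zi[OF Zp[OF z0(1)]]])
      then show ?thesis using least[of "k mod m"] m(1) by (meson dvd_eq_mod_eq_0 gr0I leD mod_less_divisor)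
    qed
    have "p (z0 [^] (d div m)) = (p x [^]\<^bsub>Q\<^esub> m) [^]\<^bsub>Q\<^esub> (d div m)"
      unfolding z0 by (rule p.hom_nat_pow[OF ZG[OF z0(1)]])
    also have "\<dots> = p \<one>" using x dvd[OF Td] pxd by (simp add: Q.nat_pow_pow)
    finally have "z0 [^] (d div m) = \<one>"
      by (intro inj Zp subgroup.one_closed[OF Z] z0)
    then obtain u where u: "u \<in> Z" "u [^] m = z0" using root[OF dvd[OF Td] z0(1)] by blast
    \<comment> \<open>Since m divides d, the hypothesis on roots yields an m-th root u of the
      element of Z that x to the m represents. Dividing by u makes the m-th power of y trivial
      modulo C.\<close>
    define y where "y = x \<otimes> inv u"
    have yG: "y \<in> carrier G" unfolding y_def using x ZG[OF u(1)] by simp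
    note yQ = p.hom_closed[OF yG]
    have y: "y \<in> carrier G" "p y = p x \<otimes>\<^bsub>Q\<^esub> inv\<^bsub>Q\<^esub> p u" unfolding y_def using x ZG[OF u(1)] by simp_all
    have yk: "p y [^]\<^bsub>Q\<^esub> k \<otimes>\<^bsub>Q\<^esub> p (u [^] k) = p x [^]\<^bsub>Q\<^esub> k" for k :: nat
      unfolding y(2) using x ZG[OF u(1)] p.hom_nat_pow[OF ZG[OF u(1)], of k]
      by (simp add: Q.nat_pow_distrib Q.m_assoc Q.nat_pow_inv)
    have ym: "p y [^]\<^bsub>Q\<^esub> m = \<one>\<^bsub>Q\<^esub>"
      using yk[of m] unfolding u(2) z0(2) using y(1) ZG[OF z0(1)] by (simp add: Q.r_cancel_one')
    \<comment> \<open>The subgroup generated by C and y. By maximality it equals C as soon as it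
      still meets Z trivially.\<close>
    define B where "B = {a \<in> carrier G. \<exists>k::nat. p a = p y [^]\<^bsub>Q\<^esub> k}"
    have "subgroup B G"
    proof (rule subgroupI)
      show "B \<subseteq> carrier G" by (auto simp: B_def)
      have "y \<in> B" unfolding B_def using yG Q.nat_pow_eone[OF yQ] by (auto intro!: exI[of _ 1])
      then show "B \<noteq> {}" by blast
      show "a \<otimes> b \<in> B" if a: "a \<in> B" and b: "b \<in> B" for a b
      proof -
        obtain k l :: nat where "p a = p y [^]\<^bsub>Q\<^esub> k" "p b = p y [^]\<^bsub>Q\<^esub> l" using a b by (auto simp: B_def)
        then have "p (a \<otimes> b) = p y [^]\<^bsub>Q\<^esub> (k + l)" using a b Q.nat_pow_mult[OF yQ, of k l] by (simp add: B_def)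
        then show ?thesis using a b by (auto simp: B_def)
      qed
      show "inv a \<in> B" if a: "a \<in> B" for a
      proof -
        obtain k :: nat where k: "p a = p y [^]\<^bsub>Q\<^esub> k" using a by (auto simp: B_def)
        have "p y [^]\<^bsub>Q\<^esub> (k * (m - 1)) \<otimes>\<^bsub>Q\<^esub> p a = (p y [^]\<^bsub>Q\<^esub> m) [^]\<^bsub>Q\<^esub> k"
          unfolding k Q.nat_pow_mult[OF yQ] Q.nat_pow_pow[OF yQ] using m(1) by (cases m) (simp_all add: algebra_simps)
        then have "p y [^]\<^bsub>Q\<^esub> (k * (m - 1)) \<otimes>\<^bsub>Q\<^esub> p a = \<one>\<^bsub>Q\<^esub>" unfolding ym by simp
        then have "inv\<^bsub>Q\<^esub> p a = p y [^]\<^bsub>Q\<^esub> (k * (m - 1))" using a yQ by (intro Q.inv_equality) (simp_all add: B_def)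
        moreover have aG: "a \<in> carrier G" using a by (simp add: B_def)
        ultimately have "p (inv a) = p y [^]\<^bsub>Q\<^esub> (k * (m - 1))" unfolding p.hom_inv[OF aG] by argo
        then show ?thesis using inv_closed[OF aG] unfolding B_def by blast
      qed
    qed
    moreover have CB: "C \<subseteq> B"
    proof
      fix a assume a: "a \<in> C"
      then have "a \<in> carrier G" "p a = p y [^]\<^bsub>Q\<^esub> (0::nat)" using p1[OF C.mem_carrier[OF a]] C.mem_carrier by simp_all
      then show "a \<in> B" unfolding B_def by blast
    qed
    moreover have "B \<inter> Z \<subseteq> {\<one>}"
    proof
      fix z assume z: "z \<in> B \<inter> Z"
      then obtain k :: nat where k: "p z = p y [^]\<^bsub>Q\<^esub> k" by (auto simp: B_def)
      have "p x [^]\<^bsub>Q\<^esub> k = p (z \<otimes> u [^] k)" unfolding yk[symmetric] k[symmetric] using z u ZG by simp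
      \<comment> \<open>A power of y that lies in Z modulo C makes the same power of x lie there
        too. Hence its exponent is a multiple of m, and the power of y is trivial.\<close>
      then have "T k" unfolding T_def by (rule bexI) (use z in \<open>intro Zm Zp u(1), simp\<close>)
      then obtain q where "k = m * q" using dvd by (auto elim: dvdE)
      then have "p z = (p y [^]\<^bsub>Q\<^esub> m) [^]\<^bsub>Q\<^esub> q" unfolding k Q.nat_pow_pow[OF yQ] by simp
      then have "p z = p \<one>" unfolding ym by simp
      then show "z \<in> {\<one>}" using inj[OF _ subgroup.one_closed[OF Z]] z by blast
    qed
    ultimately have "B = C" using max C(2) by blast
    moreover have "y \<in> B" unfolding B_def using yG Q.nat_pow_eone[OF yQ] by (auto intro!: exI[of _ 1])
    ultimately have "y \<in> C" by blast
    moreover have "x = y \<otimes> u" unfolding y_def using x ZG[OF u(1)] by (simp add: m_assoc)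
    ultimately show False using no u(1) by blast
  qed
  then show ?thesis using C by blast
qed

end

section \<open>Groups with the transferred properties\<close>

text \<open>In \<open>Dk_faithful\<close> the length k is arbitrary, so it stands for infinitely
  many transferred sentences, whereas \<open>Dk_scalars\<close> holds with the single bound
  \<open>k0\<close>.\<close>

locale interpreted = group +
  fixes n d k0 :: nat and c :: "nat \<times> nat \<Rightarrow> 'a"
  assumes c_closed: "c p \<in> carrier G" and d_pos: "0 < d"
    and rc_ring: "rc_ring n G c" and rho_group: "rho_group n d G c"
    and Dk_faithful: "Dk_faithful n d k G c" and Dk_scalars: "Dk_scalars n d k0 G c"
begin

abbreviation R :: "'a ring" where "R \<equiv> RR n G c"

lemma cm_closed: "x \<in> carrier G \<Longrightarrow> y \<in> carrier G \<Longrightarrow> cm G x y \<in> carrier G"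
  by (simp add: cm_def)

lemma rmul_closed: "x \<in> carrier G \<Longrightarrow> y \<in> carrier G \<Longrightarrow> rmul G c x y \<in> carrier G"
  unfolding rmul_def by (intro cm_closed c_closed)

lemma R_carrier: "x \<in> carrier R \<longleftrightarrow> x \<in> carrier G \<and> in_rc n G c x"
  by (simp add: RR_def)

lemma R_simps: "x \<otimes>\<^bsub>R\<^esub> y = rmul G c x y" "x \<oplus>\<^bsub>R\<^esub> y = x \<otimes> y" "\<one>\<^bsub>R\<^esub> = c (0, 1)" "\<zero>\<^bsub>R\<^esub> = \<one>"
  by (simp_all add: RR_def)

lemma rc:
  assumes "x \<in> carrier R"
  shows "inv x \<in> carrier R" "rmul G c (c (0, 1)) x = x"
    and "y \<in> carrier R \<Longrightarrow> x \<otimes> y \<in> carrier R" "y \<in> carrier R \<Longrightarrow> rmul G c x y \<in> carrier R"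
    "y \<in> carrier R \<Longrightarrow> x \<otimes> y = y \<otimes> x" "y \<in> carrier R \<Longrightarrow> rmul G c x y = rmul G c y x"
    and "y \<in> carrier R \<Longrightarrow> z \<in> carrier R \<Longrightarrow> rmul G c (rmul G c x y) z = rmul G c x (rmul G c y z)"
    "y \<in> carrier R \<Longrightarrow> z \<in> carrier R \<Longrightarrow> rmul G c (x \<otimes> y) z = rmul G c x z \<otimes> rmul G c y z"
proof -
  have xG: "x \<in> carrier G" and x: "in_rc n G c x" using assms R_carrier by blast+
  note 1 = rc_ring[unfolded rc_ring_def, THEN conjunct2, THEN conjunct2, THEN bspec, OF xG, THEN mp, OF x]
  show "inv x \<in> carrier R" unfolding R_carrier using 1 xG by simp
  show "rmul G c (c (0, 1)) x = x" using 1 by blast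
  note 2 = 1[THEN conjunct2, THEN conjunct2, THEN bspec, THEN mp]
  show "x \<otimes> y \<in> carrier R" "rmul G c x y \<in> carrier R" "x \<otimes> y = y \<otimes> x" "rmul G c x y = rmul G c y x"
    if "y \<in> carrier R"
  proof -
    have y: "y \<in> carrier G" "in_rc n G c y" using that R_carrier by blast+
    note 3 = 2[OF y]
    show "x \<otimes> y \<in> carrier R" "rmul G c x y \<in> carrier R" "x \<otimes> y = y \<otimes> x" "rmul G c x y = rmul G c y x"
      unfolding R_carrier using 3 rmul_closed[OF xG y(1)] m_closed[OF xG y(1)] by blast+
  qed
  show "rmul G c (rmul G c x y) z = rmul G c x (rmul G c y z)" "rmul G c (x \<otimes> y) z = rmul G c x z \<otimes> rmul G c y z"
    if "y \<in> carrier R" "z \<in> carrier R"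
    using 2[of y, THEN conjunct2, THEN conjunct2, THEN conjunct2, THEN conjunct2, THEN bspec, of z, THEN mp] that
    unfolding R_carrier by simp_all
qed

lemma rc_one: "c (0, 1) \<in> carrier R" and rc_zero: "\<one> \<in> carrier R"
  using rc_ring c_closed unfolding rc_ring_def R_carrier by simp_all

lemma R_cring: "cring R"
proof (rule cringI)
  note G = R_carrier[THEN iffD1, THEN conjunct1]
  show "abelian_group R"
  proof (rule abelian_groupI, unfold R_simps)
    show "x \<otimes> y \<in> carrier R" if "x \<in> carrier R" "y \<in> carrier R" for x y by (rule rc(3)[OF that])
    show "\<one> \<in> carrier R" by (rule rc_zero)
    show "x \<otimes> y \<otimes> z = x \<otimes> (y \<otimes> z)" if "x \<in> carrier R" "y \<in> carrier R" "z \<in> carrier R" for x y z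
      by (rule m_assoc[OF G[OF that(1)] G[OF that(2)] G[OF that(3)]])
    show "x \<otimes> y = y \<otimes> x" if "x \<in> carrier R" "y \<in> carrier R" for x y by (rule rc(5)[OF that])
    show "\<one> \<otimes> x = x" if "x \<in> carrier R" for x by (rule l_one[OF G[OF that]])
    show "\<exists>y\<in>carrier R. y \<otimes> x = \<one>" if "x \<in> carrier R" for x
      by (rule bexI[of _ "inv x"], rule l_inv[OF G[OF that]], rule rc(1)[OF that])
  qed
  show "Group.comm_monoid R"
  proof (rule comm_monoidI, unfold R_simps)
    show "rmul G c x y \<in> carrier R" if "x \<in> carrier R" "y \<in> carrier R" for x y by (rule rc(4)[OF that])
    show "c (0, 1) \<in> carrier R" by (rule rc_one)
    show "rmul G c (rmul G c x y) z = rmul G c x (rmul G c y z)"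
      if "x \<in> carrier R" "y \<in> carrier R" "z \<in> carrier R" for x y z by (rule rc(7)[OF that])
    show "rmul G c (c (0, 1)) x = x" if "x \<in> carrier R" for x by (rule rc(2)[OF that])
    show "rmul G c x y = rmul G c y x" if "x \<in> carrier R" "y \<in> carrier R" for x y by (rule rc(6)[OF that])
  qed
qed (unfold R_simps, rule rc(8))

sublocale R: cring R by (rule R_cring)

lemma rsum_finsum:
  "distinct xs \<Longrightarrow> (\<And>k. k \<in> set xs \<Longrightarrow> f k \<in> carrier R) \<Longrightarrow> rsum G f xs = (\<Oplus>\<^bsub>R\<^esub>k\<in>set xs. f k)"
proof (induction xs)
  case (Cons x xs)
  have "(\<Oplus>\<^bsub>R\<^esub>k\<in>insert x (set xs). f k) = f x \<oplus>\<^bsub>R\<^esub> (\<Oplus>\<^bsub>R\<^esub>k\<in>set xs. f k)"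
    by (rule R.finsum_insert) (use Cons.prems in auto)
  moreover have "rsum G f (x # xs) = f x \<otimes> rsum G f xs" by (simp add: rsum_def)
  ultimately show ?case using Cons by (simp add: R_simps)
qed (simp add: rsum_def R_simps)

lemma rprod_finprod:
  "distinct xs \<Longrightarrow> (\<And>k. k \<in> set xs \<Longrightarrow> f k \<in> carrier R) \<Longrightarrow> rprod G c f xs = (\<Otimes>\<^bsub>R\<^esub>k\<in>set xs. f k)"
proof (induction xs)
  case (Cons x xs)
  have "(\<Otimes>\<^bsub>R\<^esub>k\<in>insert x (set xs). f k) = f x \<otimes>\<^bsub>R\<^esub> (\<Otimes>\<^bsub>R\<^esub>k\<in>set xs. f k)"
    by (rule R.finprod_insert) (use Cons.prems in auto)
  moreover have "rprod G c f (x # xs) = rmul G c (f x) (rprod G c f xs)" by (simp add: rprod_def)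
  ultimately show ?case using Cons by (simp add: R_simps)
qed (simp add: rprod_def R_simps)

lemma R_uminus: "x \<in> carrier R \<Longrightarrow> \<ominus>\<^bsub>R\<^esub> x = inv x"
  by (rule R.minus_equality) (use rc(1) R_carrier in \<open>simp_all add: R_simps\<close>)

text \<open>Formulas speak of functions on pairs of indices, the special linear group of matrices;
  outside the matrix the value is a harmless group element.\<close>

definition fn :: "'a mat \<Rightarrow> nat \<times> nat \<Rightarrow> 'a" where
  "fn M p = (if fst p < n \<and> snd p < n then M $$ p else \<one>)"

definition toM :: "(nat \<times> nat \<Rightarrow> 'a) \<Rightarrow> 'a mat" where
  "toM A = mat n n A"

lemma toM_carrier [simp]: "toM A \<in> carrier_mat n n"
  by (simp add: toM_def)

lemma toM_fn: "M \<in> carrier_mat n n \<Longrightarrow> toM (fn M) = M"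
  by (rule eq_matI) (simp_all add: toM_def fn_def)

lemma fn_toM: "meq n (fn (toM A)) A"
  by (simp add: meq_def fn_def toM_def)

lemma toM_eq_iff: "toM A = toM B \<longleftrightarrow> meq n A B"
proof
  assume e: "toM A = toM B"
  show "meq n A B" unfolding meq_def
  proof (intro allI impI)
    fix i j assume "i < n" "j < n"
    moreover have "toM A $$ (i, j) = toM B $$ (i, j)" unfolding e ..
    ultimately show "A (i, j) = B (i, j)" by (simp add: toM_def)
  qed
next
  assume "meq n A B"
  then show "toM A = toM B" by (intro eq_matI) (simp_all add: toM_def meq_def)
qed

lemma mm_cong: "meq n A A' \<Longrightarrow> meq n B B' \<Longrightarrow> meq n (mm G c n A B) (mm G c n A' B')"
proof -
  assume a: "meq n A A'" "meq n B B'"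
  show ?thesis unfolding meq_def mm_def rsum_def fst_conv snd_conv
    using a unfolding meq_def by (auto intro!: foldr_cong)
qed

lemma det_over_ldet:
  assumes "\<And>i j. i < n \<Longrightarrow> j < n \<Longrightarrow> M $$ (i, j) \<in> carrier R"
  shows "det_over R n M = ldet G c n (fn M)"
proof -
  have pr: "rprod G c (\<lambda>i. fn M (i, p i)) [0..<n] = (\<Otimes>\<^bsub>R\<^esub>i\<in>{..<n}. M $$ (i, p i))"
    "(\<Otimes>\<^bsub>R\<^esub>i\<in>{..<n}. M $$ (i, p i)) \<in> carrier R" if p: "p permutes {..<n}" for p
  proof -
    have pn: "p i < n" if "i < n" for i using permutes_in_image[OF p, of i] that by simp
    have "rprod G c (\<lambda>i. fn M (i, p i)) [0..<n] = (\<Otimes>\<^bsub>R\<^esub>i\<in>set [0..<n]. fn M (i, p i))"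
      by (rule rprod_finprod) (use assms pn in \<open>simp_all add: fn_def\<close>)
    also have "\<dots> = (\<Otimes>\<^bsub>R\<^esub>i\<in>{..<n}. M $$ (i, p i))"
      by (rule R.finprod_cong') (use assms pn in \<open>auto simp: fn_def\<close>)
    finally show "rprod G c (\<lambda>i. fn M (i, p i)) [0..<n] = (\<Otimes>\<^bsub>R\<^esub>i\<in>{..<n}. M $$ (i, p i))" .
    show "(\<Otimes>\<^bsub>R\<^esub>i\<in>{..<n}. M $$ (i, p i)) \<in> carrier R"
      by (rule R.finprod_closed) (use assms pn in auto)
  qed
  let ?t = "\<lambda>p. if sign p = 1 then rprod G c (\<lambda>i. fn M (i, p i)) [0..<n] else inv rprod G c (\<lambda>i. fn M (i, p i)) [0..<n]"
  have tR: "?t p \<in> carrier R" if "p permutes {..<n}" for p using pr[OF that] rc(1) by simp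
  have "ldet G c n (fn M) = (\<Oplus>\<^bsub>R\<^esub>p\<in>set (perms n). ?t p)"
    unfolding ldet_def by (rule rsum_finsum[OF perms(1)]) (use tR perms(2) in blast)
  also have "\<dots> = (\<Oplus>\<^bsub>R\<^esub>p\<in>{p. p permutes {..<n}}. [sign p] \<cdot>\<^bsub>R\<^esub> (\<Otimes>\<^bsub>R\<^esub>i\<in>{..<n}. M $$ (i, p i)))"
    unfolding perms(2)
  proof (rule R.finsum_cong'[OF refl])
    have e: "[sign p] \<cdot>\<^bsub>R\<^esub> (\<Otimes>\<^bsub>R\<^esub>i\<in>{..<n}. M $$ (i, p i)) = ?t p" if "p permutes {..<n}" for p
    proof -
      consider "sign p = 1" | "sign p = -1" by (cases rule: sign_cases[of p])
      then show ?thesis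
    proof cases
      case 1
      then show ?thesis using pr[OF that] R.add.int_pow_1 by simp
    next
      case 2
      then show ?thesis using pr[OF that] R_uminus R.add.int_pow_neg[OF pr(2)[OF that], of 1] R.add.int_pow_1[OF pr(2)[OF that]]
        by (simp add: a_inv_def)
    qed
    qed
    show "(\<lambda>p. [sign p] \<cdot>\<^bsub>R\<^esub> (\<Otimes>\<^bsub>R\<^esub>i\<in>{..<n}. M $$ (i, p i))) \<in> {p. p permutes {..<n}} \<rightarrow> carrier R"
      using e tR by (intro funcsetI) simp
    show "?t p = [sign p] \<cdot>\<^bsub>R\<^esub> (\<Otimes>\<^bsub>R\<^esub>i\<in>{..<n}. M $$ (i, p i))" if "p \<in> {p. p permutes {..<n}}" for p
      using e that by simp
  qed
  finally show ?thesis unfolding det_over_def by (rule sym)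
qed

lemma slR_fnD:
  assumes "slR n G c (fn M)" "i < n" "j < n"
  shows "in_rc n G c (M $$ (i, j))"
  using assms by (simp add: slR_def fn_def)

definition gmat :: "'a mat \<Rightarrow> bool" where
  "gmat M \<longleftrightarrow> M \<in> carrier_mat n n \<and> (\<forall>i<n. \<forall>j<n. M $$ (i, j) \<in> carrier G)"

lemma gmat_fn: "gmat M \<Longrightarrow> \<forall>p. fn M p \<in> carrier G"
  by (auto simp: gmat_def fn_def)

lemma gmat_toM: "\<forall>p. A p \<in> carrier G \<Longrightarrow> gmat (toM A)"
  by (simp add: gmat_def toM_def)

lemma SL_carrier: "M \<in> carrier (SL n R) \<longleftrightarrow> gmat M \<and> slR n G c (fn M)"
proof -
  have el: "elements_mat M \<subseteq> carrier R \<longleftrightarrow> (\<forall>i<n. \<forall>j<n. M $$ (i, j) \<in> carrier R)" if "M \<in> carrier_mat n n"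
    using that by (force simp: elements_mat_def)
  show ?thesis
  proof (cases "M \<in> carrier_mat n n \<and> (\<forall>i<n. \<forall>j<n. M $$ (i, j) \<in> carrier R)")
    case True
    then show ?thesis using el det_over_ldet[of M]
      by (simp add: SL_def slR_def gmat_def R_carrier fn_def R_simps)
  next
    case False
    then show ?thesis using el by (auto simp: SL_def gmat_def R_carrier dest: slR_fnD)
  qed
qed

lemma SL_mult:
  assumes "M \<in> carrier (SL n R)" "N \<in> carrier (SL n R)"
  shows "M \<otimes>\<^bsub>SL n R\<^esub> N = toM (mm G c n (fn M) (fn N))"
proof (rule eq_matI)
  fix i j assume "i < dim_row (toM (mm G c n (fn M) (fn N)))" "j < dim_col (toM (mm G c n (fn M) (fn N)))"
  then have ij: "i < n" "j < n" by (simp_all add: toM_def)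
  have e: "M $$ (r, s) \<in> carrier R" "N $$ (r, s) \<in> carrier R" if "r < n" "s < n" for r s
    using assms that slR_fnD unfolding SL_carrier R_carrier gmat_def by blast+
  have "mm G c n (fn M) (fn N) (i, j) = (\<Oplus>\<^bsub>R\<^esub>k\<in>set [0..<n]. rmul G c (fn M (i, k)) (fn N (k, j)))"
    unfolding mm_def fst_conv snd_conv by (rule rsum_finsum) (use e ij rc(4) in \<open>simp_all add: fn_def\<close>)
  also have "\<dots> = (\<Oplus>\<^bsub>R\<^esub>k\<in>{..<n}. M $$ (i, k) \<otimes>\<^bsub>R\<^esub> N $$ (k, j))"
    by (rule R.finsum_cong') (use e ij rc(4) in \<open>auto simp: fn_def R_simps\<close>)
  finally show "(M \<otimes>\<^bsub>SL n R\<^esub> N) $$ (i, j) = toM (mm G c n (fn M) (fn N)) $$ (i, j)"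
    using ij by (simp add: SL_def toM_def)
qed (simp_all add: SL_def toM_def)

end

section \<open>The group of pairs, its central complement and the isomorphism\<close>

context interpreted
begin

lemma rho_one: "rho n G c \<one> (idm G c)"
  using rho_group unfolding rho_group_def by blast

lemma rho_total: "h \<in> carrier G \<Longrightarrow> \<exists>A. (\<forall>p. A p \<in> carrier G) \<and> rho n G c h A"
  using rho_group[unfolded rho_group_def, THEN conjunct2, THEN conjunct1, THEN bspec] .

lemmas slR_facts = rho_group[unfolded rho_group_def, THEN conjunct2, THEN conjunct2, THEN conjunct1,
    THEN spec, THEN mp, THEN mp]

lemma rho_surj: "\<forall>p. A p \<in> carrier G \<Longrightarrow> slR n G c A \<Longrightarrow> \<exists>h\<in>carrier G. rho n G c h A"
  and mm_idm: "\<forall>p. A p \<in> carrier G \<Longrightarrow> slR n G c A \<Longrightarrow> meq n (mm G c n (idm G c) A) A"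
  by (rule slR_facts[THEN conjunct1], assumption+)
    (rule slR_facts[THEN conjunct2, THEN conjunct1], assumption+)

lemma mm_assoc: "\<forall>p. A p \<in> carrier G \<Longrightarrow> slR n G c A \<Longrightarrow> \<forall>p. B p \<in> carrier G \<Longrightarrow> slR n G c B \<Longrightarrow>
    \<forall>p. C p \<in> carrier G \<Longrightarrow> slR n G c C \<Longrightarrow>
    meq n (mm G c n (mm G c n A B) C) (mm G c n A (mm G c n B C))"
  by (rule slR_facts[THEN conjunct2, THEN conjunct2, THEN spec, THEN mp, THEN mp, THEN spec, THEN mp, THEN mp])

lemmas rho_facts = rho_group[unfolded rho_group_def, THEN conjunct2, THEN conjunct2, THEN conjunct2, THEN conjunct1,
    THEN bspec, THEN spec, THEN mp, THEN mp]

lemma rho_inv: "h \<in> carrier G \<Longrightarrow> \<forall>p. A p \<in> carrier G \<Longrightarrow> rho n G c h A \<Longrightarrow>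
    \<exists>B. (\<forall>p. B p \<in> carrier G) \<and> rho n G c (inv h) B \<and> meq n (mm G c n B A) (idm G c)"
  by (rule rho_facts[THEN conjunct1])

lemma rho_meq: "h \<in> carrier G \<Longrightarrow> \<forall>p. A p \<in> carrier G \<Longrightarrow> rho n G c h A \<Longrightarrow>
    \<forall>p. B p \<in> carrier G \<Longrightarrow> meq n A B \<Longrightarrow> rho n G c h B"
  by (rule rho_facts[THEN conjunct2, THEN conjunct1, THEN spec, THEN mp, THEN mp])

lemma rho_mult: "h \<in> carrier G \<Longrightarrow> \<forall>p. A p \<in> carrier G \<Longrightarrow> rho n G c h A \<Longrightarrow>
    h' \<in> carrier G \<Longrightarrow> \<forall>p. B p \<in> carrier G \<Longrightarrow> rho n G c h' B \<Longrightarrow> rho n G c (h \<otimes> h') (mm G c n A B)"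
  by (rule rho_facts[THEN conjunct2, THEN conjunct2, THEN bspec, THEN spec, THEN mp, THEN mp])

lemma rho_root: "m dvd d \<Longrightarrow> z \<in> carrier G \<Longrightarrow> rho n G c z (idm G c) \<Longrightarrow> z [^] (d div m) = \<one> \<Longrightarrow>
    \<exists>u\<in>carrier G. rho n G c u (idm G c) \<and> u [^] m = z"
  by (rule rho_group[unfolded rho_group_def, THEN conjunct2, THEN conjunct2, THEN conjunct2, THEN conjunct2,
        THEN spec, THEN mp, THEN mp, THEN bspec, THEN mp, THEN mp])
    (use dvd_imp_le[of m d] d_pos in auto)

lemma Dk_trivial: "h \<in> carrier G \<Longrightarrow> \<forall>p. A p \<in> carrier G \<Longrightarrow> rho n G c h A \<Longrightarrow> Dk n d G c k h A \<Longrightarrow>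
    h = \<one> \<longleftrightarrow> meq n A (idm G c)"
  by (rule Dk_faithful[unfolded Dk_faithful_def, THEN bspec, THEN spec, THEN mp, THEN mp, THEN mp])

lemma Dk_scalar1: "h \<in> carrier G \<Longrightarrow> rho n G c h (idm G c) \<Longrightarrow>
    \<exists>A. (\<forall>p. A p \<in> carrier G) \<and> rho n G c h A \<and> Dk n d G c k0 h A"
  by (rule Dk_scalars[unfolded Dk_scalars_def, THEN conjunct1, THEN bspec, THEN mp])

lemma Dk_scalar2: "\<forall>p. A p \<in> carrier G \<Longrightarrow> rho n G c \<one> A \<Longrightarrow> \<exists>h\<in>carrier G. rho n G c h A \<and> Dk n d G c k0 h A"
  by (rule Dk_scalars[unfolded Dk_scalars_def, THEN conjunct2, THEN spec, THEN mp, THEN mp])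

lemma rho_slR: "rho n G c h A \<Longrightarrow> slR n G c A"
  by (simp add: rho_def)

lemma mm_closed:
  assumes A: "\<forall>p. A p \<in> carrier G" and B: "\<forall>p. B p \<in> carrier G"
  shows "\<forall>p. mm G c n A B p \<in> carrier G"
proof (rule allI)
  fix p
  have t: "rmul G c (A (fst p, k)) (B (k, snd p)) \<in> carrier G" for k
    by (rule rmul_closed[OF A[THEN spec] B[THEN spec]])
  have "rsum G (\<lambda>k. rmul G c (A (fst p, k)) (B (k, snd p))) xs \<in> carrier G" for xs
    by (induction xs) (simp_all add: rsum_def t)
  then show "mm G c n A B p \<in> carrier G" unfolding mm_def by this
qed

lemma idm_closed: "\<forall>p. idm G c p \<in> carrier G"
  using c_closed by (simp add: idm_def)

text \<open>The second components are matrices rather than functions, so that equality of pairs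
  means agreement of the entries only, that is \<open>meq\<close>.\<close>

definition PP :: "('a \<times> 'a mat) monoid" where
  "PP = \<lparr>carrier = {(h, M). h \<in> carrier G \<and> gmat M \<and> rho n G c h (fn M)},
    monoid.mult = (\<lambda>(h, M) (h', M'). (h \<otimes> h', toM (mm G c n (fn M) (fn M')))), one = (\<one>, toM (idm G c))\<rparr>"

lemma PP_mult: "(h, M) \<otimes>\<^bsub>PP\<^esub> (h', M') = (h \<otimes> h', toM (mm G c n (fn M) (fn M')))"
  and PP_one: "\<one>\<^bsub>PP\<^esub> = (\<one>, toM (idm G c))"
  by (simp_all add: PP_def)

lemma PP_D:
  assumes "(h, M) \<in> carrier PP"
  shows "h \<in> carrier G" "\<forall>p. fn M p \<in> carrier G" "rho n G c h (fn M)" "slR n G c (fn M)" "M \<in> carrier_mat n n" "gmat M"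
proof -
  have g: "h \<in> carrier G" "gmat M" "rho n G c h (fn M)" using assms by (simp_all add: PP_def)
  show "h \<in> carrier G" "\<forall>p. fn M p \<in> carrier G" "rho n G c h (fn M)" "slR n G c (fn M)" "gmat M"
    by (fact g(1), rule gmat_fn[OF g(2)], fact g(3), rule rho_slR[OF g(3)], fact g(2))
  show "M \<in> carrier_mat n n" using g(2) by (simp add: gmat_def)
qed

lemma PP_I:
  assumes "h \<in> carrier G" "\<forall>p. A p \<in> carrier G" "rho n G c h A"
  shows "(h, toM A) \<in> carrier PP"
proof -
  have "rho n G c h (fn (toM A))"
    by (rule rho_meq[OF assms gmat_fn[OF gmat_toM[OF assms(2)]] meq_sym[OF fn_toM]])
  then show ?thesis using assms gmat_toM by (simp add: PP_def)
qed

lemma toM_mm: "toM (mm G c n (fn (toM A)) (fn (toM B))) = toM (mm G c n A B)"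
  unfolding toM_eq_iff by (rule mm_cong[OF fn_toM fn_toM])

lemma meq_refl: "meq n A A"
  by (simp add: meq_def)

lemma PP_group: "group PP"
proof (rule groupI)
  show "x \<otimes>\<^bsub>PP\<^esub> y \<in> carrier PP" if x: "x \<in> carrier PP" and y: "y \<in> carrier PP" for x y
  proof -
    obtain h M h' M' where e: "x = (h, M)" "y = (h', M')" by (cases x, cases y)
    note a = PP_D[OF x[unfolded e]] and b = PP_D[OF y[unfolded e]]
    show ?thesis unfolding e PP_mult
      by (rule PP_I[OF m_closed[OF a(1) b(1)] mm_closed[OF a(2) b(2)] rho_mult[OF a(1,2,3) b(1,2,3)]])
  qed
  show "\<one>\<^bsub>PP\<^esub> \<in> carrier PP" unfolding PP_one by (rule PP_I[OF one_closed idm_closed rho_one])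
  show "x \<otimes>\<^bsub>PP\<^esub> y \<otimes>\<^bsub>PP\<^esub> z = x \<otimes>\<^bsub>PP\<^esub> (y \<otimes>\<^bsub>PP\<^esub> z)"
    if x: "x \<in> carrier PP" and y: "y \<in> carrier PP" and z: "z \<in> carrier PP" for x y z
  proof -
    obtain h M h' M' g N where e: "x = (h, M)" "y = (h', M')" "z = (g, N)" by (cases x, cases y, cases z)
    note a = PP_D[OF x[unfolded e]] and b = PP_D[OF y[unfolded e]] and d = PP_D[OF z[unfolded e]]
    have "meq n (mm G c n (fn (toM (mm G c n (fn M) (fn M')))) (fn N)) (mm G c n (fn M) (fn (toM (mm G c n (fn M') (fn N)))))"
      by (rule meq_trans[OF mm_cong[OF fn_toM meq_refl] meq_trans[OF mm_assoc[OF a(2,4) b(2,4) d(2,4)]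
            mm_cong[OF meq_refl meq_sym[OF fn_toM]]]])
    then show ?thesis unfolding e PP_mult prod.inject toM_eq_iff using m_assoc[OF a(1) b(1) d(1)] by blast
  qed
  show "\<one>\<^bsub>PP\<^esub> \<otimes>\<^bsub>PP\<^esub> x = x" if x: "x \<in> carrier PP" for x
  proof -
    obtain h M where e: "x = (h, M)" by (cases x)
    note a = PP_D[OF x[unfolded e]]
    have "toM (mm G c n (fn (toM (idm G c))) (fn M)) = toM (fn M)"
      unfolding toM_eq_iff by (rule meq_trans[OF mm_cong[OF fn_toM meq_refl] mm_idm[OF a(2,4)]])
    then show ?thesis unfolding e PP_mult PP_one toM_fn[OF a(5)] using a(1) by simp
  qed
  show "\<exists>y\<in>carrier PP. y \<otimes>\<^bsub>PP\<^esub> x = \<one>\<^bsub>PP\<^esub>" if x: "x \<in> carrier PP" for x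
  proof -
    obtain h M where e: "x = (h, M)" by (cases x)
    note a = PP_D[OF x[unfolded e]]
    obtain B where B: "\<forall>p. B p \<in> carrier G" "rho n G c (inv h) B" "meq n (mm G c n B (fn M)) (idm G c)"
      using rho_inv[OF a(1,2,3)] by blast
    have "toM (mm G c n (fn (toM B)) (fn M)) = toM (idm G c)"
      unfolding toM_eq_iff by (rule meq_trans[OF mm_cong[OF fn_toM meq_refl] B(3)])
    then show ?thesis unfolding e
      by (intro bexI[of _ "(inv h, toM B)"] PP_I[OF inv_closed[OF a(1)] B(1,2)]) (simp add: PP_mult PP_one a(1))
  qed
qed

sublocale PP: group PP by (rule PP_group)

lemma PP_pow: "(h, M) \<in> carrier PP \<Longrightarrow> (h, M) [^]\<^bsub>PP\<^esub> (k::nat) = (h [^] k, toM (mpow G c n (fn M) k))"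
proof (induction k)
  case 0
  have "mpow G c n (fn M) 0 = idm G c" by (rule ext) simp
  then show ?case by (simp add: PP_one)
next
  case (Suc k)
  have e: "mpow G c n (fn M) (Suc k) = mm G c n (mpow G c n (fn M) k) (fn M)" by (rule ext) simp
  have "toM (mm G c n (fn (toM (mpow G c n (fn M) k))) (fn M)) = toM (mm G c n (mpow G c n (fn M) k) (fn M))"
    unfolding toM_eq_iff by (rule mm_cong[OF fn_toM meq_refl])
  then show ?case unfolding PP.nat_pow_Suc Suc.IH[OF Suc.prems] PP_mult e by simp
qed

lemma meq_mpow: "meq n A B \<Longrightarrow> meq n (mpow G c n A k) (mpow G c n B k)"
proof (induction k)
  case (Suc k)
  have e: "mpow G c n A (Suc k) = mm G c n (mpow G c n A k) A" for A by (rule ext) simp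
  show ?case unfolding e by (rule mm_cong[OF Suc.IH[OF Suc.prems] Suc.prems])
qed (simp add: meq_def)

text \<open>Together with its converse below this identifies the first-order relation
  \<open>Dk\<close> with the graded pieces of a subgroup of \<open>PP\<close>, to which group theory
  applies.\<close>

lemma Dk_commutator_powers:
  "h \<in> carrier G \<Longrightarrow> \<forall>p. A p \<in> carrier G \<Longrightarrow> rho n G c h A \<Longrightarrow> Dk n d G c k h A \<Longrightarrow>
    (h, toM A) \<in> PP.commutator_powers d k"
proof (induction k arbitrary: h A)
  case 0
  then show ?case by (simp add: PP_one toM_eq_iff)
next
  case (Suc k)
  from Suc.prems(4) obtain h1 h2 h' h3 A1 A2 A' A3 where
    basic: "h' \<otimes> (h2 \<otimes> h1) = h1 \<otimes> h2 \<and> meq n (mm G c n A' (mm G c n A2 A1)) (mm G c n A1 A2) \<or>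
      h' = h1 [^] d \<and> meq n A' (mpow G c n A1 d)" and
    h: "h = h' \<otimes> h3" and Am: "meq n A (mm G c n A' A3)" and
    rho: "rho n G c h1 A1" "rho n G c h2 A2" "rho n G c h' A'" "rho n G c h3 A3" and
    G: "h1 \<in> carrier G" "h2 \<in> carrier G" "h' \<in> carrier G" "h3 \<in> carrier G" and
    A: "\<forall>p. A1 p \<in> carrier G" "\<forall>p. A2 p \<in> carrier G" "\<forall>p. A' p \<in> carrier G" "\<forall>p. A3 p \<in> carrier G" and
    D: "Dk n d G c k h3 A3"
    unfolding Dk.simps by (elim bexE exE conjE) (rule that)
  have x: "(h1, toM A1) \<in> carrier PP" "(h2, toM A2) \<in> carrier PP" "(h', toM A') \<in> carrier PP"
    using PP_I G A rho by blast+
  have "(h', toM A') \<otimes>\<^bsub>PP\<^esub> ((h2, toM A2) \<otimes>\<^bsub>PP\<^esub> (h1, toM A1)) = (h1, toM A1) \<otimes>\<^bsub>PP\<^esub> (h2, toM A2) \<or>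
    (h', toM A') = (h1, toM A1) [^]\<^bsub>PP\<^esub> d"
    using basic
  proof
    assume b: "h' \<otimes> (h2 \<otimes> h1) = h1 \<otimes> h2 \<and> meq n (mm G c n A' (mm G c n A2 A1)) (mm G c n A1 A2)"
    then show ?thesis unfolding PP_mult toM_mm prod.inject toM_eq_iff by blast
  next
    assume b: "h' = h1 [^] d \<and> meq n A' (mpow G c n A1 d)"
    then show ?thesis unfolding PP_pow[OF x(1)] prod.inject toM_eq_iff
      using meq_trans[OF _ meq_mpow[OF meq_sym[OF fn_toM]]] by blast
  qed
  moreover have "(h, toM A) = (h', toM A') \<otimes>\<^bsub>PP\<^esub> (h3, toM A3)"
    unfolding PP_mult toM_mm prod.inject toM_eq_iff using h Am by blast
  ultimately show ?case
    using Suc.IH[OF G(4) A(4) rho(4) D] x unfolding PP.commutator_powers.simps by blast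
qed

lemma commutator_powers_Dk:
  "(h, M) \<in> PP.commutator_powers d k \<Longrightarrow> Dk n d G c k h (fn M)"
proof (induction k arbitrary: h M)
  case 0
  then show ?case by (simp add: PP_one fn_toM)
next
  case (Suc k)
  from Suc.prems obtain b x x1 x2 where e: "(h, M) = b \<otimes>\<^bsub>PP\<^esub> x" and x: "x \<in> PP.commutator_powers d k"
    and G: "b \<in> carrier PP" "x1 \<in> carrier PP" "x2 \<in> carrier PP"
    and basic: "b \<otimes>\<^bsub>PP\<^esub> (x2 \<otimes>\<^bsub>PP\<^esub> x1) = x1 \<otimes>\<^bsub>PP\<^esub> x2 \<or> b = x1 [^]\<^bsub>PP\<^esub> d"
    unfolding PP.commutator_powers.simps by blast
  obtain h' M' where b': "b = (h', M')" by (cases b)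
  obtain h3 M3 where x': "x = (h3, M3)" by (cases x)
  obtain h1 M1 where x1': "x1 = (h1, M1)" by (cases x1)
  obtain h2 M2 where x2': "x2 = (h2, M2)" by (cases x2)
  note a' = PP_D[OF G(1)[unfolded b']] and a1 = PP_D[OF G(2)[unfolded x1']] and a2 = PP_D[OF G(3)[unfolded x2']]
    and a3 = PP_D[OF PP.commutator_powers_closed[OF x, unfolded x']]
  have D: "Dk n d G c k h3 (fn M3)" by (rule Suc.IH[OF x[unfolded x']])
  have h: "h = h' \<otimes> h3" and M: "M = toM (mm G c n (fn M') (fn M3))" using e unfolding b' x' PP_mult by simp_all
  have Mm: "meq n (fn M) (mm G c n (fn M') (fn M3))" unfolding M by (rule fn_toM)
  have bb: "h' \<otimes> (h2 \<otimes> h1) = h1 \<otimes> h2 \<and> meq n (mm G c n (fn M') (mm G c n (fn M2) (fn M1))) (mm G c n (fn M1) (fn M2)) \<or>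
      h' = h1 [^] d \<and> meq n (fn M') (mpow G c n (fn M1) d)"
    using basic
  proof
    assume "b \<otimes>\<^bsub>PP\<^esub> (x2 \<otimes>\<^bsub>PP\<^esub> x1) = x1 \<otimes>\<^bsub>PP\<^esub> x2"
    then have "h' \<otimes> (h2 \<otimes> h1) = h1 \<otimes> h2"
      "meq n (mm G c n (fn M') (fn (toM (mm G c n (fn M2) (fn M1))))) (mm G c n (fn M1) (fn M2))"
      unfolding b' x1' x2' PP_mult prod.inject toM_eq_iff by blast+
    then show ?thesis using meq_trans[OF mm_cong[OF meq_refl meq_sym[OF fn_toM]]] by blast
  next
    assume "b = x1 [^]\<^bsub>PP\<^esub> d"
    then have "h' = h1 [^] d" "M' = toM (mpow G c n (fn M1) d)"
      unfolding b' x1' PP_pow[OF G(2)[unfolded x1']] by simp_all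
    then show ?thesis using fn_toM by blast
  qed
  show ?case unfolding Dk.simps
    by (rule bexI[OF _ a1(1)], rule bexI[OF _ a2(1)], rule bexI[OF _ a'(1)], rule bexI[OF _ a3(1)],
      rule exI, rule conjI[OF a1(2)], rule exI, rule conjI[OF a2(2)], rule exI, rule conjI[OF a'(2)],
      rule exI, rule conjI[OF a3(2)], rule conjI[OF a1(3)], rule conjI[OF a2(3)], rule conjI[OF a'(3)],
      rule conjI[OF a3(3)], rule conjI[OF D], rule conjI[OF h], rule conjI[OF Mm], rule bb)
qed

text \<open>The hypotheses of the splitting: faithfulness for every k gives the trivial
  intersection, commutators and d-th powers are single factors of D, and the roots come from the
  last clause of \<open>rho_group\<close>.\<close>

lemma PP_split: "\<exists>C. subgroup C PP \<and> (\<Union>k. PP.commutator_powers d k) \<subseteq> C \<and>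
    (\<forall>z. (z, toM (idm G c)) \<in> C \<longrightarrow> z = \<one>) \<and>
    (\<forall>x\<in>carrier PP. \<exists>b\<in>C. \<exists>z\<in>carrier PP. snd z = toM (idm G c) \<and> x = b \<otimes>\<^bsub>PP\<^esub> z)"
proof -
  let ?I = "toM (idm G c)"
  let ?Z = "{x \<in> carrier PP. snd x = ?I}"
  let ?D = "\<Union>k. PP.commutator_powers d k"
  have one_Z: "\<one>\<^bsub>PP\<^esub> \<in> ?Z" using PP.one_closed by (simp add: PP_one)
  have IM: "toM (mm G c n (fn ?I) (fn M)) = M" if "(h, M) \<in> carrier PP" for h M
    using PP.l_one[OF that] unfolding PP_one PP_mult by simp
  have mult_Z: "a \<otimes>\<^bsub>PP\<^esub> b \<in> ?Z" if a: "a \<in> ?Z" and b: "b \<in> ?Z" for a b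
  proof -
    obtain h h' where e: "a = (h, ?I)" "b = (h', ?I)" using a b by (cases a, cases b) auto
    have bP: "(h', ?I) \<in> carrier PP" using b e by blast
    have "snd (a \<otimes>\<^bsub>PP\<^esub> b) = ?I" unfolding e PP_mult snd_conv by (rule IM[OF bP])
    then show ?thesis using a b by simp
  qed
  have Z: "subgroup ?Z PP"
  proof (rule PP.subgroupI)
    show "?Z \<noteq> {}" using one_Z by blast
    show "inv\<^bsub>PP\<^esub> a \<in> ?Z" if a: "a \<in> ?Z" for a
    proof -
      have aP: "a \<in> carrier PP" using a by blast
      obtain h where e: "a = (h, ?I)" using a by (cases a) auto
      obtain h' N where f: "inv\<^bsub>PP\<^esub> a = (h', N)" by (cases "inv\<^bsub>PP\<^esub> a")
      have fP: "(h', N) \<in> carrier PP" unfolding f[symmetric] by (rule PP.inv_closed[OF aP])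
      have "toM (mm G c n (fn ?I) (fn N)) = ?I"
        using PP.r_inv[OF aP, unfolded f, unfolded e PP_mult PP_one] by simp
      then have "N = ?I" unfolding IM[OF fP] .
      then show ?thesis using f fP by simp
    qed
    show "a \<otimes>\<^bsub>PP\<^esub> b \<in> ?Z" if "a \<in> ?Z" "b \<in> ?Z" for a b by (rule mult_Z[OF that])
  qed blast
  have "\<exists>C. subgroup C PP \<and> ?D \<subseteq> C \<and> C \<inter> ?Z \<subseteq> {\<one>\<^bsub>PP\<^esub>} \<and> (\<forall>x\<in>carrier PP. \<exists>b\<in>C. \<exists>z\<in>?Z. x = b \<otimes>\<^bsub>PP\<^esub> z)"
  proof (rule PP.central_complement[OF Z PP.commutator_powers_subgroup _ d_pos])
    show "?D \<inter> ?Z \<subseteq> {\<one>\<^bsub>PP\<^esub>}"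
    proof
      fix x assume x: "x \<in> ?D \<inter> ?Z"
      then obtain k where k: "x \<in> PP.commutator_powers d k" by blast
      obtain h where e: "x = (h, ?I)" using x by (cases x) auto
      have xP: "(h, ?I) \<in> carrier PP" using x e by blast
      note a = PP_D[OF xP]
      have "h = \<one> \<longleftrightarrow> meq n (fn ?I) (idm G c)"
        by (rule Dk_trivial[OF a(1,2,3) commutator_powers_Dk[OF k[unfolded e]]])
      then show "x \<in> {\<one>\<^bsub>PP\<^esub>}" using fn_toM e PP_one by simp
    qed
    show "\<exists>b\<in>?D. x \<otimes>\<^bsub>PP\<^esub> y = b \<otimes>\<^bsub>PP\<^esub> (y \<otimes>\<^bsub>PP\<^esub> x)" if x: "x \<in> carrier PP" and y: "y \<in> carrier PP" for x y
    proof -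
      define b where "b = x \<otimes>\<^bsub>PP\<^esub> y \<otimes>\<^bsub>PP\<^esub> inv\<^bsub>PP\<^esub> (y \<otimes>\<^bsub>PP\<^esub> x)"
      have bP: "b \<in> carrier PP" unfolding b_def using x y by simp
      have e: "b \<otimes>\<^bsub>PP\<^esub> (y \<otimes>\<^bsub>PP\<^esub> x) = x \<otimes>\<^bsub>PP\<^esub> y"
        unfolding b_def PP.m_assoc[OF PP.m_closed[OF x y] PP.inv_closed[OF PP.m_closed[OF y x]] PP.m_closed[OF y x]]
          PP.l_inv[OF PP.m_closed[OF y x]] by (rule PP.r_one[OF PP.m_closed[OF x y]])
      have "b \<in> PP.commutator_powers d (Suc 0)" by (rule PP.commutator_powers_1[OF bP x y disjI1[OF e]])
      then show ?thesis using e[symmetric] by blast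
    qed
    show "x [^]\<^bsub>PP\<^esub> d \<in> ?D" if x: "x \<in> carrier PP" for x
    proof -
      have "x [^]\<^bsub>PP\<^esub> d \<in> PP.commutator_powers d (Suc 0)"
        by (rule PP.commutator_powers_1[OF PP.nat_pow_closed[OF x] x x disjI2[OF refl]])
      then show ?thesis by blast
    qed
    show "\<exists>u\<in>?Z. u [^]\<^bsub>PP\<^esub> m = z" if m: "m dvd d" and z: "z \<in> ?Z" and zm: "z [^]\<^bsub>PP\<^esub> (d div m) = \<one>\<^bsub>PP\<^esub>" for m z
    proof -
      obtain h where e: "z = (h, ?I)" using z by (cases z) auto
      have zP: "(h, ?I) \<in> carrier PP" using z e by blast
      note a = PP_D[OF zP]
      have r: "rho n G c h (idm G c)" by (rule rho_meq[OF a(1,2,3) idm_closed fn_toM])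
      have "h [^] (d div m) = \<one>" using zm unfolding e PP_pow[OF zP] PP_one by simp
      then obtain u where u: "u \<in> carrier G" "rho n G c u (idm G c)" "u [^] m = h"
        using rho_root[OF m a(1) r] by blast
      have uP: "(u, ?I) \<in> carrier PP" by (rule PP_I[OF u(1) idm_closed u(2)])
      have "(u, ?I) [^]\<^bsub>PP\<^esub> k \<in> ?Z" for k :: nat
        by (induction k) (use one_Z mult_Z uP in auto)
      then have "snd ((u, ?I) [^]\<^bsub>PP\<^esub> m) = ?I" by blast
      moreover have "fst ((u, ?I) [^]\<^bsub>PP\<^esub> m) = h" unfolding PP_pow[OF uP] using u(3) by simp
      ultimately have "(u, ?I) [^]\<^bsub>PP\<^esub> m = z" unfolding e by (simp add: prod_eq_iff)
      then show ?thesis using uP by (intro bexI[of _ "(u, ?I)"]) simp_all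
    qed
  qed
  then obtain C where C: "subgroup C PP" "?D \<subseteq> C" "C \<inter> ?Z \<subseteq> {\<one>\<^bsub>PP\<^esub>}"
    and dec: "\<forall>x\<in>carrier PP. \<exists>b\<in>C. \<exists>z\<in>?Z. x = b \<otimes>\<^bsub>PP\<^esub> z" by blast
  have "z = \<one>" if "(z, ?I) \<in> C" for z
  proof -
    have "(z, ?I) \<in> C \<inter> ?Z" using that subgroup.mem_carrier[OF C(1) that] by simp
    then have "(z, ?I) = \<one>\<^bsub>PP\<^esub>" using C(3) by blast
    then show ?thesis unfolding PP_one by simp
  qed
  moreover have "\<exists>b\<in>C. \<exists>z\<in>carrier PP. snd z = ?I \<and> x = b \<otimes>\<^bsub>PP\<^esub> z" if "x \<in> carrier PP" for x
    using dec that by blast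
  ultimately show ?thesis using C(1,2) by blast
qed

text \<open>That C meets Z trivially makes the matrix determine the group element. The opposite
  direction and totality use that the scalars on either side have partners inside D, hence inside
  C.\<close>

lemma iso_SL: "G \<cong> SL n R"
proof -
  let ?I = "toM (idm G c)"
  obtain C where C: "subgroup C PP" and D: "(\<Union>k. PP.commutator_powers d k) \<subseteq> C"
    and CZ: "\<forall>z. (z, ?I) \<in> C \<longrightarrow> z = \<one>"
    and dec: "\<forall>x\<in>carrier PP. \<exists>b\<in>C. \<exists>z\<in>carrier PP. snd z = ?I \<and> x = b \<otimes>\<^bsub>PP\<^esub> z"
    using PP_split by blast
  note CP = subgroup.mem_carrier[OF C] and Cm = subgroup.m_closed[OF C] and Ci = subgroup.m_inv_closed[OF C]
  have inv_snd: "\<exists>N. inv\<^bsub>PP\<^esub> (h, M) = (inv h, N) \<and> toM (mm G c n (fn M) (fn N)) = ?I" if x: "(h, M) \<in> carrier PP" for h M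
  proof -
    obtain h' N where f: "inv\<^bsub>PP\<^esub> (h, M) = (h', N)" by (cases "inv\<^bsub>PP\<^esub> (h, M)")
    have "(h', N) \<in> carrier PP" using PP.inv_closed[OF x] unfolding f .
    then have h': "h' \<in> carrier G" by (rule PP_D(1))
    have e: "h \<otimes> h' = \<one>" "toM (mm G c n (fn M) (fn N)) = ?I"
      using PP.r_inv[OF x] unfolding f PP_mult PP_one by simp_all
    have "h' = inv h" using inv_solve_left'[of h \<one> h'] e(1) PP_D(1)[OF x] h' by (metis inv_equality inv_inv inv_closed)
    then show ?thesis using f e by simp
  qed
  have inj1: "h = h'" if x: "(h, M) \<in> C" "(h', M) \<in> C" for h h' M
  proof -
    note P = CP[OF x(1)] CP[OF x(2)]
    obtain N where N: "inv\<^bsub>PP\<^esub> (h', M) = (inv h', N)" "toM (mm G c n (fn M) (fn N)) = ?I" using inv_snd[OF P(2)] by blast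
    have "(h, M) \<otimes>\<^bsub>PP\<^esub> inv\<^bsub>PP\<^esub> (h', M) \<in> C" by (rule Cm[OF x(1) Ci[OF x(2)]])
    then have "h \<otimes> inv h' = \<one>" unfolding N(1) PP_mult N(2) using CZ by blast
    then show ?thesis using PP_D(1)[OF P(1)] PP_D(1)[OF P(2)] by (metis inv_closed inv_equality inv_inv)
  qed
  \<comment> \<open>A matrix M paired with 1 is paired in D with some w. As both pairs lie in C, w
    is 1, and faithfulness in D then gives M = 1.\<close>
  have one: "M = ?I" if x: "(\<one>, M) \<in> C" for M
  proof -
    note P = CP[OF x]
    note a = PP_D[OF P]
    obtain w where w: "w \<in> carrier G" "rho n G c w (fn M)" "Dk n d G c k0 w (fn M)" using Dk_scalar2[OF a(2,3)] by blast
    have "(w, M) \<in> PP.commutator_powers d k0"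
      using Dk_commutator_powers[OF w(1) a(2) w(2,3)] unfolding toM_fn[OF a(5)] .
    then have "(w, M) \<in> C" using D by blast
    then have w1: "w = \<one>" by (rule inj1[OF _ x])
    have "\<one> = \<one> \<longleftrightarrow> meq n (fn M) (idm G c)" by (rule Dk_trivial[OF a(1,2,3) w(3)[unfolded w1]])
    then have "toM (fn M) = ?I" unfolding toM_eq_iff by blast
    then show ?thesis unfolding toM_fn[OF a(5)] .
  qed
  have inj2: "M = N" if x: "(h, M) \<in> C" "(h, N) \<in> C" for h M N
  proof -
    note P = CP[OF x(1)] CP[OF x(2)]
    obtain N' where N': "inv\<^bsub>PP\<^esub> (h, N) = (inv h, N')" using inv_snd[OF P(2)] by blast
    have e: "(h, M) \<otimes>\<^bsub>PP\<^esub> inv\<^bsub>PP\<^esub> (h, N) = (\<one>, toM (mm G c n (fn M) (fn N')))"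
      unfolding N' PP_mult using PP_D(1)[OF P(1)] by simp
    have "(\<one>, toM (mm G c n (fn M) (fn N'))) \<in> C" using Cm[OF x(1) Ci[OF x(2)]] unfolding e .
    then have "(h, M) \<otimes>\<^bsub>PP\<^esub> inv\<^bsub>PP\<^esub> (h, N) = \<one>\<^bsub>PP\<^esub>" unfolding e PP_one using one by blast
    then have "(h, M) = (h, N)" using P by (metis PP.inv_closed PP.inv_equality PP.inv_inv)
    then show ?thesis by simp
  qed
  \<comment> \<open>The decomposition changes h by a scalar w. Some pair with first component w lies
    in D, so multiplying by it restores h at the expense of the matrix.\<close>
  have ex1: "\<exists>M. (h, M) \<in> C" if h: "h \<in> carrier G" for h
  proof -
    obtain A where A: "\<forall>p. A p \<in> carrier G" "rho n G c h A" using rho_total[OF h] by blast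
    obtain b z where bz: "b \<in> C" "z \<in> carrier PP" "snd z = ?I" "(h, toM A) = b \<otimes>\<^bsub>PP\<^esub> z"
      using dec PP_I[OF h A] by blast
    obtain h' M' where b: "b = (h', M')" by (cases b)
    obtain w where z: "z = (w, ?I)" using bz(3) by (cases z) auto
    note a = PP_D[OF bz(2)[unfolded z]]
    have r: "rho n G c w (idm G c)" by (rule rho_meq[OF a(1,2,3) idm_closed fn_toM])
    obtain B where B: "\<forall>p. B p \<in> carrier G" "rho n G c w B" "Dk n d G c k0 w B" using Dk_scalar1[OF a(1) r] by blast
    have "(w, toM B) \<in> C" using Dk_commutator_powers[OF a(1) B] D by blast
    then have "b \<otimes>\<^bsub>PP\<^esub> (w, toM B) \<in> C" by (rule Cm[OF bz(1)])
    moreover have "h = h' \<otimes> w" using bz(4) unfolding b z PP_mult by simp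
    ultimately show ?thesis unfolding b PP_mult by blast
  qed
  \<comment> \<open>Here no correction is required: a factor from Z does not alter the
    matrix.\<close>
  have ex2: "\<exists>h. (h, M) \<in> C" if M: "M \<in> carrier (SL n R)" for M
  proof -
    have g: "gmat M" "slR n G c (fn M)" using M SL_carrier by blast+
    obtain h where h: "h \<in> carrier G" "rho n G c h (fn M)" using rho_surj[OF gmat_fn[OF g(1)] g(2)] by blast
    have x: "(h, M) \<in> carrier PP" using h g(1) by (simp add: PP_def)
    obtain b z where bz: "b \<in> C" "z \<in> carrier PP" "snd z = ?I" "(h, M) = b \<otimes>\<^bsub>PP\<^esub> z" using dec x by blast
    obtain h' M' where b: "b = (h', M')" by (cases b)
    obtain w where z: "z = (w, ?I)" using bz(3) by (cases z) auto
    have "b \<otimes>\<^bsub>PP\<^esub> \<one>\<^bsub>PP\<^esub> = b" by (rule PP.r_one[OF CP[OF bz(1)]])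
    then have "toM (mm G c n (fn M') (fn ?I)) = M'" unfolding b PP_one PP_mult by simp
    then have "M = M'" using bz(4) unfolding b z PP_mult by simp
    then show ?thesis using bz(1) b by blast
  qed
  define f where "f h = (THE M. (h, M) \<in> C)" for h
  have f: "(h, f h) \<in> C" if h: "h \<in> carrier G" for h
    unfolding f_def by (rule theI') (use ex1[OF h] inj2 in blast)
  have f_eq: "f h = M" if "(h, M) \<in> C" for h M
    by (rule inj2[OF f[OF PP_D(1)[OF CP[OF that]]] that])
  have f_SL: "f h \<in> carrier (SL n R)" if h: "h \<in> carrier G" for h
    unfolding SL_carrier using PP_D(4,6)[OF CP[OF f[OF h]]] by blast
  have "f \<in> iso G (SL n R)"
  proof (rule isoI)
    show "f \<in> hom G (SL n R)"
    proof (rule homI)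
      fix x y assume x: "x \<in> carrier G" and y: "y \<in> carrier G"
      have "(x \<otimes> y, toM (mm G c n (fn (f x)) (fn (f y)))) \<in> C" using Cm[OF f[OF x] f[OF y]] unfolding PP_mult .
      then show "f (x \<otimes> y) = f x \<otimes>\<^bsub>SL n R\<^esub> f y" unfolding SL_mult[OF f_SL[OF x] f_SL[OF y]] by (rule f_eq)
    qed (rule f_SL)
    show "bij_betw f (carrier G) (carrier (SL n R))"
      unfolding bij_betw_def
    proof
      show "inj_on f (carrier G)"
      proof (rule inj_onI)
        fix x y assume x: "x \<in> carrier G" and y: "y \<in> carrier G" and e: "f x = f y"
        show "x = y" by (rule inj1[OF f[OF x] f[OF y, folded e]])
      qed
      show "f ` carrier G = carrier (SL n R)"
      proof
        show "f ` carrier G \<subseteq> carrier (SL n R)" using f_SL by blast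
        show "carrier (SL n R) \<subseteq> f ` carrier G"
        proof
          fix M assume "M \<in> carrier (SL n R)"
          then obtain h where h: "(h, M) \<in> C" using ex2 by blast
          show "M \<in> f ` carrier G" using f_eq[OF h] PP_D(1)[OF CP[OF h]] by blast
        qed
      qed
    qed
  qed
  then show ?thesis unfolding is_iso_def by blast
qed

end

section \<open>Sentences of the interpreted ring\<close>

lemma (in interpreted) reval_eval:
  assumes "range e \<subseteq> carrier R"
  shows "reval G c e t \<in> carrier R \<and> ring_eval R e t = reval G c e t"
proof (induction t)
  case (RVar x)
  then show ?case using assms by auto
next
  case (RNeg t)
  then show ?case using rc(1) R_uminus by simp
next
  case (RAdd s t)
  then show ?case using rc(3) by (simp add: R_simps)
next
  case (RMult s t)
  then show ?case using rc(4) by (simp add: R_simps)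
next
  case RZero
  show ?case unfolding reval.simps ring_eval.simps R_simps using rc_zero by blast
next
  case ROne
  show ?case unfolding reval.simps ring_eval.simps R_simps using rc_one by blast
qed

lemma ring_eval_cong: "(\<forall>x\<in>ring_term_vars t. e x = e' x) \<Longrightarrow> ring_eval R e t = ring_eval R e' t"
  by (induction t) auto

text \<open>A sentence does not depend on the assignment. The constant assignment to the unit of the
  ring is named by \<open>c\<close>, so the right-hand side is definable with parameters c
  only.\<close>

lemma (in interpreted) models_iff_sat:
  assumes "free_vars ring_term_vars \<phi> = {}"
  shows "models (carrier R) (ring_eval R) \<phi> \<longleftrightarrow> sat (carrier R) (reval G c) (\<lambda>k. c (0, 1)) \<phi>"
proof -
  have ind: "sat (carrier R) (ring_eval R) e \<phi> = sat (carrier R) (ring_eval R) e' \<phi>" for e e'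
    by (rule sat_cong[where tv = ring_term_vars], rule ring_eval_cong, assumption) (simp add: assms)
  have c: "range (\<lambda>k::nat. c (0, 1)) \<subseteq> carrier R" using rc_one by auto
  have "sat (carrier R) (ring_eval R) (\<lambda>k. c (0, 1)) \<phi> = sat (carrier R) (reval G c) (id \<circ> (\<lambda>k. c (0, 1))) \<phi>"
    by (rule sat_iso[OF bij_betw_id _ c]) (use reval_eval in simp)
  then have "sat (carrier R) (ring_eval R) (\<lambda>k. c (0, 1)) \<phi> = sat (carrier R) (reval G c) (\<lambda>k. c (0, 1)) \<phi>"
    by (simp add: o_def)
  then show ?thesis unfolding models_def using ind[of _ "\<lambda>k. c (0, 1)"] c by blast
qed

lemma (in standard_elements) interpreted:
  assumes "\<And>p. c p \<in> carrier G"
  shows "interpreted G n d (n - 1) c"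
  by (intro interpreted.intro interpreted_axioms.intro GG_group assms mu(2) rc_ring rho_group Dk_faithful Dk_scalars)

lemma em_pow:
  assumes "i < n" "j < n" "i \<noteq> j"
  shows "em n i j a ^\<^sub>m k = em n i j (of_nat k * a)"
proof (induction k)
  case 0
  have "em n i j a ^\<^sub>m 0 = 1\<^sub>m n" by (simp add: em_def)
  then show ?case by (simp add: em_zero)
next
  case (Suc k)
  show ?case unfolding pow_mat.simps Suc em_add[OF assms] by (simp add: algebra_simps)
qed

lemma (in complex_subring) steinberg_standard:
  assumes c: "\<And>i j. i < n \<Longrightarrow> j < n \<Longrightarrow> i \<noteq> j \<Longrightarrow> c (i, j) = em n i j 1" and L: "0 < L"
  shows "steinberg n L G c"
  unfolding steinberg_def
proof (intro conjI allI impI)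
  show "c (i, j) \<otimes>\<^bsub>G\<^esub> c (j, k) = c (i, k) \<otimes>\<^bsub>G\<^esub> (c (j, k) \<otimes>\<^bsub>G\<^esub> c (i, j))"
    if "i < n" "j < n" "k < n" "i \<noteq> j" "j \<noteq> k" "i \<noteq> k" for i j k
    unfolding c[OF that(1,2,4)] c[OF that(2,3,5)] c[OF that(1,3,6)] GG_mult
    using em_steinberg[OF that, of 1 1] by simp
  show "c (i, j) \<otimes>\<^bsub>G\<^esub> c (k, l) = c (k, l) \<otimes>\<^bsub>G\<^esub> c (i, j)"
    if "i < n" "j < n" "k < n" "l < n" "i \<noteq> j" "k \<noteq> l" "j \<noteq> k" "i \<noteq> l" for i j k l
    unfolding c[OF that(1,2,5)] c[OF that(3,4,6)] GG_mult by (rule em_commute[OF that(1-4,7,8)])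
  fix i j assume ij: "i < n" "j < n" "i \<noteq> j"
  have "(em n i j (of_nat L * 1)) $$ (i, j) \<noteq> 1\<^sub>m n $$ (i, j)" using ij L by (simp add: em_index)
  then show "c (i, j) [^]\<^bsub>G\<^esub> L \<noteq> \<one>\<^bsub>G\<^esub>"
    unfolding c[OF ij] GG_pow[OF em_G[OF ij one_S]] em_pow[OF ij] GG_one by auto
qed

lemma (in complex_subring) cring_complex_subring:
  "cring (ring_on S)"
proof (rule cringI)
  show "abelian_group (ring_on S)"
    by (rule abelian_groupI) (auto simp: add_S zero_S intro!: bexI[of _ "- x" for x] uminus_S)
  show "Group.comm_monoid (ring_on S)"
    by (rule comm_monoidI) (auto simp: mult_S one_S)
qed (simp add: algebra_simps)

section \<open>Transfer to an elementarily equivalent group\<close>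

locale equivalent_group = complex_subring +
  fixes H :: "('h, 'b) monoid_scheme"
  assumes H_group: "group H" and equiv: "group_elem_equiv H (GG n S)"
begin

sublocale GH: group_pair G H .

text \<open>Universal statements pass between the groups in both directions: if H had no such tuple,
  the group of matrices would have none either, against the elementary matrices.\<close>

lemma steinberg_exists:
  assumes "0 < L"
  shows "\<exists>c. range c \<subseteq> carrier H \<and> steinberg n L H c"
proof (rule ccontr)
  assume no: "\<not> (\<exists>c. range c \<subseteq> carrier H \<and> steinberg n L H c)"
  interpret HG: group_pair H G .
  define c where "c p = (if fst p < n \<and> snd p < n \<and> fst p \<noteq> snd p then em n (fst p) (snd p) 1 else 1\<^sub>m n)" for p
  have c: "c (i, j) = em n i j 1" if "i < n" "j < n" "i \<noteq> j" for i j using that by (simp add: c_def)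
  have cG: "range c \<subseteq> carrier G" using GG.one_closed em_G one_S by (auto simp: c_def)
  have "HG.dfn (\<lambda>e. \<not> steinberg n L H e) (\<lambda>e. \<not> steinberg n L G e)"
    by (intro HG.dfn_not HG.dfn_steinberg HG.dtm_var)
  moreover have "group_elem_equiv G H" using equiv by (simp add: group_elem_equiv_def)
  ultimately have "\<not> steinberg n L G c"
    by (rule HG.dfn_transfer[OF _ H_group GG_group _ _ cG]) (use no in blast)
  then show False using steinberg_standard[OF c assms] by blast
qed

text \<open>The statement transferred is that every Steinberg tuple has the property. Among matrices
  each such tuple is the image of a standard one under an automorphism, and definable properties are
  invariant.\<close>

lemma transfer_standard:
  assumes dfn: "GH.dfn P Q"
    and std: "\<And>c. (\<And>p. c p \<in> carrier G) \<Longrightarrow> standard_elements S n c \<Longrightarrow> P c"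
    and c: "range c \<subseteq> carrier H" "steinberg n (fact n ^ (n - 1)) H c"
  shows "Q c"
proof -
  let ?L = "fact n ^ (n - 1) :: nat"
  have "GH.dfn (\<lambda>e. steinberg n ?L G e \<longrightarrow> P e) (\<lambda>e. steinberg n ?L H e \<longrightarrow> Q e)"
    by (intro GH.dfn_imp GH.dfn_steinberg GH.dtm_var dfn)
  then have "steinberg n ?L H c \<longrightarrow> Q c"
  proof (rule GH.dfn_transfer[OF _ GG_group H_group equiv _ c(1)], intro impI)
    fix e assume e: "range e \<subseteq> carrier G" and st: "steinberg n ?L G e"
    interpret st: steinberg_elements S n e
      by unfold_locales (use e st in auto)
    obtain f where f: "f \<in> iso G G" "\<And>i j. i < n \<Longrightarrow> j < n \<Longrightarrow> i \<noteq> j \<Longrightarrow> f (em n i j 1) = e (i, j)"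
      using st.standard_up_to_automorphism by blast
    \<comment> \<open>The whole family is pulled back, including the diagonal positions, about which
      nothing is known beyond membership in the group.\<close>
    define e' where "e' p = inv_into (carrier G) f (e p)" for p
    have im: "f ` carrier G = carrier G" and inj: "inj_on f (carrier G)" using f(1) by (simp_all add: iso_def bij_betw_def)
    have eG: "e p \<in> f ` carrier G" for p using e unfolding im by blast
    have e'G: "e' p \<in> carrier G" for p unfolding e'_def by (rule inv_into_into[OF eG])
    have fe: "f \<circ> e' = e" unfolding e'_def by (rule ext) (simp add: f_inv_into_f[OF eG])
    have "standard_elements S n e'"
    proof unfold_locales
      show "e' (i, j) = em n i j 1" if "i < n" "j < n" "i \<noteq> j" for i j
        unfolding e'_def f(2)[OF that, symmetric] by (rule inv_into_f_f[OF inj em_G[OF that one_S]])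
    qed
    then have "P e'" by (rule std[OF e'G])
    moreover have "P (f \<circ> e') = P e'"
      by (rule GH.dfn_automorphism[OF dfn GG_group H_group f(1)]) (use e'G in blast)
    ultimately show "P e" unfolding fe by blast
  qed
  then show ?thesis using c(2) by blast
qed

theorem special_linear: "\<exists>R :: 'h ring. cring R \<and> ring_elem_equiv R (ring_on S) \<and> H \<cong> SL n R"
proof -
  let ?RS = "ring_on S"
  have L: "0 < (fact n ^ (n - 1) :: nat)" by simp
  obtain c where c: "range c \<subseteq> carrier H" "steinberg n (fact n ^ (n - 1)) H c"
    using steinberg_exists[OF L] by blast
  let ?d = "standard_elements.d S n"
  note st = standard_elements.rc_ring standard_elements.rho_group standard_elements.Dk_faithful standard_elements.Dk_scalars
  \<comment> \<open>A standard family, serving only as an instance from which d > 0 is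
    obtained.\<close>
  define c0 where "c0 p = (if fst p < n \<and> snd p < n \<and> fst p \<noteq> snd p then em n (fst p) (snd p) 1 else 1\<^sub>m n)" for p
  interpret c0: standard_elements S n c0 by unfold_locales (simp add: c0_def)
  have d: "0 < ?d" by (rule c0.mu(2))
  interpret I: interpreted H n ?d "n - 1" c
  proof (intro interpreted.intro interpreted_axioms.intro H_group d)
    show "c p \<in> carrier H" for p using c(1) by blast
    show "rc_ring n H c" by (rule transfer_standard[OF GH.dfn_rc_ring _ c]) (rule st(1))
    show "rho_group n ?d H c" by (rule transfer_standard[OF GH.dfn_rho_group _ c]) (rule st(2))
    show "Dk_faithful n ?d k H c" for k by (rule transfer_standard[OF GH.dfn_Dk_faithful _ c]) (rule st(3))
    show "Dk_scalars n ?d (n - 1) H c" by (rule transfer_standard[OF GH.dfn_Dk_scalars _ c]) (rule st(4))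
  qed
  have RS: "cring ?RS" by (rule cring_complex_subring)
  have "ring_elem_equiv (RR n H c) ?RS"
    unfolding ring_elem_equiv_def
  proof (intro allI impI)
    fix \<phi> assume closed: "free_vars ring_term_vars \<phi> = {}"
    \<comment> \<open>The truth value over the fixed ring enters as a constant predicate, and all
      free variables of the ring formula are replaced by the unit \<open>e (0, 1)\<close>.\<close>
    have dfn: "GH.dfn (\<lambda>e. sat (carrier (RR n G e)) (reval G e) (\<lambda>k. e (0, 1)) \<phi> \<longleftrightarrow> models (carrier ?RS) (ring_eval ?RS) \<phi>)
      (\<lambda>e. sat (carrier (RR n H e)) (reval H e) (\<lambda>k. e (0, 1)) \<phi> \<longleftrightarrow> models (carrier ?RS) (ring_eval ?RS) \<phi>)"
      using GH.dfn_iff[OF GH.dfn_reindex[OF GH.dfn_sat_ring, where f = "case_sum (\<lambda>p. p) (\<lambda>_. (0, 1))"] GH.dfn_const] by (simp only: sum.case)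
    have "sat (carrier (RR n H c)) (reval H c) (\<lambda>k. c (0, 1)) \<phi> \<longleftrightarrow> models (carrier ?RS) (ring_eval ?RS) \<phi>"
    proof (rule transfer_standard[OF dfn _ c])
      fix c' assume c': "\<And>p. c' p \<in> carrier G" and "standard_elements S n c'"
      then interpret c': standard_elements S n c' by blast
      interpret I': interpreted G n ?d "n - 1" c' by (rule c'.interpreted[OF c'])
      show "sat (carrier (RR n G c')) (reval G c') (\<lambda>k. c' (0, 1)) \<phi> \<longleftrightarrow> models (carrier ?RS) (ring_eval ?RS) \<phi>"
        unfolding I'.models_iff_sat[OF closed, symmetric]
        by (rule models_ring_iso[OF RS I'.R_cring c'.e_ring_iso, symmetric])
    qed
    then show "models (carrier (RR n H c)) (ring_eval (RR n H c)) \<phi> = models (carrier ?RS) (ring_eval ?RS) \<phi>"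
      unfolding I.models_iff_sat[OF closed] .
  qed
  then show ?thesis using I.R_cring I.iso_SL by blast
qed

end

section \<open>Embedding rings of integers into the complex numbers\<close>

text \<open>z is an eigenvalue of an integer matrix and so a root of its characteristic polynomial,
  which is monic.\<close>

lemma algebraic_int_eigenvalue:
  fixes z :: complex and A :: "int mat"
  assumes A: "A \<in> carrier_mat N N" and k: "k < N" "g k \<noteq> 0"
    and eq: "\<And>k. k < N \<Longrightarrow> z * g k = (\<Sum>l<N. of_int (A $$ (k, l)) * g l)"
  shows "algebraic_int z"
proof -
  let ?B = "map_mat of_int A :: complex mat"
  have B: "?B \<in> carrier_mat N N" using A by simp
  let ?v = "vec N g"
  have "?B *\<^sub>v ?v = z \<cdot>\<^sub>v ?v"
  proof (rule eq_vecI)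
    fix i assume "i < dim_vec (z \<cdot>\<^sub>v ?v)"
    then have i: "i < N" by simp
    have "(?B *\<^sub>v ?v) $ i = (\<Sum>l<N. of_int (A $$ (i, l)) * g l)"
      using A i by (auto simp: scalar_prod_def atLeast0LessThan intro!: sum.cong)
    then show "(?B *\<^sub>v ?v) $ i = (z \<cdot>\<^sub>v ?v) $ i" using eq[OF i] i by simp
  qed (use A in simp)
  moreover have "?v \<noteq> 0\<^sub>v N"
  proof
    assume "?v = 0\<^sub>v N"
    then have "?v $ k = 0\<^sub>v N $ k" by simp
    then show False using k by simp
  qed
  ultimately have "eigenvalue ?B z" unfolding eigenvalue_def eigenvector_def using A by (intro exI[of _ ?v]) simp
  then have "poly (char_poly ?B) z = 0" using eigenvalue_root_char_poly[OF B] by simp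
  then have "poly (map_poly of_int (char_poly A)) z = 0" unfolding of_int_hom.char_poly_hom[OF A] .
  then show ?thesis unfolding algebraic_int_altdef_ipoly using degree_monic_char_poly[OF A] by blast
qed

definition int_span :: "'i set \<Rightarrow> ('i \<Rightarrow> complex) \<Rightarrow> complex set" where
  "int_span I g = {z. \<exists>a. z = (\<Sum>i\<in>I. of_int (a i) * g i)}"

lemma int_spanI: "z = (\<Sum>i\<in>I. of_int (a i) * g i) \<Longrightarrow> z \<in> int_span I g"
  unfolding int_span_def mem_Collect_eq by (rule exI[of _ a])

lemma int_span_add: "y \<in> int_span I g \<Longrightarrow> z \<in> int_span I g \<Longrightarrow> y + z \<in> int_span I g"
proof -
  assume "y \<in> int_span I g" "z \<in> int_span I g"
  then obtain a b where "y = (\<Sum>i\<in>I. of_int (a i) * g i)" "z = (\<Sum>i\<in>I. of_int (b i) * g i)"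
    by (auto simp: int_span_def)
  then have "y + z = (\<Sum>i\<in>I. of_int (a i + b i) * g i)" by (simp add: sum.distrib algebra_simps)
  then show ?thesis by (rule int_spanI)
qed

lemma int_span_scale: "z \<in> int_span I g \<Longrightarrow> of_int k * z \<in> int_span I g"
proof -
  assume "z \<in> int_span I g"
  then obtain a where "z = (\<Sum>i\<in>I. of_int (a i) * g i)" by (auto simp: int_span_def)
  then have "of_int k * z = (\<Sum>i\<in>I. of_int (k * a i) * g i)" by (simp add: sum_distrib_left algebra_simps)
  then show ?thesis by (rule int_spanI)
qed

lemma int_span_zero: "0 \<in> int_span I g"
  unfolding int_span_def by (rule CollectI, rule exI[of _ "\<lambda>_. 0"]) simp

lemma int_span_sum: "(\<And>j. j \<in> J \<Longrightarrow> f j \<in> int_span I g) \<Longrightarrow> sum f J \<in> int_span I g"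
  by (induction J rule: infinite_finite_induct) (simp_all add: int_span_zero int_span_add)

lemma int_span_base:
  assumes "finite I" "i \<in> I"
  shows "g i \<in> int_span I g"
proof -
  have "(\<Sum>j\<in>I. of_int (if j = i then 1 else 0) * g j) = (\<Sum>j\<in>I. if j = i then g i else 0)"
    by (rule sum.cong) auto
  then have "g i = (\<Sum>j\<in>I. of_int (if j = i then 1 else 0) * g j)" using assms by simp
  then show ?thesis by (rule int_spanI)
qed

text \<open>The determinant trick: multiplication by z on a finitely generated module of complex
  numbers is given by an integer matrix.\<close>

lemma algebraic_int_span:
  assumes I: "finite I" and i0: "i0 \<in> I" "g i0 \<noteq> 0"
    and inv: "\<And>i. i \<in> I \<Longrightarrow> z * g i \<in> int_span I g"
  shows "algebraic_int z"
proof -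
  obtain h where h: "bij_betw h {0..<card I} I" using ex_bij_betw_nat_finite[OF I] by blast
  have hI: "h k \<in> I" if "k < card I" for k using h that by (auto simp: bij_betw_def)
  have "\<exists>a. \<forall>i\<in>I. z * g i = (\<Sum>j\<in>I. of_int (a i j) * g j)"
    using inv unfolding int_span_def by (intro bchoice) blast
  then obtain a where a: "\<And>i. i \<in> I \<Longrightarrow> z * g i = (\<Sum>j\<in>I. of_int (a i j) * g j)" by blast
  define A where "A = mat (card I) (card I) (\<lambda>(k, l). a (h k) (h l))"
  have "i0 \<in> h ` {0..<card I}" using i0(1) bij_betw_imp_surj_on[OF h] by simp
  then obtain k0 where k0: "k0 < card I" "h k0 = i0" by (rule imageE) simp
  show ?thesis
  proof (rule algebraic_int_eigenvalue[of A "card I" k0 "\<lambda>k. g (h k)"])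
    show "A \<in> carrier_mat (card I) (card I)" by (simp add: A_def)
    show "k0 < card I" "g (h k0) \<noteq> 0" using k0 i0 by simp_all
    fix k assume k: "k < card I"
    have "z * g (h k) = (\<Sum>l\<in>{0..<card I}. of_int (a (h k) (h l)) * g (h l))"
      unfolding a[OF hI[OF k]] by (rule sum.reindex_bij_betw[OF h, symmetric])
    then show "z * g (h k) = (\<Sum>l<card I. of_int (A $$ (k, l)) * g (h l))"
      using k by (simp add: A_def atLeast0LessThan)
  qed
qed

lemma algebraic_int_power_relation:
  fixes x :: complex
  assumes "algebraic_int x"
  shows "\<exists>a u. 0 < a \<and> x ^ a = (\<Sum>i<a. of_int (u i) * x ^ i)"
proof -
  obtain p :: "int poly" where p: "poly (map_poly of_int p) x = 0" "Polynomial.coeff p (Polynomial.degree p) = 1"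
    using assms unfolding algebraic_int_altdef_ipoly by blast
  let ?a = "Polynomial.degree p"
  have "poly (map_poly of_int p) x = (\<Sum>i\<le>?a. of_int (Polynomial.coeff p i) * x ^ i)"
    unfolding poly_altdef by (simp add: coeff_map_poly)
  also have "\<dots> = (\<Sum>i<?a. of_int (Polynomial.coeff p i) * x ^ i) + x ^ ?a"
    unfolding lessThan_Suc_atMost[symmetric] sum.lessThan_Suc p(2) by simp
  finally have "(\<Sum>i<?a. of_int (Polynomial.coeff p i) * x ^ i) + x ^ ?a = 0" unfolding p(1) by (rule sym)
  from minus_unique[OF this] have e: "x ^ ?a = (\<Sum>i<?a. of_int (- Polynomial.coeff p i) * x ^ i)"
    unfolding of_int_minus mult_minus_left sum_negf by (rule sym)
  moreover have "0 < ?a"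
  proof (rule ccontr)
    assume "\<not> 0 < ?a"
    then have a0: "?a = 0" by simp
    from e[unfolded a0] have "1 = (0::complex)" by (simp only: power_0 lessThan_0 sum.empty)
    then show False by (rule notE[OF one_neq_zero])
  qed
  ultimately show ?thesis
    by (intro exI[of _ ?a] exI[of _ "\<lambda>i. - Polynomial.coeff p i"] conjI)
qed

text \<open>The integral span of the products of bounded powers of x and y is stable under both,
  because the highest power of each is an integral combination of the lower ones.\<close>

lemma algebraic_int_closed:
  fixes x y :: complex
  assumes "algebraic_int x" "algebraic_int y"
  shows "algebraic_int (x + y)" "algebraic_int (x * y)"
proof -
  obtain a u where a: "0 < a" "x ^ a = (\<Sum>i<a. of_int (u i) * x ^ i)"
    using algebraic_int_power_relation[OF assms(1)] by blast
  obtain b v where b: "0 < b" "y ^ b = (\<Sum>i<b. of_int (v i) * y ^ i)"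
    using algebraic_int_power_relation[OF assms(2)] by blast
  let ?I = "{..<a} \<times> {..<b}"
  define g where "g = (\<lambda>(i, j). x ^ i * y ^ j)"
  have fin: "finite ?I" by simp
  have base: "x ^ i * y ^ j \<in> int_span ?I g" if "i < a" "j < b" for i j
    using int_span_base[OF fin, of "(i, j)" g] that by (simp add: g_def)
  have xg: "x * (x ^ i * y ^ j) \<in> int_span ?I g" if ij: "i < a" "j < b" for i j
  proof (cases "Suc i < a")
    case True
    then show ?thesis using base[OF True ij(2)] by (simp add: algebra_simps)
  next
    case False
    then have "a = Suc i" using ij by simp
    then have "x * (x ^ i * y ^ j) = x ^ a * y ^ j" by simp
    also have "\<dots> = (\<Sum>k<a. of_int (u k) * (x ^ k * y ^ j))" unfolding a(2) sum_distrib_right by (simp add: mult.assoc)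
    also have "\<dots> \<in> int_span ?I g" by (intro int_span_sum int_span_scale base) (use ij in simp_all)
    finally show ?thesis .
  qed
  have yg: "y * (x ^ i * y ^ j) \<in> int_span ?I g" if ij: "i < a" "j < b" for i j
  proof (cases "Suc j < b")
    case True
    then show ?thesis using base[OF ij(1) True] by (simp add: algebra_simps)
  next
    case False
    then have "b = Suc j" using ij by simp
    then have "y * (x ^ i * y ^ j) = x ^ i * y ^ b" by simp
    also have "\<dots> = (\<Sum>k<b. of_int (v k) * (x ^ i * y ^ k))" unfolding b(2) sum_distrib_left by (simp add: mult.left_commute)
    also have "\<dots> \<in> int_span ?I g" by (intro int_span_sum int_span_scale base) (use ij in simp_all)
    finally show ?thesis .
  qed
  have xM: "x * w \<in> int_span ?I g" if "w \<in> int_span ?I g" for w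
  proof -
    obtain c where c: "w = (\<Sum>i\<in>?I. of_int (c i) * g i)" using \<open>w \<in> _\<close> unfolding int_span_def by blast
    have "x * w = (\<Sum>i\<in>?I. of_int (c i) * (x * g i))" unfolding c sum_distrib_left by (simp add: mult.left_commute)
    moreover have "x * g i \<in> int_span ?I g" if "i \<in> ?I" for i using xg[of "fst i" "snd i"] that by (auto simp: g_def)
    ultimately show ?thesis by (simp only:) (intro int_span_sum int_span_scale)
  qed
  have 00: "(0, 0) \<in> ?I" "g (0, 0) \<noteq> 0" using a b by (simp_all add: g_def)
  show "algebraic_int (x + y)"
  proof (rule algebraic_int_span[of ?I "(0, 0)" g, OF fin 00])
    fix i assume "i \<in> ?I"
    then obtain r s where "i = (r, s)" "r < a" "s < b" by auto
    then show "(x + y) * g i \<in> int_span ?I g" using int_span_add[OF xg yg, of r s r s] by (simp add: g_def algebra_simps)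
  qed
  show "algebraic_int (x * y)"
  proof (rule algebraic_int_span[of ?I "(0, 0)" g, OF fin 00])
    fix i assume "i \<in> ?I"
    then obtain r s where "i = (r, s)" "r < a" "s < b" by auto
    then show "x * y * g i \<in> int_span ?I g" using xM[OF yg, of r s] by (simp add: g_def algebra_simps)
  qed
qed

text \<open>\<open>poly_action P b \<mu>\<close> is \<open>P\<close> of the operator sending \<open>\<mu>\<close> to \<open>y \<mapsto> \<mu> (b y)\<close>, applied to \<open>\<mu>\<close>.\<close>

definition poly_action :: "('a, 'm) monoid_scheme \<Rightarrow> complex poly \<Rightarrow> 'a \<Rightarrow> ('a \<Rightarrow> complex) \<Rightarrow> 'a \<Rightarrow> complex" where
  "poly_action K P b \<mu> y = (\<Sum>i\<le>Polynomial.degree P. Polynomial.coeff P i * \<mu> (b [^]\<^bsub>K\<^esub> i \<otimes>\<^bsub>K\<^esub> y))"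

lemma poly_action_le:
  assumes "Polynomial.degree P \<le> N"
  shows "poly_action K P b \<mu> y = (\<Sum>i\<le>N. Polynomial.coeff P i * \<mu> (b [^]\<^bsub>K\<^esub> i \<otimes>\<^bsub>K\<^esub> y))"
  unfolding poly_action_def
  by (rule sum.mono_neutral_left) (use assms in \<open>auto simp: coeff_eq_0\<close>)

lemma poly_action_add: "poly_action K (P + Q) b \<mu> y = poly_action K P b \<mu> y + poly_action K Q b \<mu> y"
proof -
  let ?N = "max (Polynomial.degree P) (Polynomial.degree Q)"
  have "Polynomial.degree (P + Q) \<le> ?N" by (rule degree_add_le) simp_all
  then show ?thesis
    using poly_action_le[of P ?N K b \<mu> y] poly_action_le[of Q ?N K b \<mu> y] poly_action_le[of "P + Q" ?N K b \<mu> y]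
    by (simp add: algebra_simps sum.distrib)
qed

lemma poly_action_monom:
  assumes "monoid K"
  shows "poly_action K (Polynomial.monom a k) b \<mu> y = a * \<mu> (b [^]\<^bsub>K\<^esub> k \<otimes>\<^bsub>K\<^esub> y)"
proof -
  have "poly_action K (Polynomial.monom a k) b \<mu> y =
      (\<Sum>i\<le>k. Polynomial.coeff (Polynomial.monom a k) i * \<mu> (b [^]\<^bsub>K\<^esub> i \<otimes>\<^bsub>K\<^esub> y))"
    by (rule poly_action_le) (rule degree_monom_le)
  also have "\<dots> = (\<Sum>i\<le>k. if i = k then a * \<mu> (b [^]\<^bsub>K\<^esub> k \<otimes>\<^bsub>K\<^esub> y) else 0)"
    by (rule sum.cong) auto
  finally show ?thesis by simp
qed

lemma poly_action_linear_factor: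
  fixes \<mu> :: "'a \<Rightarrow> complex"
  assumes K: "Group.comm_monoid K" and b: "b \<in> carrier K" and y: "y \<in> carrier K"
  shows "poly_action K ([:- z, 1:] * Q) b \<mu> y = poly_action K Q b (\<lambda>y. \<mu> (b \<otimes>\<^bsub>K\<^esub> y) - z * \<mu> y) y"
proof -
  interpret K: Group.comm_monoid K by (rule K)
  let ?d = "Polynomial.degree Q"
  let ?m = "\<lambda>i. \<mu> (b [^]\<^bsub>K\<^esub> i \<otimes>\<^bsub>K\<^esub> y)"
  have e: "[:- z, 1:] * Q = pCons 0 Q + Polynomial.smult (- z) Q" by simp
  have "poly_action K (pCons 0 Q) b \<mu> y = (\<Sum>i\<le>Suc ?d. Polynomial.coeff (pCons 0 Q) i * ?m i)"
    by (rule poly_action_le) (rule degree_pCons_le)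
  also have "\<dots> = (\<Sum>i\<le>?d. Polynomial.coeff Q i * ?m (Suc i))" unfolding sum.atMost_Suc_shift by (simp del: K.nat_pow_Suc)
  finally have 1: "poly_action K (pCons 0 Q) b \<mu> y = (\<Sum>i\<le>?d. Polynomial.coeff Q i * ?m (Suc i))" .
  have "poly_action K (Polynomial.smult (- z) Q) b \<mu> y = (\<Sum>i\<le>?d. Polynomial.coeff (Polynomial.smult (- z) Q) i * ?m i)"
    by (rule poly_action_le) (rule degree_smult_le)
  then have 2: "poly_action K (Polynomial.smult (- z) Q) b \<mu> y = (\<Sum>i\<le>?d. Polynomial.coeff Q i * (- z * ?m i))"
    by (simp add: algebra_simps)
  have 3: "b [^]\<^bsub>K\<^esub> Suc i \<otimes>\<^bsub>K\<^esub> y = b \<otimes>\<^bsub>K\<^esub> (b [^]\<^bsub>K\<^esub> i \<otimes>\<^bsub>K\<^esub> y)" for i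
    using b y by (simp add: K.m_assoc[symmetric] K.m_comm[of b])
  show ?thesis
    unfolding e poly_action_add 1 2 unfolding poly_action_def sum.distrib[symmetric] 3
    by (rule sum.cong) (simp_all add: algebra_simps)
qed

text \<open>Splitting off a linear factor of the annihilating polynomial, either the operator minus
  z kills \<open>\<mu>\<close>, which is then an eigenvector, or its value at \<open>\<mu>\<close>
  is annihilated by a polynomial of smaller degree. The predicate \<open>U\<close> carries along
  conditions stable under the operator.\<close>

lemma operator_eigenvector:
  fixes U :: "('a \<Rightarrow> complex) \<Rightarrow> bool"
  assumes K: "Group.comm_monoid K" and b: "b \<in> carrier K"
    and U: "\<And>\<mu> z. U \<mu> \<Longrightarrow> U (\<lambda>y. \<mu> (b \<otimes>\<^bsub>K\<^esub> y) - z * \<mu> y)"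
  shows "P \<noteq> 0 \<Longrightarrow> U \<mu> \<Longrightarrow> \<exists>y\<in>carrier K. \<mu> y \<noteq> 0 \<Longrightarrow> \<forall>y\<in>carrier K. poly_action K P b \<mu> y = 0 \<Longrightarrow>
    \<exists>z \<nu>. U \<nu> \<and> (\<exists>y\<in>carrier K. \<nu> y \<noteq> 0) \<and> (\<forall>y\<in>carrier K. \<nu> (b \<otimes>\<^bsub>K\<^esub> y) = z * \<nu> y)"
proof (induction "Polynomial.degree P" arbitrary: P \<mu>)
  case 0
  then obtain a where P: "P = [:a:]" by (metis degree_eq_zeroE)
  interpret K: Group.comm_monoid K by (rule K)
  obtain y where y: "y \<in> carrier K" "\<mu> y \<noteq> 0" using 0 by blast
  have "poly_action K P b \<mu> y = 0" using 0 y by blast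
  then show ?case using 0 y by (simp add: poly_action_def P)
next
  case (Suc n)
  have "\<not> constant (poly P)" using Suc.hyps(2) by (simp add: constant_degree)
  then obtain z where z: "poly P z = 0" using fundamental_theorem_of_algebra by blast
  then obtain Q where Q: "P = [:- z, 1:] * Q" unfolding poly_eq_0_iff_dvd by (rule dvdE)
  then have Q0: "Q \<noteq> 0" using Suc.prems(1) by auto
  have dQ: "n = Polynomial.degree Q"
    using Suc.hyps(2) Q0 unfolding Q by (subst (asm) degree_mult_eq) auto
  define \<nu> where "\<nu> y = \<mu> (b \<otimes>\<^bsub>K\<^esub> y) - z * \<mu> y" for y
  have U\<nu>: "U \<nu>" unfolding \<nu>_def[abs_def] by (rule U[OF Suc.prems(2)])
  show ?case
  proof (cases "\<exists>y\<in>carrier K. \<nu> y \<noteq> 0")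
    case True
    have "\<forall>y\<in>carrier K. poly_action K Q b \<nu> y = 0"
    proof
      fix y assume y: "y \<in> carrier K"
      have "poly_action K ([:- z, 1:] * Q) b \<mu> y = 0" using Suc.prems(4) y unfolding Q by blast
      then show "poly_action K Q b \<nu> y = 0" unfolding poly_action_linear_factor[OF K b y] \<nu>_def[abs_def] .
    qed
    then show ?thesis by (rule Suc.hyps(1)[OF dQ Q0 U\<nu> True])
  next
    case False
    then have "\<forall>y\<in>carrier K. \<mu> (b \<otimes>\<^bsub>K\<^esub> y) = z * \<mu> y" by (simp add: \<nu>_def)
    then show ?thesis using Suc.prems(2,3) by blast
  qed
qed

section \<open>Additive functionals on a number field and its embedding\<close>

context number_field
begin

abbreviation F :: "'a set" where "F \<equiv> generate_field K {}"

lemma subfield_F: "subfield F K"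
  by (rule generate_field_is_subfield) simp

lemma F_carrier: "k \<in> F \<Longrightarrow> k \<in> carrier K"
  by (rule generate_field_in_carrier) simp_all

definition I :: "int \<Rightarrow> 'a" where "I k = [k] \<cdot> \<one>"

lemma I_closed [simp]: "I k \<in> carrier K"
  unfolding I_def by simp

lemma I_0 [simp]: "I 0 = \<zero>" and I_1 [simp]: "I 1 = \<one>"
  unfolding I_def by (simp_all add: add.int_pow_1 add_pow_int_ge)

lemma I_add: "I (a + b) = I a \<oplus> I b"
  unfolding I_def by (rule add.int_pow_mult) simp

lemma I_uminus: "I (- a) = \<ominus> I a"
  using add.int_pow_neg[of \<one> a] unfolding I_def a_inv_def by simp

lemma I_mult: "I a \<otimes> I b = I (a * b)"
proof -
  have "I a \<otimes> I b = [a] \<cdot> (\<one> \<otimes> I b)" unfolding I_def[of a] by (rule add_pow_ldistr_int) simp_all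
  also have "\<dots> = [a] \<cdot> ([b] \<cdot> \<one>)" by (simp add: I_def)
  also have "\<dots> = [(b * a)] \<cdot> \<one>" by (rule add.int_pow_pow) simp
  finally show ?thesis by (simp add: I_def mult.commute)
qed

lemma I_eq_0: "I a = \<zero> \<longleftrightarrow> a = 0"
proof
  assume a: "I a = \<zero>"
  show "a = 0"
  proof (rule ccontr)
    assume "a \<noteq> 0"
    have n: "I (int m) = [m] \<cdot> \<one>" for m :: nat unfolding I_def by (simp add: add_pow_int_ge)
    have "I \<bar>a\<bar> = \<zero>" using a by (cases "0 \<le> a") (simp_all add: I_uminus)
    then have "[nat \<bar>a\<bar>] \<cdot> \<one> = \<zero>" using n[of "nat \<bar>a\<bar>"] by simp
    then show False using char_zero[of "nat \<bar>a\<bar>"] \<open>a \<noteq> 0\<close> by simp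
  qed
qed simp

lemma F_fraction: "x \<in> F \<Longrightarrow> \<exists>a b. b \<noteq> 0 \<and> I b \<otimes> x = I a"
proof (induction rule: generate_field.induct)
  case one
  show ?case by (intro exI[of _ 1]) simp
next
  case (incl h)
  then show ?case by simp
next
  case (a_inv h)
  then obtain a b where ab: "b \<noteq> 0" "I b \<otimes> h = I a" by blast
  have "I b \<otimes> (\<ominus> h) = I (- a)" using ab(2) F_carrier[OF a_inv(1)] by (simp add: r_minus I_uminus)
  then show ?case using ab(1) by blast
next
  case (m_inv h)
  then obtain a b where ab: "b \<noteq> 0" "I b \<otimes> h = I a" by blast
  have h: "h \<in> carrier K" "h \<in> Units K" using F_carrier[OF m_inv(1)] m_inv(2) field_Units by auto
  have "I a \<noteq> \<zero>" unfolding ab(2)[symmetric] using integral[of "I b" h] ab(1) I_eq_0 h m_inv(2) by auto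
  then have "a \<noteq> 0" by auto
  moreover have "I a \<otimes> inv h = I b" unfolding ab(2)[symmetric] using h by (simp add: m_assoc)
  ultimately show ?case by blast
next
  case (eng_add h1 h2)
  obtain a b where ab: "b \<noteq> 0" "I b \<otimes> h1 = I a" using eng_add by blast
  obtain a' b' where ab': "b' \<noteq> 0" "I b' \<otimes> h2 = I a'" using eng_add by blast
  note h = F_carrier[OF eng_add(1)] F_carrier[OF eng_add(2)]
  have "I (b * b') \<otimes> (h1 \<oplus> h2) = I b' \<otimes> (I b \<otimes> h1) \<oplus> I b \<otimes> (I b' \<otimes> h2)"
    unfolding I_mult[symmetric] using h by (simp add: r_distr m_ac)
  then have "I (b * b') \<otimes> (h1 \<oplus> h2) = I (b' * a + b * a')" unfolding ab ab' I_add I_mult .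
  then show ?case using ab(1) ab'(1) by (intro exI[of _ "b' * a + b * a'"] exI[of _ "b * b'"]) simp
next
  case (eng_mult h1 h2)
  obtain a b where ab: "b \<noteq> 0" "I b \<otimes> h1 = I a" using eng_mult by blast
  obtain a' b' where ab': "b' \<noteq> 0" "I b' \<otimes> h2 = I a'" using eng_mult by blast
  note h = F_carrier[OF eng_mult(1)] F_carrier[OF eng_mult(2)]
  have "I (b * b') \<otimes> (h1 \<otimes> h2) = (I b \<otimes> h1) \<otimes> (I b' \<otimes> h2)"
    unfolding I_mult[symmetric] using h by (simp add: m_ac)
  then have "I (b * b') \<otimes> (h1 \<otimes> h2) = I (a * a')" unfolding ab ab' I_mult .
  then show ?case using ab(1) ab'(1) by (intro exI[of _ "a * a'"] exI[of _ "b * b'"]) simp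
qed

definition additive :: "('a \<Rightarrow> complex) \<Rightarrow> bool" where
  "additive \<mu> \<longleftrightarrow> (\<forall>x\<in>carrier K. \<forall>y\<in>carrier K. \<mu> (x \<oplus> y) = \<mu> x + \<mu> y)"

lemma additiveD: "additive \<mu> \<Longrightarrow> x \<in> carrier K \<Longrightarrow> y \<in> carrier K \<Longrightarrow> \<mu> (x \<oplus> y) = \<mu> x + \<mu> y"
  by (simp add: additive_def)

lemma additive_I:
  assumes "additive \<mu>" and x: "x \<in> carrier K"
  shows "\<mu> (I a \<otimes> x) = of_int a * \<mu> x"
proof -
  note add = additiveD[OF assms(1)]
  have z: "\<mu> \<zero> = 0" using add[of \<zero> \<zero>] by simp
  have n: "\<mu> (I (int m) \<otimes> x) = of_nat m * \<mu> x" for m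
  proof (induction m)
    case (Suc m)
    have "I (int (Suc m)) \<otimes> x = I (int m) \<otimes> x \<oplus> x" using I_add[of "int m" 1] x by (simp add: l_distr add.commute)
    then show ?case using add[of "I (int m) \<otimes> x" x] x Suc by (simp add: algebra_simps)
  qed (use z x in simp)
  show ?thesis
  proof (cases "0 \<le> a")
    case True
    then show ?thesis using n[of "nat a"] by simp
  next
    case False
    then have a: "a = - int (nat (- a))" by simp
    have "I a \<otimes> x \<oplus> I (int (nat (- a))) \<otimes> x = I (a + int (nat (- a))) \<otimes> x"
      unfolding I_add using x by (simp add: l_distr)
    also have "\<dots> = \<zero>" using False x by simp
    finally have "\<mu> (I a \<otimes> x) + \<mu> (I (int (nat (- a))) \<otimes> x) = 0"
      using add[of "I a \<otimes> x" "I (int (nat (- a))) \<otimes> x"] x z by simp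
    then show ?thesis unfolding n using False by (simp add: add_eq_0_iff2)
  qed
qed

text \<open>The unique embedding of the prime field, the copy of the rationals, into the complex
  numbers.\<close>

definition ratio :: "'a \<Rightarrow> complex" where
  "ratio x = (SOME q. \<exists>a b. b \<noteq> 0 \<and> I b \<otimes> x = I a \<and> q = of_int a / of_int b)"

lemma ratio:
  assumes "x \<in> F"
  shows "\<exists>a b. b \<noteq> 0 \<and> I b \<otimes> x = I a \<and> ratio x = of_int a / of_int b"
proof -
  have "\<exists>q::complex. \<exists>a b. b \<noteq> 0 \<and> I b \<otimes> x = I a \<and> q = of_int a / of_int b"
    using F_fraction[OF assms] by blast
  then show ?thesis unfolding ratio_def by (rule someI_ex)
qed

lemma ratio_eq:
  assumes x: "x \<in> F" and "b \<noteq> 0" "I b \<otimes> x = I a"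
  shows "ratio x = of_int a / of_int b"
proof -
  obtain a' b' where ab: "b' \<noteq> 0" "I b' \<otimes> x = I a'" "ratio x = of_int a' / of_int b'" using ratio[OF x] by blast
  have "I (b' * a) = I b' \<otimes> (I b \<otimes> x)" unfolding assms(3) I_mult ..
  also have "\<dots> = I b \<otimes> (I b' \<otimes> x)" using F_carrier[OF x] by (simp add: m_lcomm)
  also have "\<dots> = I (b * a')" unfolding ab(2) I_mult ..
  finally have e: "I (b' * a) = I (b * a')" .
  have "I (b' * a - b * a') = \<zero>" unfolding diff_conv_add_uminus I_add I_uminus e by (simp add: r_neg)
  then have "b' * a = b * a'" using I_eq_0 by simp
  then have "of_int b' * of_int a = (of_int b * of_int a' :: complex)" by (metis of_int_mult)
  then show ?thesis unfolding ab(3) using ab(1) assms(2) by (simp add: field_simps)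
qed

lemma ratio_one: "ratio \<one> = 1"
  using ratio_eq[OF generate_field.one, of 1 1] by simp

lemma ratio_add:
  assumes x: "x \<in> F" and y: "y \<in> F"
  shows "ratio (x \<oplus> y) = ratio x + ratio y"
proof -
  obtain a b where ab: "b \<noteq> 0" "I b \<otimes> x = I a" "ratio x = of_int a / of_int b" using ratio[OF x] by blast
  obtain a' b' where ab': "b' \<noteq> 0" "I b' \<otimes> y = I a'" "ratio y = of_int a' / of_int b'" using ratio[OF y] by blast
  have "I (b * b') \<otimes> (x \<oplus> y) = I b' \<otimes> (I b \<otimes> x) \<oplus> I b \<otimes> (I b' \<otimes> y)"
    unfolding I_mult[symmetric] using F_carrier[OF x] F_carrier[OF y] by (simp add: r_distr m_ac)
  then have "I (b * b') \<otimes> (x \<oplus> y) = I (b' * a + b * a')" unfolding ab(2) ab'(2) I_add I_mult .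
  then have "ratio (x \<oplus> y) = of_int (b' * a + b * a') / of_int (b * b')"
    by (intro ratio_eq) (use ab ab' generate_field.eng_add[OF x y] in auto)
  then show ?thesis unfolding ab(3) ab'(3) using ab(1) ab'(1) by (simp add: field_simps)
qed

text \<open>Clearing the denominator of k shows that additivity alone implies linearity over the
  prime field.\<close>

lemma additive_F:
  assumes "additive \<mu>" "k \<in> F" "x \<in> carrier K"
  shows "\<mu> (k \<otimes> x) = ratio k * \<mu> x"
proof -
  obtain a b where ab: "b \<noteq> 0" "I b \<otimes> k = I a" "ratio k = of_int a / of_int b" using ratio[OF assms(2)] by blast
  have k: "k \<in> carrier K" by (rule F_carrier[OF assms(2)])
  have "of_int b * \<mu> (k \<otimes> x) = \<mu> (I b \<otimes> (k \<otimes> x))" using additive_I[OF assms(1)] k assms(3) by simp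
  also have "I b \<otimes> (k \<otimes> x) = I a \<otimes> x" unfolding ab(2)[symmetric] using k assms(3) by (simp add: m_assoc)
  also have "\<mu> (I a \<otimes> x) = of_int a * \<mu> x" by (rule additive_I[OF assms(1,3)])
  finally show ?thesis unfolding ab(3) using ab(1) by (simp add: field_simps)
qed

lemma ratio_nonzero: "k \<in> F \<Longrightarrow> k \<noteq> \<zero> \<Longrightarrow> ratio k \<noteq> 0"
proof
  assume k: "k \<in> F" "k \<noteq> \<zero>" and z: "ratio k = 0"
  obtain a b where ab: "b \<noteq> 0" "I b \<otimes> k = I a" "ratio k = of_int a / of_int b" using ratio[OF k(1)] by blast
  then have "I b \<otimes> k = \<zero>" using z by simp
  then show False using integral[of "I b" k] ab(1) k I_eq_0 F_carrier by auto
qed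

text \<open>K is the direct sum of a line F v and a subspace E of smaller dimension; the coordinate
  along v, read as a complex number, is additive and takes the value 1 at v.\<close>

lemma additive_exists: "\<exists>\<mu>. additive \<mu> \<and> (\<exists>y\<in>carrier K. \<mu> y \<noteq> 0)"
proof -
  obtain m where m: "dimension m F (carrier K)" using finite_degree by (rule finite_dimensionE')
  then show ?thesis
  proof (cases rule: dimension.cases)
    case zero_dim
    then have "\<one> = \<zero>" using one_closed by blast
    then show ?thesis by simp
  next
    case (Suc_dim v E m')
    note dE = Suc_dim(5)
    note E = space_subgroup_props[OF subfield_F dE]
    have EK: "x \<in> carrier K" if "x \<in> E" for x using E(1) that by blast
    have v: "v \<in> carrier K" "v \<notin> E" using Suc_dim by blast+
    have ex: "\<exists>k\<in>F. \<exists>y\<in>E. x = k \<otimes> v \<oplus> y" if "x \<in> carrier K" for x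
      using that Suc_dim(2) unfolding line_extension_mem_iff[symmetric] by blast
    have uniq: "k = k'" if k: "k \<in> F" "k' \<in> F" and y: "y \<in> E" "y' \<in> E" and e: "k \<otimes> v \<oplus> y = k' \<otimes> v \<oplus> y'" for k k' y y'
    proof (rule ccontr)
      assume ne: "k \<noteq> k'"
      note c = F_carrier[OF k(1)] F_carrier[OF k(2)] EK[OF y(1)] EK[OF y(2)] v(1)
      have d: "k \<ominus> k' \<in> F" unfolding a_minus_def by (intro generate_field.eng_add generate_field.a_inv k)
      have dn: "k \<ominus> k' \<noteq> \<zero>" using ne c by simp
      have "(k \<ominus> k') \<otimes> v = (k \<otimes> v \<oplus> y) \<oplus> (\<ominus> (k' \<otimes> v \<oplus> y')) \<oplus> (y' \<oplus> \<ominus> y)"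
        using c by (simp add: a_minus_def l_distr l_minus minus_add a_ac r_neg r_neg1 r_neg2)
      also have "\<dots> = y' \<oplus> \<ominus> y" unfolding e using c by (simp add: r_neg)
      finally have "(k \<ominus> k') \<otimes> v \<in> E" using E(3)[OF y(2) E(4)[OF y(1)]] by simp
      then have "v \<in> E" using E(6)[of "k \<ominus> k'" v] d dn v(1) by blast
      then show False using v(2) by blast
    qed
    define \<kappa> where "\<kappa> x = (SOME k. k \<in> F \<and> (\<exists>y\<in>E. x = k \<otimes> v \<oplus> y))" for x
    have \<kappa>: "\<kappa> x \<in> F \<and> (\<exists>y\<in>E. x = \<kappa> x \<otimes> v \<oplus> y)" if "x \<in> carrier K" for x
      unfolding \<kappa>_def by (rule someI_ex) (use ex[OF that] in blast)
    have \<kappa>_eq: "\<kappa> x = k" if k: "k \<in> F" "y \<in> E" "x = k \<otimes> v \<oplus> y" for x k y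
    proof -
      have "x \<in> carrier K" using k EK F_carrier v by simp
      from \<kappa>[OF this] obtain y' where "\<kappa> x \<in> F" "y' \<in> E" "x = \<kappa> x \<otimes> v \<oplus> y'" by blast
      then show ?thesis using uniq[of "\<kappa> x" k y' y] k by argo
    qed
    have "additive (\<lambda>x. ratio (\<kappa> x))"
      unfolding additive_def
    proof (intro ballI)
      fix x x' assume x: "x \<in> carrier K" "x' \<in> carrier K"
      obtain y where y: "\<kappa> x \<in> F" "y \<in> E" "x = \<kappa> x \<otimes> v \<oplus> y" using \<kappa>[OF x(1)] by blast
      obtain y' where y': "\<kappa> x' \<in> F" "y' \<in> E" "x' = \<kappa> x' \<otimes> v \<oplus> y'" using \<kappa>[OF x(2)] by blast
      define k k' where kk: "k = \<kappa> x" "k' = \<kappa> x'"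
      note c = F_carrier[OF y(1), folded kk] F_carrier[OF y'(1), folded kk] EK[OF y(2)] EK[OF y'(2)] v(1)
      have "x \<oplus> x' = (k \<oplus> k') \<otimes> v \<oplus> (y \<oplus> y')"
        using y(3)[folded kk] y'(3)[folded kk] c by (simp add: l_distr a_ac)
      then have "\<kappa> (x \<oplus> x') = k \<oplus> k'"
        by (intro \<kappa>_eq[OF generate_field.eng_add[OF y(1) y'(1), folded kk] E(3)[OF y(2) y'(2)]])
      then show "ratio (\<kappa> (x \<oplus> x')) = ratio (\<kappa> x) + ratio (\<kappa> x')" using ratio_add[OF y(1) y'(1)] kk by simp
    qed
    moreover have "\<kappa> v = \<one>" by (rule \<kappa>_eq[OF generate_field.one E(2)]) (use v in simp)
    ultimately show ?thesis using ratio_one v(1) by (intro exI[of _ "\<lambda>x. ratio (\<kappa> x)"]) (auto intro!: bexI[of _ v])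
  qed
qed

text \<open>b satisfies a polynomial over the prime field. Since additive maps are linear over that
  field through \<open>ratio\<close>, the same polynomial with complex coefficients annihilates the
  operator of multiplication by b.\<close>

lemma algebraic_action:
  assumes b: "b \<in> carrier K"
  shows "\<exists>P. P \<noteq> 0 \<and> (\<forall>\<mu>. additive \<mu> \<longrightarrow> (\<forall>y\<in>carrier K. poly_action K P b \<mu> y = 0))"
proof -
  obtain p where p: "p \<in> carrier (F[X])" "p \<noteq> []" "eval p b = \<zero>"
    by (rule domain.algebraicE[OF domain_axioms subfieldE(1)[OF subfield_F] b
          finite_dimension_imp_algebraic[OF subfield_F carrier_is_subring finite_degree b]])
  have pF: "set p \<subseteq> F" "hd p \<noteq> \<zero>"
    using p(1,2) unfolding univ_poly_carrier[symmetric] polynomial_def by auto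
  have act: "set ps \<subseteq> F \<Longrightarrow> additive \<mu> \<Longrightarrow> y \<in> carrier K \<Longrightarrow>
      poly_action K (Poly (rev (map ratio ps))) b \<mu> y = \<mu> (eval ps b \<otimes> y)" for ps \<mu> y
  proof (induction ps)
    case Nil
    have "\<mu> \<zero> = 0" using additiveD[OF Nil(2), of \<zero> \<zero>] by simp
    then show ?case using Nil by (simp add: poly_action_def)
  next
    case (Cons q ps)
    have q: "q \<in> F" "q \<in> carrier K" "set ps \<subseteq> F" using Cons.prems(1) F_carrier by auto
    have ev: "eval ps b \<in> carrier K" by (rule eval_in_carrier) (use q F_carrier b in auto)
    have bl: "b [^] length ps \<otimes> y \<in> carrier K" using b Cons.prems(3) by simp
    have e: "eval (q # ps) b \<otimes> y = q \<otimes> (b [^] length ps \<otimes> y) \<oplus> eval ps b \<otimes> y"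
      using q ev b Cons.prems(3) by (simp add: l_distr m_assoc)
    have "\<mu> (eval (q # ps) b \<otimes> y) = ratio q * \<mu> (b [^] length ps \<otimes> y) + \<mu> (eval ps b \<otimes> y)"
      unfolding e using additiveD[OF Cons.prems(2), of "q \<otimes> (b [^] length ps \<otimes> y)" "eval ps b \<otimes> y"]
        additive_F[OF Cons.prems(2) q(1) bl] q ev bl Cons.prems(3) by simp
    moreover have "poly_action K (Poly (rev (map ratio (q # ps)))) b \<mu> y =
        poly_action K (Poly (rev (map ratio ps))) b \<mu> y + ratio q * \<mu> (b [^] length ps \<otimes> y)"
      using poly_action_monom[OF monoid_axioms, of "ratio q" "length ps" b \<mu> y]
      by (simp add: Poly_snoc poly_action_add)
    ultimately show ?case using Cons.IH[OF q(3) Cons.prems(2,3)] by simp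
  qed
  \<comment> \<open>Lists of coefficients start with the leading one on the side of K and with the
    constant one in \<open>Poly\<close>, hence the reversal.\<close>
  let ?P = "Poly (rev (map ratio p))"
  have co: "Polynomial.coeff ?P (length p - 1) = ratio (hd p)"
    using p(2) by (cases p) (simp_all add: nth_default_def nth_append)
  have "ratio (hd p) \<noteq> 0" using ratio_nonzero pF p(2) by (cases p) auto
  then have "?P \<noteq> 0" using co by (metis coeff_0)
  moreover have "poly_action K ?P b \<mu> y = 0" if "additive \<mu>" "y \<in> carrier K" for \<mu> y
    using act[OF pF(1) that] that additiveD[OF that(1), of \<zero> \<zero>] p(3) by simp
  ultimately show ?thesis by blast
qed

text \<open>The eigenvectors found for the earlier elements form a space stable under multiplication
  by the next one, because multiplications in K commute; an eigenvector is then sought inside this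
  space.\<close>

lemma common_eigenvector:
  "set vs \<subseteq> carrier K \<Longrightarrow> \<exists>\<mu> \<epsilon>. additive \<mu> \<and> (\<exists>y\<in>carrier K. \<mu> y \<noteq> 0) \<and>
    (\<forall>v\<in>set vs. \<forall>y\<in>carrier K. \<mu> (v \<otimes> y) = \<epsilon> v * \<mu> y)"
proof (induction vs)
  case Nil
  then show ?case using additive_exists by simp
next
  case (Cons b vs)
  then have b: "b \<in> carrier K" and vs: "set vs \<subseteq> carrier K" by auto
  obtain \<mu> \<epsilon> where \<mu>: "additive \<mu>" "\<exists>y\<in>carrier K. \<mu> y \<noteq> 0" "\<forall>v\<in>set vs. \<forall>y\<in>carrier K. \<mu> (v \<otimes> y) = \<epsilon> v * \<mu> y"
    using Cons.IH[OF vs] by blast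
  \<comment> \<open>A repeated element is treated apart, as its eigenvalue in
    \<open>\<epsilon>\<close> must not be overwritten.\<close>
  show ?case
  proof (cases "b \<in> set vs")
    case True
    then have "set (b # vs) = set vs" by auto
    then show ?thesis using \<mu> by (intro exI[of _ \<mu>] exI[of _ \<epsilon>]) simp
  next
    case False
    define U where "U \<nu> \<longleftrightarrow> additive \<nu> \<and> (\<forall>v\<in>set vs. \<forall>y\<in>carrier K. \<nu> (v \<otimes> y) = \<epsilon> v * \<nu> y)" for \<nu>
    obtain P where P: "P \<noteq> 0" "\<forall>\<mu>. additive \<mu> \<longrightarrow> (\<forall>y\<in>carrier K. poly_action K P b \<mu> y = 0)"
      using algebraic_action[OF b] by blast
    have "\<exists>z \<nu>. U \<nu> \<and> (\<exists>y\<in>carrier K. \<nu> y \<noteq> 0) \<and> (\<forall>y\<in>carrier K. \<nu> (b \<otimes> y) = z * \<nu> y)"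
    proof (rule operator_eigenvector[OF _ b _ P(1)])
      show "Group.comm_monoid K" by (rule comm_monoid_axioms)
      show "U \<mu>" unfolding U_def using \<mu> by blast
      show "\<exists>y\<in>carrier K. \<mu> y \<noteq> 0" by (rule \<mu>(2))
      show "\<forall>y\<in>carrier K. poly_action K P b \<mu> y = 0" using P(2) \<mu>(1) by blast
      fix \<nu> z assume \<nu>: "U \<nu>"
      then have a: "additive \<nu>" and ev: "\<And>v y. v \<in> set vs \<Longrightarrow> y \<in> carrier K \<Longrightarrow> \<nu> (v \<otimes> y) = \<epsilon> v * \<nu> y"
        by (simp_all add: U_def)
      show "U (\<lambda>y. \<nu> (b \<otimes> y) - z * \<nu> y)"
        unfolding U_def additive_def
      proof (intro conjI ballI)
        fix x y assume xy: "x \<in> carrier K" "y \<in> carrier K"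
        have "\<nu> (b \<otimes> (x \<oplus> y)) = \<nu> (b \<otimes> x) + \<nu> (b \<otimes> y)"
          using additiveD[OF a, of "b \<otimes> x" "b \<otimes> y"] b xy by (simp add: r_distr)
        then show "\<nu> (b \<otimes> (x \<oplus> y)) - z * \<nu> (x \<oplus> y) = \<nu> (b \<otimes> x) - z * \<nu> x + (\<nu> (b \<otimes> y) - z * \<nu> y)"
          using additiveD[OF a xy] by (simp add: algebra_simps)
      next
        fix v y assume v: "v \<in> set vs" and y: "y \<in> carrier K"
        have vc: "v \<in> carrier K" using v vs by blast
        have "b \<otimes> (v \<otimes> y) = v \<otimes> (b \<otimes> y)" using b vc y by (simp add: m_lcomm)
        then show "\<nu> (b \<otimes> (v \<otimes> y)) - z * \<nu> (v \<otimes> y) = \<epsilon> v * (\<nu> (b \<otimes> y) - z * \<nu> y)"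
          using ev[OF v, of "b \<otimes> y"] ev[OF v y] b y by (simp add: algebra_simps)
      qed
    qed
    then obtain z \<nu> where \<nu>: "U \<nu>" "\<exists>y\<in>carrier K. \<nu> y \<noteq> 0" "\<forall>y\<in>carrier K. \<nu> (b \<otimes> y) = z * \<nu> y" by blast
    show ?thesis
    proof (rule exI[of _ \<nu>], rule exI[of _ "\<epsilon>(b := z)"], intro conjI ballI)
      show "additive \<nu>" using \<nu>(1) by (simp add: U_def)
      show "\<exists>y\<in>carrier K. \<nu> y \<noteq> 0" by (rule \<nu>(2))
      show "\<nu> (v \<otimes> y) = (\<epsilon>(b := z)) v * \<nu> y" if "v \<in> set (b # vs)" "y \<in> carrier K" for v y
        using that \<nu>(1,3) False by (cases "v = b") (auto simp: U_def)
    qed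
  qed
qed

text \<open>An eigenvector for a generating list of K over F is one for every x in K. The eigenvalue
  is \<open>\<mu> x / \<mu> 1\<close>, hence additive, and as an eigenvalue of multiplication by x
  it is multiplicative.\<close>

theorem complex_embedding:
  "\<exists>\<epsilon>. (\<forall>x\<in>carrier K. \<forall>y\<in>carrier K. \<epsilon> (x \<oplus> y) = \<epsilon> x + \<epsilon> y \<and> \<epsilon> (x \<otimes> y) = (\<epsilon> x * \<epsilon> y :: complex)) \<and> \<epsilon> \<one> = 1"
proof -
  obtain m where m: "dimension m F (carrier K)" using finite_degree by (rule finite_dimensionE')
  obtain Vs where Vs: "set Vs \<subseteq> carrier K" "Span F Vs = carrier K" using exists_base[OF subfield_F m] by blast
  obtain \<mu> \<epsilon>0 where \<mu>: "additive \<mu>" "\<exists>y\<in>carrier K. \<mu> y \<noteq> 0"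
    and ev: "\<forall>v\<in>set Vs. \<forall>y\<in>carrier K. \<mu> (v \<otimes> y) = \<epsilon>0 v * \<mu> y"
    using common_eigenvector[OF Vs(1)] by blast
  have span: "set us \<subseteq> set Vs \<Longrightarrow> \<forall>x\<in>Span F us. x \<in> carrier K \<and> (\<exists>z. \<forall>y\<in>carrier K. \<mu> (x \<otimes> y) = z * \<mu> y)" for us
  proof (induction us)
    case Nil
    have "\<mu> \<zero> = 0" using additiveD[OF \<mu>(1), of \<zero> \<zero>] by simp
    then show ?case by (auto intro!: exI[of _ 0])
  next
    case (Cons u us)
    then have IH: "\<forall>x\<in>Span F us. x \<in> carrier K \<and> (\<exists>z. \<forall>y\<in>carrier K. \<mu> (x \<otimes> y) = z * \<mu> y)"
      and u: "u \<in> set Vs" "u \<in> carrier K" using Vs(1) by auto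
    show ?case
    proof
      fix x assume "x \<in> Span F (u # us)"
      then obtain k w where kw: "k \<in> F" "w \<in> Span F us" "x = k \<otimes> u \<oplus> w"
        unfolding Span.simps foldr_Cons comp_apply line_extension_mem_iff by blast
      obtain z where w: "w \<in> carrier K" "\<forall>y\<in>carrier K. \<mu> (w \<otimes> y) = z * \<mu> y" using IH kw(2) by blast
      note k = F_carrier[OF kw(1)]
      have "\<mu> (x \<otimes> y) = (ratio k * \<epsilon>0 u + z) * \<mu> y" if y: "y \<in> carrier K" for y
      proof -
        have "x \<otimes> y = k \<otimes> (u \<otimes> y) \<oplus> w \<otimes> y" unfolding kw(3) using k u w y by (simp add: l_distr m_assoc)
        then have "\<mu> (x \<otimes> y) = \<mu> (k \<otimes> (u \<otimes> y)) + \<mu> (w \<otimes> y)"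
          using additiveD[OF \<mu>(1), of "k \<otimes> (u \<otimes> y)" "w \<otimes> y"] k u w y by simp
        also have "\<mu> (k \<otimes> (u \<otimes> y)) = ratio k * (\<epsilon>0 u * \<mu> y)"
          using additive_F[OF \<mu>(1) kw(1), of "u \<otimes> y"] ev u y by simp
        finally show ?thesis using w(2) y by (simp add: algebra_simps)
      qed
      then show "x \<in> carrier K \<and> (\<exists>z. \<forall>y\<in>carrier K. \<mu> (x \<otimes> y) = z * \<mu> y)"
        using kw(3) k u w by blast
    qed
  qed
  have ex: "\<exists>z. \<forall>y\<in>carrier K. \<mu> (x \<otimes> y) = z * \<mu> y" if "x \<in> carrier K" for x
    using span[of Vs] that unfolding Vs(2) by blast
  \<comment> \<open>If \<open>\<mu>\<close> vanished at the unit, the eigenvector equation would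
    make it vanish at every x.\<close>
  have \<mu>1: "\<mu> \<one> \<noteq> 0"
  proof
    assume "\<mu> \<one> = 0"
    have "\<mu> x = 0" if x: "x \<in> carrier K" for x
    proof -
      obtain z where "\<forall>y\<in>carrier K. \<mu> (x \<otimes> y) = z * \<mu> y" using ex[OF x] by blast
      then have "\<mu> (x \<otimes> \<one>) = z * \<mu> \<one>" by blast
      then show ?thesis using \<open>\<mu> \<one> = 0\<close> x by simp
    qed
    then show False using \<mu>(2) by blast
  qed
  define \<epsilon> where "\<epsilon> x = \<mu> x / \<mu> \<one>" for x
  have e: "\<mu> (x \<otimes> y) = \<epsilon> x * \<mu> y" if x: "x \<in> carrier K" and y: "y \<in> carrier K" for x y
  proof -
    obtain z where z: "\<forall>y\<in>carrier K. \<mu> (x \<otimes> y) = z * \<mu> y" using ex[OF x] by blast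
    then have "\<mu> (x \<otimes> \<one>) = z * \<mu> \<one>" by blast
    then have "\<epsilon> x = z" using x \<mu>1 by (simp add: \<epsilon>_def)
    then show ?thesis using z y by blast
  qed
  show ?thesis
  proof (rule exI[of _ \<epsilon>], intro conjI ballI)
    show "\<epsilon> \<one> = 1" using \<mu>1 by (simp add: \<epsilon>_def)
    fix x y assume xy: "x \<in> carrier K" "y \<in> carrier K"
    show "\<epsilon> (x \<oplus> y) = \<epsilon> x + \<epsilon> y" unfolding \<epsilon>_def additiveD[OF \<mu>(1) xy] by (simp add: add_divide_distrib)
    show "\<epsilon> (x \<otimes> y) = \<epsilon> x * \<epsilon> y" unfolding \<epsilon>_def[of "x \<otimes> y"] e[OF xy] by (simp add: \<epsilon>_def)
  qed
qed

end

section \<open>Change of the coefficient ring, and the ring of integers as a ring of complex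
  numbers\<close>

lemma (in complex_subring) finsum_ring_on:
  assumes "finite J" "f \<in> J \<rightarrow> S"
  shows "(\<Oplus>\<^bsub>ring_on S\<^esub>i\<in>J. f i) = sum f J"
proof -
  interpret R: cring "ring_on S" by (rule cring_complex_subring)
  show ?thesis using assms
  proof (induction J rule: finite_induct)
    case (insert x J)
    have "(\<Oplus>\<^bsub>ring_on S\<^esub>i\<in>insert x J. f i) = f x \<oplus>\<^bsub>ring_on S\<^esub> (\<Oplus>\<^bsub>ring_on S\<^esub>i\<in>J. f i)"
      by (rule R.finsum_insert) (use insert in auto)
    then show ?case using insert by auto
  qed (use R.finsum_empty in simp)
qed

lemma (in complex_subring) finprod_ring_on:
  assumes "finite J" "f \<in> J \<rightarrow> S"
  shows "(\<Otimes>\<^bsub>ring_on S\<^esub>i\<in>J. f i) = prod f J"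
proof -
  interpret R: cring "ring_on S" by (rule cring_complex_subring)
  show ?thesis using assms
  proof (induction J rule: finite_induct)
    case (insert x J)
    have "(\<Otimes>\<^bsub>ring_on S\<^esub>i\<in>insert x J. f i) = f x \<otimes>\<^bsub>ring_on S\<^esub> (\<Otimes>\<^bsub>ring_on S\<^esub>i\<in>J. f i)"
      by (rule R.finprod_insert) (use insert in auto)
    then show ?case using insert by auto
  qed (use R.finprod_empty in simp)
qed

text \<open>Applying the isomorphism to the entries commutes with the Leibniz formula and the matrix
  product; the remaining care is that sums, products and signs are those of a ring record on one
  side and of the complex numbers on the other.\<close>

lemma (in complex_subring) SL_iso_GG:
  assumes O: "cring (\<O> :: ('b, 'm) ring_scheme)"
    and \<delta>: "\<delta> \<in> ring_iso (ring_on S) \<O>"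
  shows "map_mat \<delta> \<in> iso G (SL n \<O>)"
proof -
  let ?R = "ring_on S"
  interpret R: cring ?R by (rule cring_complex_subring)
  interpret OO: cring \<O> by (rule O)
  interpret \<delta>: ring_hom_cring ?R \<O> \<delta>
    by (intro ring_hom_cring.intro ring_hom_cring_axioms.intro cring_complex_subring O)
      (use \<delta> in \<open>simp add: ring_iso_def\<close>)
  have bij: "bij_betw \<delta> S (carrier \<O>)" using \<delta> by (simp add: ring_iso_def)
  have \<delta>S: "\<delta> a \<in> carrier \<O>" if "a \<in> S" for a using \<delta>.hom_closed[of a] that by simp
  have sum: "\<delta> (sum f J) = (\<Oplus>\<^bsub>\<O>\<^esub>i\<in>J. \<delta> (f i))" if "finite J" "\<And>i. i \<in> J \<Longrightarrow> f i \<in> S" for f :: "'z \<Rightarrow> complex" and J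
    using \<delta>.hom_finsum[of f J] finsum_ring_on[OF that(1), of f] that(2) by (simp add: o_def Pi_def)
  have prod: "\<delta> (prod f J) = (\<Otimes>\<^bsub>\<O>\<^esub>i\<in>J. \<delta> (f i))" if "finite J" "\<And>i. i \<in> J \<Longrightarrow> f i \<in> S" for f :: "'z \<Rightarrow> complex" and J
    using \<delta>.hom_finprod[of f J] finprod_ring_on[OF that(1), of f] that(2) by (simp add: o_def Pi_def)
  have neg: "\<delta> (- a) = \<ominus>\<^bsub>\<O>\<^esub> \<delta> a" if "a \<in> S" for a
  proof -
    have "\<delta> (- a) \<oplus>\<^bsub>\<O>\<^esub> \<delta> a = \<zero>\<^bsub>\<O>\<^esub>"
      using \<delta>.hom_add[of "- a" a] \<delta>.hom_zero that uminus_S by simp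
    then show ?thesis using OO.minus_equality[of "\<delta> (- a)" "\<delta> a"] \<delta>S that uminus_S by simp
  qed
  have sgn: "\<delta> (of_int (sign p) * a) = [sign p] \<cdot>\<^bsub>\<O>\<^esub> \<delta> a" if "a \<in> S" for a p
  proof -
    have a: "\<delta> a \<in> carrier \<O>" by (rule \<delta>S[OF that])
    consider "sign p = 1" | "sign p = -1" by (cases rule: sign_cases[of p])
    then show ?thesis
    proof cases
      case 1
      then show ?thesis using a by simp
    next
      case 2
      have "[(- 1::int)] \<cdot>\<^bsub>\<O>\<^esub> \<delta> a = \<ominus>\<^bsub>\<O>\<^esub> \<delta> a"
        using OO.add.int_pow_neg[OF a, of 1] OO.add.int_pow_1[OF a] by (simp add: a_inv_def)
      then show ?thesis using 2 neg[OF that] by simp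
    qed
  qed
  have det: "det_over \<O> n (map_mat \<delta> M) = \<delta> (det M)" if M: "M \<in> carrier_mat n n" "\<And>i j. i < n \<Longrightarrow> j < n \<Longrightarrow> M $$ (i, j) \<in> S" for M
  proof -
    have pn: "p i < n" if "p permutes {..<n}" "i < n" for p i using permutes_in_image[OF that(1), of i] that(2) by simp
    have pS: "(\<Prod>i<n. M $$ (i, p i)) \<in> S" if "p permutes {..<n}" for p
      by (rule prod_S) (use M(2) pn[OF that] in simp)
    have "\<delta> (det M) = \<delta> (\<Sum>p\<in>{p. p permutes {..<n}}. of_int (sign p) * (\<Prod>i<n. M $$ (i, p i)))"
      unfolding det_def'[OF M(1)] by (simp add: atLeast0LessThan)
    also have "\<dots> = (\<Oplus>\<^bsub>\<O>\<^esub>p\<in>{p. p permutes {..<n}}. \<delta> (of_int (sign p) * (\<Prod>i<n. M $$ (i, p i))))"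
    proof (rule sum)
      show "finite {p. p permutes {..<n}}" by (rule finite_permutations) simp
      fix p assume "p \<in> {p. p permutes {..<n}}"
      then have s: "(\<Prod>i<n. M $$ (i, p i)) \<in> S" using pS by simp
      show "of_int (sign p) * (\<Prod>i<n. M $$ (i, p i)) \<in> S"
        by (cases rule: sign_cases[of p]) (use s uminus_S in simp_all)
    qed
    also have "\<dots> = det_over \<O> n (map_mat \<delta> M)"
      unfolding det_over_def
    proof (rule OO.finsum_cong'[OF refl])
      have e: "(\<Otimes>\<^bsub>\<O>\<^esub>i\<in>{..<n}. map_mat \<delta> M $$ (i, p i)) = \<delta> (\<Prod>i<n. M $$ (i, p i))" if p: "p permutes {..<n}" for p
      proof -
        have "\<delta> (\<Prod>i<n. M $$ (i, p i)) = (\<Otimes>\<^bsub>\<O>\<^esub>i\<in>{..<n}. \<delta> (M $$ (i, p i)))"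
          by (rule prod) (use M(2) pn[OF p] in simp_all)
        also have "\<dots> = (\<Otimes>\<^bsub>\<O>\<^esub>i\<in>{..<n}. map_mat \<delta> M $$ (i, p i))"
          by (rule OO.finprod_cong') (use M pn[OF p] \<delta>S in auto)
        finally show ?thesis by (rule sym)
      qed
      show "(\<lambda>p. [sign p] \<cdot>\<^bsub>\<O>\<^esub> (\<Otimes>\<^bsub>\<O>\<^esub>i\<in>{..<n}. map_mat \<delta> M $$ (i, p i))) \<in> {p. p permutes {..<n}} \<rightarrow> carrier \<O>"
      proof (rule funcsetI)
        fix p assume "p \<in> {p. p permutes {..<n}}"
        then have p: "p permutes {..<n}" by simp
        show "[sign p] \<cdot>\<^bsub>\<O>\<^esub> (\<Otimes>\<^bsub>\<O>\<^esub>i\<in>{..<n}. map_mat \<delta> M $$ (i, p i)) \<in> carrier \<O>"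
          unfolding e[OF p] by (rule OO.add.int_pow_closed[OF \<delta>S[OF pS[OF p]]])
      qed
      show "\<delta> (of_int (sign p) * (\<Prod>i<n. M $$ (i, p i))) = [sign p] \<cdot>\<^bsub>\<O>\<^esub> (\<Otimes>\<^bsub>\<O>\<^esub>i\<in>{..<n}. map_mat \<delta> M $$ (i, p i))"
        if "p \<in> {p. p permutes {..<n}}" for p
        using e[of p] sgn[OF pS, of p] that by simp
    qed
    finally show ?thesis by (rule sym)
  qed
  have one: "\<delta> 1 = \<one>\<^bsub>\<O>\<^esub>" using \<delta>.hom_one by simp
  have inj: "inj_on \<delta> S" and im: "\<delta> ` S = carrier \<O>" using bij by (simp_all add: bij_betw_def)
  show ?thesis
  proof (rule isoI)
    have cl: "map_mat \<delta> M \<in> carrier (SL n \<O>)" if M: "M \<in> carrier G" for M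
    proof -
      note m = GG_D[OF M]
      have "elements_mat (map_mat \<delta> M) \<subseteq> carrier \<O>" using m(1,2) \<delta>S by (auto simp: elements_mat_def)
      then show ?thesis using m(1) det[OF m(1,2)] unfolding m(3) one by (simp add: SL_def)
    qed
    show "map_mat \<delta> \<in> hom G (SL n \<O>)"
    proof (rule homI)
      fix A B assume A: "A \<in> carrier G" and B: "B \<in> carrier G"
      note a = GG_D[OF A] and b = GG_D[OF B]
      show "map_mat \<delta> (A \<otimes>\<^bsub>G\<^esub> B) = map_mat \<delta> A \<otimes>\<^bsub>SL n \<O>\<^esub> map_mat \<delta> B"
      proof (rule eq_matI)
        fix i j assume "i < dim_row (map_mat \<delta> A \<otimes>\<^bsub>SL n \<O>\<^esub> map_mat \<delta> B)" "j < dim_col (map_mat \<delta> A \<otimes>\<^bsub>SL n \<O>\<^esub> map_mat \<delta> B)"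
        then have ij: "i < n" "j < n" by (simp_all add: SL_def)
        have "map_mat \<delta> (A \<otimes>\<^bsub>G\<^esub> B) $$ (i, j) = \<delta> (\<Sum>k<n. A $$ (i, k) * B $$ (k, j))"
          using ij a(1) b(1) mat_mult_index[OF a(1) b(1) ij] by simp
        also have "\<dots> = (\<Oplus>\<^bsub>\<O>\<^esub>k\<in>{..<n}. \<delta> (A $$ (i, k) * B $$ (k, j)))"
          by (rule sum) (use a(2) b(2) ij mult_S in simp_all)
        also have "\<dots> = (\<Oplus>\<^bsub>\<O>\<^esub>k\<in>{..<n}. map_mat \<delta> A $$ (i, k) \<otimes>\<^bsub>\<O>\<^esub> map_mat \<delta> B $$ (k, j))"
        proof (rule OO.finsum_cong'[OF refl])
          show "\<delta> (A $$ (i, k) * B $$ (k, j)) = map_mat \<delta> A $$ (i, k) \<otimes>\<^bsub>\<O>\<^esub> map_mat \<delta> B $$ (k, j)" if "k \<in> {..<n}" for k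
            using \<delta>.hom_mult[of "A $$ (i, k)" "B $$ (k, j)"] a(1,2) b(1,2) ij that by simp
        qed (use a(1,2) b(1,2) ij \<delta>S in auto)
        finally show "map_mat \<delta> (A \<otimes>\<^bsub>G\<^esub> B) $$ (i, j) = (map_mat \<delta> A \<otimes>\<^bsub>SL n \<O>\<^esub> map_mat \<delta> B) $$ (i, j)"
          using ij by (simp add: SL_def)
      qed (use a(1) b(1) in \<open>simp_all add: SL_def\<close>)
    qed (rule cl)
    show "bij_betw (map_mat \<delta>) (carrier G) (carrier (SL n \<O>))"
      unfolding bij_betw_def
    proof
      show "inj_on (map_mat \<delta>) (carrier G)"
      proof (rule inj_onI)
        fix A B assume A: "A \<in> carrier G" and B: "B \<in> carrier G" and e: "map_mat \<delta> A = map_mat \<delta> B"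
        note a = GG_D[OF A] and b = GG_D[OF B]
        show "A = B"
        proof (rule eq_matI)
          fix i j assume "i < dim_row B" "j < dim_col B"
          then have ij: "i < n" "j < n" using b(1) by simp_all
          have "map_mat \<delta> A $$ (i, j) = map_mat \<delta> B $$ (i, j)" unfolding e ..
          then have "\<delta> (A $$ (i, j)) = \<delta> (B $$ (i, j))" using a(1) b(1) ij by simp
          then show "A $$ (i, j) = B $$ (i, j)" by (rule inj_onD[OF inj _ a(2)[OF ij] b(2)[OF ij]])
        qed (use a(1) b(1) in simp_all)
      qed
      show "map_mat \<delta> ` carrier G = carrier (SL n \<O>)"
      proof
        show "map_mat \<delta> ` carrier G \<subseteq> carrier (SL n \<O>)" using cl by blast
        show "carrier (SL n \<O>) \<subseteq> map_mat \<delta> ` carrier G"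
        proof
          fix N assume N: "N \<in> carrier (SL n \<O>)"
          then have N1: "N \<in> carrier_mat n n" "det_over \<O> n N = \<one>\<^bsub>\<O>\<^esub>" and el: "elements_mat N \<subseteq> carrier \<O>"
            by (simp_all add: SL_def)
          have NO: "N $$ (i, j) \<in> \<delta> ` S" if "i < n" "j < n" for i j
            unfolding im by (rule subsetD[OF el]) (use N1(1) that in \<open>force simp: elements_mat_def\<close>)
          define M where "M = map_mat (inv_into S \<delta>) N"
          have Mc: "M \<in> carrier_mat n n" using N1(1) by (simp add: M_def)
          have MS: "M $$ (i, j) \<in> S" if "i < n" "j < n" for i j
            using inv_into_into[OF NO[OF that]] N1(1) that by (simp add: M_def)
          have MN: "map_mat \<delta> M = N"
            by (rule eq_matI) (use N1(1) NO in \<open>simp_all add: M_def f_inv_into_f\<close>)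
          have "\<delta> (det M) = \<delta> 1" using det[OF Mc MS] unfolding MN N1(2) one by simp
          then have "det M = 1" by (rule inj_onD[OF inj _ det_S[OF Mc MS] one_S])
          then have "M \<in> carrier G" using Mc MS by (intro GG_I)
          then show "N \<in> map_mat \<delta> ` carrier G" using MN by blast
        qed
      qed
    qed
  qed
qed

text \<open>A ring homomorphism to the complex numbers is additive, so it sends \<open>I k\<close>
  to the integer k; integral equations over K thereby become integral equations of complex
  numbers.\<close>

lemma (in number_field) eval_hom:
  assumes add: "\<And>x y. x \<in> carrier K \<Longrightarrow> y \<in> carrier K \<Longrightarrow> \<epsilon> (x \<oplus> y) = \<epsilon> x + \<epsilon> y"
    and mult: "\<And>x y. x \<in> carrier K \<Longrightarrow> y \<in> carrier K \<Longrightarrow> \<epsilon> (x \<otimes> y) = \<epsilon> x * (\<epsilon> y :: complex)"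
    and one: "\<epsilon> \<one> = 1" and x: "x \<in> carrier K"
  shows "\<epsilon> (eval (map I ks) x) = poly (map_poly of_int (Poly (rev ks))) (\<epsilon> x)"
proof -
  have ad: "additive \<epsilon>" using add by (simp add: additive_def)
  have z: "\<epsilon> \<zero> = 0" using add[of \<zero> \<zero>] by simp
  have I: "\<epsilon> (I k) = of_int k" for k using additive_I[OF ad one_closed, of k] one by simp
  have pw: "\<epsilon> (x [^] m) = \<epsilon> x ^ m" for m :: nat
    by (induction m) (simp_all add: one mult x)
  show ?thesis
  proof (induction ks)
    case (Cons k ks)
    have c: "eval (map I ks) x \<in> carrier K" by (rule eval_in_carrier) (use x in auto)
    have "\<epsilon> (eval (map I (k # ks)) x) = of_int k * \<epsilon> x ^ length ks + \<epsilon> (eval (map I ks) x)"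
      using add[of "I k \<otimes> x [^] length ks" "eval (map I ks) x"] mult[of "I k" "x [^] length ks"] c x I pw by simp
    moreover have "map_poly of_int (Poly (rev (k # ks))) =
        map_poly of_int (Poly (rev ks)) + Polynomial.monom (of_int k :: complex) (length ks)"
      by (simp add: Poly_snoc of_int_poly_hom.hom_add map_poly_monom)
    ultimately show ?case unfolding Cons by (simp add: poly_monom add.commute)
  qed (simp add: z)
qed

text \<open>Under an injective embedding, integrality in K is the same as being a complex algebraic
  integer. So closure under the ring operations is inherited from the complex numbers.\<close>

lemma (in number_field) ring_of_integers_iso:
  "\<exists>S \<delta>. cring (ring_of_integers K) \<and> (\<forall>n\<ge>3. complex_subring S n) \<and>
    \<delta> \<in> ring_iso (ring_on S) (ring_of_integers K)"
proof -
  obtain \<epsilon> where \<epsilon>: "\<forall>x\<in>carrier K. \<forall>y\<in>carrier K. \<epsilon> (x \<oplus> y) = \<epsilon> x + \<epsilon> y \<and> \<epsilon> (x \<otimes> y) = (\<epsilon> x * \<epsilon> y :: complex)"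
    and one: "\<epsilon> \<one> = 1" using complex_embedding by blast
  have add: "\<epsilon> (x \<oplus> y) = \<epsilon> x + \<epsilon> y" and mult: "\<epsilon> (x \<otimes> y) = \<epsilon> x * \<epsilon> y" if "x \<in> carrier K" "y \<in> carrier K" for x y
    using \<epsilon> that by blast+
  have z: "\<epsilon> \<zero> = 0" using add[of \<zero> \<zero>] by simp
  have neg: "\<epsilon> (\<ominus> x) = - \<epsilon> x" if "x \<in> carrier K" for x
    using add[of "\<ominus> x" x] that z by (simp add: l_neg eq_neg_iff_add_eq_0)
  have ker: "x = \<zero>" if x: "x \<in> carrier K" and "\<epsilon> x = 0" for x
  proof (rule ccontr)
    assume "x \<noteq> \<zero>"
    then have u: "x \<in> Units K" using x field_Units by blast
    have "\<epsilon> (x \<otimes> inv x) = 0" using mult[OF x Units_inv_closed[OF u]] that by simp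
    then show False using Units_r_inv[OF u] one by simp
  qed
  have inj: "x = y" if x: "x \<in> carrier K" and y: "y \<in> carrier K" and e: "\<epsilon> x = \<epsilon> y" for x y
  proof -
    have "\<epsilon> (x \<ominus> y) = 0" unfolding a_minus_def using add[of x "\<ominus> y"] neg[OF y] x y e by simp
    then have "x \<ominus> y = \<zero>" using ker x y by simp
    then show ?thesis using x y by simp
  qed
  let ?O = "carrier (ring_of_integers K)"
  \<comment> \<open>Monic integral equations are carried over in both directions: K has
    characteristic zero, so a leading coefficient equal to the unit of K comes from the integer 1,
    and injectivity of \<open>\<epsilon>\<close> brings an equation back.\<close>
  have mem: "x \<in> ?O \<longleftrightarrow> x \<in> carrier K \<and> algebraic_int (\<epsilon> x)" for x
  proof
    assume "x \<in> ?O"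
    then obtain p where x: "x \<in> carrier K" and p: "p \<noteq> []" "hd p = \<one>" "set p \<subseteq> range (\<lambda>k::int. [k] \<cdot> \<one>)" "eval p x = \<zero>"
      by (auto simp: ring_of_integers_def)
    have "set p \<subseteq> range I" using p(3) unfolding I_def[abs_def] .
    then have "\<exists>ks. p = map I ks" by (induction p) (auto, metis list.simps(9))
    then obtain ks where ks: "p = map I ks" by blast
    obtain k ks' where k: "ks = k # ks'" using p(1) ks by (cases ks) auto
    have "I k = \<one>" using p(2) ks k by simp
    then have "I (k - 1) = \<zero>" using I_add[of k "- 1"] I_uminus[of 1] by (simp add: r_neg)
    then have k1: "k = 1" using I_eq_0 by simp
    let ?P = "Poly (rev ks)"
    have "?P = Poly (rev ks') + Polynomial.monom 1 (length ks')" unfolding k k1 by (simp add: Poly_snoc)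
    have co: "Polynomial.coeff ?P i = nth_default 0 (rev ks) i" for i by simp
    have top: "Polynomial.coeff ?P (length ks') = 1" unfolding co k k1 by (simp add: nth_default_def nth_append)
    have dle: "Polynomial.degree ?P \<le> length ks'"
      by (rule degree_le) (use k in \<open>auto simp: nth_default_def\<close>)
    have "Polynomial.degree ?P = length ks'" using dle le_degree[of ?P "length ks'"] top by simp
    then have "Polynomial.lead_coeff ?P = 1" using top by simp
    moreover have "poly (map_poly of_int ?P) (\<epsilon> x) = 0"
      using eval_hom[of \<epsilon> x ks, OF add mult one x] p(4) z unfolding ks by simp
    ultimately show "x \<in> carrier K \<and> algebraic_int (\<epsilon> x)" unfolding algebraic_int_altdef_ipoly using x by blast
  next
    assume a: "x \<in> carrier K \<and> algebraic_int (\<epsilon> x)"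
    then have x: "x \<in> carrier K" by simp
    obtain P :: "int poly" where P: "poly (map_poly of_int P) (\<epsilon> x) = 0" "Polynomial.lead_coeff P = 1"
      using a unfolding algebraic_int_altdef_ipoly by blast
    let ?ks = "rev (coeffs P)"
    have P0: "P \<noteq> 0" using P(2) by auto
    have c: "eval (map I ?ks) x \<in> carrier K" by (rule eval_in_carrier) (use x in auto)
    have "\<epsilon> (eval (map I ?ks) x) = 0" using eval_hom[of \<epsilon> x ?ks, OF add mult one x] P(1) by simp
    then have "eval (map I ?ks) x = \<zero>" by (rule ker[OF c])
    moreover have "hd (map I ?ks) = \<one>"
      using P0 P(2) by (simp add: hd_map hd_rev last_coeffs_eq_coeff_degree)
    moreover have "map I ?ks \<noteq> []" using P0 by simp
    moreover have "set (map I ?ks) \<subseteq> range (\<lambda>k::int. [k] \<cdot> \<one>)" unfolding I_def[abs_def] by auto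
    ultimately have "\<exists>p. p \<noteq> [] \<and> hd p = \<one> \<and> set p \<subseteq> range (\<lambda>k::int. [k] \<cdot> \<one>) \<and> eval p x = \<zero>" by blast
    then show "x \<in> ?O" unfolding ring_of_integers_def using x by simp
  qed
  define S where "S = \<epsilon> ` ?O"
  have OK: "?O \<subseteq> carrier K" using mem by blast
  have O1: "\<one> \<in> ?O" unfolding mem using one by simp
  have Oadd: "x \<oplus> y \<in> ?O" "x \<otimes> y \<in> ?O" if "x \<in> ?O" "y \<in> ?O" for x y
    using that unfolding mem by (simp_all add: add mult algebraic_int_closed)
  have alg1: "algebraic_int (- 1 :: complex)" by (rule int_imp_algebraic_int) simp
  have Oneg: "\<ominus> x \<in> ?O" if "x \<in> ?O" for x
    using that algebraic_int_closed(2)[OF alg1, of "\<epsilon> x"] unfolding mem by (simp add: neg)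
  have sub: "subring ?O K" by (rule subringI[OF OK O1 Oneg Oadd(2) Oadd(1)])
  have "cring (K\<lparr>carrier := ?O\<rparr>)" using subcring_iff[OF OK] subcringI'[OF sub] by blast
  then have cr: "cring (ring_of_integers K)" by (simp add: ring_of_integers_def)
  let ?R = "ring_on S"
  have S: "complex_subring S n" if "3 \<le> n" for n
  proof
    show "1 \<in> S" unfolding S_def using O1 one by (metis imageI)
    show "a + b \<in> S" if "a \<in> S" "b \<in> S" for a b
    proof -
      obtain x y where xy: "x \<in> ?O" "y \<in> ?O" "a = \<epsilon> x" "b = \<epsilon> y" using \<open>a \<in> S\<close> \<open>b \<in> S\<close> unfolding S_def by blast
      have "a + b = \<epsilon> (x \<oplus> y)" using add[OF subsetD[OF OK xy(1)] subsetD[OF OK xy(2)]] xy(3,4) by simp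
      then show ?thesis unfolding S_def using Oadd(1)[OF xy(1,2)] by blast
    qed
    show "a * b \<in> S" if "a \<in> S" "b \<in> S" for a b
    proof -
      obtain x y where xy: "x \<in> ?O" "y \<in> ?O" "a = \<epsilon> x" "b = \<epsilon> y" using \<open>a \<in> S\<close> \<open>b \<in> S\<close> unfolding S_def by blast
      have "a * b = \<epsilon> (x \<otimes> y)" using mult[OF subsetD[OF OK xy(1)] subsetD[OF OK xy(2)]] xy(3,4) by simp
      then show ?thesis unfolding S_def using Oadd(2)[OF xy(1,2)] by blast
    qed
    show "- a \<in> S" if "a \<in> S" for a
    proof -
      obtain x where x: "x \<in> ?O" "a = \<epsilon> x" using \<open>a \<in> S\<close> unfolding S_def by blast
      have "- a = \<epsilon> (\<ominus> x)" using neg[OF subsetD[OF OK x(1)]] x(2) by simp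
      then show ?thesis unfolding S_def using Oneg[OF x(1)] by blast
    qed
  qed fact
  have simps: "x \<otimes>\<^bsub>ring_of_integers K\<^esub> y = x \<otimes> y" "x \<oplus>\<^bsub>ring_of_integers K\<^esub> y = x \<oplus> y" "\<one>\<^bsub>ring_of_integers K\<^esub> = \<one>" for x y
    by (simp_all add: ring_of_integers_def)
  have "\<epsilon> \<in> ring_iso (ring_of_integers K) ?R"
  proof (rule ring_iso_memI)
    show "\<epsilon> x \<in> carrier ?R" if "x \<in> ?O" for x using that by (simp add: S_def)
    show "\<epsilon> (x \<otimes>\<^bsub>ring_of_integers K\<^esub> y) = \<epsilon> x \<otimes>\<^bsub>?R\<^esub> \<epsilon> y" if "x \<in> ?O" "y \<in> ?O" for x y
      using mult[OF subsetD[OF OK that(1)] subsetD[OF OK that(2)]] unfolding simps by simp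
    show "\<epsilon> (x \<oplus>\<^bsub>ring_of_integers K\<^esub> y) = \<epsilon> x \<oplus>\<^bsub>?R\<^esub> \<epsilon> y" if "x \<in> ?O" "y \<in> ?O" for x y
      using add[OF subsetD[OF OK that(1)] subsetD[OF OK that(2)]] unfolding simps by simp
    show "\<epsilon> \<one>\<^bsub>ring_of_integers K\<^esub> = \<one>\<^bsub>?R\<^esub>" unfolding simps using one by simp
    show "bij_betw \<epsilon> ?O (carrier ?R)" unfolding bij_betw_def
      using inj OK by (auto simp: S_def inj_on_def)
  qed
  then have "inv_into ?O \<epsilon> \<in> ring_iso ?R (ring_of_integers K)"
    using ring_iso_set_sym[of "ring_of_integers K" \<epsilon> ?R] cr cring.axioms(1) by blast
  then show ?thesis using cr S by blast
qed

text \<open>The ring may be taken over the type of H because it lives on a subset of H, the analogue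
  of a root subgroup.\<close>

theorem theorem2p6:
  fixes n :: nat
    and K :: "('k, 'm) ring_scheme"
    and H :: "('h, 'b) monoid_scheme"
  assumes "n \<ge> 3"
    and "number_field K"
    and "group H"
    and "group_elem_equiv H (SL n (ring_of_integers K))"
  shows "\<exists>R :: 'h ring. cring R \<and> ring_elem_equiv R (ring_of_integers K) \<and> H \<cong> SL n R"
proof -
  let ?O = "ring_of_integers K"
  interpret number_field K by fact
  obtain S \<delta> where O: "cring ?O" and S3: "\<forall>n\<ge>3. complex_subring S n"
    and \<delta>: "\<delta> \<in> ring_iso (ring_on S) ?O"
    using ring_of_integers_iso by blast
  interpret S: complex_subring S n using S3 assms(1) by blast
  let ?R = "ring_on S"
  note iso = S.SL_iso_GG[OF O \<delta>]
  \<comment> \<open>The group structure of the special linear group over the ring of integers is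
    obtained as the image of a group; this requires that its unit is the image of the unit
    matrix.\<close>
  have "map_mat \<delta> (1\<^sub>m n) = \<one>\<^bsub>SL n ?O\<^esub>"
  proof -
    interpret OO: cring ?O by (rule O)
    interpret RR: cring ?R by (rule S.cring_complex_subring)
    have "\<delta> 1 = \<one>\<^bsub>?O\<^esub>" using ring_iso_memE(4)[OF \<delta>] by simp
    moreover have "\<delta> 0 = \<zero>\<^bsub>?O\<^esub>"
      using ring_hom_zero[OF _ RR.ring_axioms OO.ring_axioms, of \<delta>] \<delta> by (simp add: ring_iso_def)
    ultimately show ?thesis by (intro eq_matI) (simp_all add: SL_def)
  qed
  then have "(SL n ?O)\<lparr>one := map_mat \<delta> \<one>\<^bsub>S.G\<^esub>\<rparr> = SL n ?O" by (simp add: SL_def)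
  then have grp: "group (SL n ?O)" using S.GG.iso_imp_img_group[OF iso] by simp
  have "group_elem_equiv H (GG n S)"
    using assms(4) models_group_iso[OF S.GG_group grp iso] by (simp add: group_elem_equiv_def)
  then interpret E: equivalent_group S n H
    by (intro equivalent_group.intro equivalent_group_axioms.intro S.complex_subring_axioms assms(3))
  obtain R :: "'h ring" where R: "cring R" "ring_elem_equiv R ?R" "H \<cong> SL n R" using E.special_linear by blast
  have "ring_elem_equiv R ?O"
    using R(2) models_ring_iso[OF S.cring_complex_subring O \<delta>] by (simp add: ring_elem_equiv_def)
  then show ?thesis using R by blast
qed

end
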